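(* Let $P\subseteq\mathbb{R}^2$ be a convex heptagon in general position, let $d\ge 0$ be an integer, and let $Q\subseteq\mathbb{R}^{(2+d)+q}$ be a minimum size extension of $P\times[0,1]^d$. Then at least $\frac{1}{9}$ of the vertices of $Q$ are not projected onto a vertex of $P\times[0,1]^d$; that is, the number of vertices of $Q$ whose projection is not a vertex of $P\times[0,1]^d$ is at least $\frac19$ times the total number of vertices of $Q$.
   Context: A polytope $Q\subseteq\mathbb{R}^n$ is an extension of a polytope $R\subseteq\mathbb{R}^m$ if the orthogonal projection of $Q$ onto the first $m$ coordinates equals $R$; "projected" refers to this projection. The size of a polytope is its number of facets; the extension complexity of $R$ is the minimum size of an extension of $R$, and a minimum size extension is one attaining it. A convex heptagon $P$ (a convex polygon with exactly seven vertices) is in general position if: (1) there are no four pairwise distinct vertices $u_1,\dots,u_4$ of $P$ such that the lines $\overline{u_1u_2}$ and $\overline{u_3u_4}$ are parallel; (2) there are no six pairwise distinct vertices $u_1,\dots,u_6$ of $P$ such that the lines $\overline{u_1u_2}$, $\overline{u_3u_4}$, $\overline{u_5u_6}$ have a point common to all three; (3) there are no seven pairwise distinct vertices $u_1,\dots,u_7$ of $P$ such that the intersection points $\overline{u_1u_2}\cap\overline{u_3u_4}$, $\overline{u_2u_5}\cap\overline{u_4u_6}$ and $\overline{u_3u_7}\cap\overline{u_1u_5}$ lie on a common line. Here $\overline{ab}$ denotes the line through $a$ and $b$. *)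

theory Defs
  imports "HOL-Analysis.Analysis" "HOL-Analysis.Finite_Function_Topology"
begin

text \<open>
  The ambient dimension of an extension ranges over all natural numbers inside a single formula.
  Hence \<open>\<real>\<^sup>n\<close> is rendered as the subspace \<open>rspace n\<close> of the real vector space of finitely
  supported functions \<open>nat \<Rightarrow>\<^sub>0 real\<close>; the coordinates of a point are indexed by
  \<open>0, \<dots>, n - 1\<close>.
\<close>

definition rspace :: "nat \<Rightarrow> (nat \<Rightarrow>\<^sub>0 real) set" where
  "rspace n = {x. Poly_Mapping.keys x \<subseteq> {..<n}}"

definition proj :: "nat \<Rightarrow> (nat \<Rightarrow>\<^sub>0 real) \<Rightarrow> (nat \<Rightarrow>\<^sub>0 real)" where
  "proj m x = (\<Sum>i<m. Poly_Mapping.single i (Poly_Mapping.lookup x i))"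

lemma lookup_proj:
  "Poly_Mapping.lookup (proj m x) i = (if i < m then Poly_Mapping.lookup x i else 0)"
proof -
  have "Poly_Mapping.lookup (proj m x) i
      = (\<Sum>j<m. if j = i then Poly_Mapping.lookup x j else 0)"
    by (simp add: proj_def lookup_sum lookup_single when_def)
  then show ?thesis
    by simp
qed

definition vertices :: "'a::real_vector set \<Rightarrow> 'a set" where
  "vertices S = {v. v extreme_point_of S}"

text \<open>
  The library constants \<^const>\<open>aff_dim\<close> and \<^const>\<open>facet_of\<close> exist only over Euclidean spaces.
  For a nonempty set \<open>S\<close>, \<open>adim S\<close> is the dimension of the linear space parallel to the affine
  hull of \<open>S\<close>.
\<close>

definition adim :: "'a::real_vector set \<Rightarrow> nat" where
  "adim S = dim {x - y | x y. x \<in> S \<and> y \<in> S}"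

definition is_facet :: "'a::real_vector set \<Rightarrow> 'a set \<Rightarrow> bool" where
  "is_facet F S \<longleftrightarrow> F face_of S \<and> F \<noteq> {} \<and> adim F + 1 = adim S"

lemma aff_dim_eq_adim:
  fixes S :: "'a::euclidean_space set"
  assumes "S \<noteq> {}"
  shows "aff_dim S = int (adim S)"
proof -
  obtain a where a: "a \<in> S"
    using assms by blast
  let ?A = "(\<lambda>x. x - a) ` S" and ?D = "{x - y | x y. x \<in> S \<and> y \<in> S}"
  have "?D \<subseteq> span ?A"
  proof
    fix z assume "z \<in> ?D"
    then obtain x y where xy: "x \<in> S" "y \<in> S" "z = (x - a) - (y - a)"
      by auto
    have "(x - a) - (y - a) \<in> span ?A"
      by (rule span_diff; rule span_base; use xy in blast)
    then show "z \<in> span ?A"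
      using xy(3) by simp
  qed
  moreover have "?A \<subseteq> span ?D"
    using a by (intro subset_trans[OF _ span_superset]) blast
  ultimately have "span ?D = span ?A"
    by (subst span_eq) (rule conjI)
  then have "dim ?D = dim ?A"
    by (rule span_eq_dim)
  moreover have "aff_dim S = int (dim ?A)"
    using aff_dim_eq_dim_subtract[OF hull_inc[OF a]] by simp
  ultimately show ?thesis
    by (simp add: adim_def)
qed

lemma is_facet_iff_facet_of:
  fixes S :: "'a::euclidean_space set"
  shows "is_facet F S \<longleftrightarrow> F facet_of S"
proof (cases "F face_of S \<and> F \<noteq> {}")
  case True
  then have "S \<noteq> {}"
    using face_of_imp_subset by fastforce
  with True show ?thesis
    by (auto simp: is_facet_def facet_of_def aff_dim_eq_adim)
qed (auto simp: is_facet_def facet_of_def)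

definition psize :: "'a::real_vector set \<Rightarrow> nat" where
  "psize S = card {F. is_facet F S}"

text \<open>\<open>is_extension n Q m R\<close>: the polytope \<open>Q\<close> in dimension \<open>n\<close> is an extension of the
  polytope \<open>R\<close> in dimension \<open>m\<close>.\<close>

definition is_extension ::
  "nat \<Rightarrow> (nat \<Rightarrow>\<^sub>0 real) set \<Rightarrow> nat \<Rightarrow> (nat \<Rightarrow>\<^sub>0 real) set \<Rightarrow> bool" where
  "is_extension n Q m R \<longleftrightarrow>
     m \<le> n \<and> polytope R \<and> R \<subseteq> rspace m \<and> polytope Q \<and> Q \<subseteq> rspace n \<and> proj m ` Q = R"

definition extension_complexity :: "nat \<Rightarrow> (nat \<Rightarrow>\<^sub>0 real) set \<Rightarrow> nat" where
  "extension_complexity m R = (LEAST k. \<exists>n Q. is_extension n Q m R \<and> psize Q = k)"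

definition minimum_size_extension ::
  "nat \<Rightarrow> (nat \<Rightarrow>\<^sub>0 real) set \<Rightarrow> nat \<Rightarrow> (nat \<Rightarrow>\<^sub>0 real) set \<Rightarrow> bool" where
  "minimum_size_extension n Q m R \<longleftrightarrow>
     is_extension n Q m R \<and> psize Q = extension_complexity m R"

definition convex_heptagon :: "(real^2) set \<Rightarrow> bool" where
  "convex_heptagon P \<longleftrightarrow> polytope P \<and> card (vertices P) = 7"

definition line :: "real^2 \<Rightarrow> real^2 \<Rightarrow> (real^2) set" where
  "line a b = affine hull {a, b}"

text \<open>
  In the third condition the three intersections are single points as soon as the first
  condition holds.
\<close>

definition general_position :: "(real^2) set \<Rightarrow> bool" where
  "general_position P \<longleftrightarrow>
     (\<nexists>u1 u2 u3 u4. distinct [u1, u2, u3, u4] \<and> {u1, u2, u3, u4} \<subseteq> vertices P \<and>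
        affine_parallel (line u1 u2) (line u3 u4)) \<and>
     (\<nexists>u1 u2 u3 u4 u5 u6. distinct [u1, u2, u3, u4, u5, u6] \<and>
        {u1, u2, u3, u4, u5, u6} \<subseteq> vertices P \<and>
        line u1 u2 \<inter> line u3 u4 \<inter> line u5 u6 \<noteq> {}) \<and>
     (\<nexists>u1 u2 u3 u4 u5 u6 u7 a b c. distinct [u1, u2, u3, u4, u5, u6, u7] \<and>
        {u1, u2, u3, u4, u5, u6, u7} \<subseteq> vertices P \<and>
        a \<in> line u1 u2 \<inter> line u3 u4 \<and>
        b \<in> line u2 u5 \<inter> line u4 u6 \<and>
        c \<in> line u3 u7 \<inter> line u1 u5 \<and>
        collinear {a, b, c})"

text \<open>\<open>times_cube P d\<close> is \<open>P \<times> [0,1]\<^sup>d\<close>.\<close>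

definition times_cube :: "(real^2) set \<Rightarrow> nat \<Rightarrow> (nat \<Rightarrow>\<^sub>0 real) set" where
  "times_cube P d =
     {x \<in> rspace (2 + d).
        vector [Poly_Mapping.lookup x 0, Poly_Mapping.lookup x 1] \<in> P \<and>
        (\<forall>i\<in>{2..<2 + d}. Poly_Mapping.lookup x i \<in> {0..1})}"

end

theory Submission
  imports Defs
begin

text \<open>
  Lower bound: the facets of a polytope are tight inequalities, so an extension of
  \<open>P \<times> [0,1]\<^sup>d\<close> has faces \<open>G\<^sub>0\<close>, \<open>G\<^sub>1\<close> cut out by a cube coordinate being \<open>0\<close> or \<open>1\<close>, and
  counting the facets of \<open>Q\<close> that do not induce facets of \<open>G\<^sub>0\<close> and \<open>G\<^sub>1\<close> gives, by induction on
  \<open>d\<close>, at least \<open>6 + 2d\<close> facets. If there are exactly so many, then \<open>G\<^sub>0\<close> and \<open>G\<^sub>1\<close> are minimal as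
  well. All vertices outside of them are projected badly, so the ratio \<open>1/9\<close> is
  inherited from \<open>d = 0\<close>.

  For \<open>d = 0\<close> a polytope with at most six facets has at most nine vertices, so it suffices that some
  vertex is not projected to a vertex of \<open>P\<close>. Otherwise the slack vectors of the (at least seven)
  vertices are in the nonnegative orthant of \<open>\<real>\<^sup>6\<close>. If they span a hyperplane, the vertices
  form the product structure of two simplices, and three of its edges are on lines that meet,
  against the first two conditions. If the polytope is three-dimensional, its
  facet adjacency graph is that of the cube or the complement of a path with three edges and a
  disjoint edge; in the cube two adjacent vertices are projected to the same
  point. In both cases three intersection points as in the third condition are on
  a line, namely the image of the line in which the planes of two non-adjacent facets meet.

  Upper bound: lifting two vertices of \<open>P\<close> suitably yields a three-dimensional extension with six
  facets, provided that two inequalities between oriented areas hold for some labelling. If they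
  failed for all rotations, multiplying them cyclically would contradict the
  Pluecker relations.
\<close>

section \<open>Facets of polytopes\<close>

text \<open>The number of ambient coordinates of \<open>Q\<close> is unbounded, so no enumeration is
  possible there. Slack vectors remove this obstacle: a polytope with at most six facets becomes the
  slice of a cone in a space of six coordinates, and only the linear dimension of the span remains
  to be distinguished. The constant 9 is the vertex number 3 * 3 of a product of two triangles, the
  largest that six facets allow. Working in the cone also treats meeting and parallel lines alike: a
  vector of height 0 is a point at infinity. The facet bound and the ratio go through one induction,
  because the ratio is inherited only by end faces with the least possible number of facets, and
  that minimality comes out of the same count. Facets are handled through linear functionals on
  finitely generated cones, since the results are needed in arbitrary real vector spaces, where
  neither an inner product nor a finite basis is at hand. In dimension three the obstacle is a
  projection that need not be injective on the vertices.\<close>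

lemma farkas_family:
  fixes v :: "'i \<Rightarrow> 'a::real_vector"
  assumes "finite A"
    and "\<nexists>c. (\<forall>i\<in>A. 0 \<le> c i) \<and> x = (\<Sum>i\<in>A. c i *\<^sub>R v i)"
  shows "\<exists>f::'a \<Rightarrow> real. linear f \<and> (\<forall>i\<in>A. 0 \<le> f (v i)) \<and> f x < 0"
  using assms
proof (induction A arbitrary: x v rule: finite_induct)
  case empty
  then have "x \<noteq> 0" by auto
  then have "independent {x}" by (simp add: dependent_single)
  then obtain f :: "'a \<Rightarrow> real" where "linear f" "\<forall>y\<in>{x}. f y = - 1"
    using linear_independent_extend[of "{x}" "\<lambda>_. - 1"] by blast
  then show ?case by (intro exI[of _ f]) auto
next
  case (insert a A)
  have "\<nexists>c. (\<forall>i\<in>A. 0 \<le> c i) \<and> x = (\<Sum>i\<in>A. c i *\<^sub>R v i)"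
  proof
    assume "\<exists>c. (\<forall>i\<in>A. 0 \<le> c i) \<and> x = (\<Sum>i\<in>A. c i *\<^sub>R v i)"
    then obtain c where c: "\<forall>i\<in>A. 0 \<le> c i" "x = (\<Sum>i\<in>A. c i *\<^sub>R v i)" by blast
    have "(\<Sum>i\<in>insert a A. (c(a := 0)) i *\<^sub>R v i) = (\<Sum>i\<in>A. c i *\<^sub>R v i)"
      using insert.hyps by (simp, intro sum.cong) auto
    then show False using insert.prems c by (metis fun_upd_apply insert_iff order_refl)
  qed
  then obtain f :: "'a \<Rightarrow> real" where f: "linear f" "\<forall>i\<in>A. 0 \<le> f (v i)" "f x < 0"
    using insert.IH by blast
  show ?case
  proof (cases "0 \<le> f (v a)")
    case True
    then show ?thesis using f by auto
  next
    case False
    \<comment> \<open>Projection along \<open>v a\<close> onto the kernel of \<open>f\<close>. It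
      may identify several vectors, which is why the cone is generated by an indexed family and not
      by a set.\<close>
    define p where "p y = y - (f y / f (v a)) *\<^sub>R v a" for y
    have lp: "linear p"
      unfolding p_def using f(1)
      by (intro linearI) (auto simp: linear_add linear_scale algebra_simps add_divide_distrib)
    have "\<nexists>c. (\<forall>i\<in>A. 0 \<le> c i) \<and> p x = (\<Sum>i\<in>A. c i *\<^sub>R p (v i))"
    proof
      assume "\<exists>c. (\<forall>i\<in>A. 0 \<le> c i) \<and> p x = (\<Sum>i\<in>A. c i *\<^sub>R p (v i))"
      then obtain c where c: "\<forall>i\<in>A. 0 \<le> c i" "p x = (\<Sum>i\<in>A. c i *\<^sub>R p (v i))" by blast
      \<comment> \<open>The coefficient of \<open>v a\<close> that is lost under \<open>p\<close>.
        It is nonnegative because \<open>f\<close> is negative at \<open>x\<close> and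
        \<open>v a\<close> and nonnegative at the other generators.\<close>
      define k where "k = f x / f (v a) - (\<Sum>i\<in>A. c i * (f (v i) / f (v a)))"
      have "0 \<le> f x / f (v a)" using False f(3) by (simp add: divide_nonpos_nonpos)
      moreover have "(\<Sum>i\<in>A. c i * (f (v i) / f (v a))) \<le> 0"
        using False f(2) c(1)
        by (intro sum_nonpos mult_nonneg_nonpos divide_nonneg_nonpos) auto
      ultimately have "0 \<le> k" by (simp add: k_def)
      have "x = p x + (f x / f (v a)) *\<^sub>R v a" by (simp add: p_def)
      also have "p x = (\<Sum>i\<in>A. c i *\<^sub>R v i - (c i * (f (v i) / f (v a))) *\<^sub>R v a)"
        unfolding c(2) by (simp add: p_def algebra_simps)
      also have "\<dots> = (\<Sum>i\<in>A. c i *\<^sub>R v i) - (\<Sum>i\<in>A. c i * (f (v i) / f (v a))) *\<^sub>R v a"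
        by (simp add: sum_subtractf scaleR_sum_left)
      finally have "x = k *\<^sub>R v a + (\<Sum>i\<in>A. c i *\<^sub>R v i)"
        by (simp add: k_def algebra_simps)
      also have "(\<Sum>i\<in>A. c i *\<^sub>R v i) = (\<Sum>i\<in>A. (c(a := k)) i *\<^sub>R v i)"
        using insert.hyps by (intro sum.cong) auto
      finally have "x = (\<Sum>i\<in>insert a A. (c(a := k)) i *\<^sub>R v i)"
        using insert.hyps by simp
      moreover have "\<forall>i\<in>insert a A. 0 \<le> (c(a := k)) i" using c(1) \<open>0 \<le> k\<close> by auto
      ultimately show False using insert.prems by blast
    qed
    from insert.IH[OF this] obtain g :: "'a \<Rightarrow> real"
      where g: "linear g" "\<forall>i\<in>A. 0 \<le> g (p (v i))" "g (p x) < 0" by blast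
    have "p (v a) = 0" using False by (simp add: p_def)
    then have "g (p (v a)) = 0" using g(1) by (simp add: linear_0)
    then show ?thesis
      using g linear_compose[OF lp g(1)] by (intro exI[of _ "g \<circ> p"]) (auto simp: o_def)
  qed
qed

lemma linear_separating_span:
  fixes S :: "'a::real_vector set"
  assumes "x \<notin> span S"
  shows "\<exists>g::'a \<Rightarrow> real. linear g \<and> (\<forall>s\<in>span S. g s = 0) \<and> g x = 1"
proof -
  obtain B where B: "B \<subseteq> span S" "independent B" "span S \<subseteq> span B"
    by (rule basis_exists)
  then have "span B = span S" by (metis span_minimal subset_antisym subspace_span)
  then have "x \<notin> span B" "x \<notin> B" using assms span_base by auto
  then have "independent (insert x B)" using B(2) by (simp add: independent_insert)
  then obtain g :: "'a \<Rightarrow> real" where g: "linear g" "\<forall>y\<in>insert x B. g y = (if y = x then 1 else 0)"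
    using linear_independent_extend[of "insert x B" "\<lambda>y. if y = x then 1 else 0"] by blast
  have "g s = 0" if "s \<in> span S" for s
    using linear_eq_0_on_span[OF g(1), of B s] g(2) \<open>x \<notin> B\<close> that \<open>span B = span S\<close> by fastforce
  then show ?thesis using g by auto
qed

text \<open>Among the functionals separating \<open>x\<close> from the cone, one with a maximal zero set is as
  rigid as possible: its zero set spans a hyperplane of \<open>span S\<close>.\<close>

lemma farkas_hyperplane:
  fixes S :: "'a::real_vector set"
  assumes S: "finite S" and x: "x \<in> span S"
    and nc: "\<nexists>c. (\<forall>s\<in>S. 0 \<le> c s) \<and> x = (\<Sum>s\<in>S. c s *\<^sub>R s)"
  obtains h :: "'a \<Rightarrow> real" and s0 where "linear h" "\<forall>s\<in>S. 0 \<le> h s" "h x < 0" "s0 \<in> S" "h s0 \<noteq> 0"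
    "S \<subseteq> span (insert s0 {s\<in>S. h s = 0})"
proof -
  define good where "good h \<longleftrightarrow> linear h \<and> (\<forall>s\<in>S. 0 \<le> h s) \<and> h x < 0" for h :: "'a \<Rightarrow> real"
  define z where "z h = card {s\<in>S. h s = 0}" for h :: "'a \<Rightarrow> real"
  have "\<exists>h. good h" using farkas_family[OF S nc] by (auto simp: good_def)
  moreover have "\<forall>h. good h \<longrightarrow> z h < Suc (card S)"
    by (auto simp: z_def less_Suc_eq_le intro!: card_mono S)
  ultimately obtain h where h: "good h" and hmax: "\<And>h'. good h' \<Longrightarrow> z h' \<le> z h"
    using ex_has_greatest_nat[of good _ z "Suc (card S)"] by blast
  have lin: "linear h" and pos: "\<forall>s\<in>S. 0 \<le> h s" and neg: "h x < 0" using h by (auto simp: good_def)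
  define T where "T = {s\<in>S. h s = 0}"
  obtain s0 where s0: "s0 \<in> S" "h s0 \<noteq> 0"
    using linear_eq_0_on_span[OF lin _ x] neg by fastforce
  have "S \<subseteq> span (insert s0 T)"
  proof (rule ccontr)
    assume "\<not> S \<subseteq> span (insert s0 T)"
    then obtain s1 where s1: "s1 \<in> S" "s1 \<notin> span (insert s0 T)" by blast
    from linear_separating_span[OF this(2)] obtain g :: "'a \<Rightarrow> real"
      where g: "linear g" "\<forall>s\<in>span (insert s0 T). g s = 0" "g s1 = 1" by blast
    \<comment> \<open>The correction by \<open>h\<close> makes \<open>g'\<close> vanish at
      \<open>x\<close> as well as on \<open>T\<close>, so adding multiples of it to \<open>h\<close>
      changes neither the value at \<open>x\<close> nor the zeros in \<open>T\<close>.\<close>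
    define g' where "g' y = g y - (g x / h x) * h y" for y
    have lg': "linear g'"
      unfolding g'_def using g(1) lin
      by (intro linearI) (auto simp: linear_add linear_scale algebra_simps add_divide_distrib)
    have g'x: "g' x = 0" using neg by (simp add: g'_def)
    have g'T: "g' s = 0" if "s \<in> T" for s
      using that g(2) by (auto simp: g'_def T_def span_base)
    \<comment> \<open>If \<open>g'\<close> vanishes at \<open>s0\<close>, where \<open>g\<close>
      does too, the correction term is zero, and then \<open>g' s1 = g s1 = 1\<close>.\<close>
    have "\<exists>s2\<in>S. g' s2 \<noteq> 0"
    proof (cases "g' s0 = 0")
      case True
      moreover have "g s0 = 0" using g(2) by (simp add: span_base)
      ultimately have "g x = 0" using s0 neg by (simp add: g'_def)
      then show ?thesis using s1 g(3) by (intro bexI[of _ s1]) (auto simp: g'_def)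
    qed (use s0 in auto)
    then obtain s2 where s2: "s2 \<in> S" "g' s2 \<noteq> 0" by blast
    define G where "G y = (if g' s2 < 0 then g' y else - g' y)" for y
    have lG: "linear G" using lg' linear_compose_neg[OF lg'] by (cases "g' s2 < 0") (auto simp: G_def[abs_def])
    have Gs2: "G s2 < 0" using s2 by (auto simp: G_def)
    have GT: "G s = 0" if "s \<in> T" for s using g'T[OF that] by (simp add: G_def)
    have Gx: "G x = 0" using g'x by (simp add: G_def)
    define N where "N = {s\<in>S. G s < 0}"
    have N: "finite N" "N \<noteq> {}" using S s2 Gs2 by (auto simp: N_def)
    \<comment> \<open>The largest step for which \<open>h + t * G\<close> stays nonnegative on
      \<open>S\<close>. There some \<open>s3\<close> outside \<open>T\<close> joins the zero set,
      against the maximal choice of \<open>h\<close>.\<close>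
    define t where "t = Min ((\<lambda>s. h s / - G s) ` N)"
    have "t \<in> (\<lambda>s. h s / - G s) ` N"
      unfolding t_def using N by (intro Min_in) auto
    then obtain s3 where s3: "s3 \<in> N" "t = h s3 / - G s3" by blast
    have tle: "t \<le> h s / - G s" if "s \<in> N" for s
      using that N unfolding t_def by (intro Min_le) auto
    have t0: "0 \<le> t" using s3 pos by (auto simp: N_def divide_nonneg_nonpos)
    define h' where "h' y = h y + t * G y" for y
    have "linear h'" unfolding h'_def using lin lG
      by (intro linearI) (auto simp: linear_add linear_scale algebra_simps)
    moreover have "0 \<le> h' s" if "s \<in> S" for s
    proof (cases "G s < 0")
      case True
      then have "t \<le> h s / - G s" using tle[of s] that by (simp add: N_def)
      then have "t * - G s \<le> h s" using True by (subst (asm) pos_le_divide_eq) auto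
      then show ?thesis by (simp add: h'_def)
    next
      case False
      then show ?thesis using pos t0 that by (simp add: h'_def)
    qed
    moreover have "h' x < 0" using neg Gx by (simp add: h'_def)
    ultimately have "good h'" by (simp add: good_def)
    have "s3 \<notin> T" using GT s3 by (force simp: N_def)
    moreover have "insert s3 T \<subseteq> {s\<in>S. h' s = 0}"
      using s3 GT by (auto simp: h'_def T_def N_def)
    moreover have "finite T" using S by (simp add: T_def)
    ultimately have "Suc (card T) \<le> z h'"
      unfolding z_def using S card_mono[of "{s\<in>S. h' s = 0}" "insert s3 T"] by simp
    then show False using hmax[OF \<open>good h'\<close>] by (simp add: z_def T_def)
  qed
  then show ?thesis using that lin pos neg s0 by (simp add: T_def)
qed

text \<open>The finite set \<open>C\<close> keeps bases finite; without it the cardinality of a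
  basis could be the default 0 and the count would fail.\<close>

lemma dim_insert_finite:
  fixes D :: "'a::real_vector set"
  assumes "finite C" "D \<subseteq> span C" "x \<notin> span D"
  shows "dim (insert x D) = dim D + 1"
proof -
  obtain B where B: "B \<subseteq> D" "independent B" "D \<subseteq> span B" "card B = dim D"
    using basis_exists by blast
  have "span B = span D" using B by (meson span_eq order_trans span_superset)
  have "finite B"
    using independent_span_bound[OF assms(1) B(2)] B(1) assms(2) by blast
  have "x \<notin> span B" using assms(3) \<open>span B = span D\<close> by simp
  then have "independent (insert x B)" "x \<notin> B" using B(2) by (auto simp: independent_insert span_base)
  moreover have "span (insert x B) = span (insert x D)"
    using \<open>span B = span D\<close> by (metis span_insert)
  ultimately have "dim (insert x D) = card (insert x B)" by (intro dim_eq_card)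
  then show ?thesis using \<open>finite B\<close> \<open>x \<notin> B\<close> B(4) by simp
qed

abbreviation diffs :: "'a::real_vector set \<Rightarrow> 'a set" where
  "diffs S \<equiv> {x - y | x y. x \<in> S \<and> y \<in> S}"

lemma polytope_diffs:
  fixes S :: "'a::real_vector set"
  assumes "polytope S"
  obtains C where "finite C" "diffs S \<subseteq> span C"
proof -
  obtain V where V: "finite V" "S = convex hull V" using assms by (auto simp: polytope_def)
  have "S \<subseteq> span V"
    using V convex_hull_subset_span by blast
  then show ?thesis using that[OF V(1)] by (auto intro!: span_diff)
qed

text \<open>Weighting the end points of two scaled chords by \<open>t / (t + t')\<close> and
  \<open>t' / (t + t')\<close> merges them into one, so the scaled chords of a convex set already
  form a subspace.\<close>

lemma span_diffs_convex:
  fixes F :: "'a::real_vector set"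
  assumes "convex F" "F \<noteq> {}" "d \<in> span (diffs F)"
  obtains t p q where "0 < t" "p \<in> F" "q \<in> F" "d = t *\<^sub>R (p - q)"
proof -
  let ?W = "{d. \<exists>t p q. 0 < t \<and> p \<in> F \<and> q \<in> F \<and> d = t *\<^sub>R (p - q)}"
  have "subspace ?W"
  proof (rule subspaceI)
    show "0 \<in> ?W" using assms(2) by (force intro: exI[of _ 1])
  next
    fix x y assume "x \<in> ?W" "y \<in> ?W"
    then obtain t p q t' p' q' where *: "0 < t" "p \<in> F" "q \<in> F" "x = t *\<^sub>R (p - q)"
      "0 < t'" "p' \<in> F" "q' \<in> F" "y = t' *\<^sub>R (p' - q')" by blast
    let ?a = "t / (t + t')" and ?b = "t' / (t + t')"
    have ab: "0 \<le> ?a" "0 \<le> ?b" "?a + ?b = 1" using * by (auto simp: divide_simps)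
    have "(t + t') * ?a = t" "(t + t') * ?b = t'" using * by (auto simp: divide_simps)
    then have "x + y = (t + t') *\<^sub>R ((?a *\<^sub>R p + ?b *\<^sub>R p') - (?a *\<^sub>R q + ?b *\<^sub>R q'))"
      using * by (simp add: scaleR_right_diff_distrib scaleR_add_right)
    moreover have "?a *\<^sub>R p + ?b *\<^sub>R p' \<in> F" "?a *\<^sub>R q + ?b *\<^sub>R q' \<in> F"
      using assms(1) ab * by (auto simp: convex_def)
    moreover have "0 < t + t'" using * by simp
    ultimately show "x + y \<in> ?W" by blast
  next
    fix c :: real and x assume "x \<in> ?W"
    then obtain t p q where *: "0 < t" "p \<in> F" "q \<in> F" "x = t *\<^sub>R (p - q)" by blast
    consider "c = 0" | "c > 0" | "c < 0" by linarith
    then show "c *\<^sub>R x \<in> ?W"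
    proof cases
      case 1 then show ?thesis using * by (auto intro!: exI[of _ 1] exI[of _ p])
    next
      case 2
      then have "0 < c * t" using * by simp
      moreover have "c *\<^sub>R x = (c * t) *\<^sub>R (p - q)" using * by simp
      ultimately show ?thesis using * by blast
    next
      case 3
      then have "0 < (- c) * t" using * by (simp add: mult_neg_pos)
      moreover have "c *\<^sub>R x = ((- c) * t) *\<^sub>R (q - p)"
        unfolding *(4) by (simp add: algebra_simps)
      ultimately show ?thesis using * by blast
    qed
  qed
  moreover have "diffs F \<subseteq> ?W"
    by (force intro: exI[of _ 1])
  ultimately have "span (diffs F) \<subseteq> ?W" by (simp add: span_minimal)
  then show ?thesis using assms(3) that by blast
qed

text \<open>If a point \<open>x\<close> outside \<open>F\<close> did not raise the dimension, its
  offset from \<open>F\<close> would be a scaled chord of \<open>F\<close>, and a segment from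
  \<open>x\<close> to a point of \<open>F\<close> would have an inner point in \<open>F\<close>,
  which a face excludes.\<close>

lemma adim_face_less:
  fixes Q :: "'a::real_vector set"
  assumes Q: "polytope Q" and F: "F face_of Q" "F \<noteq> {}" "F \<noteq> Q"
  shows "adim F < adim Q"
proof -
  obtain C where C: "finite C" "diffs Q \<subseteq> span C" using polytope_diffs[OF Q] .
  have FQ: "F \<subseteq> Q" using F(1) by (rule face_of_imp_subset)
  then obtain x where x: "x \<in> Q" "x \<notin> F" using F(3) by blast
  obtain a where a: "a \<in> F" using F(2) by blast
  have "x - a \<notin> span (diffs F)"
  proof
    assume "x - a \<in> span (diffs F)"
    then obtain t p q where t: "0 < t" "p \<in> F" "q \<in> F" "x - a = t *\<^sub>R (p - q)"
      using span_diffs_convex[OF face_of_imp_convex[OF F(1)] F(2)] by blast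
    \<comment> \<open>Since \<open>x - a\<close> is \<open>t\<close> times \<open>p - q\<close>,
      this point lies both between \<open>x\<close> and \<open>q\<close> and between
      \<open>a\<close> and \<open>p\<close>.\<close>
    define m where "m = (1 / (1 + t)) *\<^sub>R x + (t / (1 + t)) *\<^sub>R q"
    have xeq: "x = a + t *\<^sub>R (p - q)" using t(4) by (metis add_diff_cancel_left' add.commute diff_add_cancel)
    have "m = (1 / (1 + t)) *\<^sub>R a + (t / (1 + t)) *\<^sub>R p"
      unfolding m_def xeq by (simp add: algebra_simps)
    moreover have "1 / (1 + t) + t / (1 + t) = 1" using t(1) by (simp add: divide_simps)
    ultimately have "m \<in> F"
      using convexD[OF face_of_imp_convex[OF F(1)] a t(2), of "1 / (1 + t)" "t / (1 + t)"] t(1) by simp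
    moreover have "m \<in> open_segment x q"
      unfolding in_segment(2) m_def using t x
      by (intro conjI exI[of _ "t / (1 + t)"]) (auto simp: divide_simps)
    ultimately show False using F(1) x t(3) FQ by (meson face_ofD subsetD)
  qed
  moreover have "diffs F \<subseteq> span C" using C(2) FQ by blast
  ultimately have "dim (insert (x - a) (diffs F)) = dim (diffs F) + 1"
    using C(1) by (intro dim_insert_finite)
  moreover have "dim (insert (x - a) (diffs F)) \<le> dim (diffs Q)"
  proof -
    obtain B where B: "B \<subseteq> insert (x - a) (diffs F)" "independent B"
        "insert (x - a) (diffs F) \<subseteq> span B" "card B = dim (insert (x - a) (diffs F))"
      by (rule basis_exists)
    obtain B' where B': "B' \<subseteq> diffs Q" "independent B'" "diffs Q \<subseteq> span B'" "card B' = dim (diffs Q)"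
      by (rule basis_exists)
    have "finite B'" using independent_span_bound[OF C(1) B'(2)] B'(1) C(2) by blast
    have "insert (x - a) (diffs F) \<subseteq> diffs Q" using FQ x a by blast
    then have "B \<subseteq> span B'" using B(1) B'(3) by blast
    then have "card B \<le> card B'" using independent_span_bound[OF \<open>finite B'\<close> B(2)] by blast
    then show ?thesis using B B' by simp
  qed
  ultimately show ?thesis by (simp add: adim_def)
qed

section \<open>Facets cut out by linear functionals\<close>

lemma face_of_supporting:
  fixes f :: "'a::real_vector \<Rightarrow> real"
  assumes "convex Q" "linear f" "\<forall>x\<in>Q. 0 \<le> f x + c"
  shows "{x\<in>Q. f x + c = 0} face_of Q"
  unfolding face_of_def
proof (intro conjI ballI impI)
  show "convex {x\<in>Q. f x + c = 0}"
  proof (rule convexI, safe)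
    fix x y and u v :: real
    assume "x \<in> Q" "y \<in> Q" "0 \<le> u" "0 \<le> v" "u + v = 1" "f x + c = 0" "f y + c = 0"
    then show "u *\<^sub>R x + v *\<^sub>R y \<in> Q" using assms(1) by (simp add: convex_def)
    have "f (u *\<^sub>R x + v *\<^sub>R y) + c = u * (f x + c) + v * (f y + c) + (1 - (u + v)) * c"
      using assms(2) by (simp add: linear_add linear_scale algebra_simps)
    then show "f (u *\<^sub>R x + v *\<^sub>R y) + c = 0" using \<open>u + v = 1\<close> \<open>f x + c = 0\<close> \<open>f y + c = 0\<close> by simp
  qed
next
  fix a b x assume *: "a \<in> Q" "b \<in> Q" "x \<in> {x\<in>Q. f x + c = 0}" "x \<in> open_segment a b"
  then obtain u where u: "0 < u" "u < 1" "x = (1 - u) *\<^sub>R a + u *\<^sub>R b" by (auto simp: in_segment)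
  have "f x + c = (1 - u) * (f a + c) + u * (f b + c)"
    unfolding u(3) using assms(2) by (simp only: linear_add linear_scale) (simp add: algebra_simps)
  moreover have "0 \<le> (1 - u) * (f a + c)" "0 \<le> u * (f b + c)" using assms(3) * u by auto
  ultimately have "(1 - u) * (f a + c) = 0 \<and> u * (f b + c) = 0"
    using * by (simp add: add_nonneg_eq_0_iff)
  then show "a \<in> {x\<in>Q. f x + c = 0}" "b \<in> {x\<in>Q. f x + c = 0}" using * u by auto
qed auto

lemma affine_functional_hull_nonneg:
  fixes f :: "'a::real_vector \<Rightarrow> real"
  assumes "linear f" "\<forall>s\<in>S. 0 \<le> f s + c" "y \<in> convex hull S"
  shows "0 \<le> f y + c"
proof -
  have "convex {y. 0 \<le> f y + c}"
  proof (rule convexI, safe)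
    fix x y and u v :: real
    assume *: "0 \<le> u" "0 \<le> v" "u + v = 1" "0 \<le> f x + c" "0 \<le> f y + c"
    then have "v = 1 - u" by simp
    have "f (u *\<^sub>R x + v *\<^sub>R y) + c = u * (f x + c) + v * (f y + c)"
      unfolding \<open>v = 1 - u\<close> using assms(1)
      by (simp only: linear_add linear_scale) (simp add: algebra_simps)
    then show "0 \<le> f (u *\<^sub>R x + v *\<^sub>R y) + c" using * by simp
  qed
  moreover have "S \<subseteq> {y. 0 \<le> f y + c}" using assms(2) by blast
  ultimately show ?thesis using assms(3) hull_minimal by blast
qed

lemma sum_fst_snd_pair:
  "(\<Sum>i\<in>A. c i *\<^sub>R (v i, 1::real)) = (\<Sum>i\<in>A. c i *\<^sub>R v i, \<Sum>i\<in>A. c i)"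
  by (induction A rule: infinite_finite_induct) (auto simp: zero_prod_def)

text \<open>Lifting the points to height 1 turns the hull into a cone, so
  \<open>farkas_hyperplane\<close> applies; the spanning zero set found there is what makes the
  cut-out face a facet. The last clause, uniqueness of the facet functional up to a factor, allows
  one functional of a facet to be exchanged for another.\<close>

lemma facet_separation:
  fixes S :: "'a::real_vector set"
  assumes S: "finite S" and x: "x \<in> affine hull S" "x \<notin> convex hull S"
  obtains f c where "linear f" "\<forall>y\<in>convex hull S. 0 \<le> f y + c" "f x + c < (0::real)"
    "is_facet {y\<in>convex hull S. f y + c = 0} (convex hull S)"
    "\<And>f' c'. \<lbrakk>linear f'; \<forall>y\<in>{y\<in>convex hull S. f y + c = 0}. f' y + c' = (0::real)\<rbrakk>
       \<Longrightarrow> \<exists>k. \<forall>y\<in>convex hull S. f' y + c' = k * (f y + c)"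
proof -
  define h1 where "h1 s = (s, 1::real)" for s :: 'a
  have inj: "inj_on h1 S" by (auto simp: h1_def inj_on_def)
  obtain a where a: "sum a S = 1" "(\<Sum>s\<in>S. a s *\<^sub>R s) = x"
    using x(1) affine_hull_finite[OF S] by auto
  have "h1 x = (\<Sum>s\<in>S. a s *\<^sub>R h1 s)"
    unfolding h1_def sum_fst_snd_pair a by simp
  then have "h1 x \<in> span (h1 ` S)"
    by (simp only:) (intro span_sum span_scale span_base imageI)
  moreover have "\<nexists>c. (\<forall>s\<in>h1 ` S. 0 \<le> c s) \<and> h1 x = (\<Sum>s\<in>h1 ` S. c s *\<^sub>R s)"
  proof
    assume "\<exists>c. (\<forall>s\<in>h1 ` S. 0 \<le> c s) \<and> h1 x = (\<Sum>s\<in>h1 ` S. c s *\<^sub>R s)"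
    then obtain c where c: "\<forall>s\<in>S. 0 \<le> c (h1 s)" "h1 x = (\<Sum>s\<in>S. c (h1 s) *\<^sub>R h1 s)"
      using inj by (auto simp: sum.reindex)
    then have "(\<Sum>s\<in>S. c (h1 s)) = 1" "x = (\<Sum>s\<in>S. c (h1 s) *\<^sub>R s)"
      unfolding h1_def sum_fst_snd_pair by simp_all
    then have "x \<in> convex hull S"
      unfolding convex_hull_finite[OF S] using c(1)
      by (intro CollectI exI[of _ "\<lambda>s. c (h1 s)"]) auto
    then show False using x(2) by blast
  qed
  ultimately obtain h :: "'a \<times> real \<Rightarrow> real" and t0 where h: "linear h" "\<forall>s\<in>h1 ` S. 0 \<le> h s"
    "h (h1 x) < 0" "t0 \<in> h1 ` S" "h t0 \<noteq> 0" "h1 ` S \<subseteq> span (insert t0 {s\<in>h1 ` S. h s = 0})"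
    by (rule farkas_hyperplane[OF finite_imageI[OF S]])
  define f where "f y = h (y, 0)" for y
  define c where "c = h (0, 1)"
  have lf: "linear f"
    using h(1) linear_add[OF h(1), of "(_, 0)" "(_, 0)"] linear_scale[OF h(1), of _ "(_, 0)"]
    by (intro linearI) (auto simp: f_def)
  have hf: "h (h1 y) = f y + c" for y
    using linear_add[OF h(1), of "(y, 0)" "(0, 1)"] by (simp add: h1_def f_def c_def)
  obtain s0 where s0: "s0 \<in> S" "t0 = h1 s0" using h(4) by blast
  have fs0: "f s0 + c \<noteq> 0" using h(5) s0(2) hf by simp
  let ?Q = "convex hull S"
  let ?F = "{y\<in>?Q. f y + c = 0}"
  define T where "T = {s\<in>S. f s + c = 0}"
  have Teq: "{s\<in>h1 ` S. h s = 0} = h1 ` T" by (auto simp: T_def hf)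
  have nonneg: "\<forall>y\<in>?Q. 0 \<le> f y + c"
    using affine_functional_hull_nonneg[OF lf] h(2) hf by auto
  \<comment> \<open>Otherwise all lifted points would be multiples of one vector, so
    \<open>S\<close> would be a single point and its hull would equal its affine hull.\<close>
  have "T \<noteq> {}"
  proof
    assume "T = {}"
    have "s = s0" if "s \<in> S" for s
    proof -
      have "h1 s \<in> span {h1 s0}" using h(6) that s0 Teq \<open>T = {}\<close> by auto
      then show ?thesis by (auto simp: span_singleton h1_def)
    qed
    then have "S = {s0}" using s0 by blast
    then show False using a x(2) by simp
  qed
  then obtain q where q: "q \<in> T" by blast
  \<comment> \<open>Undoes the lifting: \<open>(s, 1)\<close> goes to \<open>s - q\<close>, so a
    spanning statement for lifted points becomes one for directions.\<close>
  define g where "g z = fst z - snd z *\<^sub>R q" for z :: "'a \<times> real"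
  have lg: "linear g" unfolding g_def by (intro linearI) (auto simp: algebra_simps)
  have gh1: "g (h1 s) = s - q" for s by (simp add: g_def h1_def)
  have TF: "T \<subseteq> ?F" by (auto simp: T_def hull_inc)
  have in_span: "y - q \<in> span (insert (s0 - q) (diffs ?F))" if "y \<in> ?Q" for y
  proof -
    have "convex {y. y - q \<in> span (insert (s0 - q) (diffs ?F))}"
    proof (rule convexI, safe)
      fix x y and u v :: real
      assume *: "0 \<le> u" "0 \<le> v" "u + v = 1"
        "x - q \<in> span (insert (s0 - q) (diffs ?F))" "y - q \<in> span (insert (s0 - q) (diffs ?F))"
      then have "u *\<^sub>R (x - q) + v *\<^sub>R (y - q) \<in> span (insert (s0 - q) (diffs ?F))"
        by (intro span_add span_scale)
      moreover have "u *\<^sub>R (x - q) + v *\<^sub>R (y - q) = u *\<^sub>R x + v *\<^sub>R y - (u + v) *\<^sub>R q"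
        by (simp add: algebra_simps)
      ultimately show "u *\<^sub>R x + v *\<^sub>R y - q \<in> span (insert (s0 - q) (diffs ?F))"
        using * by simp
    qed
    moreover have "S \<subseteq> {y. y - q \<in> span (insert (s0 - q) (diffs ?F))}"
    proof safe
      fix s assume "s \<in> S"
      then have "h1 s \<in> span (insert (h1 s0) (h1 ` T))" using h(6) s0 Teq by auto
      then have "g (h1 s) \<in> span (g ` insert (h1 s0) (h1 ` T))"
        using linear_span_image[OF lg] by blast
      moreover have "g ` insert (h1 s0) (h1 ` T) \<subseteq> insert (s0 - q) (diffs ?F)"
      proof -
        have "t - q \<in> diffs ?F" if "t \<in> T" for t using that TF q by blast
        then show ?thesis unfolding image_insert gh1 image_image by blast
      qed
      ultimately have "g (h1 s) \<in> span (insert (s0 - q) (diffs ?F))"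
        using span_mono by blast
      then show "s - q \<in> span (insert (s0 - q) (diffs ?F))" by (simp only: gh1)
    qed
    ultimately have "?Q \<subseteq> {y. y - q \<in> span (insert (s0 - q) (diffs ?F))}"
      by (rule hull_minimal[rotated])
    then show ?thesis using that by blast
  qed
  have fd: "f d = 0" if "d \<in> span (diffs ?F)" for d
    by (rule linear_eq_0_on_span[OF lf _ that]) (auto simp: linear_diff[OF lf])
  have "f (s0 - q) \<noteq> 0" using fs0 q by (simp add: linear_diff[OF lf] T_def)
  then have notin: "s0 - q \<notin> span (diffs ?F)" using fd by blast
  obtain C where C: "finite C" "diffs ?Q \<subseteq> span C"
    using polytope_diffs[OF polytope_convex_hull[OF S]] by blast
  have "dim (insert (s0 - q) (diffs ?F)) = dim (diffs ?F) + 1"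
    by (rule dim_insert_finite[OF C(1) _ notin]) (use C(2) in blast)
  moreover have "span (insert (s0 - q) (diffs ?F)) = span (diffs ?Q)"
  proof (rule subset_antisym)
    have "s0 \<in> ?Q" "q \<in> ?Q" using s0(1) q by (auto simp: T_def hull_inc)
    then have "insert (s0 - q) (diffs ?F) \<subseteq> diffs ?Q" by blast
    then show "span (insert (s0 - q) (diffs ?F)) \<subseteq> span (diffs ?Q)" by (rule span_mono)
    have "diffs ?Q \<subseteq> span (insert (s0 - q) (diffs ?F))"
    proof safe
      fix y z assume "y \<in> ?Q" "z \<in> ?Q"
      then have "(y - q) - (z - q) \<in> span (insert (s0 - q) (diffs ?F))"
        by (intro span_diff in_span)
      then show "y - z \<in> span (insert (s0 - q) (diffs ?F))" by simp
    qed
    then show "span (diffs ?Q) \<subseteq> span (insert (s0 - q) (diffs ?F))"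
      by (simp add: span_minimal)
  qed
  from span_eq_dim[OF this] have "dim (insert (s0 - q) (diffs ?F)) = dim (diffs ?Q)" .
  ultimately have "dim (diffs ?F) + 1 = dim (diffs ?Q)" by simp
  then have "adim ?F + 1 = adim ?Q" by (simp add: adim_def)
  moreover have "?F face_of ?Q" by (rule face_of_supporting[OF convex_convex_hull lf nonneg])
  moreover have "?F \<noteq> {}" using TF q by blast
  ultimately have "is_facet ?F ?Q" by (simp add: is_facet_def)
  have "\<exists>k. \<forall>y\<in>?Q. f' y + c' = k * (f y + c)" if f': "linear f'" "\<forall>y\<in>?F. f' y + c' = 0" for f' c'
  proof -
    \<comment> \<open>The factor is read off at \<open>s0\<close>, which is off the facet;
      \<open>s0 - q\<close> and the facet directions span all directions of the hull.\<close>
    define k where "k = f' (s0 - q) / f (s0 - q)"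
    define g where "g y = f' y - k * f y" for y
    have lg: "linear g" unfolding g_def using f'(1) lf
      by (intro linearI) (auto simp: linear_add linear_scale algebra_simps)
    have "g d = 0" if "d \<in> diffs ?F" for d
    proof -
      from that obtain y z where yz: "y \<in> ?F" "z \<in> ?F" "d = y - z" by blast
      then have "f' y + c' = 0" "f' z + c' = 0" "f y + c = 0" "f z + c = 0" using f'(2) by auto
      then have "f' y = f' z" "f y = f z" by linarith+
      then show ?thesis using yz(3) by (simp add: g_def linear_diff[OF f'(1)] linear_diff[OF lf])
    qed
    moreover have "g (s0 - q) = 0" using \<open>f (s0 - q) \<noteq> 0\<close> by (simp add: g_def k_def)
    ultimately have g0: "g d = 0" if "d \<in> span (insert (s0 - q) (diffs ?F))" for d
      using linear_eq_0_on_span[OF lg _ that] by blast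
    have "f q + c = 0" "f' q + c' = 0" using q TF f'(2) by (auto simp: T_def)
    moreover have "g y = g q" if "y \<in> ?Q" for y
      using g0[OF in_span[OF that]] by (simp add: linear_diff[OF lg])
    ultimately have "f' y + c' = k * (f y + c)" if "y \<in> ?Q" for y
    proof -
      have "f q = - c" "f' q = - c'" "f' y - k * f y = f' q - k * f q"
        using \<open>f q + c = 0\<close> \<open>f' q + c' = 0\<close> \<open>\<And>y. y \<in> ?Q \<Longrightarrow> g y = g q\<close>[OF that]
        by (auto simp: g_def)
      then show ?thesis by (simp add: algebra_simps)
    qed
    then show ?thesis by blast
  qed
  then show ?thesis using that[OF lf nonneg _ \<open>is_facet ?F ?Q\<close>] h(3) hf by auto
qed

section \<open>Faces and vertices of polytopes\<close>

lemma face_of_convex_hull_finite: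
  fixes S :: "'a::real_vector set"
  assumes S: "finite S" and F: "F face_of (convex hull S)"
  shows "F = convex hull (S \<inter> F)"
proof
  have "convex F" using F by (rule face_of_imp_convex)
  then show "convex hull (S \<inter> F) \<subseteq> F" by (simp add: hull_minimal)
  show "F \<subseteq> convex hull (S \<inter> F)"
  proof
    fix x assume x: "x \<in> F"
    then have "x \<in> convex hull S" using F face_of_imp_subset by blast
    then obtain u where u: "\<forall>s\<in>S. 0 \<le> u s" "sum u S = 1" "(\<Sum>s\<in>S. u s *\<^sub>R s) = x"
      using convex_hull_finite[OF S] by auto
    \<comment> \<open>A generator with positive weight in \<open>x\<close> either equals
      \<open>x\<close>, or \<open>x\<close> lies strictly between it and the weighted mean
      \<open>y\<close> of the others.\<close>
    have "s \<in> F" if s: "s \<in> S" "0 < u s" for s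
    proof (cases "u s = 1")
      case True
      have "sum u (S - {s}) = 0" using u(2) True S s by (simp add: sum_diff1)
      then have "\<forall>t\<in>S - {s}. u t = 0" using u(1) S by (subst (asm) sum_nonneg_eq_0_iff) auto
      then have "x = s" using u(3) True S s by (simp add: sum.remove)
      then show ?thesis using x by simp
    next
      case False
      have "u s \<le> 1" using u(1,2) S s member_le_sum[of s S u] by simp
      then have lt: "u s < 1" using False by simp
      define y where "y = (\<Sum>t\<in>S - {s}. (u t / (1 - u s)) *\<^sub>R t)"
      have sum1: "sum u (S - {s}) = 1 - u s" using u(2) S s by (simp add: sum_diff1)
      have "y \<in> convex hull (S - {s})"
        unfolding y_def using S u(1) lt sum1
        by (intro convex_sum convex_convex_hull) (auto simp: hull_inc sum_divide_distrib[symmetric])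
      then have yQ: "y \<in> convex hull S" using hull_mono[of "S - {s}" S convex] by auto
      have "(1 - u s) *\<^sub>R y = (\<Sum>t\<in>S - {s}. u t *\<^sub>R t)"
        using lt by (simp add: y_def scaleR_sum_right)
      then have xe: "x = (1 - u s) *\<^sub>R y + u s *\<^sub>R s"
        using u(3) S s by (simp add: sum.remove add.commute)
      show ?thesis
      proof (cases "y = s")
        case True
        then show ?thesis using xe x by (simp add: scaleR_left_diff_distrib)
      next
        case ne: False
        then have "x \<in> open_segment y s" unfolding in_segment(2) using xe s(2) lt by blast
        then show ?thesis using face_ofD[OF F _ yQ _ x] s hull_inc by metis
      qed
    qed
    then have *: "u s = 0" if "s \<in> S - (S \<inter> F)" for s
      using that u(1) by force
    have "sum u (S \<inter> F) = 1" "(\<Sum>s\<in>S \<inter> F. u s *\<^sub>R s) = x"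
      using u(2,3) sum.mono_neutral_right[OF S, of "S \<inter> F" u]
        sum.mono_neutral_right[OF S, of "S \<inter> F" "\<lambda>s. u s *\<^sub>R s"] * by auto
    then show "x \<in> convex hull (S \<inter> F)"
      using convex_hull_finite[of "S \<inter> F"] S u(1) by auto
  qed
qed

lemma polytope_face:
  "polytope Q \<Longrightarrow> F face_of Q \<Longrightarrow> polytope F"
  for Q :: "'a::real_vector set"
  using face_of_convex_hull_finite unfolding polytope_def by (metis finite_Int)

lemma finite_faces:
  fixes Q :: "'a::real_vector set"
  assumes "polytope Q"
  shows "finite {F. F face_of Q}"
proof -
  obtain S where S: "finite S" "Q = convex hull S" using assms by (auto simp: polytope_def)
  have "{F. F face_of Q} \<subseteq> (\<lambda>T. convex hull T) ` Pow S"
    using face_of_convex_hull_finite[OF S(1)] S(2) by blast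
  then show ?thesis using S(1) finite_subset by blast
qed

lemma finite_facets: "polytope Q \<Longrightarrow> finite {F. is_facet F Q}"
  for Q :: "'a::real_vector set"
  by (rule finite_subset[OF _ finite_faces[of Q]]) (auto simp: is_facet_def)

text \<open>In a generating set of least size no point lies in the hull of the others, so it
  consists of extreme points.\<close>

lemma polytope_vertices:
  fixes Q :: "'a::real_vector set"
  assumes "polytope Q"
  shows "finite (vertices Q)" "Q = convex hull (vertices Q)"
proof -
  obtain S0 where S0: "finite S0" "Q = convex hull S0" using assms by (auto simp: polytope_def)
  obtain S where S: "finite S" "Q = convex hull S"
    and min: "\<And>T. finite T \<Longrightarrow> Q = convex hull T \<Longrightarrow> card S \<le> card T"
    using ex_has_least_nat[of "\<lambda>S. finite S \<and> Q = convex hull S" S0 card] S0 by blast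
  have vS: "vertices Q \<subseteq> S"
    using extreme_point_of_convex_hull S(2) by (auto simp: vertices_def)
  have "s \<in> vertices Q" if "s \<in> S" for s
  proof -
    have "s \<notin> convex hull (S - {s})"
    proof
      assume "s \<in> convex hull (S - {s})"
      then have "convex hull (S - {s}) = Q"
        using S(2) that hull_redundant[of s convex "S - {s}"] by (simp add: insert_absorb)
      then show False using min[of "S - {s}"] S(1) that
        by (metis card_Diff1_less finite_Diff leD)
    qed
    then have "s extreme_point_of (convex hull (insert s (S - {s})))"
      using S(1) by (intro extreme_point_of_convex_hull_insert) auto
    then show ?thesis using S(2) that by (simp add: vertices_def insert_absorb)
  qed
  then have "vertices Q = S" using vS by blast
  then show "finite (vertices Q)" "Q = convex hull (vertices Q)" using S by auto
qed

lemma vertices_face: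
  "F face_of Q \<Longrightarrow> vertices F = vertices Q \<inter> F"
  by (auto simp: vertices_def extreme_point_of_face)

section \<open>Facets among the inequalities of a description\<close>

lemma polyhedral_extend:
  fixes f :: "'j \<Rightarrow> 'a::real_vector \<Rightarrow> real"
  assumes J: "finite J" and lin: "\<And>j. j \<in> J \<Longrightarrow> linear (f j)"
    and z: "\<And>j. j \<in> J \<Longrightarrow> 0 \<le> f j z + c j"
    and d: "\<And>j. j \<in> J \<Longrightarrow> f j z + c j = 0 \<Longrightarrow> 0 \<le> f j d"
  obtains e where "0 < e" "\<And>j t. j \<in> J \<Longrightarrow> 0 \<le> t \<Longrightarrow> t \<le> e \<Longrightarrow> 0 \<le> f j (z + t *\<^sub>R d) + c j"
proof -
  have "\<exists>e>0. \<forall>j\<in>J. \<forall>t. 0 \<le> t \<and> t \<le> e \<longrightarrow> 0 \<le> f j (z + t *\<^sub>R d) + c j"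
    using J lin z d
  proof (induction J rule: finite_induct)
    case empty
    then show ?case by (auto intro: exI[of _ 1])
  next
    case (insert k J)
    then obtain e where e: "0 < e" "\<forall>j\<in>J. \<forall>t. 0 \<le> t \<and> t \<le> e \<longrightarrow> 0 \<le> f j (z + t *\<^sub>R d) + c j"
      by auto
    have feq: "f k (z + t *\<^sub>R d) + c k = (f k z + c k) + t * f k d" for t
      using insert.prems(1)[of k] by (simp add: linear_add linear_scale)
    show ?case
    proof (cases "0 \<le> f k d")
      case True
      then have "\<forall>t. 0 \<le> t \<and> t \<le> e \<longrightarrow> 0 \<le> f k (z + t *\<^sub>R d) + c k"
        using insert.prems(2)[of k] True unfolding feq
        by (intro allI impI add_nonneg_nonneg[of "f k z + c k"] mult_nonneg_nonneg) auto
      then show ?thesis using e by auto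
    next
      case False
      then have pos: "0 < f k z + c k" using insert.prems(2,3)[of k] by force
      \<comment> \<open>Only a constraint that decreases along \<open>d\<close> limits the step, and
        such a constraint is strict at \<open>z\<close>.\<close>
      define e' where "e' = min e ((f k z + c k) / - f k d)"
      have "0 < e'" using False pos e(1) by (simp add: e'_def divide_pos_neg)
      moreover have "0 \<le> f k (z + t *\<^sub>R d) + c k" if "0 \<le> t" "t \<le> e'" for t
      proof -
        have "t \<le> (f k z + c k) / - f k d" using that by (simp add: e'_def)
        then have "t * - f k d \<le> f k z + c k" using False by (subst (asm) pos_le_divide_eq) auto
        then show ?thesis by (simp add: feq)
      qed
      moreover have "e' \<le> e" by (simp add: e'_def)
      ultimately show ?thesis using e(2) by (intro exI[of _ e']) auto
    qed
  qed
  then show ?thesis using that by blast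
qed

text \<open>Midpoints keep strict inequalities strict, so one point can serve all constraints. It
  plays the part of a relative interior point of \<open>F\<close>.\<close>

lemma convex_all_positive_point:
  fixes f :: "'j \<Rightarrow> 'a::real_vector \<Rightarrow> real"
  assumes J: "finite J" and lin: "\<And>j. j \<in> J \<Longrightarrow> linear (f j)" and F: "convex F" "F \<noteq> {}"
    and nonneg: "\<And>j x. j \<in> J \<Longrightarrow> x \<in> F \<Longrightarrow> 0 \<le> f j x + c j"
    and pos: "\<And>j. j \<in> J \<Longrightarrow> \<exists>x\<in>F. 0 < f j x + c j"
  obtains z where "z \<in> F" "\<And>j. j \<in> J \<Longrightarrow> 0 < f j z + c j"
proof -
  have "\<exists>z\<in>F. \<forall>j\<in>J. 0 < f j z + c j"
    using J lin nonneg pos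
  proof (induction J rule: finite_induct)
    case empty
    then show ?case using F by auto
  next
    case (insert k J)
    then obtain z where z: "z \<in> F" "\<forall>j\<in>J. 0 < f j z + c j" by auto
    obtain x where x: "x \<in> F" "0 < f k x + c k" using insert.prems(3) by auto
    define w where "w = (1/2) *\<^sub>R z + (1/2) *\<^sub>R x"
    have "w \<in> F" unfolding w_def using F(1) z x by (intro convexD) auto
    moreover have weq: "f j w + c j = (1/2) * (f j z + c j) + (1/2) * (f j x + c j)" if "j \<in> insert k J" for j
      using insert.prems(1)[OF that] by (simp add: w_def linear_add linear_scale field_simps)
    have "0 < f j w + c j" if "j \<in> insert k J" for j
    proof (cases "j = k")
      case True
      then show ?thesis
        using weq[OF that] x insert.prems(2)[of k z] z(1) add_nonneg_pos[of "(f k z + c k) / 2" "(f k x + c k) / 2"]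
        by simp
    next
      case False
      then have "0 < f j z + c j" using z that by simp
      then show ?thesis
        using weq[OF that] insert.prems(2)[OF that x(1)] add_pos_nonneg[of "(f j z + c j) / 2" "(f j x + c j) / 2"]
        by simp
    qed
    ultimately show ?case by blast
  qed
  then show ?thesis using that by blast
qed

lemma affine_functional_hull_zero:
  fixes f :: "'a::real_vector \<Rightarrow> real"
  assumes "linear f" "\<forall>s\<in>S. f s + c = 0" "y \<in> affine hull S"
  shows "f y + c = 0"
proof -
  have "affine {y. f y + c = 0}"
    unfolding affine_def
  proof (intro ballI allI impI CollectI)
    fix x y and u v :: real
    assume *: "x \<in> {y. f y + c = 0}" "y \<in> {y. f y + c = 0}" "u + v = 1"
    then have "f x = - c" "f y = - c" by auto
    then have "f (u *\<^sub>R x + v *\<^sub>R y) + c = - (u + v) * c + c"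
      using assms(1) by (simp add: linear_add linear_scale algebra_simps)
    then show "f (u *\<^sub>R x + v *\<^sub>R y) + c = 0" using *(3) by simp
  qed
  moreover have "S \<subseteq> {y. f y + c = 0}" using assms(2) by blast
  ultimately show ?thesis using assms(3) hull_minimal by blast
qed

text \<open>If no proper constraint were tight on all of \<open>G\<close>, a point \<open>z\<close>
  of \<open>G\<close> satisfying them strictly could be moved a little away from any
  \<open>y\<close> outside \<open>G\<close> without leaving \<open>Q\<close>; then \<open>z\<close>
  is interior to a segment ending in \<open>y\<close>, against the face property. So
  \<open>G\<close> lies in some \<open>E j\<close>, and comparing dimensions gives equality.\<close>

lemma facet_eq_supporting:
  fixes f :: "'j \<Rightarrow> 'a::real_vector \<Rightarrow> real"
  assumes J: "finite J" and lin: "\<And>j. j \<in> J \<Longrightarrow> linear (f j)"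
    and Q: "polytope Q" and A: "affine A" and QA: "Q = {x\<in>A. \<forall>j\<in>J. 0 \<le> f j x + c j}"
    and G: "is_facet G Q"
  obtains j where "j \<in> J" "G = {x\<in>Q. f j x + c j = 0}"
proof -
  define E where "E j = {x\<in>Q. f j x + c j = 0}" for j
  \<comment> \<open>Constraints that are equalities on all of \<open>Q\<close> do not single out a
    face and are set aside.\<close>
  define J' where "J' = {j\<in>J. E j \<noteq> Q}"
  have Gf: "G face_of Q" "G \<noteq> {}" "adim G + 1 = adim Q" using G by (auto simp: is_facet_def)
  then have GQ: "G \<subseteq> Q" "G \<noteq> Q" using face_of_imp_subset by auto
  have nonneg: "0 \<le> f j x + c j" if "j \<in> J" "x \<in> Q" for j x using that QA by auto
  have "\<exists>j\<in>J'. \<forall>x\<in>G. f j x + c j = 0"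
  proof (rule ccontr)
    assume neg: "\<not> (\<exists>j\<in>J'. \<forall>x\<in>G. f j x + c j = 0)"
    have pos: "\<exists>x\<in>G. 0 < f j x + c j" if j: "j \<in> J'" for j
    proof -
      obtain x where x: "x \<in> G" "f j x + c j \<noteq> 0" using neg j by blast
      then have "0 \<le> f j x + c j" using nonneg[of j x] j GQ by (auto simp: J'_def)
      then show ?thesis using x by (intro bexI[of _ x]) auto
    qed
    have fJ': "finite J'" using J by (simp add: J'_def)
    have linJ': "linear (f j)" if "j \<in> J'" for j using lin that by (simp add: J'_def)
    have nonnegJ': "0 \<le> f j x + c j" if "j \<in> J'" "x \<in> G" for j x
      using nonneg that GQ by (auto simp: J'_def)
    obtain z where z: "z \<in> G" "\<And>j. j \<in> J' \<Longrightarrow> 0 < f j z + c j"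
      by (rule convex_all_positive_point[OF fJ' linJ' face_of_imp_convex[OF Gf(1)] Gf(2) nonnegJ' pos]) blast+
    obtain y where y: "y \<in> Q" "y \<notin> G" using GQ by blast
    have zQ: "z \<in> Q" using z GQ by blast
    have "0 \<le> f j (z - y)" if "j \<in> J" "f j z + c j = 0" for j
    proof -
      have "j \<notin> J'" using z(2)[of j] that by auto
      then have "E j = Q" using that by (simp add: J'_def)
      then have "f j y + c j = 0" using y by (auto simp: E_def)
      then show ?thesis using that lin by (simp add: linear_diff)
    qed
    then obtain e where e: "0 < e" "\<And>j t. j \<in> J \<Longrightarrow> 0 \<le> t \<Longrightarrow> t \<le> e \<Longrightarrow> 0 \<le> f j (z + t *\<^sub>R (z - y)) + c j"
      using polyhedral_extend[of J f z c "z - y"] J lin nonneg zQ by blast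
    define w where "w = z + e *\<^sub>R (z - y)"
    have "w = (1 + e) *\<^sub>R z + (- e) *\<^sub>R y" by (simp add: w_def algebra_simps)
    moreover have "z \<in> A" "y \<in> A" using zQ y QA by auto
    ultimately have "w \<in> A" using A mem_affine[of A z y "1 + e" "- e"] by simp
    then have "w \<in> Q" using e unfolding QA w_def by auto
    have "w = (1 + e) *\<^sub>R z + (- e) *\<^sub>R y" by (simp add: w_def algebra_simps)
    have "z = (1 - 1 / (1 + e)) *\<^sub>R y + (1 / (1 + e)) *\<^sub>R w"
    proof -
      have "(1 / (1 + e)) *\<^sub>R w = z - (e / (1 + e)) *\<^sub>R y"
        using e(1) unfolding \<open>w = (1 + e) *\<^sub>R z + (- e) *\<^sub>R y\<close> by (simp add: scaleR_right_diff_distrib)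
      moreover have "1 - 1 / (1 + e) = e / (1 + e)" using e(1) by (simp add: field_simps)
      ultimately show ?thesis by simp
    qed
    moreover have "y \<noteq> w"
    proof
      assume "y = w"
      then have "(1 + e) *\<^sub>R (z - y) = 0" by (simp add: w_def algebra_simps)
      then show False using e(1) z y by auto
    qed
    ultimately have "z \<in> open_segment y w"
      unfolding in_segment(2) using e(1)
      by (intro conjI exI[of _ "1 / (1 + e)"]) auto
    then have "y \<in> G" using face_ofD[OF Gf(1) _ y(1) \<open>w \<in> Q\<close> z(1)] by blast
    then show False using y by blast
  qed
  then obtain j where j: "j \<in> J" "E j \<noteq> Q" "\<forall>x\<in>G. f j x + c j = 0" by (auto simp: J'_def)
  have Ef: "E j face_of Q"
    unfolding E_def using lin j nonneg
    by (intro face_of_supporting polytope_imp_convex Q) auto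
  have GE: "G \<subseteq> E j" using j GQ by (auto simp: E_def)
  then have "E j \<noteq> {}" using Gf by blast
  then have lt: "adim (E j) < adim Q" using adim_face_less[OF Q Ef _ j(2)] by blast
  have "G face_of E j" using Gf(1) GE face_of_imp_subset[OF Ef] face_of_subset by blast
  then have "G = E j"
    using adim_face_less[OF polytope_face[OF Q Ef], of G] Gf lt by fastforce
  then show ?thesis using that[OF j(1)] by (simp add: E_def)
qed

lemma psize_le_inequalities:
  fixes f :: "'j \<Rightarrow> 'a::real_vector \<Rightarrow> real"
  assumes J: "finite J" and lin: "\<And>j. j \<in> J \<Longrightarrow> linear (f j)"
    and Q: "polytope Q" and A: "affine A" and QA: "Q = {x\<in>A. \<forall>j\<in>J. 0 \<le> f j x + c j}"
  shows "psize Q \<le> card J"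
proof -
  have "{F. is_facet F Q} \<subseteq> (\<lambda>j. {x\<in>Q. f j x + c j = 0}) ` J"
    using facet_eq_supporting[OF assms] by blast
  then show ?thesis
    unfolding psize_def using surj_card_le[OF J] by blast
qed

text \<open>\<open>J\<close> collects the facets known to have a supporting functional. Separation
  shows that these alone describe \<open>Q\<close>; only then does
  \<open>facet_eq_supporting\<close> show that \<open>J\<close> contains every facet.\<close>

lemma facet_description:
  fixes Q :: "'a::real_vector set"
  assumes Q: "polytope Q"
  obtains f :: "'a set \<Rightarrow> 'a \<Rightarrow> real" and c :: "'a set \<Rightarrow> real" where
    "\<And>F. is_facet F Q \<Longrightarrow> linear (f F)"
    "\<And>F x. is_facet F Q \<Longrightarrow> x \<in> Q \<Longrightarrow> 0 \<le> f F x + c F"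
    "\<And>F. is_facet F Q \<Longrightarrow> F = {x\<in>Q. f F x + c F = 0}"
    "\<And>x. x \<in> affine hull Q \<Longrightarrow> (\<And>F. is_facet F Q \<Longrightarrow> 0 \<le> f F x + c F) \<Longrightarrow> x \<in> Q"
proof -
  obtain S where S: "finite S" "Q = convex hull S" using Q by (auto simp: polytope_def)
  define ex where "ex F f c \<longleftrightarrow> linear f \<and> (\<forall>x\<in>Q. 0 \<le> f x + c) \<and> F = {x\<in>Q. f x + c = 0}"
    for F and f :: "'a \<Rightarrow> real" and c
  define J where "J = {F. is_facet F Q \<and> (\<exists>f c. ex F f c)}"
  have "\<forall>F\<in>J. \<exists>fc. ex F (fst fc) (snd fc)" by (auto simp: J_def)
  then obtain fc where fc': "\<forall>F\<in>J. ex F (fst (fc F)) (snd (fc F))" by metis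
  define f where "f F = fst (fc F)" for F
  define c where "c F = snd (fc F)" for F
  have fc: "ex F (f F) (c F)" if "F \<in> J" for F using fc' that by (simp add: f_def c_def)
  have finJ: "finite J" using finite_facets[OF Q] by (simp add: J_def)
  have desc: "x \<in> Q" if x: "x \<in> affine hull Q" "\<And>F. F \<in> J \<Longrightarrow> 0 \<le> f F x + c F" for x
  proof (rule ccontr)
    assume "x \<notin> Q"
    then have nx: "x \<notin> convex hull S" and xS: "x \<in> affine hull S" using x(1) S(2) by simp_all
    obtain g b where g: "linear g" "\<forall>y\<in>Q. 0 \<le> g y + b" "g x + b < (0::real)"
      "is_facet {y\<in>Q. g y + b = 0} Q"
      "\<And>f' c'. \<lbrakk>linear f'; \<forall>y\<in>{y\<in>Q. g y + b = 0}. f' y + c' = (0::real)\<rbrakk>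
         \<Longrightarrow> \<exists>k. \<forall>y\<in>Q. f' y + c' = k * (g y + b)"
      unfolding S(2) by (rule facet_separation[OF S(1) xS nx]) blast
    let ?F = "{y\<in>Q. g y + b = 0}"
    have FJ: "?F \<in> J" using g by (auto simp: J_def ex_def)
    have e: "linear (f ?F)" "\<forall>y\<in>Q. 0 \<le> f ?F y + c ?F" "?F = {y\<in>Q. f ?F y + c ?F = 0}"
      using fc[OF FJ] by (auto simp: ex_def)
    then have "\<forall>y\<in>?F. f ?F y + c ?F = 0" by blast
    \<comment> \<open>The chosen functional of the facet is a multiple of the separating
      \<open>g\<close>, with positive factor because both are positive off the facet; hence the
      chosen one is negative at \<open>x\<close> too.\<close>
    then obtain k where k: "\<forall>y\<in>Q. f ?F y + c ?F = k * (g y + b)" using g(5) e(1) by blast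
    have "?F \<noteq> Q" using g(4) by (auto simp: is_facet_def)
    then obtain y where y: "y \<in> Q" "y \<notin> ?F" by blast
    then have "0 < g y + b" "0 < f ?F y + c ?F"
      using g(2) e(2,3) by (auto simp: less_le)
    moreover have "f ?F y + c ?F = k * (g y + b)" using k y(1) by blast
    ultimately have "0 < k" using zero_less_mult_pos2[of k "g y + b"] by simp
    have "linear (\<lambda>y. f ?F y - k * g y)" using e(1) g(1)
      by (intro linearI) (auto simp: linear_add linear_scale algebra_simps)
    then have "(f ?F x - k * g x) + (c ?F - k * b) = 0"
      using x(1) k by (intro affine_functional_hull_zero[of "\<lambda>y. f ?F y - k * g y" Q]) (auto simp: algebra_simps)
    then have "f ?F x + c ?F = k * (g x + b)" by (simp add: algebra_simps)
    moreover have "k * (g x + b) < 0" using \<open>0 < k\<close> g(3) by (simp add: mult_pos_neg)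
    ultimately show False using x(2)[OF FJ] by simp
  qed
  have QJ: "Q = {x\<in>affine hull Q. \<forall>F\<in>J. 0 \<le> f F x + c F}"
    using desc fc hull_subset[of Q affine] by (auto simp: ex_def)
  have linJ: "linear (f F)" if "F \<in> J" for F using fc[OF that] by (simp add: ex_def)
  have allJ: "F \<in> J" if F: "is_facet F Q" for F
  proof -
    obtain G where G: "G \<in> J" "F = {x\<in>Q. f G x + c G = 0}"
      by (rule facet_eq_supporting[OF finJ linJ Q affine_affine_hull QJ F])
    then have "ex F (f G) (c G)" using fc by (auto simp: ex_def)
    then show ?thesis using F by (auto simp: J_def)
  qed
  show ?thesis
  proof (rule that[of f c])
    show "x \<in> Q" if "x \<in> affine hull Q" "\<And>F. is_facet F Q \<Longrightarrow> 0 \<le> f F x + c F" for x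
      using desc that by (auto simp: J_def)
  qed (use allJ fc in \<open>auto simp: ex_def\<close>)
qed

text \<open>The push argument of \<open>facet_eq_supporting\<close> again: from a point
  \<open>z\<close> of \<open>F\<close> that is off all facets not containing \<open>F\<close>, a
  small step away from \<open>x\<close> stays in \<open>Q\<close>, so \<open>x\<close> is the end of
  a segment through \<open>z\<close>.\<close>

lemma in_face_if_in_facets:
  fixes Q :: "'a::real_vector set"
  assumes Q: "polytope Q" and F: "F face_of Q" "F \<noteq> {}" and x: "x \<in> Q"
    and all: "\<And>H. is_facet H Q \<Longrightarrow> F \<subseteq> H \<Longrightarrow> x \<in> H"
  shows "x \<in> F"
proof -
  obtain f c where fc: "\<And>F. is_facet F Q \<Longrightarrow> linear (f F)"
    "\<And>F x. is_facet F Q \<Longrightarrow> x \<in> Q \<Longrightarrow> 0 \<le> f F x + c F"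
    "\<And>F. is_facet F Q \<Longrightarrow> F = {x\<in>Q. f F x + c F = (0::real)}"
    "\<And>x. x \<in> affine hull Q \<Longrightarrow> (\<And>F. is_facet F Q \<Longrightarrow> 0 \<le> f F x + c F) \<Longrightarrow> x \<in> Q"
    by (rule facet_description[OF Q]) blast
  define J where "J = {H. is_facet H Q}"
  define J' where "J' = {H. is_facet H Q \<and> \<not> F \<subseteq> H}"
  have fin: "finite J" "finite J'" using finite_facets[OF Q] by (auto simp: J_def J'_def)
  have FQ: "F \<subseteq> Q" using F(1) by (rule face_of_imp_subset)
  have pos: "\<exists>y\<in>F. 0 < f H y + c H" if "H \<in> J'" for H
  proof -
    from that obtain y where "y \<in> F" "y \<notin> H" by (auto simp: J'_def)
    moreover have "y \<in> Q" "is_facet H Q" using \<open>y \<in> F\<close> FQ that by (auto simp: J'_def)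
    ultimately have "f H y + c H \<noteq> 0" "0 \<le> f H y + c H" using fc(2,3)[of H] by blast+
    then show ?thesis using \<open>y \<in> F\<close> by force
  qed
  have linJ': "linear (f j)" if "j \<in> J'" for j using fc(1) that by (simp add: J'_def)
  have nonnegJ': "0 \<le> f j x + c j" if "j \<in> J'" "x \<in> F" for j x
    using fc(2) that FQ by (auto simp: J'_def)
  obtain z where z: "z \<in> F" "\<And>H. H \<in> J' \<Longrightarrow> 0 < f H z + c H"
    by (rule convex_all_positive_point[OF fin(2) linJ' face_of_imp_convex[OF F(1)] F(2) nonnegJ' pos]) blast+
  have zQ: "z \<in> Q" using z FQ by blast
  have "0 \<le> f H (z - x)" if "H \<in> J" "f H z + c H = 0" for H
  proof -
    have H: "is_facet H Q" using that by (simp add: J_def)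
    have "H \<notin> J'" using z(2)[of H] that by auto
    then have "x \<in> H" using all H by (simp add: J'_def)
    then have "f H x + c H = 0" using fc(3)[OF H] by blast
    then show ?thesis using that fc(1)[OF H] by (simp add: linear_diff)
  qed
  then obtain e where e: "0 < e" "\<And>j t. j \<in> J \<Longrightarrow> 0 \<le> t \<Longrightarrow> t \<le> e \<Longrightarrow> 0 \<le> f j (z + t *\<^sub>R (z - x)) + c j"
    using polyhedral_extend[of J f z c "z - x"] fin fc zQ by (auto simp: J_def)
  define w where "w = z + e *\<^sub>R (z - x)"
  have weq: "w = (1 + e) *\<^sub>R z + (- e) *\<^sub>R x" by (simp add: w_def algebra_simps)
  then have "w \<in> affine hull Q"
    using mem_affine[OF affine_affine_hull hull_inc[OF zQ] hull_inc[OF x], of "1 + e" "- e"] by simp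
  then have "w \<in> Q" using e fc(4) by (simp add: w_def J_def)
  show ?thesis
  proof (cases "x = z")
    case True
    then show ?thesis using z by simp
  next
    case False
    have "(1 / (1 + e)) *\<^sub>R w = z - (e / (1 + e)) *\<^sub>R x"
      using e(1) unfolding weq by (simp add: scaleR_right_diff_distrib)
    moreover have "1 - 1 / (1 + e) = e / (1 + e)" using e(1) by (simp add: field_simps)
    ultimately have "z = (1 - 1 / (1 + e)) *\<^sub>R x + (1 / (1 + e)) *\<^sub>R w" by simp
    moreover have "x \<noteq> w"
    proof
      assume "x = w"
      then have "(1 + e) *\<^sub>R (z - x) = 0" by (simp add: w_def algebra_simps)
      then show False using e(1) False by auto
    qed
    ultimately have "z \<in> open_segment x w"
      unfolding in_segment(2) using e(1)
      by (intro conjI exI[of _ "1 / (1 + e)"]) auto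
    then show ?thesis using face_ofD[OF F(1) _ x \<open>w \<in> Q\<close> z(1)] by blast
  qed
qed

lemma face_in_facet:
  fixes Q :: "'a::real_vector set"
  assumes "polytope Q" "F face_of Q" "F \<noteq> {}" "F \<noteq> Q"
  obtains H where "is_facet H Q" "F \<subseteq> H"
proof -
  obtain x where "x \<in> Q" "x \<notin> F" using assms face_of_imp_subset by blast
  then show ?thesis using in_face_if_in_facets[OF assms(1-3)] that by blast
qed

text \<open>A facet \<open>G\<close> of \<open>F\<close> misses some \<open>x\<close> in
  \<open>F\<close>, so some facet \<open>H\<close> of \<open>Q\<close> contains \<open>G\<close> but
  not \<open>x\<close>; then \<open>F \<inter> H\<close> is a proper face of \<open>F\<close> above
  \<open>G\<close> and equals it by dimension.\<close>

lemma psize_face_le: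
  fixes Q :: "'a::real_vector set"
  assumes Q: "polytope Q" and F: "F face_of Q" "F \<noteq> {}"
  shows "psize F \<le> card {H. is_facet H Q \<and> \<not> F \<subseteq> H \<and> F \<inter> H \<noteq> {}}"
proof -
  let ?J = "{H. is_facet H Q \<and> \<not> F \<subseteq> H \<and> F \<inter> H \<noteq> {}}"
  have "finite ?J" using finite_facets[OF Q] by simp
  moreover have "{G. is_facet G F} \<subseteq> (\<lambda>H. F \<inter> H) ` ?J"
  proof safe
    fix G assume G: "is_facet G F"
    then have Gf: "G face_of F" "G \<noteq> {}" "G \<noteq> F" by (auto simp: is_facet_def)
    then have GF: "G \<subseteq> F" using face_of_imp_subset by blast
    obtain x where x: "x \<in> F" "x \<notin> G" using Gf GF by blast
    have "x \<in> Q" using x F face_of_imp_subset by blast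
    then obtain H where H: "is_facet H Q" "G \<subseteq> H" "x \<notin> H"
      using in_face_if_in_facets[OF Q face_of_trans[OF Gf(1) F(1)] Gf(2)] x by blast
    have "F \<inter> H face_of Q" using F(1) H by (auto simp: is_facet_def intro: face_of_Int)
    then have FH: "F \<inter> H face_of F"
      using face_of_subset[of "F \<inter> H" Q F] face_of_imp_subset[OF F(1)] by blast
    have "F \<inter> H \<noteq> F" "F \<inter> H \<noteq> {}" using H x GF Gf by auto
    then have lt: "adim (F \<inter> H) < adim F" using adim_face_less[OF polytope_face[OF Q F(1)] FH] by blast
    have "G face_of F \<inter> H" using face_of_subset[OF Gf(1), of "F \<inter> H"] H GF by blast
    then have "G = F \<inter> H"
      using adim_face_less[OF polytope_face[OF polytope_face[OF Q F(1)] FH], of G] Gf G lt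
      by (fastforce simp: is_facet_def)
    moreover have "H \<in> ?J" using H x \<open>F \<inter> H \<noteq> {}\<close> by blast
    ultimately show "G \<in> (\<lambda>H. F \<inter> H) ` ?J" by blast
  qed
  ultimately show ?thesis
    unfolding psize_def by (rule surj_card_le)
qed

section \<open>Opposite faces and prisms\<close>

text \<open>Facets of \<open>Q\<close> that contain or miss a face contribute no facet to it. Two
  facets through \<open>F\<close> settle the first alternative. A face lying in just one facet is
  that facet, and it misses the opposite face; this supplies the lacking count in the other
  cases.\<close>

lemma psize_opposite_faces:
  fixes Q :: "'a::real_vector set"
  assumes Q: "polytope Q" and F: "F face_of Q" "F \<noteq> {}" and F': "F' face_of Q" "F' \<noteq> {}"
    and disj: "F \<inter> F' = {}"
  shows "psize F + 2 \<le> psize Q \<or> psize F' + 3 \<le> psize Q"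
proof -
  define A where "A X = {H. is_facet H Q \<and> X \<subseteq> H}" for X
  define D where "D X = {H. is_facet H Q \<and> X \<inter> H = {}}" for X
  have finA: "finite (A X)" and finD: "finite (D X)" for X
    using finite_facets[OF Q] by (auto simp: A_def D_def)
  have ne: "F \<noteq> Q" "F' \<noteq> Q"
    using F F' disj face_of_imp_subset[OF F(1)] face_of_imp_subset[OF F'(1)] by auto
  have A1: "1 \<le> card (A X)" if X: "X face_of Q" "X \<noteq> {}" "X \<noteq> Q" for X
  proof -
    obtain H where "is_facet H Q" "X \<subseteq> H" using face_in_facet[OF Q X] .
    then have "A X \<noteq> {}" by (auto simp: A_def)
    then show ?thesis using finA[of X] by (simp add: Suc_le_eq card_gt_0_iff)
  qed
  have single: "is_facet X Q" if X: "X face_of Q" "X \<noteq> {}" "card (A X) = 1" for X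
  proof -
    obtain H where H: "A X = {H}" using X(3) by (auto simp: card_1_singleton_iff)
    then have *: "is_facet H Q" "X \<subseteq> H" by (auto simp: A_def)
    have "H \<subseteq> X"
    proof
      fix x assume x: "x \<in> H"
      then have "x \<in> Q" using * face_of_imp_subset by (auto simp: is_facet_def)
      then show "x \<in> X"
        using in_face_if_in_facets[OF Q X(1,2)] H x by (auto simp: A_def)
    qed
    then show ?thesis using * by (metis subset_antisym)
  qed
  have bound: "psize X + card (A X) + card (D X) \<le> psize Q" if X: "X face_of Q" "X \<noteq> {}" for X
  proof -
    let ?M = "{H. is_facet H Q \<and> \<not> X \<subseteq> H \<and> X \<inter> H \<noteq> {}}"
    have "finite ?M" using finite_facets[OF Q] by simp
    moreover have "A X \<inter> D X = {}" "?M \<inter> (A X \<union> D X) = {}" using X(2) by (auto simp: A_def D_def)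
    moreover have "{H. is_facet H Q} = ?M \<union> (A X \<union> D X)" by (auto simp: A_def D_def)
    ultimately have "psize Q = card ?M + (card (A X) + card (D X))"
      unfolding psize_def using finA[of X] finD[of X] by (simp add: card_Un_disjoint)
    then show ?thesis using psize_face_le[OF Q X] by simp
  qed
  have D1: "1 \<le> card (D X)" if "is_facet Y Q" "X \<inter> Y = {}" for X Y
    using that finD[of X] by (auto simp: D_def Suc_le_eq card_gt_0_iff)
  consider "2 \<le> card (A F)" | "card (A F) = 1" "card (A F') = 1" | "card (A F) = 1" "2 \<le> card (A F')"
    using A1[OF F ne(1)] A1[OF F' ne(2)] by (cases "card (A F) = 1"; cases "card (A F') = 1") auto
  then show ?thesis
  proof cases
    case 1
    then show ?thesis using bound[OF F] by simp
  next
    case 2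
    then show ?thesis using bound[OF F] D1[OF single[OF F' 2(2)] disj] by simp
  next
    case 3
    have "F' \<inter> F = {}" using disj by blast
    from D1[OF single[OF F 3(1)] this] show ?thesis using 3 bound[OF F'] by simp
  qed
qed

text \<open>The ratio is tied to the facet number in \<open>base\<close> and in the conclusion,
  since it is claimed for facet-minimal polytopes only. \<open>hit\<close> asks for preimages of all
  corners over each vertex of \<open>P\<close>; this keeps both end faces nonempty and passes on to
  them.\<close>

theorem prism_extension_bound:
  fixes p :: "'a::real_vector \<Rightarrow> 'b::real_vector" and t :: "nat \<Rightarrow> 'a \<Rightarrow> real"
  assumes p: "linear p" and P: "vertices P \<noteq> {}" and m: "1 \<le> m"
    and base: "\<And>Q. polytope Q \<Longrightarrow> p ` Q \<subseteq> P \<Longrightarrow> vertices P \<subseteq> p ` Q \<Longrightarrow>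
        k \<le> psize Q \<and>
        (psize Q \<le> k \<longrightarrow> card (vertices Q) \<le> m * card {v\<in>vertices Q. p v \<notin> vertices P})"
    and t: "\<And>i. i < d \<Longrightarrow> linear (t i)"
    and Q: "polytope Q" "p ` Q \<subseteq> P" "\<And>i x. i < d \<Longrightarrow> x \<in> Q \<Longrightarrow> t i x \<in> {0..1}"
    and hit: "\<And>q T. q \<in> vertices P \<Longrightarrow> \<exists>x\<in>Q. p x = q \<and> (\<forall>i<d. t i x = (if i \<in> T then 1 else 0))"
  shows "k + 2 * d \<le> psize Q \<and>
    (psize Q \<le> k + 2 * d \<longrightarrow> card (vertices Q)
      \<le> m * card {v\<in>vertices Q. \<not> (p v \<in> vertices P \<and> (\<forall>i<d. t i v \<in> {0, 1}))})"
  using t Q hit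
proof (induction d arbitrary: Q)
  case 0
  have "vertices P \<subseteq> p ` Q" using "0.prems"(5) by fastforce
  then show ?case using base[OF "0.prems"(2,3)] by simp
next
  case (Suc d)
  let ?bad = "\<lambda>d Q. {v\<in>vertices Q. \<not> (p v \<in> vertices P \<and> (\<forall>i<d. t i v \<in> {0, 1}))}"
  define G where "G b = {x\<in>Q. t d x = b}" for b :: real
  have ltd: "linear (t d)" using Suc.prems(1) by simp
  have conv: "convex Q" using Suc.prems(2) by (rule polytope_imp_convex)
  have Gface: "G b face_of Q" if "b \<in> {0, 1}" for b
  proof -
    have "G 0 = {x\<in>Q. t d x + 0 = 0}" by (simp add: G_def)
    also have "\<dots> face_of Q"
      using Suc.prems(4)[of d] by (intro face_of_supporting conv ltd) auto
    finally have "G 0 face_of Q" .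
    moreover have "G 1 = {x\<in>Q. - t d x + 1 = 0}" by (auto simp: G_def)
    moreover have "\<dots> face_of Q"
      using Suc.prems(4)[of d] by (intro face_of_supporting conv linear_compose_neg ltd) auto
    ultimately show ?thesis using that by auto
  qed
  have IH: "k + 2 * d \<le> psize (G b) \<and>
    (psize (G b) \<le> k + 2 * d \<longrightarrow> card (vertices (G b)) \<le> m * card (?bad d (G b)))"
    if b: "b \<in> {0, 1}" for b
  proof (rule Suc.IH)
    show "linear (t i)" if "i < d" for i using Suc.prems(1) that by simp
    show "polytope (G b)" using polytope_face[OF Suc.prems(2) Gface[OF b]] .
    show "p ` G b \<subseteq> P" using Suc.prems(3) by (auto simp: G_def)
    show "t i x \<in> {0..1}" if "i < d" "x \<in> G b" for i x
      using Suc.prems(4)[of i x] that by (simp add: G_def)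
    show "\<exists>x\<in>G b. p x = q \<and> (\<forall>i<d. t i x = (if i \<in> T then 1 else 0))" if q: "q \<in> vertices P" for q T
    proof -
      obtain x where "x \<in> Q" "p x = q"
        "\<forall>i<Suc d. t i x = (if i \<in> (if b = 1 then insert d T else T - {d}) then 1 else 0)"
        using Suc.prems(5)[OF q] by blast
      then show ?thesis using b by (intro bexI[of _ x]) (auto simp: G_def)
    qed
  qed
  have Gne: "G b \<noteq> {}" if "b \<in> {0, 1}" for b
  proof -
    obtain q where "q \<in> vertices P" using P by blast
    then obtain x where "x \<in> Q" "\<forall>i<Suc d. t i x = (if i \<in> (if b = 1 then {d} else {}) then 1 else 0)"
      using Suc.prems(5) by blast
    then have "x \<in> G b" using that by (auto simp: G_def)
    then show ?thesis by blast
  qed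
  have disj: "G 0 \<inter> G 1 = {}" "G 1 \<inter> G 0 = {}" by (auto simp: G_def)
  \<comment> \<open>The count is asymmetric, so it is applied in both orders. For a minimal
    \<open>Q\<close> the alternatives with 3 contradict the induction hypothesis, and the remaining
    ones bound the facets of \<open>G 0\<close> and of \<open>G 1\<close>.\<close>
  have alt0: "psize (G 0) + 2 \<le> psize Q \<or> psize (G 1) + 3 \<le> psize Q"
    by (rule psize_opposite_faces) (use Suc.prems(2) Gface Gne disj in auto)
  have alt1: "psize (G 1) + 2 \<le> psize Q \<or> psize (G 0) + 3 \<le> psize Q"
    by (rule psize_opposite_faces) (use Suc.prems(2) Gface Gne disj in auto)
  have I0: "k + 2 * d \<le> psize (G 0)" and I1: "k + 2 * d \<le> psize (G 1)" using IH by auto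
  have "k + 2 * Suc d \<le> psize Q" using alt0 I0 I1 by (elim disjE) simp_all
  moreover have "card (vertices Q) \<le> m * card (?bad (Suc d) Q)" if le: "psize Q \<le> k + 2 * Suc d"
  proof -
    have "psize (G 0) \<le> k + 2 * d" "psize (G 1) \<le> k + 2 * d"
      using alt0 alt1 I0 I1 le by (auto elim!: disjE)
    then have c: "card (vertices (G 0)) \<le> m * card (?bad d (G 0))"
      "card (vertices (G 1)) \<le> m * card (?bad d (G 1))" using IH by auto
    \<comment> \<open>Vertices strictly between the end faces are all bad, and by
      \<open>1 \<le> m\<close> they do not spoil the ratio.\<close>
    define R where "R = {v\<in>vertices Q. t d v \<notin> {0, 1}}"
    have fin: "finite (vertices Q)" using polytope_vertices Suc.prems(2) by blast
    have vG: "vertices (G b) = {v\<in>vertices Q. t d v = b}" if "b \<in> {0, 1}" for b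
      using vertices_face[OF Gface[OF that]] by (auto simp: G_def vertices_def extreme_point_of_def)
    have bG: "?bad d (G b) = {v\<in>?bad (Suc d) Q. t d v = b}" if "b \<in> {0, 1}" for b
      using vG[OF that] that by (auto simp: less_Suc_eq)
    have "vertices Q = vertices (G 0) \<union> vertices (G 1) \<union> R" using vG by (auto simp: R_def)
    then have "card (vertices Q) \<le> card (vertices (G 0)) + card (vertices (G 1)) + card R"
      using card_Un_le[of "vertices (G 0) \<union> vertices (G 1)" R]
        card_Un_le[of "vertices (G 0)" "vertices (G 1)"] by simp
    also have "\<dots> \<le> m * card (?bad d (G 0)) + m * card (?bad d (G 1)) + m * card R"
      using c m by (intro add_mono) auto
    also have "\<dots> = m * (card (?bad d (G 0)) + card (?bad d (G 1)) + card R)"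
      by (simp add: distrib_left)
    also have "card (?bad d (G 0)) + card (?bad d (G 1)) + card R = card (?bad (Suc d) Q)"
    proof -
      have "?bad (Suc d) Q = ?bad d (G 0) \<union> ?bad d (G 1) \<union> R"
        using bG[of 0] bG[of 1] by (auto simp: R_def)
      moreover have "?bad d (G 0) \<inter> ?bad d (G 1) = {}" "(?bad d (G 0) \<union> ?bad d (G 1)) \<inter> R = {}"
        using bG[of 0] bG[of 1] by (auto simp: R_def)
      moreover have "finite (?bad d (G 0))" "finite (?bad d (G 1))" "finite R"
        using bG[of 0] bG[of 1] fin by (auto simp: R_def)
      ultimately show ?thesis by (simp add: card_Un_disjoint)
    qed
    finally show ?thesis .
  qed
  ultimately show ?case by blast
qed

section \<open>Slack vectors\<close>

text \<open>The slack vectors \<open>y\<close> of the vertices of a polytope whose facets are indexed by \<open>I\<close>: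
  coordinate \<open>i\<close> measures the distance to facet \<open>i\<close>. The cone over the polytope is the
  intersection of \<open>span Y\<close> with the nonnegative orthant, and \<open>(pt, ht)\<close> is the homogenized
  projection.\<close>

locale slack_vectors =
  fixes Y :: "(real^'n) set" and I :: "'n set" and pt :: "real^'n \<Rightarrow> 'b::real_vector" and ht :: "real^'n \<Rightarrow> real"
  assumes lin_pt: "linear pt" and lin_ht: "linear ht"
    and fin: "finite Y"
    and ht1: "y \<in> Y \<Longrightarrow> ht y = 1"
    and nonneg: "y \<in> Y \<Longrightarrow> 0 \<le> y $ i"
    and off: "y \<in> Y \<Longrightarrow> i \<notin> I \<Longrightarrow> y $ i = 0"
    and extremal: "y \<in> Y \<Longrightarrow> x \<in> span Y \<Longrightarrow> (\<And>i. y $ i = 0 \<Longrightarrow> x $ i = 0) \<Longrightarrow> \<exists>c. x = c *\<^sub>R y"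
    and in_cone: "x \<in> span Y \<Longrightarrow> (\<And>i. 0 \<le> x $ i) \<Longrightarrow>
        \<exists>d. (\<forall>y\<in>Y. 0 \<le> d y) \<and> x = (\<Sum>y\<in>Y. d y *\<^sub>R y)"
    and facet_not_subset: "i \<in> I \<Longrightarrow> j \<in> I \<Longrightarrow> i \<noteq> j \<Longrightarrow> \<exists>y\<in>Y. y $ i = 0 \<and> 0 < y $ j"
    and facet_proper: "i \<in> I \<Longrightarrow> \<exists>y\<in>Y. 0 < y $ i"
begin

definition Z :: "real^'n \<Rightarrow> 'n set" where
  "Z y = {i\<in>I. y $ i = 0}"

text \<open>The linear counterpart of intersecting facet hyperplanes; this subspace may meet the
  cone only in 0.\<close>

definition ker :: "'n set \<Rightarrow> (real^'n) set" where
  "ker J = {x\<in>span Y. \<forall>i\<in>J. x $ i = 0}"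

lemma subspace_ker: "subspace (ker J)"
  unfolding ker_def subspace_def
  by (auto intro: span_add span_scale span_zero)

lemma ker_le_span: "ker J \<subseteq> span Y"
  by (auto simp: ker_def)

lemma off_span: "x \<in> span Y \<Longrightarrow> i \<notin> I \<Longrightarrow> x $ i = 0"
proof -
  assume "x \<in> span Y" "i \<notin> I"
  have "linear (\<lambda>x::real^'n. x $ i)" by (intro linearI) auto
  from linear_eq_0_on_span[OF this _ \<open>x \<in> span Y\<close>] show ?thesis using off \<open>i \<notin> I\<close> by blast
qed

lemma support_subset_eq:
  assumes "y \<in> Y" "y' \<in> Y" "\<And>i. i \<in> I \<Longrightarrow> y $ i = 0 \<Longrightarrow> y' $ i = 0"
  shows "y' = y"
proof -
  obtain c where c: "y' = c *\<^sub>R y"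
    using extremal[of y y'] assms off by (meson span_base)
  then have "ht y' = c * ht y" using lin_ht by (simp add: linear_scale)
  then show ?thesis using c ht1 assms by simp
qed

lemma Z_subset_eq: "y \<in> Y \<Longrightarrow> y' \<in> Y \<Longrightarrow> Z y \<subseteq> Z y' \<Longrightarrow> y' = y"
  by (rule support_subset_eq) (auto simp: Z_def)

lemma Y_nonzero: "y \<in> Y \<Longrightarrow> \<exists>i\<in>I. 0 < y $ i"
proof (rule ccontr)
  assume y: "y \<in> Y" and "\<not> (\<exists>i\<in>I. 0 < y $ i)"
  then have "y $ i = 0" for i using off[OF y, of i] nonneg[OF y, of i] by force
  then have "y = 0" by (simp add: vec_eq_iff)
  then show False using ht1[OF y] linear_0[OF lin_ht] by simp
qed

lemma nonneg_comb_eq: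
  assumes "y1 \<in> Y" "y2 \<in> Y" "y3 \<in> Y" "0 \<le> a" "0 \<le> b" "a \<noteq> 0 \<or> b \<noteq> 0"
    and eq: "a *\<^sub>R y1 + b *\<^sub>R y2 = c *\<^sub>R y3"
  shows "y1 = y3 \<or> y2 = y3"
proof -
  have *: "a * y1 $ i = 0 \<and> b * y2 $ i = 0" if "y3 $ i = 0" for i
  proof -
    have "a * y1 $ i + b * y2 $ i = c * y3 $ i"
      using arg_cong[OF eq, of "\<lambda>x. x $ i"] by simp
    then show ?thesis
      using that assms nonneg by (simp add: add_nonneg_eq_0_iff)
  qed
  then show ?thesis
    using assms(6) support_subset_eq[OF assms(3,1)] support_subset_eq[OF assms(3,2)] by auto
qed

lemma indep2:
  assumes "y1 \<in> Y" "y2 \<in> Y" "y1 \<noteq> y2" and eq: "a *\<^sub>R y1 = b *\<^sub>R y2"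
  shows "a = 0" "b = 0"
proof -
  have "ht (a *\<^sub>R y1) = ht (b *\<^sub>R y2)" using eq by simp
  then have ht: "a = b" using ht1[OF assms(1)] ht1[OF assms(2)] by (simp add: linear_scale[OF lin_ht])
  then have "a *\<^sub>R (y1 - y2) = 0" using eq by (simp add: scaleR_right_diff_distrib)
  then show "a = 0" "b = 0" using ht assms(3) by auto
qed

text \<open>Two of three coefficients have a common sign. Then a multiple of the third vector is a
  nonnegative combination of the other two, and one of these has its support inside that of the
  third. Geometrically, no three vertices are collinear.\<close>

lemma indep3:
  assumes Y: "y1 \<in> Y" "y2 \<in> Y" "y3 \<in> Y" and ne: "y1 \<noteq> y2" "y1 \<noteq> y3" "y2 \<noteq> y3"
    and eq: "a *\<^sub>R y1 + b *\<^sub>R y2 + c *\<^sub>R y3 = 0"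
  shows "a = 0 \<and> b = 0 \<and> c = 0"
proof -
  have key: "\<not> (0 \<le> a \<and> 0 \<le> b \<and> (a \<noteq> 0 \<or> b \<noteq> 0))"
    if "y1 \<in> Y" "y2 \<in> Y" "y3 \<in> Y" "y1 \<noteq> y3" "y2 \<noteq> y3" "a *\<^sub>R y1 + b *\<^sub>R y2 + c *\<^sub>R y3 = 0"
    for a b c y1 y2 y3
  proof
    assume *: "0 \<le> a \<and> 0 \<le> b \<and> (a \<noteq> 0 \<or> b \<noteq> 0)"
    have "a *\<^sub>R y1 + b *\<^sub>R y2 = (- c) *\<^sub>R y3" using that(6) by (simp add: eq_neg_iff_add_eq_0)
    then show False using nonneg_comb_eq[of y1 y2 y3 a b] * that by blast
  qed
  have keyn: "\<not> (a \<le> 0 \<and> b \<le> 0 \<and> (a \<noteq> 0 \<or> b \<noteq> 0))"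
    if "y1 \<in> Y" "y2 \<in> Y" "y3 \<in> Y" "y1 \<noteq> y3" "y2 \<noteq> y3" "a *\<^sub>R y1 + b *\<^sub>R y2 + c *\<^sub>R y3 = 0"
    for a b c y1 y2 y3
  proof -
    have "(- a) *\<^sub>R y1 + (- b) *\<^sub>R y2 + (- c) *\<^sub>R y3 = - (a *\<^sub>R y1 + b *\<^sub>R y2 + c *\<^sub>R y3)"
      by simp
    also have "\<dots> = 0" using that(6) by simp
    finally show ?thesis using key[OF that(1-5)] by fastforce
  qed
  have e13: "a *\<^sub>R y1 + c *\<^sub>R y3 + b *\<^sub>R y2 = 0" and e23: "b *\<^sub>R y2 + c *\<^sub>R y3 + a *\<^sub>R y1 = 0"
    using eq by (simp_all add: algebra_simps)
  note k = key[OF Y(1,2,3) ne(2,3) eq] keyn[OF Y(1,2,3) ne(2,3) eq]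
    key[OF Y(1,3,2) ne(1) ne(3)[symmetric] e13] keyn[OF Y(1,3,2) ne(1) ne(3)[symmetric] e13]
    key[OF Y(2,3,1) ne(1)[symmetric] ne(2)[symmetric] e23] keyn[OF Y(2,3,1) ne(1)[symmetric] ne(2)[symmetric] e23]
  show ?thesis using k by linarith
qed

text \<open>A linear plane corresponds to a line in the polytope, and by \<open>indep3\<close> no
  line carries three vertices.\<close>

lemma card_plane:
  assumes W: "subspace W" "dim W \<le> 2"
  shows "card (Y \<inter> W) \<le> 2"
proof (rule ccontr)
  assume "\<not> card (Y \<inter> W) \<le> 2"
  then have "3 \<le> card (Y \<inter> W)" by simp
  then obtain T where T: "T \<subseteq> Y \<inter> W" "card T = 3" using obtain_subset_with_card_n by metis
  then obtain y1 y2 y3 where t: "T = {y1, y2, y3}" "y1 \<noteq> y2" "y1 \<noteq> y3" "y2 \<noteq> y3"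
    by (auto simp: card_3_iff)
  have "independent T"
  proof (rule independent_if_scalars_zero)
    show "finite T" using t by simp
    fix f x assume "(\<Sum>x\<in>T. f x *\<^sub>R x) = 0" "x \<in> T"
    then have "f y1 *\<^sub>R y1 + f y2 *\<^sub>R y2 + f y3 *\<^sub>R y3 = 0" using t by (simp add: algebra_simps)
    then show "f x = 0" using indep3[of y1 y2 y3 "f y1" "f y2" "f y3"] t T(1) \<open>x \<in> T\<close> by auto
  qed
  then have "card T \<le> dim W" using T independent_card_le_dim[of T W] by simp
  then show False using T W by simp
qed

lemma dim_slice: "subspace U \<Longrightarrow> dim U \<le> dim {x\<in>U. x $ i = 0} + 1"
  for U :: "(real^'n) set"
proof -
  assume U: "subspace U"
  have hyp: "{x::real^'n. x $ i = 0} = {x. axis i 1 \<bullet> x = 0}" by (simp add: inner_axis')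
  have sH: "subspace {x::real^'n. x $ i = 0}" unfolding hyp by (rule subspace_hyperplane)
  have "dim {x::real^'n. x $ i = 0} = DIM(real^'n) - 1"
    unfolding hyp by (rule dim_hyperplane) (simp add: axis_eq_0_iff)
  moreover have "dim {x + y |x y. x \<in> U \<and> y \<in> {x::real^'n. x $ i = 0}} + dim (U \<inter> {x. x $ i = 0})
      = dim U + dim {x::real^'n. x $ i = 0}"
    by (rule dim_sums_Int[OF U sH])
  moreover have "dim {x + y |x y. x \<in> U \<and> y \<in> {x::real^'n. x $ i = 0}} \<le> DIM(real^'n)"
    by (rule dim_subset_UNIV)
  moreover have "dim (U \<inter> {x. x $ i = 0}) = dim {x\<in>U. x $ i = 0}" by (simp add: Int_def)
  moreover have "0 < DIM(real^'n)" by (rule DIM_positive)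
  ultimately show ?thesis by linarith
qed

lemma ker_insert: "ker (insert i J) = {x\<in>ker J. x $ i = 0}"
  by (auto simp: ker_def)

lemma dim_ker_ge: "finite J \<Longrightarrow> dim (span Y) \<le> dim (ker J) + card J"
proof (induction J rule: finite_induct)
  case empty
  then show ?case by (simp add: ker_def)
next
  case (insert i J)
  then show ?case using dim_slice[OF subspace_ker[of J], of i] by (simp add: ker_insert)
qed

lemma ker_Z: "y \<in> Y \<Longrightarrow> ker (Z y) = span {y}"
proof
  assume y: "y \<in> Y"
  show "ker (Z y) \<subseteq> span {y}"
  proof
    fix x assume x: "x \<in> ker (Z y)"
    have "\<exists>c. x = c *\<^sub>R y"
    proof (rule extremal[OF y])
      show "x \<in> span Y" using x ker_le_span by blast
      show "x $ i = 0" if "y $ i = 0" for i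
        using x that off_span[of x i] by (cases "i \<in> I") (auto simp: ker_def Z_def)
    qed
    then show "x \<in> span {y}" by (auto simp: span_singleton)
  qed
  show "span {y} \<subseteq> ker (Z y)"
    using y by (intro span_minimal subspace_ker) (auto simp: ker_def Z_def span_base)
qed

text \<open>Each vanishing coordinate lowers the dimension by at most one, and those in
  \<open>Z y\<close> together cut the span down to the line through \<open>y\<close>.\<close>

lemma card_Z_ge: "y \<in> Y \<Longrightarrow> dim (span Y) \<le> card (Z y) + 1"
  using dim_ker_ge[of "Z y"] ker_Z[of y] dim_le_card[of "span {y}" "{y}"] by simp

lemma dim_ker_less:
  assumes "x \<in> ker J" "x $ i \<noteq> 0"
  shows "dim (ker (insert i J)) < dim (ker J)"
proof -
  have "ker (insert i J) \<subset> ker J" using assms by (auto simp: ker_def)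
  then show ?thesis
    using dim_psubset[of "ker (insert i J)" "ker J"] subspace_ker by (simp add: span_eq_iff[THEN iffD2])
qed

lemma in_ker_iff: "y \<in> Y \<Longrightarrow> y \<in> ker J \<longleftrightarrow> (\<forall>i\<in>J. y $ i = 0)"
  by (auto simp: ker_def span_base)

text \<open>The polygon case, by counting incidences: each vertex lies on at least two facets, each
  facet carries at most two vertices.\<close>

lemma card_le_of_dim_le_3:
  assumes "dim (span Y) \<le> 3" "card I \<le> 6" "finite I"
  shows "card Y \<le> 6"
proof (cases "dim (span Y) \<le> 2")
  case True
  then have "card (Y \<inter> span Y) \<le> 2" by (intro card_plane) auto
  moreover have "Y \<inter> span Y = Y" using span_superset by blast
  ultimately show ?thesis by simp
next
  case False
  then have K: "dim (span Y) = 3" using assms by simp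
  have two: "card {y\<in>Y. y $ i = 0} \<le> 2" if i: "i \<in> I" for i
  proof -
    obtain y where y: "y \<in> Y" "0 < y $ i" using facet_proper[OF i] by blast
    then have "dim (ker {i}) < dim (ker {})"
      by (intro dim_ker_less[of y]) (auto simp: in_ker_iff)
    moreover have "ker {} = span Y" by (simp add: ker_def)
    ultimately have "card (Y \<inter> ker {i}) \<le> 2" using K by (intro card_plane subspace_ker) simp
    moreover have "Y \<inter> ker {i} = {y\<in>Y. y $ i = 0}" by (auto simp: ker_def span_base)
    ultimately show ?thesis by simp
  qed
  have "2 * card Y \<le> (\<Sum>y\<in>Y. card (Z y))"
    using card_Z_ge K sum_bounded_below[of Y 2 "\<lambda>y. card (Z y)"] by fastforce
  also have "\<dots> = (\<Sum>y\<in>Y. \<Sum>i\<in>I. if y $ i = 0 then 1 else 0)"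
    using assms(3) by (simp add: Z_def sum.If_cases Int_def)
  also have "\<dots> = (\<Sum>i\<in>I. \<Sum>y\<in>Y. if y $ i = 0 then 1 else 0)" by (rule sum.swap)
  also have "\<dots> = (\<Sum>i\<in>I. card {y\<in>Y. y $ i = 0})"
    using fin by (simp add: sum.If_cases Int_def)
  also have "\<dots> \<le> card I * 2" using two sum_bounded_above[of I "\<lambda>i. card {y\<in>Y. y $ i = 0}" 2] by simp
  finally show ?thesis using assms by simp
qed

lemma off_space:
  "subspace {x::real^'n. \<forall>i. i \<notin> J \<longrightarrow> x $ i = 0}" "dim {x::real^'n. \<forall>i. i \<notin> J \<longrightarrow> x $ i = 0} = card J"
proof -
  have eq: "{x::real^'n. \<forall>i. i \<notin> J \<longrightarrow> x $ i = 0} = span ((\<lambda>i. axis i 1) ` J)"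
  proof
    show "span ((\<lambda>i. axis i 1) ` J) \<subseteq> {x::real^'n. \<forall>i. i \<notin> J \<longrightarrow> x $ i = 0}"
      by (rule span_minimal) (auto simp: subspace_def axis_def)
    show "{x::real^'n. \<forall>i. i \<notin> J \<longrightarrow> x $ i = 0} \<subseteq> span ((\<lambda>i. axis i 1) ` J)"
    proof
      fix x :: "real^'n" assume x: "x \<in> {x. \<forall>i. i \<notin> J \<longrightarrow> x $ i = 0}"
      have "x = (\<Sum>i\<in>J. (x $ i) *\<^sub>R axis i 1)"
        using x by (auto simp: vec_eq_iff axis_def if_distrib cong: if_cong)
      then show "x \<in> span ((\<lambda>i. axis i 1) ` J)"
        by (metis (no_types, lifting) imageI span_base span_scale span_sum)
    qed
  qed
  show "subspace {x::real^'n. \<forall>i. i \<notin> J \<longrightarrow> x $ i = 0}" by (auto simp: subspace_def)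
  have "independent ((\<lambda>i. axis i 1 :: real^'n) ` J)"
    by (rule independent_mono[OF independent_Basis]) (auto simp: axis_in_Basis_iff)
  moreover have "inj_on (\<lambda>i. axis i 1 :: real^'n) J" by (auto simp: inj_on_def axis_eq_axis)
  ultimately show "dim {x::real^'n. \<forall>i. i \<notin> J \<longrightarrow> x $ i = 0} = card J"
    unfolding eq by (simp add: dim_eq_card_independent card_image)
qed

lemma span_le_off_space: "span Y \<subseteq> {x. \<forall>i. i \<notin> I \<longrightarrow> x $ i = 0}"
  using off_span by blast

text \<open>The simplex case: an axis vector in the support of a vertex lies in the span, so
  extremality leaves each vertex with a single nonzero coordinate.\<close>

lemma card_le_of_full_dim:
  assumes "card I \<le> dim (span Y)" "finite I"
  shows "card Y \<le> card I"
proof -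
  have full: "span Y = {x. \<forall>i. i \<notin> I \<longrightarrow> x $ i = 0}"
    using subspace_dim_equal[OF subspace_span off_space(1) span_le_off_space] assms off_space(2)
    by simp
  have supp: "\<exists>i\<in>I. \<forall>j. y $ j = 0 \<longleftrightarrow> j \<noteq> i" if y: "y \<in> Y" for y
  proof -
    obtain i where i: "i \<in> I" "0 < y $ i" using Y_nonzero[OF y] by blast
    have "axis i 1 \<in> span Y" using i by (auto simp: full axis_def)
    then obtain c where c: "axis i 1 = c *\<^sub>R y"
      using extremal[OF y, of "axis i 1"] i by (force simp: axis_def)
    have cy: "c * y $ j = (if j = i then 1 else 0)" for j
      using arg_cong[OF c, of "\<lambda>x. x $ j"] by (auto simp: axis_def)
    have "y $ j = 0 \<longleftrightarrow> j \<noteq> i" for j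
      using cy[of j] cy[of i] by (auto split: if_splits)
    then show ?thesis using i by blast
  qed
  then obtain h where h: "\<And>y. y \<in> Y \<Longrightarrow> h y \<in> I" "\<And>y j. y \<in> Y \<Longrightarrow> y $ j = 0 \<longleftrightarrow> j \<noteq> h y"
    by metis
  have "inj_on h Y"
    using h(2) support_subset_eq by (metis inj_onI)
  then show ?thesis using h(1) assms(2) by (intro card_inj_on_le) auto
qed

lemma dim_le_card: "finite I \<Longrightarrow> dim (span Y) \<le> card I"
  using dim_subset[OF span_le_off_space] off_space(2)[of I] by simp

end

section \<open>Lines through vertices in general position\<close>

text \<open>Two coefficients of the same strict sign would put the third point strictly between the
  other two. So some coefficient vanishes, and the remaining two vanish because the points
  differ.\<close>

lemma extreme_points_indep3:
  fixes a b c :: "'a::real_vector"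
  assumes ext: "a \<in> vertices S" "b \<in> vertices S" "c \<in> vertices S" and ne: "a \<noteq> b" "a \<noteq> c" "b \<noteq> c"
    and sum: "\<alpha> + \<beta> + \<gamma> = 0" and eq: "\<alpha> *\<^sub>R a + \<beta> *\<^sub>R b + \<gamma> *\<^sub>R c = 0"
  shows "\<alpha> = 0 \<and> \<beta> = 0 \<and> \<gamma> = 0"
proof -
  have key: "\<not> (0 < \<alpha> \<and> 0 < \<beta>)"
    if "a \<in> vertices S" "b \<in> vertices S" "c \<in> vertices S" "a \<noteq> b"
      "\<alpha> + \<beta> + \<gamma> = 0" "\<alpha> *\<^sub>R a + \<beta> *\<^sub>R b + \<gamma> *\<^sub>R c = 0" for \<alpha> \<beta> \<gamma> :: real and a b c :: 'a
  proof
    assume *: "0 < \<alpha> \<and> 0 < \<beta>"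
    have "\<gamma> = - (\<alpha> + \<beta>)" using that(5) by simp
    then have "(\<alpha> + \<beta>) *\<^sub>R c = \<alpha> *\<^sub>R a + \<beta> *\<^sub>R b" using that(6) unfolding \<open>\<gamma> = - (\<alpha> + \<beta>)\<close> by (simp add: algebra_simps)
    then have "(1 / (\<alpha> + \<beta>)) *\<^sub>R ((\<alpha> + \<beta>) *\<^sub>R c) = (1 / (\<alpha> + \<beta>)) *\<^sub>R (\<alpha> *\<^sub>R a + \<beta> *\<^sub>R b)" by simp
    then have "c = (\<alpha> / (\<alpha> + \<beta>)) *\<^sub>R a + (\<beta> / (\<alpha> + \<beta>)) *\<^sub>R b" using * by (simp add: scaleR_add_right)
    moreover have "\<alpha> / (\<alpha> + \<beta>) = 1 - \<beta> / (\<alpha> + \<beta>)" using * by (simp add: field_simps)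
    ultimately have "c \<in> open_segment a b"
      unfolding in_segment(2) using * that(4) by (intro conjI exI[of _ "\<beta> / (\<alpha> + \<beta>)"]) auto
    then show False using that(1-3) by (auto simp: vertices_def extreme_point_of_def)
  qed
  have keyn: "\<not> (\<alpha> < 0 \<and> \<beta> < 0)"
    if "a \<in> vertices S" "b \<in> vertices S" "c \<in> vertices S" "a \<noteq> b"
      "\<alpha> + \<beta> + \<gamma> = 0" "\<alpha> *\<^sub>R a + \<beta> *\<^sub>R b + \<gamma> *\<^sub>R c = 0" for \<alpha> \<beta> \<gamma> :: real and a b c :: 'a
  proof -
    have "(- \<alpha>) *\<^sub>R a + (- \<beta>) *\<^sub>R b + (- \<gamma>) *\<^sub>R c = - (\<alpha> *\<^sub>R a + \<beta> *\<^sub>R b + \<gamma> *\<^sub>R c)" by simp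
    then show ?thesis using key[OF that(1-4), of "- \<alpha>" "- \<beta>" "- \<gamma>"] that(5,6) by auto
  qed
  have two: False if "\<alpha> \<noteq> 0" "\<alpha> + \<beta> = 0" "\<alpha> *\<^sub>R a + \<beta> *\<^sub>R b = 0" "a \<noteq> b" for \<alpha> \<beta> :: real and a b :: 'a
  proof -
    have "\<beta> = - \<alpha>" using that(2) by simp
    then have "\<alpha> *\<^sub>R (a - b) = 0" using that(3) by (simp add: algebra_simps)
    then show False using that by simp
  qed
  have e13: "\<alpha> *\<^sub>R a + \<gamma> *\<^sub>R c + \<beta> *\<^sub>R b = 0" and e23: "\<beta> *\<^sub>R b + \<gamma> *\<^sub>R c + \<alpha> *\<^sub>R a = 0"
    using eq by (simp_all add: algebra_simps)
  have s13: "\<alpha> + \<gamma> + \<beta> = 0" and s23: "\<beta> + \<gamma> + \<alpha> = 0" using sum by simp_all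
  note k = key[OF ext(1,2,3) ne(1) sum eq] keyn[OF ext(1,2,3) ne(1) sum eq]
    key[OF ext(1,3,2) ne(2) s13 e13] keyn[OF ext(1,3,2) ne(2) s13 e13]
    key[OF ext(2,3,1) ne(3) s23 e23] keyn[OF ext(2,3,1) ne(3) s23 e23]
  have "\<alpha> = 0 \<or> \<beta> = 0 \<or> \<gamma> = 0" using k by linarith
  then show ?thesis
  proof (elim disjE)
    assume "\<alpha> = 0"
    then show ?thesis using two[of \<beta> \<gamma> b c] sum eq ne by force
  next
    assume "\<beta> = 0"
    then show ?thesis using two[of \<alpha> \<gamma> a c] sum eq ne by force
  next
    assume "\<gamma> = 0"
    then show ?thesis using two[of \<alpha> \<beta> a b] sum eq ne by force
  qed
qed

lemma parallel_lines:
  fixes p1 q1 p2 q2 :: "real^2"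
  assumes "s *\<^sub>R (p1 - q1) = t *\<^sub>R (p2 - q2)" "s \<noteq> 0" "t \<noteq> 0"
  shows "affine_parallel (line p1 q1) (line p2 q2)"
proof -
  have hull: "affine hull {a, b} = (\<lambda>u. a + u *\<^sub>R (b - a)) ` UNIV" for a b :: "real^2"
  proof
    show "affine hull {a, b} \<subseteq> (\<lambda>u. a + u *\<^sub>R (b - a)) ` UNIV"
    proof
      fix x assume "x \<in> affine hull {a, b}"
      then obtain u v where "x = u *\<^sub>R a + v *\<^sub>R b" "u + v = 1" by (auto simp: affine_hull_2)
      then have x: "x = u *\<^sub>R a + v *\<^sub>R b" and u: "u = 1 - v" by auto
      have "x = a + v *\<^sub>R (b - a)" unfolding x u by (simp add: algebra_simps)
      then show "x \<in> (\<lambda>u. a + u *\<^sub>R (b - a)) ` UNIV" by blast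
    qed
    show "(\<lambda>u. a + u *\<^sub>R (b - a)) ` UNIV \<subseteq> affine hull {a, b}"
    proof safe
      fix u
      have "a + u *\<^sub>R (b - a) = (1 - u) *\<^sub>R a + u *\<^sub>R b" by (simp add: algebra_simps)
      then show "a + u *\<^sub>R (b - a) \<in> affine hull {a, b}"
        unfolding affine_hull_2 by (intro CollectI exI[of _ "1 - u"] exI[of _ u]) simp
    qed
  qed
  define r where "r = t / s"
  have r: "r \<noteq> 0" using assms by (simp add: r_def)
  have "s *\<^sub>R (q1 - p1) = t *\<^sub>R (q2 - p2)"
    using assms(1) by (metis minus_diff_eq scaleR_minus_right)
  then have "(1 / s) *\<^sub>R (s *\<^sub>R (q1 - p1)) = (1 / s) *\<^sub>R (t *\<^sub>R (q2 - p2))" by simp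
  then have d: "q1 - p1 = r *\<^sub>R (q2 - p2)" using assms by (simp add: r_def)
  have "affine hull {p2, q2} = (+) (p2 - p1) ` (affine hull {p1, q1})"
  proof -
    have "(+) (p2 - p1) ` (affine hull {p1, q1}) = (\<lambda>u. p2 + (u * r) *\<^sub>R (q2 - p2)) ` UNIV"
      unfolding hull image_image d by simp
    also have "\<dots> = (\<lambda>v. p2 + v *\<^sub>R (q2 - p2)) ` range (\<lambda>u. u * r)" by (simp add: image_image)
    also have "range (\<lambda>u. u * r) = UNIV"
    proof -
      have "v = (v / r) * r" for v using r by simp
      then show ?thesis by blast
    qed
    finally show ?thesis by (simp add: hull)
  qed
  then show ?thesis unfolding affine_parallel_def line_def by blast
qed

text \<open>If two of the four end points coincided, the two representations of the common vector
  would combine to an affine relation between three distinct extreme points with a nonzero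
  coefficient.\<close>

lemma lines_meet_three_vertices:
  fixes p1 q1 p2 q2 :: "real^2"
  assumes V: "{p1, q1, p2, q2} \<subseteq> vertices S" and nz: "s1 \<noteq> 0" "t1 \<noteq> 0" "s2 \<noteq> 0" "t2 \<noteq> 0"
    and h: "s1 - t1 = s2 - t2" and x: "s1 *\<^sub>R p1 - t1 *\<^sub>R q1 = s2 *\<^sub>R p2 - t2 *\<^sub>R q2"
    and c: "3 \<le> card {p1, q1, p2, q2}"
  shows "distinct [p1, q1, p2, q2]"
proof (rule ccontr)
  assume nd: "\<not> distinct [p1, q1, p2, q2]"
  have *: "s1 *\<^sub>R p1 - t1 *\<^sub>R q1 - s2 *\<^sub>R p2 + t2 *\<^sub>R q2 = 0" "s1 - t1 - s2 + t2 = 0"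
    using h x by (auto simp: algebra_simps)
  note ind = extreme_points_indep3[of _ S]
  from nd consider "p1 = q1" | "p2 = q2" | "p1 = p2" | "p1 = q2" | "q1 = p2" | "q1 = q2" by auto
  then show False
  proof cases
    case 1
    then have "p1 \<noteq> p2 \<and> p1 \<noteq> q2 \<and> p2 \<noteq> q2" using c by (auto simp: card_insert_if split: if_splits)
    then show ?thesis using ind[of p1 p2 q2 "s1 - t1" "- s2" t2] V * nz 1 by (auto simp: algebra_simps)
  next
    case 2
    then have "p1 \<noteq> q1 \<and> p1 \<noteq> p2 \<and> q1 \<noteq> p2" using c by (auto simp: card_insert_if split: if_splits)
    then show ?thesis using ind[of p1 q1 p2 s1 "- t1" "t2 - s2"] V * nz 2 by (auto simp: algebra_simps)
  next
    case 3
    then have "p1 \<noteq> q1 \<and> p1 \<noteq> q2 \<and> q1 \<noteq> q2" using c by (auto simp: card_insert_if split: if_splits)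
    then show ?thesis using ind[of p1 q1 q2 "s1 - s2" "- t1" t2] V * nz 3 by (auto simp: algebra_simps)
  next
    case 4
    then have "p1 \<noteq> q1 \<and> p1 \<noteq> p2 \<and> q1 \<noteq> p2" using c by (auto simp: card_insert_if split: if_splits)
    then show ?thesis using ind[of p1 q1 p2 "s1 + t2" "- t1" "- s2"] V * nz 4 by (auto simp: algebra_simps)
  next
    case 5
    then have "p1 \<noteq> q1 \<and> p1 \<noteq> q2 \<and> q1 \<noteq> q2" using c by (auto simp: card_insert_if split: if_splits)
    then show ?thesis using ind[of p1 q1 q2 s1 "- t1 - s2" t2] V * nz 5 by (auto simp: algebra_simps)
  next
    case 6
    then have "p1 \<noteq> q1 \<and> p1 \<noteq> p2 \<and> q1 \<noteq> p2" using c by (auto simp: card_insert_if split: if_splits)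
    then show ?thesis using ind[of p1 q1 p2 s1 "t2 - t1" "- s2"] V * nz 6 by (auto simp: algebra_simps)
  qed
qed

text \<open>In homogeneous coordinates, three lines \<open>p\<^sub>jq\<^sub>j\<close> are concurrent or parallel if some
  combinations of \<open>(p\<^sub>j, 1)\<close> and \<open>(q\<^sub>j, 1)\<close> agree.\<close>

lemma general_position_no_concurrent:
  assumes gp: "general_position P" and V: "{p1, q1, p2, q2, p3, q3} \<subseteq> vertices P"
    and nz: "s1 \<noteq> 0" "t1 \<noteq> 0" "s2 \<noteq> 0" "t2 \<noteq> 0" "s3 \<noteq> 0" "t3 \<noteq> 0"
    and h: "s1 - t1 = h" "s2 - t2 = h" "s3 - t3 = h"
    and x: "s1 *\<^sub>R p1 - t1 *\<^sub>R q1 = x" "s2 *\<^sub>R p2 - t2 *\<^sub>R q2 = x" "s3 *\<^sub>R p3 - t3 *\<^sub>R q3 = x"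
  shows "card {p1, q1, p2, q2, p3, q3} \<le> 4"
proof (rule ccontr)
  assume "\<not> ?thesis"
  \<comment> \<open>Five distinct end points leave at least three for any two of the lines; hence
    any two lines have four distinct end points, and all six are distinct.\<close>
  then have c5: "5 \<le> card {p1, q1, p2, q2, p3, q3}" by simp
  have le: "3 \<le> card S" if "{p1, q1, p2, q2, p3, q3} \<subseteq> insert a (insert b S)" "finite S" for a b S
  proof -
    have "5 \<le> card (insert a (insert b S))"
      by (rule order_trans[OF c5 card_mono[OF _ that(1)]]) (use that(2) in simp)
    also have "\<dots> \<le> card S + 2" using that(2) by (simp add: card_insert_if)
    finally show ?thesis by simp
  qed
  have c3: "3 \<le> card {p1, q1, p2, q2}" "3 \<le> card {p1, q1, p3, q3}" "3 \<le> card {p2, q2, p3, q3}"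
    using le[of p3 q3 "{p1, q1, p2, q2}"] le[of p2 q2 "{p1, q1, p3, q3}"] le[of p1 q1 "{p2, q2, p3, q3}"]
    by simp_all
  have eqs: "s1 - t1 = s2 - t2" "s1 - t1 = s3 - t3" "s2 - t2 = s3 - t3" unfolding h by simp_all
  have eqx: "s1 *\<^sub>R p1 - t1 *\<^sub>R q1 = s2 *\<^sub>R p2 - t2 *\<^sub>R q2" "s1 *\<^sub>R p1 - t1 *\<^sub>R q1 = s3 *\<^sub>R p3 - t3 *\<^sub>R q3"
    "s2 *\<^sub>R p2 - t2 *\<^sub>R q2 = s3 *\<^sub>R p3 - t3 *\<^sub>R q3" unfolding x by simp_all
  have "distinct [p1, q1, p2, q2]"
    by (rule lines_meet_three_vertices[OF _ nz(1,2,3,4) eqs(1) eqx(1) c3(1)]) (use V in blast)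
  moreover have "distinct [p1, q1, p3, q3]"
    by (rule lines_meet_three_vertices[OF _ nz(1,2,5,6) eqs(2) eqx(2) c3(2)]) (use V in blast)
  moreover have "distinct [p2, q2, p3, q3]"
    by (rule lines_meet_three_vertices[OF _ nz(3,4,5,6) eqs(3) eqx(3) c3(3)]) (use V in blast)
  ultimately have dist: "distinct [p1, q1, p2, q2, p3, q3]" by auto
  show False
  \<comment> \<open>\<open>h\<close> is the height of the common vector: height 0 means parallel
    lines, against the first condition; otherwise scaling by \<open>1 / h\<close> gives a common
    point, against the second.\<close>
  proof (cases "h = 0")
    case True
    then have "s1 = t1" "s2 = t2" using h by auto
    then have "s1 *\<^sub>R (p1 - q1) = s2 *\<^sub>R (p2 - q2)" using x by (simp add: scaleR_right_diff_distrib)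
    then have "affine_parallel (line p1 q1) (line p2 q2)" using nz by (intro parallel_lines)
    moreover have "distinct [p1, q1, p2, q2]" "{p1, q1, p2, q2} \<subseteq> vertices P" using dist V by auto
    ultimately show False using gp[unfolded general_position_def, THEN conjunct1] by blast
  next
    case False
    have on: "(1 / h) *\<^sub>R x \<in> line p q" if "s - t = h" "s *\<^sub>R p - t *\<^sub>R q = x" for s t p q
    proof -
      have "(1 / h) *\<^sub>R x = (s / h) *\<^sub>R p + (- t / h) *\<^sub>R q"
        unfolding that(2)[symmetric] by (simp add: scaleR_right_diff_distrib)
      moreover have "s / h + - t / h = 1" using that(1) False by (simp add: field_simps)
      ultimately show ?thesis unfolding line_def affine_hull_2 by blast
    qed
    have "(1 / h) *\<^sub>R x \<in> line p1 q1 \<inter> line p2 q2 \<inter> line p3 q3" using on h x by blast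
    then show False using gp dist V unfolding general_position_def by blast
  qed
qed

text \<open>The situation to be refuted: every vertex is projected to a vertex of \<open>P\<close>.
  Different vertices may have the same image.\<close>

locale heptagon_slack = slack_vectors Y I pt ht
  for Y :: "(real^'n) set" and I and pt :: "real^'n \<Rightarrow> real^2" and ht +
  fixes P
  assumes gp: "general_position P" and conv_P: "convex P" and pt_Y: "pt ` Y = vertices P" and card_P: "card (vertices P) = 7"
begin

lemma card_Y_ge: "7 \<le> card Y"
  using card_image_le[OF fin, of pt] pt_Y card_P by simp

text \<open>Vertices of \<open>P\<close> not hit by \<open>X\<close> need preimages outside
  \<open>X\<close>. When there are few vertices, this contradicts the small images found by
  \<open>no_concurrent\<close>.\<close>

lemma card_image_ge:
  assumes "X \<subseteq> Y"
  shows "7 \<le> card (pt ` X) + (card Y - card X)"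
proof -
  have "vertices P = pt ` X \<union> pt ` (Y - X)" using assms pt_Y by blast
  then have "7 \<le> card (pt ` X) + card (pt ` (Y - X))" using card_P card_Un_le by metis
  also have "card (pt ` (Y - X)) \<le> card (Y - X)" using fin by (intro card_image_le) simp
  also have "card (Y - X) = card Y - card X" using assms fin by (simp add: card_Diff_subset finite_subset)
  finally show ?thesis by simp
qed

text \<open>Applying \<open>pt\<close> and \<open>ht\<close> to the three representations of
  \<open>x\<close> gives the homogeneous relations of
  \<open>general_position_no_concurrent\<close>.\<close>

lemma no_concurrent:
  assumes V: "{p1, q1, p2, q2, p3, q3} \<subseteq> Y"
    and nz: "s1 \<noteq> 0" "t1 \<noteq> 0" "s2 \<noteq> 0" "t2 \<noteq> 0" "s3 \<noteq> 0" "t3 \<noteq> 0"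
    and x: "s1 *\<^sub>R p1 - t1 *\<^sub>R q1 = x" "s2 *\<^sub>R p2 - t2 *\<^sub>R q2 = x" "s3 *\<^sub>R p3 - t3 *\<^sub>R q3 = x"
  shows "card (pt ` {p1, q1, p2, q2, p3, q3}) \<le> 4"
proof -
  have ht: "s - t = ht x" if "p \<in> Y" "q \<in> Y" "s *\<^sub>R p - t *\<^sub>R q = x" for s t p q
    using arg_cong[OF that(3), of ht] ht1[OF that(1)] ht1[OF that(2)]
    by (simp add: linear_diff[OF lin_ht] linear_scale[OF lin_ht])
  have pt: "s *\<^sub>R pt p - t *\<^sub>R pt q = pt x" if "s *\<^sub>R p - t *\<^sub>R q = x" for s t p q
    using arg_cong[OF that, of pt] by (simp add: linear_diff[OF lin_pt] linear_scale[OF lin_pt])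
  have "card {pt p1, pt q1, pt p2, pt q2, pt p3, pt q3} \<le> 4"
    using ht[OF _ _ x(1)] ht[OF _ _ x(2)] ht[OF _ _ x(3)] pt[OF x(1)] pt[OF x(2)] pt[OF x(3)] V pt_Y
    by (intro general_position_no_concurrent[OF gp _ nz, where h = "ht x" and x = "pt x"]) auto
  then show ?thesis by simp
qed

end

section \<open>Slack spaces of codimension one\<close>

context slack_vectors
begin

text \<open>\<open>n\<close> is the normal of \<open>span Y\<close> inside the coordinate space of
  \<open>I\<close>. Its positive and negative entries belong to the facets of the two simplices in
  the product; each zero entry adds the apex of a pyramid.\<close>

definition relation :: "real^'n \<Rightarrow> bool" where
  "relation n \<longleftrightarrow> n \<noteq> 0 \<and> (\<forall>i. i \<notin> I \<longrightarrow> n $ i = 0) \<and>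
     span Y = {x. (\<forall>i. i \<notin> I \<longrightarrow> x $ i = 0) \<and> n \<bullet> x = 0}"

lemma relation_uminus: "relation n \<Longrightarrow> relation (- n)"
  by (simp add: relation_def)

lemma exists_relation:
  assumes "dim (span Y) + 1 = card I"
  obtains n where "relation n"
proof -
  let ?R = "{x::real^'n. \<forall>i. i \<notin> I \<longrightarrow> x $ i = 0}"
  have R: "subspace ?R" "dim ?R = card I" by (rule off_space)+
  have "dim (span Y) \<noteq> dim ?R" using assms R(2) by linarith
  then have "span Y \<noteq> ?R" by (rule contrapos_nn) (simp only:)
  with span_le_off_space have "span Y \<subset> ?R" by (rule psubsetI)
  moreover have spR: "span ?R = ?R" using R(1) by (simp only: span_eq_iff)
  ultimately have "span (span Y) \<subset> span ?R" by (simp only: span_span)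
  then obtain n where n: "n \<noteq> 0" "n \<in> span ?R" "\<And>y. y \<in> span (span Y) \<Longrightarrow> orthogonal n y"
    using orthogonal_to_subspace_exists_gen by blast
  have nR: "n \<in> ?R" using n(2) unfolding spR .
  let ?H = "{x. (\<forall>i. i \<notin> I \<longrightarrow> x $ i = 0) \<and> n \<bullet> x = 0}"
  have sH: "subspace ?H" by (auto simp: subspace_def inner_add_right)
  have sub: "span Y \<subseteq> ?H" using span_le_off_space n(3) by (auto simp: orthogonal_def span_base)
  have "n \<notin> ?H" using n(1) by simp
  moreover have "?H \<subseteq> ?R" by blast
  ultimately have "?H \<subset> ?R" using nR by blast
  then have "span ?H \<subset> span ?R" unfolding spR using sH by (simp only: span_eq_iff[THEN iffD2])
  then have "dim ?H < dim ?R" by (rule dim_psubset)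
  then have "dim ?H \<le> dim (span Y)" using assms R by simp
  then have "span Y = ?H" using subspace_dim_equal[OF subspace_span sH sub] by simp
  then show ?thesis using that[of n] n nR by (simp add: relation_def)
qed

definition supp :: "real^'n \<Rightarrow> 'n set" where
  "supp y = {i. y $ i \<noteq> 0}"

lemma supp_eq: "y \<in> Y \<Longrightarrow> y' \<in> Y \<Longrightarrow> supp y = supp y' \<Longrightarrow> y = y'"
  by (rule support_subset_eq) (auto simp: supp_def)

lemma supp_extremal:
  assumes "y \<in> Y" "x \<in> span Y" "x \<noteq> 0" "supp x \<subseteq> supp y"
  shows "supp y = supp x"
proof -
  obtain c where "x = c *\<^sub>R y"
    using extremal[OF assms(1,2)] assms(4) by (auto simp: supp_def)
  then show ?thesis using assms(3) by (auto simp: supp_def)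
qed

lemma axis_pair:
  fixes i j :: 'n
  assumes "i \<noteq> j" "n $ i \<noteq> 0" "n $ j \<noteq> 0"
  defines "x \<equiv> \<bar>n $ j\<bar> *\<^sub>R axis i 1 + \<bar>n $ i\<bar> *\<^sub>R (axis j 1 :: real^'n)"
  shows "supp x = {i, j}" "n $ i * n $ j < 0 \<Longrightarrow> n \<bullet> x = 0" "0 \<le> x $ k" "x \<noteq> 0"
proof -
  have comp: "x $ k = (if k = i then \<bar>n $ j\<bar> else if k = j then \<bar>n $ i\<bar> else 0)" for k
    using assms(1) by (auto simp: x_def axis_def)
  show "supp x = {i, j}" using assms(1,2,3) by (auto simp: supp_def comp)
  then show "x \<noteq> 0" by (auto simp: supp_def)
  show "0 \<le> x $ k" by (simp add: comp)
  show "n \<bullet> x = 0" if "n $ i * n $ j < 0"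
    using that by (auto simp: x_def inner_add_right inner_axis mult_less_0_iff)
qed

text \<open>For \<open>i\<close> in the support of \<open>y\<close>, either \<open>n\<close>
  vanishes at \<open>i\<close> or orthogonality forces an entry of the opposite sign in the support.
  The corresponding vector with one or two nonzero entries lies in \<open>span Y\<close>, and
  extremality makes its support that of \<open>y\<close>.\<close>

lemma supp_cases:
  assumes n: "relation n" and y: "y \<in> Y"
  obtains m where "m \<in> I" "n $ m = 0" "supp y = {m}"
    | a b where "a \<in> I" "b \<in> I" "0 < n $ a" "n $ b < 0" "supp y = {a, b}"
proof -
  obtain i where i: "i \<in> I" "0 < y $ i" using Y_nonzero[OF y] by blast
  have S: "span Y = {x. (\<forall>i. i \<notin> I \<longrightarrow> x $ i = 0) \<and> n \<bullet> x = 0}" using n by (simp add: relation_def)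
  show ?thesis
  proof (cases "n $ i = 0")
    case True
    let ?x = "axis i 1 :: real^'n"
    have "n \<bullet> ?x = 0" using True by (simp add: inner_axis)
    moreover have "\<forall>k. k \<notin> I \<longrightarrow> ?x $ k = 0" using i by (auto simp: axis_def)
    ultimately have "?x \<in> span Y" by (simp add: S)
    moreover have "supp ?x = {i}" by (auto simp: supp_def axis_def)
    ultimately have "supp y = {i}" using supp_extremal[OF y, of ?x] i by (auto simp: supp_def)
    then show ?thesis using that(1) i True by blast
  next
    case False
    have "n \<bullet> y = 0" using y S span_base by blast
    then have sum: "(\<Sum>k\<in>UNIV. n $ k * y $ k) = 0" by (simp add: inner_vec_def)
    have "\<exists>j. n $ i * (n $ j * y $ j) < 0"
    proof (rule ccontr)
      assume "\<not> (\<exists>j. n $ i * (n $ j * y $ j) < 0)"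
      then have nn: "0 \<le> n $ i * (n $ j * y $ j)" for j by (simp add: not_less)
      have s0: "(\<Sum>j\<in>UNIV. n $ i * (n $ j * y $ j)) = 0"
        using sum by (simp add: sum_distrib_left[symmetric])
      have "n $ i * (n $ i * y $ i) = 0"
        by (rule sum_nonneg_0[OF finite nn s0]) simp
      then show False using False i by simp
    qed
    then obtain j where j: "n $ i * (n $ j * y $ j) < 0" by blast
    then have "y $ j \<noteq> 0" by auto
    then have yj: "0 < y $ j" using nonneg[OF y, of j] by simp
    then have nij: "n $ i * n $ j < 0" using j by (simp add: mult.assoc[symmetric] mult_less_0_iff)
    have jI: "j \<in> I" using off[OF y, of j] yj by auto
    have ne: "i \<noteq> j" "n $ j \<noteq> 0" using nij by (auto simp: mult_less_0_iff)
    note ap = axis_pair[OF ne(1) False ne(2)]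
    let ?x = "\<bar>n $ j\<bar> *\<^sub>R axis i 1 + \<bar>n $ i\<bar> *\<^sub>R (axis j 1 :: real^'n)"
    have "?x \<in> span Y" using ap(1) ap(2)[OF nij] i(1) jI by (auto simp: S supp_def)
    moreover have "supp ?x \<subseteq> supp y" unfolding ap(1) using i yj by (auto simp: supp_def)
    ultimately have sy: "supp y = {i, j}" using supp_extremal[OF y _ ap(4)] ap(1) by simp
    show ?thesis
    proof (cases "0 < n $ i")
      case True
      then show ?thesis using that(2)[of i j] nij i jI sy by (auto simp: mult_less_0_iff)
    next
      case False
      then have "0 < n $ j" "n $ i < 0" using nij by (auto simp: mult_less_0_iff)
      moreover have "supp y = {j, i}" using sy by blast
      ultimately show ?thesis using that(2)[of j i] i jI by blast
    qed
  qed
qed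

text \<open>The balanced vector on \<open>a\<close> and \<open>b\<close> is in the cone, hence a
  nonnegative combination of vertices. A vertex occurring in it is supported in
  \<open>{a, b}\<close>, and \<open>supp_cases\<close> leaves only the full pair.\<close>

lemma exists_supp_pair:
  assumes n: "relation n" and ab: "a \<in> I" "b \<in> I" "0 < n $ a" "n $ b < 0"
  shows "\<exists>y\<in>Y. supp y = {a, b}"
proof -
  have S: "span Y = {x. (\<forall>i. i \<notin> I \<longrightarrow> x $ i = 0) \<and> n \<bullet> x = 0}" using n by (simp add: relation_def)
  have ne: "a \<noteq> b" "n $ a \<noteq> 0" "n $ b \<noteq> 0" "n $ a * n $ b < 0"
    using ab by (auto simp: mult_pos_neg)
  note ap = axis_pair[OF ne(1-3)]
  let ?x = "\<bar>n $ b\<bar> *\<^sub>R axis a 1 + \<bar>n $ a\<bar> *\<^sub>R (axis b 1 :: real^'n)"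
  have "?x \<in> span Y" using ap(1) ap(2)[OF ne(4)] ab by (auto simp: S supp_def)
  then obtain d where d: "\<forall>y\<in>Y. 0 \<le> d y" "?x = (\<Sum>y\<in>Y. d y *\<^sub>R y)"
    using in_cone[of ?x] ap(3) by blast
  have "\<exists>y\<in>Y. d y \<noteq> 0"
  proof (rule ccontr)
    assume "\<not> (\<exists>y\<in>Y. d y \<noteq> 0)"
    then have "?x = 0" using d(2) by simp
    then show False using ap(4) by blast
  qed
  then obtain y where y: "y \<in> Y" "d y \<noteq> 0" by blast
  have "supp y \<subseteq> {a, b}"
  proof
    fix k assume k: "k \<in> supp y"
    show "k \<in> {a, b}"
    proof (rule ccontr)
      assume "k \<notin> {a, b}"
      then have "?x $ k = 0" using ap(1) by (auto simp: supp_def)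
      then have "(\<Sum>y\<in>Y. d y * y $ k) = 0" using arg_cong[OF d(2), of "\<lambda>x. x $ k"] by simp
      then have "d y * y $ k = 0"
        by (rule sum_nonneg_0[OF fin _ _ y(1), rotated]) (use d(1) nonneg in auto)
      then show False using y(2) k by (simp add: supp_def)
    qed
  qed
  from n y(1) have "supp y = {a, b}"
  proof (cases rule: supp_cases)
    case (1 m)
    then have "m \<in> {a, b}" using \<open>supp y \<subseteq> {a, b}\<close> by simp
    then have "n $ m \<noteq> 0" using ab(3,4) by auto
    then show ?thesis using 1(2) by contradiction
  next
    case (2 a' b')
    have "a' \<in> {a, b}" "b' \<in> {a, b}" using \<open>supp y \<subseteq> {a, b}\<close> unfolding 2(5) by simp_all
    moreover have "a' \<noteq> b" "b' \<noteq> a" using 2(3,4) ab(3,4) by auto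
    ultimately have "a' = a" "b' = b" by simp_all
    then show ?thesis using 2(5) by simp
  qed
  then show ?thesis using y by blast
qed

definition pos_idx :: "real^'n \<Rightarrow> 'n set" where "pos_idx n = {i\<in>I. 0 < n $ i}"
definition neg_idx :: "real^'n \<Rightarrow> 'n set" where "neg_idx n = {i\<in>I. n $ i < 0}"
definition zero_idx :: "real^'n \<Rightarrow> 'n set" where "zero_idx n = {i\<in>I. n $ i = 0}"

lemma idx_uminus: "pos_idx (- n) = neg_idx n" "neg_idx (- n) = pos_idx n" "zero_idx (- n) = zero_idx n"
  by (auto simp: pos_idx_def neg_idx_def zero_idx_def)

lemma card_idx: "card (pos_idx n) + card (neg_idx n) + card (zero_idx n) = card I"
proof -
  have "I = pos_idx n \<union> neg_idx n \<union> zero_idx n"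
    by (auto simp: pos_idx_def neg_idx_def zero_idx_def)
  moreover have "card (pos_idx n \<union> neg_idx n \<union> zero_idx n) = card (pos_idx n) + card (neg_idx n) + card (zero_idx n)"
    by (subst card_Un_disjoint; (subst card_Un_disjoint)?) (auto simp: pos_idx_def neg_idx_def zero_idx_def)
  ultimately show ?thesis by simp
qed

definition block :: "'n set \<Rightarrow> 'n set \<Rightarrow> (real^'n) set" where
  "block A B = {y\<in>Y. \<exists>a\<in>A. \<exists>b\<in>B. supp y = {a, b}}"

lemma card_block:
  assumes n: "relation n" and A: "A \<subseteq> pos_idx n" and B: "B \<subseteq> neg_idx n"
  shows "card (block A B) = card A * card B"
proof -
  have inj: "inj_on supp (block A B)" by (auto simp: inj_on_def block_def intro: supp_eq)
  have "supp ` block A B = (\<lambda>(a, b). {a, b}) ` (A \<times> B)"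
  proof
    show "supp ` block A B \<subseteq> (\<lambda>(a, b). {a, b}) ` (A \<times> B)" by (auto simp: block_def)
    show "(\<lambda>(a, b). {a, b}) ` (A \<times> B) \<subseteq> supp ` block A B"
    proof clarsimp
      fix a b assume ab: "a \<in> A" "b \<in> B"
      then have "a \<in> I" "b \<in> I" "0 < n $ a" "n $ b < 0"
        using A B by (auto simp: pos_idx_def neg_idx_def)
      then obtain y where "y \<in> Y" "supp y = {a, b}" using exists_supp_pair[OF n] by blast
      then have "y \<in> block A B" using ab unfolding block_def by blast
      then show "{a, b} \<in> supp ` block A B" using \<open>supp y = {a, b}\<close> by blast
    qed
  qed
  moreover have "inj_on (\<lambda>(a, b). {a, b}) (A \<times> B)"
    using A B by (force simp: inj_on_def doubleton_eq_iff pos_idx_def neg_idx_def)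
  ultimately have "card (supp ` block A B) = card (A \<times> B)" by (simp add: card_image)
  then show ?thesis using card_image[OF inj] by (simp add: card_cartesian_product)
qed

lemma card_Y_relation:
  assumes n: "relation n"
  shows "card Y \<le> card (pos_idx n) * card (neg_idx n) + card (zero_idx n)"
proof -
  let ?M = "{y\<in>Y. \<exists>m\<in>zero_idx n. supp y = {m}}"
  have "Y \<subseteq> block (pos_idx n) (neg_idx n) \<union> ?M"
  proof
    fix y assume y: "y \<in> Y"
    from n y show "y \<in> block (pos_idx n) (neg_idx n) \<union> ?M"
      by (cases rule: supp_cases) (use y in \<open>auto simp: block_def pos_idx_def neg_idx_def zero_idx_def\<close>)
  qed
  moreover have finB: "finite (block (pos_idx n) (neg_idx n) \<union> ?M)" using fin by (auto simp: block_def)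
  ultimately have "card Y \<le> card (block (pos_idx n) (neg_idx n) \<union> ?M)" by (rule card_mono[rotated])
  also have "\<dots> \<le> card (block (pos_idx n) (neg_idx n)) + card ?M" by (rule card_Un_le)
  also have "card ?M \<le> card (zero_idx n)"
  proof -
    have "inj_on supp ?M" by (auto simp: inj_on_def intro: supp_eq)
    then have "card ?M = card (supp ` ?M)" by (simp add: card_image)
    also have "\<dots> \<le> card ((\<lambda>m. {m}) ` zero_idx n)" by (intro card_mono) (auto simp: zero_idx_def)
    also have "\<dots> \<le> card (zero_idx n)" by (intro card_image_le) (auto simp: zero_idx_def)
    finally show ?thesis .
  qed
  finally show ?thesis using card_block[OF n subset_refl subset_refl] by simp
qed

text \<open>The maximum 9 belongs to \<open>3 * 3\<close>, the maximum 6 to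
  \<open>2 * 3\<close>.\<close>

lemma product_bounds:
  fixes a b m :: nat
  assumes "a + b + m \<le> 6"
  shows "a * b + m \<le> 9" "a + b + m \<le> 5 \<Longrightarrow> a * b + m \<le> 6"
proof -
  have "a = 0 \<or> a = 1 \<or> a = 2 \<or> a = 3 \<or> a = 4 \<or> a = 5 \<or> a = 6" using assms by linarith
  then show "a * b + m \<le> 9" "a + b + m \<le> 5 \<Longrightarrow> a * b + m \<le> 6"
    using assms by (elim disjE; simp)+
qed

text \<open>Without positive entries some slack would vanish at all vertices; with a single positive
  entry \<open>a\<close>, the facet \<open>a\<close> would lie in the facet of a negative
  entry.\<close>

lemma card_pos_idx_ge: "relation n \<Longrightarrow> 2 \<le> card (pos_idx n)"
proof (rule ccontr)
  assume n: "relation n" and "\<not> 2 \<le> card (pos_idx n)"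
  then have c: "card (pos_idx n) = 0 \<or> card (pos_idx n) = 1" by linarith
  have sum: "(\<Sum>k\<in>UNIV. n $ k * y $ k) = 0" if "y \<in> Y" for y
    using n that span_base[of y Y] by (auto simp: relation_def inner_vec_def)
  have off_n: "n $ k = 0" if "k \<notin> I" for k using n that by (simp add: relation_def)
  have contra: "n $ k * y $ k = 0" if y: "y \<in> Y" "\<And>i. 0 < n $ i \<Longrightarrow> y $ i = 0" for y k
  proof -
    have "n $ j * y $ j \<le> 0" for j
      using that(2)[of j] nonneg[OF y(1), of j] by (cases "0 < n $ j") (auto simp: mult_nonpos_nonneg)
    then have nn: "0 \<le> - (n $ j * y $ j)" for j by simp
    have s0: "(\<Sum>j\<in>UNIV. - (n $ j * y $ j)) = 0" using sum[OF y(1)] by (simp add: sum_negf)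
    have "- (n $ k * y $ k) = 0" by (rule sum_nonneg_0[OF finite nn s0]) simp
    then show ?thesis by simp
  qed
  from c show False
  proof
    assume "card (pos_idx n) = 0"
    then have "pos_idx n = {}" by simp
    then have npos: "\<not> 0 < n $ i" for i
      using off_n[of i] by (cases "i \<in> I") (auto simp: pos_idx_def)
    obtain k where k: "n $ k \<noteq> 0" using n by (auto simp: relation_def vec_eq_iff)
    then have "k \<in> I" using off_n by blast
    then obtain y where "y \<in> Y" "0 < y $ k" using facet_proper by blast
    then show False using contra[of y k] npos k by auto
  next
    assume "card (pos_idx n) = 1"
    then obtain a where a: "pos_idx n = {a}" by (auto simp: card_1_singleton_iff)
    then have aI: "a \<in> I" "0 < n $ a" by (auto simp: pos_idx_def)
    have only: "i = a" if "0 < n $ i" for i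
      using that a off_n[of i] by (cases "i \<in> I") (auto simp: pos_idx_def)
    obtain y0 where y0: "y0 \<in> Y" "0 < y0 $ a" using facet_proper[OF aI(1)] by blast
    have "\<exists>b. n $ b < 0"
    proof (rule ccontr)
      assume "\<not> (\<exists>b. n $ b < 0)"
      then have nn: "0 \<le> n $ k * y0 $ k" for k using nonneg[OF y0(1)] by (simp add: not_less)
      have "n $ a * y0 $ a = 0" by (rule sum_nonneg_0[OF finite nn sum[OF y0(1)]]) simp
      then show False using aI y0 by simp
    qed
    then obtain b where b: "n $ b < 0" by blast
    then have "b \<in> I" "a \<noteq> b" using off_n[of b] aI by (cases "b \<in> I"; auto)+
    then obtain y where y: "y \<in> Y" "y $ a = 0" "0 < y $ b" using facet_not_subset[OF aI(1)] by blast
    then show False using contra[of y b] only b by auto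
  qed
qed

lemma card_neg_idx_ge: "relation n \<Longrightarrow> 2 \<le> card (neg_idx n)"
  using card_pos_idx_ge[OF relation_uminus] by (simp add: idx_uminus)

lemma inner_supp_pair:
  assumes "supp p = {a, b}" "a \<noteq> b"
  shows "n \<bullet> p = n $ a * p $ a + n $ b * p $ b"
proof -
  have "n \<bullet> p = (\<Sum>k\<in>UNIV. n $ k * p $ k)" by (simp add: inner_vec_def)
  also have "\<dots> = (\<Sum>k\<in>{a, b}. n $ k * p $ k)"
    using assms by (intro sum.mono_neutral_right) (auto simp: supp_def)
  finally show ?thesis using assms(2) by simp
qed

text \<open>The entries at \<open>b\<close> cancel, so the resulting vector depends on
  \<open>a\<close> and \<open>a'\<close> only: the lines of all edges that exchange \<open>a\<close>
  for \<open>a'\<close> pass through one point.\<close>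

lemma supp_pair_line:
  assumes n: "relation n" and ab: "a \<in> pos_idx n" "a' \<in> pos_idx n" "a \<noteq> a'" "b \<in> neg_idx n"
    and p: "p \<in> Y" "supp p = {a, b}" and q: "q \<in> Y" "supp q = {a', b}"
  shows "(n $ a' / p $ a) *\<^sub>R p - (n $ a / q $ a') *\<^sub>R q = (n $ a') *\<^sub>R axis a 1 - (n $ a) *\<^sub>R axis a' 1"
    "n $ a' / p $ a \<noteq> 0" "n $ a / q $ a' \<noteq> 0"
proof -
  have pos: "0 < n $ a" "0 < n $ a'" "n $ b < 0" using ab by (auto simp: pos_idx_def neg_idx_def)
  have ne: "a \<noteq> b" "a' \<noteq> b" using pos by auto
  have nz: "p $ a \<noteq> 0" "q $ a' \<noteq> 0" using p q by (auto simp: supp_def)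
  then show "n $ a' / p $ a \<noteq> 0" "n $ a / q $ a' \<noteq> 0" using pos by auto
  have "n \<bullet> p = 0" "n \<bullet> q = 0" using n p(1) q(1) span_base by (auto simp: relation_def)
  then have rel: "n $ a * p $ a + n $ b * p $ b = 0" "n $ a' * q $ a' + n $ b * q $ b = 0"
    using inner_supp_pair[OF p(2) ne(1)] inner_supp_pair[OF q(2) ne(2)] by auto
  then have pb: "p $ b = - n $ a * p $ a / n $ b" "q $ b = - n $ a' * q $ a' / n $ b"
    using pos by (auto simp: field_simps)
  have zp: "p $ k = 0" if "k \<notin> {a, b}" for k using p(2) that by (auto simp: supp_def)
  have zq: "q $ k = 0" if "k \<notin> {a', b}" for k using q(2) that by (auto simp: supp_def)
  have "(n $ a' / p $ a) * p $ k - (n $ a / q $ a') * q $ k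
      = n $ a' * axis a 1 $ k - n $ a * axis a' 1 $ k" for k
  proof -
    consider "k = a" | "k = a'" | "k = b" | "k \<noteq> a" "k \<noteq> a'" "k \<noteq> b" by blast
    then show ?thesis
    proof cases
      case 1
      then show ?thesis using zq[of a] nz ab(3) ne by (simp add: axis_def)
    next
      case 2
      then show ?thesis using zp[of a'] nz ab(3) ne by (simp add: axis_def)
    next
      case 3
      then show ?thesis using pb nz ne by (simp add: axis_def)
    next
      case 4
      then show ?thesis using zp[of k] zq[of k] by (simp add: axis_def)
    qed
  qed
  then show "(n $ a' / p $ a) *\<^sub>R p - (n $ a / q $ a') *\<^sub>R q = (n $ a') *\<^sub>R axis a 1 - (n $ a) *\<^sub>R axis a' 1"
    by (simp add: vec_eq_iff)
qed

end

context heptagon_slack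
begin

text \<open>A block of size 2 by 3 consists of three edges that exchange \<open>a\<close> for
  \<open>a'\<close>, so \<open>supp_pair_line\<close> and \<open>no_concurrent\<close>
  apply.\<close>

lemma card_image_block:
  assumes n: "relation n" and A: "A \<subseteq> pos_idx n" "card A = 2" and B: "B \<subseteq> neg_idx n" "card B = 3"
  shows "card (pt ` block A B) \<le> 4"
proof -
  obtain a a' where a: "A = {a, a'}" "a \<noteq> a'" using A(2) by (auto simp: card_2_iff)
  obtain b1 b2 b3 where b: "B = {b1, b2, b3}" using B(2) by (auto simp: card_3_iff)
  have ex: "\<exists>y\<in>Y. supp y = {x, z}" if "x \<in> A" "z \<in> B" for x z
    using exists_supp_pair[OF n] that A B by (auto simp: pos_idx_def neg_idx_def subset_iff)
  obtain p1 q1 where 1: "p1 \<in> Y" "supp p1 = {a, b1}" "q1 \<in> Y" "supp q1 = {a', b1}"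
    using ex[of a b1] ex[of a' b1] a b by auto
  obtain p2 q2 where 2: "p2 \<in> Y" "supp p2 = {a, b2}" "q2 \<in> Y" "supp q2 = {a', b2}"
    using ex[of a b2] ex[of a' b2] a b by auto
  obtain p3 q3 where 3: "p3 \<in> Y" "supp p3 = {a, b3}" "q3 \<in> Y" "supp q3 = {a', b3}"
    using ex[of a b3] ex[of a' b3] a b by auto
  have "block A B \<subseteq> {p1, q1, p2, q2, p3, q3}"
  proof
    fix y assume "y \<in> block A B"
    then obtain x z where y: "y \<in> Y" "x \<in> A" "z \<in> B" "supp y = {x, z}" by (auto simp: block_def)
    have "\<forall>x\<in>A. \<forall>z\<in>B. {x, z} \<in> {supp p1, supp q1, supp p2, supp q2, supp p3, supp q3}"
      unfolding a(1) b 1(2,4) 2(2,4) 3(2,4) by simp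
    then have "supp y \<in> {supp p1, supp q1, supp p2, supp q2, supp p3, supp q3}"
      using y by blast
    moreover have "y = w" if "w \<in> Y" "supp y = supp w" for w using supp_eq[OF y(1) that] .
    ultimately show "y \<in> {p1, q1, p2, q2, p3, q3}" using 1(1,3) 2(1,3) 3(1,3) by blast
  qed
  then have "card (pt ` block A B) \<le> card (pt ` {p1, q1, p2, q2, p3, q3})"
    by (intro card_mono image_mono) auto
  also have "\<dots> \<le> 4"
  proof -
    have idx: "a \<in> pos_idx n" "a' \<in> pos_idx n" "b1 \<in> neg_idx n" "b2 \<in> neg_idx n" "b3 \<in> neg_idx n"
      using a b A B by auto
    note l1 = supp_pair_line[OF n idx(1,2) a(2) idx(3) 1]
    note l2 = supp_pair_line[OF n idx(1,2) a(2) idx(4) 2]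
    note l3 = supp_pair_line[OF n idx(1,2) a(2) idx(5) 3]
    show ?thesis
      by (rule no_concurrent[OF _ l1(2,3) l2(2,3) l3(2,3) l1(1) l2(1) l3(1)]) (use 1 2 3 in blast)
  qed
  finally show ?thesis .
qed

text \<open>With two positive entries there are at most 8 vertices, six of which have at most 4
  images together, too few to reach 7. With three and three the vertices form a 3 by 3 array, and
  dropping any row leaves at most 4 images.\<close>

lemma relation_neg_3_False:
  assumes n: "relation n" and I: "card I \<le> 6" and neg: "3 \<le> card (neg_idx n)"
  shows False
proof -
  let ?A = "pos_idx n" and ?B = "neg_idx n"
  have sum: "card ?A + card ?B + card (zero_idx n) \<le> 6" using card_idx I by simp
  have A2: "2 \<le> card ?A" by (rule card_pos_idx_ge[OF n])
  then have A: "card ?A = 2 \<or> card ?A = 3" using sum neg by linarith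
  have blY: "block A B \<subseteq> Y" for A B by (auto simp: block_def)
  obtain B where B: "B \<subseteq> ?B" "card B = 3" by (rule obtain_subset_with_card_n[OF neg])
  from A show False
  proof
    assume A: "card ?A = 2"
    then have "card Y \<le> 8" using card_Y_relation[OF n] sum by simp
    moreover have "card (block ?A B) = 6" using card_block[OF n subset_refl B(1)] A B by simp
    ultimately have "5 \<le> card (pt ` block ?A B)" using card_image_ge[OF blY[of ?A B]] by simp
    then show False using card_image_block[OF n subset_refl A B] by simp
  next
    assume A: "card ?A = 3"
    then have B3: "card ?B = 3" "card (zero_idx n) = 0" using sum neg by linarith+
    have bl9: "card (block ?A ?B) = 9" using card_block[OF n subset_refl subset_refl] A B3 by simp
    have "card Y \<le> 9" using card_Y_relation[OF n] A B3 by simp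
    then have Yeq: "Y = block ?A ?B" using card_seteq[OF fin blY[of ?A ?B]] bl9 by simp
    \<comment> \<open>The vertices of \<open>P\<close> all of whose preimages lie in row
      \<open>a\<close>. Each row has at least 7 - 4 of them and the rows give disjoint sets, but 9
      exceeds 7.\<close>
    define E where "E a = vertices P - pt ` block (?A - {a}) ?B" for a
    have finP: "finite (vertices P)" using card_P card.infinite by fastforce
    have E3: "3 \<le> card (E a)" if "a \<in> ?A" for a
    proof -
      have "card (?A - {a}) = 2" using that A by simp
      then have "card (pt ` block (?A - {a}) ?B) \<le> 4" using card_image_block[OF n _ _ _ B3(1)] by simp
      moreover have "card (vertices P) - card (pt ` block (?A - {a}) ?B) \<le> card (E a)"
        unfolding E_def using fin blY by (intro diff_card_le_card_Diff) (meson finite_imageI finite_subset)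
      ultimately show ?thesis using card_P by simp
    qed
    have disj: "E a \<inter> E a' = {}" if "a \<noteq> a'" for a a'
    proof -
      have "Y \<subseteq> block (?A - {a}) ?B \<union> block (?A - {a'}) ?B"
        using that by (subst Yeq) (auto simp: block_def)
      then have "vertices P \<subseteq> pt ` block (?A - {a}) ?B \<union> pt ` block (?A - {a'}) ?B"
        unfolding pt_Y[symmetric] by blast
      then show ?thesis unfolding E_def by blast
    qed
    obtain a1 a2 a3 where a: "?A = {a1, a2, a3}" "a1 \<noteq> a2" "a1 \<noteq> a3" "a2 \<noteq> a3"
      using A by (auto simp: card_3_iff)
    have finE: "finite (E a)" for a using finP by (simp add: E_def)
    have "card (E a1 \<union> E a2 \<union> E a3) = card (E a1) + card (E a2) + card (E a3)"
      using finE disj a(2,3,4) by (simp add: card_Un_disjoint Int_Un_distrib2)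
    moreover have "card (E a1 \<union> E a2 \<union> E a3) \<le> card (vertices P)"
      using finP by (intro card_mono) (auto simp: E_def)
    ultimately show False using E3[of a1] E3[of a2] E3[of a3] a card_P by simp
  qed
qed

lemma relation_False:
  assumes n: "relation n" and I: "card I \<le> 6"
  shows False
proof (cases "3 \<le> card (neg_idx n)")
  case True
  then show ?thesis using relation_neg_3_False[OF n I] by simp
next
  case False
  then have neg: "card (neg_idx n) = 2" using card_neg_idx_ge[OF n] by simp
  \<comment> \<open>Otherwise there are at most \<open>2 * 2 + 2\<close> vertices. With three
    positive entries the sign of \<open>n\<close> can be reversed.\<close>
  have "\<not> card (pos_idx n) \<le> 2"
  proof
    assume "card (pos_idx n) \<le> 2"
    then have "card (pos_idx n) = 2" using card_pos_idx_ge[OF n] by simp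
    then show False using card_Y_relation[OF n] card_Y_ge card_idx[of n] neg I by simp
  qed
  then show ?thesis
    using relation_neg_3_False[OF relation_uminus[OF n] I] by (simp add: idx_uminus)
qed

end

section \<open>Three-dimensional polytopes with six facets\<close>

text \<open>The dimension 4 is that of the cone, one more than that of the polytope.\<close>

locale slack_dim3 = slack_vectors Y I pt ht
  for Y :: "(real^'n) set" and I and pt :: "real^'n \<Rightarrow> 'b::real_vector" and ht +
  assumes dim4: "dim (span Y) = 4" and card_I: "card I = 6"
begin

lemma finite_I: "finite I"
  using card_I card.infinite by fastforce

text \<open>Of three real coefficients two have a nonnegative product. At a vertex on the third
  facet but off one of these two, only terms of one sign remain, so both coefficients vanish; a
  vertex off the last facet disposes of the third.\<close>

lemma facet_triple_indep:
  assumes ijk: "i \<in> I" "j \<in> I" "k \<in> I" and ne: "i \<noteq> j" "i \<noteq> k" "j \<noteq> k"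
    and eq: "\<And>y. y \<in> Y \<Longrightarrow> \<alpha> * y $ i + \<beta> * y $ j + \<gamma> * y $ k = 0"
  shows "\<alpha> = 0 \<and> \<beta> = 0 \<and> \<gamma> = 0"
proof -
  have key: "\<alpha> = 0" if iI: "i \<in> I" "j \<in> I" "k \<in> I" "k \<noteq> i" and ab: "0 \<le> \<alpha> * \<beta>"
    and e: "\<And>y. y \<in> Y \<Longrightarrow> \<alpha> * y $ i + \<beta> * y $ j + \<gamma> * y $ k = 0" for \<alpha> \<beta> \<gamma> and i j k :: 'n
  proof (rule ccontr)
    assume a: "\<alpha> \<noteq> 0"
    obtain y where y: "y \<in> Y" "y $ k = 0" "0 < y $ i" using facet_not_subset[OF iI(3,1,4)] by blast
    then have "\<alpha> * y $ i + \<beta> * y $ j = 0" using e[OF y(1)] by simp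
    then have "\<alpha> * (\<alpha> * y $ i + \<beta> * y $ j) = 0" by simp
    then have "\<alpha>\<^sup>2 * y $ i + (\<alpha> * \<beta>) * y $ j = 0" by (simp add: power2_eq_square algebra_simps)
    moreover have "0 \<le> (\<alpha> * \<beta>) * y $ j" using ab nonneg[OF y(1)] by simp
    moreover have "0 < \<alpha>\<^sup>2 * y $ i" using a y(3) by simp
    ultimately show False by linarith
  qed
  have last: "\<alpha> = 0" if "i \<in> I" "\<And>y. y \<in> Y \<Longrightarrow> \<alpha> * y $ i = 0" for \<alpha> and i :: 'n
  proof -
    obtain y where "y \<in> Y" "0 < y $ i" using facet_proper[OF \<open>i \<in> I\<close>] by blast
    then show ?thesis using that(2)[of y] by simp
  qed
  have "0 \<le> \<alpha> * \<beta> \<or> 0 \<le> \<alpha> * \<gamma> \<or> 0 \<le> \<beta> * \<gamma>"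
    by (cases "0 \<le> \<alpha>"; cases "0 \<le> \<beta>"; cases "0 \<le> \<gamma>") (simp_all add: zero_le_mult_iff)
  moreover have e: "\<beta> * y $ j + \<alpha> * y $ i + \<gamma> * y $ k = 0" "\<alpha> * y $ i + \<gamma> * y $ k + \<beta> * y $ j = 0"
    "\<gamma> * y $ k + \<alpha> * y $ i + \<beta> * y $ j = 0" "\<beta> * y $ j + \<gamma> * y $ k + \<alpha> * y $ i = 0"
    "\<gamma> * y $ k + \<beta> * y $ j + \<alpha> * y $ i = 0" if "y \<in> Y" for y
    using eq[OF that] by (simp_all add: add_ac)
  ultimately have "\<alpha> = 0 \<and> \<beta> = 0 \<or> \<alpha> = 0 \<and> \<gamma> = 0 \<or> \<beta> = 0 \<and> \<gamma> = 0"
  proof (elim disjE)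
    assume s: "0 \<le> \<alpha> * \<beta>"
    then have s': "0 \<le> \<beta> * \<alpha>" by (simp add: mult.commute)
    show ?thesis
      using key[OF ijk ne(2)[symmetric] s eq] key[OF ijk(2,1,3) ne(3)[symmetric] s' e(1)] by blast
  next
    assume s: "0 \<le> \<alpha> * \<gamma>"
    then have s': "0 \<le> \<gamma> * \<alpha>" by (simp add: mult.commute)
    show ?thesis
      using key[OF ijk(1,3,2) ne(1)[symmetric] s e(2)] key[OF ijk(3,1,2) ne(3) s' e(3)] by blast
  next
    assume s: "0 \<le> \<beta> * \<gamma>"
    then have s': "0 \<le> \<gamma> * \<beta>" by (simp add: mult.commute)
    show ?thesis
      using key[OF ijk(2,3,1) ne(1) s e(4)] key[OF ijk(3,2,1) ne(2) s' e(5)] by blast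
  qed
  then show ?thesis
  proof (elim disjE conjE)
    assume z: "\<alpha> = 0" "\<beta> = 0"
    then have "\<gamma> * y $ k = 0" if "y \<in> Y" for y using eq[OF that] by simp
    then show ?thesis using last[OF ijk(3)] z by blast
  next
    assume z: "\<alpha> = 0" "\<gamma> = 0"
    then have "\<beta> * y $ j = 0" if "y \<in> Y" for y using eq[OF that] by simp
    then show ?thesis using last[OF ijk(2)] z by blast
  next
    assume z: "\<beta> = 0" "\<gamma> = 0"
    then have "\<alpha> * y $ i = 0" if "y \<in> Y" for y using eq[OF that] by simp
    then show ?thesis using last[OF ijk(1)] z by blast
  qed
qed

text \<open>If the slack at \<open>k\<close> vanished on \<open>ker {i, j}\<close>, it would be a
  combination of the slacks at \<open>i\<close> and \<open>j\<close>, against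
  \<open>facet_triple_indep\<close>. The vector \<open>x\<close> need not lie in the cone.\<close>

lemma ker_pair_nonzero:
  assumes ijk: "i \<in> I" "j \<in> I" "k \<in> I" and ne: "i \<noteq> j" "i \<noteq> k" "j \<noteq> k"
  obtains x where "x \<in> ker {i, j}" "0 < x $ k"
proof -
  have "\<exists>x\<in>ker {i, j}. x $ k \<noteq> 0"
  proof (rule ccontr)
    assume neg: "\<not> (\<exists>x\<in>ker {i, j}. x $ k \<noteq> 0)"
    obtain u where u: "u \<in> Y" "u $ i = 0" "0 < u $ j" using facet_not_subset[OF ijk(1,2) ne(1)] by blast
    obtain v where v: "v \<in> Y" "v $ j = 0" "0 < v $ i"
      using facet_not_subset[OF ijk(2,1) ne(1)[symmetric]] by blast
    have "(v $ k / v $ i) * y $ i + (u $ k / u $ j) * y $ j + (- 1) * y $ k = 0" if y: "y \<in> Y" for y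
    proof -
      let ?z = "y - (y $ i / v $ i) *\<^sub>R v - (y $ j / u $ j) *\<^sub>R u"
      have "?z \<in> span Y" using y u v by (intro span_diff span_scale span_base)
      then have "?z \<in> ker {i, j}" using u v by (auto simp: ker_def)
      then have "?z $ k = 0" using neg by blast
      then show ?thesis by (simp add: algebra_simps)
    qed
    then show False using facet_triple_indep[OF ijk ne] by fastforce
  qed
  then obtain x where x: "x \<in> ker {i, j}" "x $ k \<noteq> 0" by blast
  have "- x \<in> ker {i, j}" using subspace_neg[OF subspace_ker x(1)] .
  then show ?thesis using that[of x] that[of "- x"] x by (cases "0 < x $ k") auto
qed

lemma dim_ker_pair: "i \<in> I \<Longrightarrow> j \<in> I \<Longrightarrow> i \<noteq> j \<Longrightarrow> dim (ker {i, j}) \<le> 2"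
proof -
  assume ij: "i \<in> I" "j \<in> I" "i \<noteq> j"
  have ke: "ker {} = span Y" by (simp add: ker_def)
  obtain u where u: "u \<in> Y" "u $ i = 0" "0 < u $ j" using facet_not_subset[OF ij] by blast
  obtain v where v: "v \<in> Y" "0 < v $ i" using facet_proper[OF ij(1)] by blast
  have "dim (ker {i}) < dim (ker {})" using v by (intro dim_ker_less[of v]) (auto simp: in_ker_iff)
  moreover have "dim (ker {j, i}) < dim (ker {i})" using u by (intro dim_ker_less[of u]) (auto simp: in_ker_iff)
  ultimately show ?thesis using dim4 by (simp add: ke insert_commute)
qed

lemma dim_ker_triple:
  assumes ijk: "i \<in> I" "j \<in> I" "k \<in> I" and ne: "i \<noteq> j" "i \<noteq> k" "j \<noteq> k"
  shows "dim (ker {i, j, k}) \<le> 1"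
proof -
  obtain x where x: "x \<in> ker {i, j}" "0 < x $ k" using ker_pair_nonzero[OF assms] .
  then have "dim (ker {k, i, j}) < dim (ker {i, j})" by (intro dim_ker_less[of x]) auto
  moreover have "{k, i, j} = {i, j, k}" by auto
  ultimately show ?thesis using dim_ker_pair[OF ijk(1,2) ne(1)] by simp
qed

lemma ker_triple_multiple:
  assumes ijk: "i \<in> I" "j \<in> I" "k \<in> I" "i \<noteq> j" "i \<noteq> k" "j \<noteq> k"
    and v: "v \<in> ker {i, j, k}" "v \<noteq> 0" and x: "x \<in> ker {i, j, k}"
  obtains c where "x = c *\<^sub>R v"
proof -
  have "ker {i, j, k} \<subseteq> span {v}"
    using v dim_ker_triple[OF ijk] by (intro card_ge_dim_independent) (auto simp: dependent_single)
  then show ?thesis using x that by (auto simp: span_singleton)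
qed

lemma triple_unique:
  assumes ijk: "i \<in> I" "j \<in> I" "k \<in> I" "i \<noteq> j" "i \<noteq> k" "j \<noteq> k"
    and y: "y \<in> Y" "y $ i = 0" "y $ j = 0" "y $ k = 0" and w: "w \<in> Y" "w $ i = 0" "w $ j = 0" "w $ k = 0"
  shows "w = y"
proof -
  have "y \<noteq> 0" using Y_nonzero[OF y(1)] by auto
  moreover have "y \<in> ker {i, j, k}" "w \<in> ker {i, j, k}" using y w by (auto simp: in_ker_iff)
  ultimately obtain c where "w = c *\<^sub>R y" using ker_triple_multiple[OF ijk] by blast
  then show ?thesis by (intro support_subset_eq[OF y(1) w(1)]) auto
qed

definition common :: "'n \<Rightarrow> 'n \<Rightarrow> (real^'n) set" where
  "common i j = {y\<in>Y. y $ i = 0 \<and> y $ j = 0}"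

lemma common_commute: "common i j = common j i"
  by (auto simp: common_def)

lemma finite_common: "finite (common i j)"
  using fin by (simp add: common_def)

lemma card_common_le: "i \<in> I \<Longrightarrow> j \<in> I \<Longrightarrow> i \<noteq> j \<Longrightarrow> card (common i j) \<le> 2"
proof -
  assume ij: "i \<in> I" "j \<in> I" "i \<noteq> j"
  have "common i j = Y \<inter> ker {i, j}" by (auto simp: common_def ker_def span_base)
  then show ?thesis using card_plane[OF subspace_ker dim_ker_pair[OF ij]] by simp
qed

text \<open>An edge is recognised by its two end vertices; facets sharing a single vertex do not
  count as adjacent.\<close>

definition adj :: "'n \<Rightarrow> 'n \<Rightarrow> bool" where
  "adj i j \<longleftrightarrow> i \<in> I \<and> j \<in> I \<and> i \<noteq> j \<and> card (common i j) = 2"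

lemma adj_commute: "adj i j \<longleftrightarrow> adj j i"
  by (auto simp: adj_def common_commute)

lemma adj_irrefl: "\<not> adj i i"
  by (simp add: adj_def)

lemma adj_iff_other:
  assumes "i \<in> I" "j \<in> I" "i \<noteq> j" "y \<in> common i j"
  shows "adj i j \<longleftrightarrow> (\<exists>w\<in>common i j. w \<noteq> y)"
proof -
  have "card (common i j) = Suc (card (common i j - {y}))"
    using card.remove[OF finite_common assms(4)] .
  moreover have "card (common i j - {y}) = 0 \<longleftrightarrow> \<not> (\<exists>w\<in>common i j. w \<noteq> y)"
    using finite_common by auto
  ultimately show ?thesis using card_common_le[OF assms(1-3)] assms(1-3) by (auto simp: adj_def)
qed

lemma adj_no_three:
  assumes "adj i j" "{u, v, w} \<subseteq> common i j"
  shows "u = v \<or> u = w \<or> v = w"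
proof (rule ccontr)
  assume "\<not> ?thesis"
  then have "card {u, v, w} = 3" by auto
  then show False using card_mono[OF finite_common assms(2)] assms(1) by (simp add: adj_def)
qed

text \<open>A small step from \<open>y\<close> along \<open>x\<close> violates no facet through
  \<open>y\<close> and so stays in the cone. Among the vertices representing the reached point, one
  lies off \<open>j\<close> and on every facet through \<open>y\<close> along which \<open>x\<close>
  runs.\<close>

lemma edge_exists:
  assumes y: "y \<in> Y" and x: "x \<in> span Y" "\<And>i. y $ i = 0 \<Longrightarrow> 0 \<le> x $ i" and j: "y $ j = 0" "0 < x $ j"
  obtains w where "w \<in> Y" "0 < w $ j" "\<And>i. y $ i = 0 \<Longrightarrow> x $ i = 0 \<Longrightarrow> w $ i = 0"
proof -
  \<comment> \<open>The 1 in the denominator avoids division by 0; the 1 inserted into the minimum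
    covers an empty \<open>S\<close>.\<close>
  define S where "S = (\<lambda>i. y $ i / (\<bar>x $ i\<bar> + 1)) ` {i. 0 < y $ i}"
  define e where "e = Min (insert 1 S)"
  have "finite S" by (simp add: S_def)
  moreover have "\<forall>s\<in>insert 1 S. 0 < s" by (auto simp: S_def intro!: divide_pos_pos)
  ultimately have e: "0 < e" "\<forall>s\<in>S. e \<le> s" by (auto simp: e_def)
  have nn: "0 \<le> (y + e *\<^sub>R x) $ i" for i
  proof (cases "0 < y $ i")
    case True
    then have "e \<le> y $ i / (\<bar>x $ i\<bar> + 1)" using e(2) by (auto simp: S_def)
    then have "e * (\<bar>x $ i\<bar> + 1) \<le> y $ i" by (subst (asm) pos_le_divide_eq) auto
    moreover have "- (e * \<bar>x $ i\<bar>) \<le> e * x $ i"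
      using abs_ge_minus_self[of "e * x $ i"] e(1) by (simp add: abs_mult)
    ultimately show ?thesis using e(1) by (simp add: distrib_left)
  next
    case False
    then have "y $ i = 0" using nonneg[OF y, of i] by simp
    then show ?thesis using x(2)[of i] e(1) by simp
  qed
  have "y + e *\<^sub>R x \<in> span Y" by (rule span_add[OF span_base[OF y] span_scale[OF x(1)]])
  then obtain d where d: "\<forall>w\<in>Y. 0 \<le> d w" "y + e *\<^sub>R x = (\<Sum>w\<in>Y. d w *\<^sub>R w)"
    using in_cone nn by blast
  have comp: "y $ i + e * x $ i = (\<Sum>w\<in>Y. d w * w $ i)" for i
    using arg_cong[OF d(2), of "\<lambda>x. x $ i"] by simp
  have "(\<Sum>w\<in>Y. d w * w $ j) \<noteq> 0" using comp[of j] j e(1) by auto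
  then obtain w where w: "w \<in> Y" "d w * w $ j \<noteq> 0"
    by (rule sum.not_neutral_contains_not_neutral)
  have "w $ i = 0" if "y $ i = 0" "x $ i = 0" for i
  proof -
    have s0: "(\<Sum>w\<in>Y. d w * w $ i) = 0" using comp[of i] that by simp
    have "d w * w $ i = 0"
      by (rule sum_nonneg_0[OF fin _ s0 w(1)]) (simp add: d(1) nonneg)
    then show ?thesis using w(2) by auto
  qed
  moreover have "0 < w $ j" using w nonneg[OF w(1), of j] by auto
  ultimately show ?thesis using that w(1) by blast
qed

text \<open>Leaving \<open>y\<close> inside \<open>ker {i, j}\<close> towards positive
  \<open>k\<close> violates no facet through \<open>y\<close>, so \<open>edge_exists\<close> gives a
  second vertex on \<open>i\<close> and \<open>j\<close>.\<close>

lemma deg3_adj: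
  assumes y: "y \<in> Y" "Z y = {i, j, k}" and ne: "i \<noteq> j" "i \<noteq> k" "j \<noteq> k"
  shows "adj i j"
proof -
  have I: "i \<in> I" "j \<in> I" "k \<in> I" and y0: "y $ i = 0" "y $ j = 0" "y $ k = 0" using y(2) by (auto simp: Z_def)
  obtain x where x: "x \<in> ker {i, j}" "0 < x $ k" using ker_pair_nonzero[OF I ne] .
  have xs: "x \<in> span Y" using x(1) ker_le_span by blast
  have "0 \<le> x $ l" if "y $ l = 0" for l
  proof (cases "l \<in> I")
    case True
    then have "l \<in> {i, j, k}" using that y(2) by (auto simp: Z_def)
    then show ?thesis using x by (auto simp: ker_def)
  qed (simp add: off_span[OF xs])
  then obtain w where w: "w \<in> Y" "0 < w $ k" "\<And>i. y $ i = 0 \<Longrightarrow> x $ i = 0 \<Longrightarrow> w $ i = 0"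
    using edge_exists[OF y(1) xs _ y0(3) x(2)] by blast
  have "x $ i = 0" "x $ j = 0" using x(1) by (simp_all add: ker_def)
  then have "w $ i = 0" "w $ j = 0" using w(3) y0 by blast+
  then have "w \<in> common i j" "w \<noteq> y" using w(1,2) y0(3) by (auto simp: common_def)
  moreover have yc: "y \<in> common i j" using y(1) y0 by (simp add: common_def)
  ultimately show ?thesis using adj_iff_other[OF I(1,2) ne(1) yc] by blast
qed

text \<open>The signs of the relation decide: on \<open>ker {a, c}\<close> the slacks at
  \<open>b\<close> and \<open>d\<close> are positive multiples of each other, so an edge leaves
  \<open>y\<close> there; a vertex on \<open>a\<close> and \<open>b\<close> lies on \<open>c\<close>
  and \<open>d\<close> too, hence is \<open>y\<close>.\<close>

lemma deg4_rel_adj: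
  assumes y: "y \<in> Y" "Z y = {a, b, c, d}" and dist: "distinct [a, b, c, d]"
    and pos: "0 < A" "0 < B" "0 < C" "0 < D"
    and rel: "\<And>x. x \<in> span Y \<Longrightarrow> A * x $ a + B * x $ b = C * x $ c + D * x $ d"
  shows "adj a c" "\<not> adj a b"
proof -
  have I: "a \<in> I" "b \<in> I" "c \<in> I" "d \<in> I" and y0: "y $ a = 0" "y $ b = 0" "y $ c = 0" "y $ d = 0"
    using y(2) by (auto simp: Z_def)
  have ne: "a \<noteq> b" "a \<noteq> c" "b \<noteq> c" using dist by auto
  obtain x where x: "x \<in> ker {a, c}" "0 < x $ b" using ker_pair_nonzero[OF I(1,3,2) ne(2,1) ne(3)[symmetric]] .
  have xs: "x \<in> span Y" and x0: "x $ a = 0" "x $ c = 0" using x(1) by (auto simp: ker_def)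
  have "D * x $ d = B * x $ b" using rel[OF xs] x0 by simp
  then have "0 < D * x $ d" using pos(2) x(2) by simp
  then have xd: "0 < x $ d" using pos(4) by (rule zero_less_mult_pos)
  have "0 \<le> x $ l" if "y $ l = 0" for l
  proof (cases "l \<in> I")
    case True
    then have "l \<in> {a, b, c, d}" using that y(2) by (auto simp: Z_def)
    then show ?thesis using x0 xd x(2) by auto
  qed (simp add: off_span[OF xs])
  then obtain w where w: "w \<in> Y" "0 < w $ b" "\<And>i. y $ i = 0 \<Longrightarrow> x $ i = 0 \<Longrightarrow> w $ i = 0"
    using edge_exists[OF y(1) xs _ y0(2) x(2)] by blast
  have "w $ a = 0" "w $ c = 0" using w(3) y0 x0 by blast+
  then have "w \<in> common a c" "w \<noteq> y" using w(1,2) y0(2) by (auto simp: common_def)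
  moreover have yac: "y \<in> common a c" using y(1) y0 by (simp add: common_def)
  ultimately show "adj a c" using adj_iff_other[OF I(1,3) ne(2) yac] by blast
  have yab: "y \<in> common a b" using y(1) y0 by (simp add: common_def)
  have "w = y" if w: "w \<in> common a b" for w
  proof -
    have wY: "w \<in> Y" and w0: "w $ a = 0" "w $ b = 0" using w by (auto simp: common_def)
    then have "C * w $ c + D * w $ d = 0" using rel[OF span_base[OF wY]] by simp
    moreover have "0 \<le> C * w $ c" "0 \<le> D * w $ d" using pos nonneg[OF wY] by simp_all
    ultimately have "C * w $ c = 0" by linarith
    then have "w $ c = 0" using pos by simp
    then show ?thesis using triple_unique[OF I(1,2,3) ne(1,2,3) y(1) y0(1,2,3) wY w0] by blast
  qed
  then show "\<not> adj a b" using adj_iff_other[OF I(1,2) ne(1) yab] by blast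
qed

text \<open>Four slacks vanish at \<open>y\<close>, hence live on a quotient of dimension 3 and
  satisfy a relation. Its coefficients are nonzero by \<open>facet_triple_indep\<close>, and any
  signs other than two against two would make one facet contain another.\<close>

lemma deg4_relation:
  assumes y: "y \<in> Y" "card (Z y) = 4"
  obtains a b c d A B C D where "Z y = {a, b, c, d}" "distinct [a, b, c, d]"
    "0 < A" "0 < B" "0 < C" "0 < (D::real)"
    "\<And>x. x \<in> span Y \<Longrightarrow> A * x $ a + B * x $ b = C * x $ c + D * x $ d"
proof -
  have "Z y \<noteq> {}" using y(2) by auto
  then obtain l where l: "l \<in> Z y" by blast
  define T where "T = Z y - {l}"
  have lT: "Z y = insert l T" "l \<notin> T" "card T = 3" using l y(2) by (auto simp: T_def)
  obtain i j k where T: "T = {i, j, k}" and ne: "i \<noteq> j" "i \<noteq> k" "j \<noteq> k"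
    using lT(3) by (auto simp: card_3_iff)
  have lne: "l \<noteq> i" "l \<noteq> j" "l \<noteq> k" using lT(2) T by auto
  have I: "i \<in> I" "j \<in> I" "k \<in> I" "l \<in> I" and y0: "y $ i = 0" "y $ j = 0" "y $ k = 0" "y $ l = 0"
    using lT(1) T by (auto simp: Z_def)
  have ynz: "y \<noteq> 0" using Y_nonzero[OF y(1)] by auto
  have yk: "y \<in> ker {i, j, k}" using y(1) y0 by (simp add: in_ker_iff)
  obtain u where u: "u \<in> ker {j, k}" "0 < u $ i" using ker_pair_nonzero[OF I(2,3,1) ne(3) ne(1)[symmetric] ne(2)[symmetric]] .
  obtain v where v: "v \<in> ker {i, k}" "0 < v $ j" using ker_pair_nonzero[OF I(1,3,2) ne(2,1) ne(3)[symmetric]] .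
  obtain w where w: "w \<in> ker {i, j}" "0 < w $ k" using ker_pair_nonzero[OF I(1,2,3) ne] .
  \<comment> \<open>Up to scaling, \<open>u\<close>, \<open>v\<close>, \<open>w\<close> are dual to
    the slacks at \<open>i\<close>, \<open>j\<close>, \<open>k\<close>, so the coefficients of the
    relation are read off there.\<close>
  define \<alpha> where "\<alpha> = u $ l / u $ i"
  define \<beta> where "\<beta> = v $ l / v $ j"
  define \<gamma> where "\<gamma> = w $ l / w $ k"
  have rel: "x $ l = \<alpha> * x $ i + \<beta> * x $ j + \<gamma> * x $ k" if x: "x \<in> span Y" for x
  proof -
    let ?z = "x - (x $ i / u $ i) *\<^sub>R u - (x $ j / v $ j) *\<^sub>R v - (x $ k / w $ k) *\<^sub>R w"
    have "?z \<in> span Y" using x u(1) v(1) w(1) by (intro span_diff span_scale) (auto simp: ker_def)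
    moreover have "?z $ i = 0" "?z $ j = 0" "?z $ k = 0" using u v w by (auto simp: ker_def)
    ultimately have "?z \<in> ker {i, j, k}" by (simp add: ker_def)
    then obtain c where "?z = c *\<^sub>R y" using ker_triple_multiple[OF I(1,2,3) ne yk ynz] by blast
    from arg_cong[OF this, of "\<lambda>x. x $ l"] have "?z $ l = 0" using y0(4) by simp
    then show ?thesis by (simp add: \<alpha>_def \<beta>_def \<gamma>_def algebra_simps)
  qed
  have rel': "x $ l = \<alpha> * x $ i + \<beta> * x $ j + \<gamma> * x $ k" if "x \<in> Y" for x using rel that span_base by blast
  have nz: "\<alpha> \<noteq> 0" "\<beta> \<noteq> 0" "\<gamma> \<noteq> 0"
  proof -
    show "\<alpha> \<noteq> 0"
      using facet_triple_indep[OF I(2,3,4) ne(3) lne(2)[symmetric] lne(3)[symmetric], of \<beta> \<gamma> "- 1"] rel' by auto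
    show "\<beta> \<noteq> 0"
      using facet_triple_indep[OF I(1,3,4) ne(2) lne(1)[symmetric] lne(3)[symmetric], of \<alpha> \<gamma> "- 1"] rel' by auto
    show "\<gamma> \<noteq> 0"
      using facet_triple_indep[OF I(1,2,4) ne(1) lne(1)[symmetric] lne(2)[symmetric], of \<alpha> \<beta> "- 1"] rel' by auto
  qed
  have not3: False if "0 < \<alpha>" "0 < \<beta>" "0 < \<gamma>"
  proof -
    obtain x where x: "x \<in> Y" "x $ l = 0" "0 < x $ i" using facet_not_subset[OF I(4,1) lne(1)] by blast
    then have "0 < \<alpha> * x $ i" "0 \<le> \<beta> * x $ j" "0 \<le> \<gamma> * x $ k" using that nonneg[OF x(1)] by simp_all
    then show False using rel'[OF x(1)] x(2) by linarith
  qed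
  have not1: False if neg: "\<beta>' < 0" "\<gamma>' < 0" and i': "i' \<in> I" "l \<noteq> i'"
    and e: "\<And>x. x \<in> Y \<Longrightarrow> x $ l = \<alpha>' * x $ i' + \<beta>' * x $ j' + \<gamma>' * x $ k'" for \<alpha>' \<beta>' \<gamma>' i' j' k'
  proof -
    obtain x where x: "x \<in> Y" "x $ i' = 0" "0 < x $ l" using facet_not_subset[OF i'(1) I(4) i'(2)[symmetric]] by blast
    have "\<beta>' * x $ j' \<le> 0" "\<gamma>' * x $ k' \<le> 0"
      using neg nonneg[OF x(1)] by (simp_all add: mult_nonpos_nonneg)
    then show False using e[OF x(1)] x(2,3) by simp
  qed
  have n1: False if "\<beta> < 0" "\<gamma> < 0" using not1[OF that I(1) lne(1), of \<alpha> j k] rel' by blast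
  have n2: False if "\<alpha> < 0" "\<gamma> < 0"
    by (rule not1[OF that I(2) lne(2), of \<beta> i k]) (use rel' in simp)
  have n3: False if "\<alpha> < 0" "\<beta> < 0"
    by (rule not1[OF that I(3) lne(3), of \<gamma> i j]) (use rel' in simp)
  consider "0 < \<alpha>" "0 < \<beta>" "\<gamma> < 0" | "0 < \<alpha>" "\<beta> < 0" "0 < \<gamma>" | "\<alpha> < 0" "0 < \<beta>" "0 < \<gamma>"
  proof -
    have "0 < \<alpha> \<or> \<alpha> < 0" "0 < \<beta> \<or> \<beta> < 0" "0 < \<gamma> \<or> \<gamma> < 0" using nz by linarith+
    then show ?thesis using that not3 n1 n2 n3 by blast
  qed
  then show ?thesis
  proof cases
    case 1
    show ?thesis
      by (rule that[of i j k l \<alpha> \<beta> "- \<gamma>" 1]) (use 1 lT T ne lne rel in auto)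
  next
    case 2
    show ?thesis
      by (rule that[of i k j l \<alpha> \<gamma> "- \<beta>" 1]) (use 2 lT T ne lne rel in auto)
  next
    case 3
    show ?thesis
      by (rule that[of j k i l \<beta> \<gamma> "- \<alpha>" 1]) (use 3 lT T ne lne rel in auto)
  qed
qed

text \<open>The two sides of the relation are the opposite pairs: the facets around \<open>y\<close>
  form the cycle \<open>a\<close>, \<open>c\<close>, \<open>b\<close>, \<open>d\<close>.\<close>

lemma deg4_adj:
  assumes y: "y \<in> Y" "card (Z y) = 4"
  obtains a b c d where "Z y = {a, b, c, d}" "distinct [a, b, c, d]"
    "adj a c" "adj a d" "adj b c" "adj b d" "\<not> adj a b" "\<not> adj c d"
proof -
  obtain a b c d A B C D where *: "Z y = {a, b, c, d}" "distinct [a, b, c, d]"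
    "0 < A" "0 < B" "0 < C" "0 < (D::real)"
    "\<And>x. x \<in> span Y \<Longrightarrow> A * x $ a + B * x $ b = C * x $ c + D * x $ d"
    by (rule deg4_relation[OF y]) blast
  show ?thesis
  proof (rule that[OF *(1,2)])
    show "adj a c" "\<not> adj a b" using deg4_rel_adj[OF y(1) *] by blast+
    show "adj a d"
      by (rule deg4_rel_adj(1)[OF y(1), of a b d c A B D C]) (use * in \<open>auto simp: algebra_simps\<close>)
    show "adj b c"
      by (rule deg4_rel_adj(1)[OF y(1), of b a c d B A C D]) (use * in \<open>auto simp: algebra_simps\<close>)
    show "adj b d"
      by (rule deg4_rel_adj(1)[OF y(1), of b a d c B A D C]) (use * in \<open>auto simp: algebra_simps\<close>)
    show "\<not> adj c d"
      by (rule deg4_rel_adj(2)[OF y(1), of c d a b C D A B]) (use * in \<open>auto simp: algebra_simps\<close>)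
  qed
qed

lemma card_Z_ge_3: "y \<in> Y \<Longrightarrow> 3 \<le> card (Z y)"
  using card_Z_ge[of y] dim4 by simp

lemma finite_Z: "finite (Z y)"
  using finite_I by (simp add: Z_def)

lemma sum_card_swap:
  assumes "finite A" "finite B"
  shows "(\<Sum>a\<in>A. card {b\<in>B. R a b}) = (\<Sum>b\<in>B. card {a\<in>A. R a b})"
proof -
  have "(\<Sum>a\<in>A. card {b\<in>B. R a b}) = (\<Sum>a\<in>A. \<Sum>b\<in>B. if R a b then 1 else 0)"
    using assms(2) by (simp add: sum.If_cases Int_def)
  also have "\<dots> = (\<Sum>b\<in>B. \<Sum>a\<in>A. if R a b then 1 else 0)" by (rule sum.swap)
  also have "\<dots> = (\<Sum>b\<in>B. card {a\<in>A. R a b})" using assms(1) by (simp add: sum.If_cases Int_def)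
  finally show ?thesis .
qed

text \<open>A vertex on five of the six facets makes the polytope a pyramid over the sixth. Each
  base vertex lies on at least two of the five, and each of these carries at most two base vertices,
  so there are at most 5 + 1 vertices.\<close>

lemma card_Z_le_4:
  assumes Y7: "7 \<le> card Y" and y: "y \<in> Y"
  shows "card (Z y) \<le> 4"
proof (rule ccontr)
  assume "\<not> card (Z y) \<le> 4"
  then have z5: "5 \<le> card (Z y)" by simp
  obtain k where k: "k \<in> I" "0 < y $ k" using Y_nonzero[OF y] by blast
  have Zk: "Z y \<subseteq> I - {k}" using k by (auto simp: Z_def)
  have cIk: "card (I - {k}) = 5" using k card_I by simp
  have Zeq: "Z y = I - {k}" using card_seteq[OF _ Zk] cIk z5 finite_I by simp
  define Y' where "Y' = Y - {y}"
  have wk: "w $ k = 0" if w: "w \<in> Y'" for w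
  proof (rule ccontr)
    assume wk: "w $ k \<noteq> 0"
    have "y = w"
    proof (rule support_subset_eq)
      show "w \<in> Y" "y \<in> Y" using w y by (auto simp: Y'_def)
      fix i assume "i \<in> I" "w $ i = 0"
      then have "i \<in> Z y" using wk Zeq by auto
      then show "y $ i = 0" by (simp add: Z_def)
    qed
    then show False using w by (simp add: Y'_def)
  qed
  have two: "2 \<le> card {j\<in>Z y. w $ j = 0}" if w: "w \<in> Y'" for w
  proof -
    have "Z w \<subseteq> insert k {j\<in>Z y. w $ j = 0}" unfolding Zeq by (auto simp: Z_def)
    then have "card (Z w) \<le> card (insert k {j\<in>Z y. w $ j = 0})"
      using finite_Z by (intro card_mono) auto
    also have "\<dots> \<le> card {j\<in>Z y. w $ j = 0} + 1" using finite_Z by (simp add: card_insert_if)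
    finally show ?thesis using card_Z_ge_3[of w] w by (simp add: Y'_def)
  qed
  have "card Y' * 2 \<le> (\<Sum>w\<in>Y'. card {j\<in>Z y. w $ j = 0})"
    using two sum_bounded_below[of Y' 2 "\<lambda>w. card {j\<in>Z y. w $ j = 0}"] by simp
  also have "\<dots> = (\<Sum>j\<in>Z y. card {w\<in>Y'. w $ j = 0})"
    using fin finite_Z by (intro sum_card_swap) (auto simp: Y'_def)
  also have "\<dots> \<le> card (Z y) * 2"
  proof -
    have "card {w\<in>Y'. w $ j = 0} \<le> 2" if j: "j \<in> Z y" for j
    proof -
      have "{w\<in>Y'. w $ j = 0} \<subseteq> common k j" using wk by (auto simp: common_def Y'_def)
      then have "card {w\<in>Y'. w $ j = 0} \<le> card (common k j)" by (rule card_mono[OF finite_common])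
      also have "\<dots> \<le> 2" using j k Zeq by (intro card_common_le) auto
      finally show ?thesis .
    qed
    then show ?thesis using sum_bounded_above[of "Z y" "\<lambda>j. card {w\<in>Y'. w $ j = 0}" 2] by simp
  qed
  finally have "card Y' \<le> 5" using Zeq cIk by simp
  moreover have "card Y' = card Y - 1" using y by (simp add: Y'_def)
  ultimately show False using Y7 by simp
qed

section \<open>Counting edges as pairs of adjacent facets\<close>

definition edges :: "'n set set" where
  "edges = {S. \<exists>i j. adj i j \<and> S = {i, j}}"

lemma edges_subset: "edges \<subseteq> {S. S \<subseteq> I \<and> card S = 2}"
  by (auto simp: edges_def adj_def)

lemma edges_iff: "{i, j} \<in> edges \<longleftrightarrow> adj i j"
  by (auto simp: edges_def doubleton_eq_iff adj_commute)

lemma finite_pairs: "finite {S. S \<subseteq> I \<and> card S = 2}"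
  using finite_I by simp

lemma finite_edges: "finite edges"
  using finite_subset[OF edges_subset finite_pairs] .

lemma card_pairs: "card {S. S \<subseteq> I \<and> card S = 2} = 15"
  using n_subsets[OF finite_I, of 2] card_I by (simp add: choose_two)

lemma three_edges_at_vertex:
  assumes Y7: "7 \<le> card Y" and y: "y \<in> Y"
  shows "3 \<le> card {S\<in>edges. S \<subseteq> Z y}"
proof -
  have ge: "3 \<le> card {S\<in>edges. S \<subseteq> Z y}"
    if "adj a b" "adj c d" "adj e f" "{a, b, c, d, e, f} \<subseteq> Z y" "card {{a, b}, {c, d}, {e, f}} = 3" for a b c d e f
  proof -
    have "{{a, b}, {c, d}, {e, f}} \<subseteq> {S\<in>edges. S \<subseteq> Z y}" using that(1-4) by (auto simp: edges_iff)
    then have "card {{a, b}, {c, d}, {e, f}} \<le> card {S\<in>edges. S \<subseteq> Z y}"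
      by (rule card_mono[rotated]) (use finite_edges in simp)
    then show ?thesis using that(5) by simp
  qed
  consider "card (Z y) = 3" | "card (Z y) = 4"
    using card_Z_ge_3[OF y] card_Z_le_4[OF Y7 y] by linarith
  then show ?thesis
  proof cases
    case 1
    then obtain i j k where z: "Z y = {i, j, k}" "i \<noteq> j" "i \<noteq> k" "j \<noteq> k" by (auto simp: card_3_iff)
    have "Z y = {i, k, j}" "Z y = {j, k, i}" using z(1) by auto
    then have "adj i j" "adj i k" "adj j k"
      using deg3_adj[OF y z(1)] deg3_adj[OF y, of i k j] deg3_adj[OF y, of j k i] z(2-4) by blast+
    moreover have "card {{i, j}, {i, k}, {j, k}} = 3" using z(2-4) by (simp add: doubleton_eq_iff)
    ultimately show ?thesis using ge[of i j i k j k] z(1) by simp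
  next
    case 2
    obtain a b c d where z: "Z y = {a, b, c, d}" "distinct [a, b, c, d]"
      "adj a c" "adj a d" "adj b c" by (rule deg4_adj[OF y 2])
    have "card {{a, c}, {a, d}, {b, c}} = 3" using z(2) by (auto simp: doubleton_eq_iff card_insert_if)
    then show ?thesis using ge[OF z(3,4,5)] z(1) by simp
  qed
qed

text \<open>Double counting: an adjacent pair of facets has exactly two common vertices.\<close>

lemma sum_edges_at_vertices: "(\<Sum>y\<in>Y. card {S\<in>edges. S \<subseteq> Z y}) = 2 * card edges"
proof -
  have "(\<Sum>y\<in>Y. card {S\<in>edges. S \<subseteq> Z y}) = (\<Sum>S\<in>edges. card {y\<in>Y. S \<subseteq> Z y})"
    by (rule sum_card_swap[OF fin finite_edges])
  also have "\<dots> = (\<Sum>S\<in>edges. 2)"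
  proof (rule sum.cong)
    fix S assume "S \<in> edges"
    then obtain i j where S: "adj i j" "S = {i, j}" by (auto simp: edges_def)
    then have "{y\<in>Y. S \<subseteq> Z y} = common i j" by (auto simp: common_def Z_def adj_def)
    then show "card {y\<in>Y. S \<subseteq> Z y} = 2" using S(1) by (simp add: adj_def)
  qed simp
  finally show ?thesis by simp
qed

lemma card_edges_ge:
  assumes Y7: "7 \<le> card Y"
  shows "3 * card Y \<le> 2 * card edges"
  using three_edges_at_vertex[OF Y7] sum_bounded_below[of Y 3 "\<lambda>y. card {S\<in>edges. S \<subseteq> Z y}"]
  by (simp add: sum_edges_at_vertices)

text \<open>Five pairwise adjacent facets are impossible: their functionals are linearly dependent on the
  four-dimensional \<open>span Y\<close>, one side of the dependency involves at most two facets, and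
  then the face common to these lies in a third one.\<close>

lemma radon_contradiction:
  assumes n: "n \<noteq> 0" "\<And>i. i \<notin> J \<Longrightarrow> n $ i = 0" and J: "J \<subseteq> I"
    and orth: "\<And>y. y \<in> Y \<Longrightarrow> n \<bullet> y = 0" and c: "card {i\<in>J. 0 < n $ i} \<le> 2"
    and all: "\<And>i j. i \<in> J \<Longrightarrow> j \<in> J \<Longrightarrow> i \<noteq> j \<Longrightarrow> adj i j"
  shows False
proof -
  let ?A = "{i\<in>J. 0 < n $ i}"
  have sum: "(\<Sum>k\<in>UNIV. n $ k * y $ k) = 0" if "y \<in> Y" for y
    using orth[OF that] by (simp add: inner_vec_def)
  have vanish: "n $ k * y $ k = 0" if y: "y \<in> Y" "\<And>i. i \<in> ?A \<Longrightarrow> y $ i = 0" for y k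
  proof -
    have nn: "0 \<le> - (n $ j * y $ j)" for j
    proof (cases "0 < n $ j")
      case True
      then have "j \<in> ?A" using n(2)[of j] by auto
      then show ?thesis using y(2) by simp
    next
      case False
      then show ?thesis using nonneg[OF y(1), of j] by (simp add: mult_nonpos_nonneg)
    qed
    have s0: "(\<Sum>j\<in>UNIV. - (n $ j * y $ j)) = 0" using sum[OF y(1)] by (simp add: sum_negf)
    have "- (n $ k * y $ k) = 0" by (rule sum_nonneg_0[OF finite nn s0]) simp
    then show ?thesis by simp
  qed
  \<comment> \<open>A dependency with nonnegative coefficients only would make some slack zero at
    every vertex.\<close>
  have "\<exists>k\<in>J. n $ k < 0"
  proof (rule ccontr)
    assume neg: "\<not> (\<exists>k\<in>J. n $ k < 0)"
    then have n0: "0 \<le> n $ k" for k using n(2)[of k] by (cases "k \<in> J") (auto simp: not_less)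
    obtain k where k: "n $ k \<noteq> 0" using n(1) by (auto simp: vec_eq_iff)
    then have "k \<in> I" using n(2) J by blast
    then obtain y where y: "y \<in> Y" "0 < y $ k" using facet_proper by blast
    have nn: "0 \<le> n $ j * y $ j" for j using n0 nonneg[OF y(1)] by simp
    have "n $ k * y $ k = 0" by (rule sum_nonneg_0[OF finite nn sum[OF y(1)]]) simp
    then show False using k y(2) by simp
  qed
  then obtain k where k: "k \<in> J" "n $ k < 0" by blast
  have kI: "k \<in> I" and kA: "k \<notin> ?A" using k J by auto
  have yk: "y $ k = 0" if "y \<in> Y" "\<And>i. i \<in> ?A \<Longrightarrow> y $ i = 0" for y
    using vanish[OF that, of k] k(2) by simp
  have "finite ?A" by simp
  consider "?A = {}" | a where "?A = {a}" | a a' where "?A = {a, a'}" "a \<noteq> a'"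
  proof -
    have "card ?A = 0 \<or> card ?A = 1 \<or> card ?A = 2" using c by linarith
    then show ?thesis
    proof (elim disjE)
      assume "card ?A = 0"
      then show ?thesis using that(1) by simp
    next
      assume "card ?A = 1"
      then show ?thesis using that(2) by (auto simp: card_1_singleton_iff)
    next
      assume "card ?A = 2"
      then show ?thesis using that(3) by (auto simp: card_2_iff)
    qed
  qed
  then show False
  proof cases
    case 1
    obtain y where "y \<in> Y" "0 < y $ k" using facet_proper[OF kI] by blast
    then show False using yk[of y] 1 by simp
  next
    case (2 a)
    then have a: "a \<in> I" "a \<noteq> k" using J kA by auto
    obtain y where "y \<in> Y" "y $ a = 0" "0 < y $ k" using facet_not_subset[OF a(1) kI a(2)] by blast
    then show False using yk[of y] 2 by simp
  next
    \<comment> \<open>Both ends of the edge of \<open>a\<close> and \<open>a'\<close> lie on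
      \<open>k\<close> as well, but three facets have at most one common vertex.\<close>
    case (3 a a')
    then have aJ: "a \<in> J" "a' \<in> J" by blast+
    have ne: "a \<noteq> k" "a' \<noteq> k" using 3(1) kA by auto
    have "adj a a'" using all aJ 3(2) by blast
    then obtain u v where "common a a' = {u, v}" "u \<noteq> v" by (auto simp: adj_def card_2_iff)
    then have "u \<in> common a a'" "v \<in> common a a'" "u \<noteq> v" by auto
    then have u: "u \<in> Y" "u $ a = 0" "u $ a' = 0" and v: "v \<in> Y" "v $ a = 0" "v $ a' = 0"
      and "u \<noteq> v" by (auto simp: common_def)
    have "u $ k = 0" by (rule yk[OF u(1)]) (use u 3(1) in auto)
    moreover have "v $ k = 0" by (rule yk[OF v(1)]) (use v 3(1) in auto)
    ultimately have "v = u"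
      using triple_unique[of a a' k u v] aJ J kI 3(2) ne u v by blast
    then show False using \<open>u \<noteq> v\<close> by simp
  qed
qed

lemma no_five_adjacent:
  assumes J: "J \<subseteq> I" "card J = 5"
  shows "\<exists>i\<in>J. \<exists>j\<in>J. i \<noteq> j \<and> \<not> adj i j"
proof (rule ccontr)
  assume neg: "\<not> ?thesis"
  then have all: "adj i j" if "i \<in> J" "j \<in> J" "i \<noteq> j" for i j using that by blast
  let ?R = "{x::real^'n. \<forall>i. i \<notin> J \<longrightarrow> x $ i = 0}"
  \<comment> \<open>Restriction to the five coordinates in \<open>J\<close>. The image of the
    four-dimensional span is a proper subspace there, and its normal \<open>n\<close> is the
    dependency of the five slacks.\<close>
  define T where "T x = (\<chi> i. if i \<in> J then x $ i else 0)" for x :: "real^'n"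
  have lT: "linear T" by (rule linearI) (auto simp: T_def vec_eq_iff)
  have R: "subspace ?R" "dim ?R = 5" using off_space[of J] J by auto
  have sT: "subspace (T ` span Y)" using lT by (intro linear_subspace_image) auto
  have TR: "T ` span Y \<subseteq> ?R" by (auto simp: T_def)
  have "dim (T ` span Y) \<le> dim (span Y)" by (rule dim_image_le[OF lT])
  then have "dim (T ` span Y) \<noteq> dim ?R" using dim4 R by linarith
  then have "T ` span Y \<noteq> ?R" by (rule contrapos_nn) (simp only:)
  with TR have "T ` span Y \<subset> ?R" by (rule psubsetI)
  moreover have spR: "span ?R = ?R" using R(1) by (simp only: span_eq_iff)
  moreover have spT: "span (T ` span Y) = T ` span Y" using sT by (simp only: span_eq_iff)
  ultimately have "span (T ` span Y) \<subset> span ?R" by (simp only:)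
  then obtain n where n: "n \<noteq> 0" "n \<in> span ?R" "\<And>y. y \<in> span (T ` span Y) \<Longrightarrow> orthogonal n y"
    using orthogonal_to_subspace_exists_gen by blast
  have nR: "n $ i = 0" if "i \<notin> J" for i using n(2) that unfolding spR by blast
  have orth: "n \<bullet> y = 0" if "y \<in> Y" for y
  proof -
    have "n \<bullet> T y = 0" using n(3)[of "T y"] that by (auto simp: orthogonal_def span_base)
    moreover have "n \<bullet> T y = n \<bullet> y"
      unfolding inner_vec_def by (rule sum.cong) (auto simp: T_def nR)
    ultimately show ?thesis by simp
  qed
  have "card {i\<in>J. 0 < n $ i} + card {i\<in>J. n $ i < 0} \<le> card J"
  proof -
    have "card {i\<in>J. 0 < n $ i} + card {i\<in>J. n $ i < 0} = card ({i\<in>J. 0 < n $ i} \<union> {i\<in>J. n $ i < 0})"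
      by (rule card_Un_disjoint[symmetric]) auto
    also have "\<dots> \<le> card J" by (intro card_mono) auto
    finally show ?thesis .
  qed
  then consider "card {i\<in>J. 0 < n $ i} \<le> 2" | "card {i\<in>J. 0 < (- n) $ i} \<le> 2" using J by fastforce
  then show False
  proof cases
    case 1
    show False by (rule radon_contradiction[OF n(1) nR J(1) orth 1 all])
  next
    case 2
    show False
      by (rule radon_contradiction[of "- n" J, OF _ _ J(1) _ 2 all]) (use n(1) nR orth in auto)
  qed
qed

text \<open>Dropping a facet of one non-adjacent pair leaves five facets that contain another such
  pair, so at least two of the 15 pairs are no edges.\<close>

lemma card_edges_le: "card edges \<le> 13"
proof -
  obtain J where J: "J \<subseteq> I" "card J = 5" by (rule obtain_subset_with_card_n[of 5 I]) (use card_I in auto)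
  obtain i j where ij: "i \<in> J" "j \<in> J" "i \<noteq> j" "\<not> adj i j" using no_five_adjacent[OF J] by blast
  have "i \<in> I" using ij J by blast
  then have "card (I - {i}) = 5" using card_I by simp
  then obtain k l where kl: "k \<in> I - {i}" "l \<in> I - {i}" "k \<noteq> l" "\<not> adj k l"
    using no_five_adjacent[OF Diff_subset] by blast
  have "{{i, j}, {k, l}} \<subseteq> {S. S \<subseteq> I \<and> card S = 2} - edges"
    using ij kl J by (auto simp: edges_iff)
  then have "card {{i, j}, {k, l}} \<le> card ({S. S \<subseteq> I \<and> card S = 2} - edges)"
    using finite_pairs by (intro card_mono) auto
  moreover have "card {{i, j}, {k, l}} = 2" using ij(3) kl by (auto simp: doubleton_eq_iff card_insert_if)
  moreover have "card ({S. S \<subseteq> I \<and> card S = 2} - edges) = 15 - card edges"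
    using card_Diff_subset[OF finite_edges edges_subset] card_pairs by simp
  ultimately show ?thesis by linarith
qed

lemma card_Y_le_8: "card Y \<le> 8"
proof (cases "7 \<le> card Y")
  case True
  then show ?thesis using card_edges_ge card_edges_le by linarith
qed simp

end

text \<open>The two possible non-adjacency graphs of the facets: a perfect matching, as for the cube, or a
  path with three edges together with a disjoint edge.\<close>

lemma nonadjacency_structure:
  fixes N :: "'a \<Rightarrow> 'a set"
  assumes I: "finite I" "card I = 6"
    and sym: "\<And>i j. i \<in> N j \<Longrightarrow> j \<in> N i" and irr: "\<And>i. i \<notin> N i"
    and N: "\<And>i. i \<in> I \<Longrightarrow> N i \<subseteq> I" and sum: "(\<Sum>i\<in>I. card (N i)) \<le> 8"
    and two: "\<And>i j. i \<in> I \<Longrightarrow> j \<in> I \<Longrightarrow> i \<noteq> j \<Longrightarrow> j \<notin> N i \<Longrightarrow> 2 \<le> card (N i \<union> N j)"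
  shows "(\<forall>i\<in>I. card (N i) = 1) \<or> (\<exists>a' a c d e f. I = {a', a, c, d, e, f} \<and>
    distinct [a', a, c, d, e, f] \<and> N a' = {a} \<and> N a = {a', c} \<and> N c = {a, d} \<and> N d = {c} \<and>
    N e = {f} \<and> N f = {e})"
proof -
  have finN: "finite (N i)" if "i \<in> I" for i using N[OF that] I(1) finite_subset by blast
  \<comment> \<open>An isolated index would by \<open>two\<close> force degree at least 2 on the
    other five, and 10 exceeds 8.\<close>
  have N1: "1 \<le> card (N i)" if i: "i \<in> I" for i
  proof (rule ccontr)
    assume "\<not> 1 \<le> card (N i)"
    then have "N i = {}" using finN[OF i] by (simp add: not_le)
    then have "2 \<le> card (N j)" if "j \<in> I - {i}" for j using two[of i j] i that by auto
    then have "card (I - {i}) * 2 \<le> (\<Sum>j\<in>I - {i}. card (N j))"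
      using sum_bounded_below[of "I - {i}" 2 "\<lambda>j. card (N j)"] by simp
    also have "\<dots> \<le> (\<Sum>j\<in>I. card (N j))" using I(1) by (intro sum_mono2) auto
    finally show False using sum I i by simp
  qed
  show ?thesis
  proof (cases "\<forall>i\<in>I. card (N i) = 1")
    case False
    then obtain a where a: "a \<in> I" "card (N a) \<noteq> 1" by blast
    then have a2: "2 \<le> card (N a)" using N1[OF a(1)] by simp
    obtain T where "T \<subseteq> N a" "card T = 2" by (rule obtain_subset_with_card_n[OF a2])
    then obtain x0 y0 where xy0: "x0 \<in> N a" "y0 \<in> N a" "x0 \<noteq> y0" by (auto simp: card_2_iff)
    have xyI: "x0 \<in> I" "y0 \<in> I" using xy0 N[OF a(1)] by auto
    \<comment> \<open>Indices outside \<open>A\<close> contribute at least 1 each, which leaves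
      little room inside \<open>A\<close>.\<close>
    have lower: "(\<Sum>i\<in>A. card (N i)) + (6 - card A) \<le> 8" if A: "A \<subseteq> I" for A
    proof -
      have "card (I - A) = 6 - card A" using A I by (simp add: card_Diff_subset finite_subset)
      moreover have "card (I - A) * 1 \<le> (\<Sum>i\<in>I - A. card (N i))"
        using N1 sum_bounded_below[of "I - A" 1 "\<lambda>i. card (N i)"] by simp
      ultimately show ?thesis using sum.subset_diff[OF A I(1), of "\<lambda>i. card (N i)"] sum by simp
    qed
    have ge2: "2 \<le> card (N i)" if "i \<in> I" "{u, v} \<subseteq> N i" "u \<noteq> v" for i u v
      using card_mono[OF finN[OF that(1)] that(2)] that(3) by simp
    \<comment> \<open>A triangle costs at least \<open>2 + 2 + 2 + 3 = 9\<close>.\<close>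
    have nxy: "y0 \<notin> N x0"
    proof
      assume "y0 \<in> N x0"
      then have "2 \<le> card (N x0)" "2 \<le> card (N y0)"
        using ge2[OF xyI(1), of a y0] ge2[OF xyI(2), of a x0] sym xy0 irr by auto
      moreover have "a \<noteq> x0" "a \<noteq> y0" using xy0 irr by auto
      ultimately show False using lower[of "{a, x0, y0}"] a a2 xyI xy0(3) by simp
    qed
    \<comment> \<open>A path \<open>y\<close>, \<open>a\<close>, \<open>x\<close>, \<open>z\<close>
      uses up the sum 8: \<open>a\<close> and \<open>x\<close> have degree 2, all others degree 1,
      so the two remaining indices are matched.\<close>
    have main: ?thesis if x: "x \<in> N a" "y \<in> N a" "x \<noteq> y" "y \<notin> N x" "z \<in> N x" "z \<noteq> a" for x y z
    proof -
      have I': "x \<in> I" "y \<in> I" using x(1,2) N[OF a(1)] by auto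
      then have zI: "z \<in> I" using x(5) N by blast
      have aN: "a \<in> N x" "a \<in> N y" "x \<in> N z" using x(1,2,5) sym by auto
      have ne: "a \<noteq> x" "a \<noteq> y" "x \<noteq> z" "y \<noteq> z" using x aN irr by auto
      have x2: "2 \<le> card (N x)" using ge2[OF I'(1), of a z] x(5,6) aN by auto
      have ca: "card (N a) = 2" "card (N x) = 2"
        using lower[of "{a, x}"] a a2 x2 I' ne by simp_all
      have c1: "card (N i) = 1" if i: "i \<in> I" "i \<noteq> a" "i \<noteq> x" for i
        using lower[of "{a, x, i}"] N1[OF i(1)] a(1) ca I' ne i by simp
      have "N a = {x, y}" using card_seteq[OF finN[OF a(1)], of "{x, y}"] x ca by simp
      moreover have "N x = {a, z}" using card_seteq[OF finN[OF I'(1)], of "{a, z}"] x aN ca by simp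
      moreover have Ny: "N y = {a}"
        using c1[OF I'(2)] ne x(3) aN(2) by (auto simp: card_1_singleton_iff)
      moreover have Nz: "N z = {x}"
        using c1[OF zI] ne x(6) aN(3) by (auto simp: card_1_singleton_iff)
      moreover have "card (I - {a, x, y, z}) = 2"
        using I a I' zI ne x by (simp add: card_Diff_subset)
      then obtain e f where ef: "I - {a, x, y, z} = {e, f}" "e \<noteq> f" by (auto simp: card_2_iff)
      have efI: "e \<in> I" "f \<in> I" "e \<notin> {a, x, y, z}" "f \<notin> {a, x, y, z}" using ef by auto
      have Ieq: "I = {y, a, x, z, e, f}" using ef(1) a I' zI by auto
      have one: "N g = {h}" if g: "{g, h} = {e, f}" "g \<noteq> h" for g h
      proof -
        have gI: "g \<in> I" "g \<notin> {a, x, y, z}" using g efI by auto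
        then obtain k where k: "N g = {k}" using c1[of g] by (auto simp: card_1_singleton_iff)
        then have "g \<in> N k" using sym by blast
        moreover have "k \<in> I" using k N[OF gI(1)] by auto
        ultimately have "k \<in> {e, f}"
          using Ieq gI(2) \<open>N a = {x, y}\<close> \<open>N x = {a, z}\<close> Ny Nz by auto
        moreover have "k \<noteq> g" using k irr by auto
        ultimately show ?thesis using k g by auto
      qed
      have "N e = {f}" using one[of e f] ef(2) by blast
      moreover have "N f = {e}" using one[of f e] ef(2) by blast
      moreover have "distinct [y, a, x, z, e, f]" using ne x efI ef by auto
      moreover have "N a = {y, x}" using \<open>N a = {x, y}\<close> by auto
      ultimately show ?thesis using Ieq by blast
    qed
    \<comment> \<open>This rules out a star: one of the two neighbours of \<open>a\<close> has a
      neighbour other than \<open>a\<close>.\<close>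
    have "2 \<le> card (N x0 \<union> N y0)" using two[OF xyI xy0(3) nxy] .
    moreover have "\<not> N x0 \<union> N y0 \<subseteq> {a}"
    proof
      assume "N x0 \<union> N y0 \<subseteq> {a}"
      then have "card (N x0 \<union> N y0) \<le> card {a}" by (intro card_mono) auto
      then show False using \<open>2 \<le> card (N x0 \<union> N y0)\<close> by simp
    qed
    ultimately obtain z where z: "z \<noteq> a" "z \<in> N x0 \<or> z \<in> N y0" by blast
    from z(2) show ?thesis
    proof
      assume "z \<in> N x0"
      then show ?thesis using main[OF xy0 nxy] z(1) by blast
    next
      assume "z \<in> N y0"
      then show ?thesis using main[OF xy0(2,1) xy0(3)[symmetric]] nxy sym z(1) by blast
    qed
  qed simp
qed

section \<open>Meeting points of edge lines\<close>

lemma dependent_three: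
  fixes W :: "'a::euclidean_space set"
  assumes W: "subspace W" "dim W \<le> 2" and x: "x1 \<in> W" "x2 \<in> W" "x3 \<in> W"
  obtains a b c :: real where "a *\<^sub>R x1 + b *\<^sub>R x2 + c *\<^sub>R x3 = 0" "a \<noteq> 0 \<or> b \<noteq> 0 \<or> c \<noteq> 0"
proof -
  consider "x1 = x2" | "x1 = x3" | "x2 = x3" | "x1 \<noteq> x2" "x1 \<noteq> x3" "x2 \<noteq> x3" by blast
  then show ?thesis
  proof cases
    case 1 then show ?thesis using that[of 1 "- 1" 0] by simp
  next
    case 2 then show ?thesis using that[of 1 0 "- 1"] by simp
  next
    case 3 then show ?thesis using that[of 0 1 "- 1"] by simp
  next
    case 4
    have "dependent {x1, x2, x3}"
    proof (rule ccontr)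
      assume "independent {x1, x2, x3}"
      then have "card {x1, x2, x3} \<le> dim W" using x by (intro independent_card_le_dim) auto
      then show False using W(2) 4 by simp
    qed
    then obtain u v where u: "v \<in> {x1, x2, x3}" "u v \<noteq> 0" "(\<Sum>v\<in>{x1, x2, x3}. u v *\<^sub>R v) = 0"
      using dependent_finite[of "{x1, x2, x3}"] by auto
    then have "u x1 *\<^sub>R x1 + u x2 *\<^sub>R x2 + u x3 *\<^sub>R x3 = 0" using 4 by (simp add: add.assoc)
    then show ?thesis using that[of "u x1" "u x2" "u x3"] u by auto
  qed
qed

lemma collinear_if_affinely_dependent:
  fixes X1 X2 X3 :: "'a::euclidean_space"
  assumes "b1 + b2 + b3 = 0" "b1 *\<^sub>R X1 + b2 *\<^sub>R X2 + b3 *\<^sub>R X3 = 0" "b1 \<noteq> 0 \<or> b2 \<noteq> 0 \<or> b3 \<noteq> 0"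
  shows "collinear {X1, X2, X3}"
proof -
  have key: "collinear {X1, X2, X3}"
    if "b1 + b2 + b3 = 0" "b1 *\<^sub>R X1 + b2 *\<^sub>R X2 + b3 *\<^sub>R X3 = 0" "b1 \<noteq> 0"
    for b1 b2 b3 and X1 X2 X3 :: 'a
  proof -
    have "b1 *\<^sub>R X1 = (- b2) *\<^sub>R X2 + (- b3) *\<^sub>R X3" using that(2) by (simp add: eq_neg_iff_add_eq_0 algebra_simps)
    then have "(1 / b1) *\<^sub>R (b1 *\<^sub>R X1) = (1 / b1) *\<^sub>R ((- b2) *\<^sub>R X2 + (- b3) *\<^sub>R X3)" by simp
    then have X1: "X1 = (- b2 / b1) *\<^sub>R X2 + (- b3 / b1) *\<^sub>R X3"
      using that(3) by (simp add: scaleR_right_diff_distrib)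
    have "- b2 / b1 + - b3 / b1 = 1" using that(1,3) by (simp add: field_simps)
    then have "X1 \<in> affine hull {X2, X3}" unfolding affine_hull_2 using X1 by blast
    then have "collinear {X2, X3, X1}"
      by (cases "X2 = X3") (simp_all add: collinear_3_affine_hull)
    then show ?thesis by (simp add: insert_commute)
  qed
  from assms(3) show ?thesis
  proof (elim disjE)
    assume "b1 \<noteq> 0"
    then show ?thesis using key[OF assms(1,2)] by blast
  next
    assume "b2 \<noteq> 0"
    then have "collinear {X2, X1, X3}"
      using key[of b2 b1 b3 X2 X1 X3] assms(1,2) by (simp add: algebra_simps)
    then show ?thesis by (simp add: insert_commute)
  next
    assume "b3 \<noteq> 0"
    then have "collinear {X3, X1, X2}"
      using key[of b3 b1 b2 X3 X1 X2] assms(1,2) by (simp add: algebra_simps)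
    then show ?thesis by (simp add: insert_commute)
  qed
qed

context slack_dim3
begin

text \<open>Cancelling coordinate \<open>j\<close> gives the point where the line through
  \<open>p\<close> and \<open>q\<close> meets the hyperplane of facet \<open>j\<close>.\<close>

lemma ker_line_vector:
  assumes p: "p \<in> common i k" "q \<in> common i k" "p \<noteq> q" and pj: "p $ j \<noteq> 0"
  shows "(q $ j) *\<^sub>R p - (p $ j) *\<^sub>R q \<in> ker {i, j, k}" "(q $ j) *\<^sub>R p - (p $ j) *\<^sub>R q \<noteq> 0"
proof -
  have Y: "p \<in> Y" "q \<in> Y" "p $ i = 0" "p $ k = 0" "q $ i = 0" "q $ k = 0" using p by (auto simp: common_def)
  have "(q $ j) *\<^sub>R p - (p $ j) *\<^sub>R q \<in> span Y" using Y by (intro span_diff span_scale span_base)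
  then show "(q $ j) *\<^sub>R p - (p $ j) *\<^sub>R q \<in> ker {i, j, k}" using Y by (simp add: ker_def)
  show "(q $ j) *\<^sub>R p - (p $ j) *\<^sub>R q \<noteq> 0"
    using indep2(2)[OF Y(1,2) p(3), of "q $ j" "p $ j"] pj by auto
qed

text \<open>Both edges lie on facet \<open>k\<close>. The line of each meets the hyperplane of the
  remaining facet in \<open>ker {i, j, k}\<close>, which has dimension at most 1, so the meeting
  points agree up to a factor.\<close>

lemma edge_lines_meet:
  assumes I: "i \<in> I" "j \<in> I" "k \<in> I" "i \<noteq> j" "i \<noteq> k" "j \<noteq> k"
    and p: "p \<in> common i k" "q \<in> common i k" "p \<noteq> q" "p $ j \<noteq> 0" "q $ j \<noteq> 0"
    and r: "r \<in> common j k" "s \<in> common j k" "r \<noteq> s" "r $ i \<noteq> 0" "s $ i \<noteq> 0"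
  obtains x a b c d where "x \<in> ker {i, j, k}" "a \<noteq> 0" "b \<noteq> 0" "c \<noteq> 0" "d \<noteq> 0"
    "a *\<^sub>R p - b *\<^sub>R q = x" "c *\<^sub>R r - d *\<^sub>R s = x"
proof -
  let ?x = "(q $ j) *\<^sub>R p - (p $ j) *\<^sub>R q" and ?y = "(s $ i) *\<^sub>R r - (r $ i) *\<^sub>R s"
  note x = ker_line_vector[OF p(1,2,3,4)]
  have y: "?y \<in> ker {i, j, k}" "?y \<noteq> 0" using ker_line_vector[OF r(1,2,3,4)] by (simp_all add: insert_commute)
  obtain t where t: "?y = t *\<^sub>R ?x" by (rule ker_triple_multiple[OF I x y(1)])
  then have "t \<noteq> 0" using y(2) by auto
  have "(1 / t) *\<^sub>R ?y = ?x" using t \<open>t \<noteq> 0\<close> by simp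
  then have "(s $ i / t) *\<^sub>R r - (r $ i / t) *\<^sub>R s = ?x" by (simp add: scaleR_right_diff_distrib)
  then show ?thesis using that[OF x(1) p(5,4), of "s $ i / t" "r $ i / t"] r \<open>t \<noteq> 0\<close> by simp
qed

end

locale heptagon_dim3 = heptagon_slack Y I pt ht P + slack_dim3 Y I pt ht
  for Y :: "(real^'n) set" and I and pt :: "real^'n \<Rightarrow> real^2" and ht and P
begin

text \<open>Without a common vertex the three edges would have six different ends and concurrent or
  parallel lines; at most 4 images and at most two further vertices cannot give 7. The common vertex
  lies on no fourth facet, since among three facets at a vertex on four facets two are
  opposite.\<close>

lemma triangle_vertex:
  assumes adj: "adj i j" "adj i k" "adj j k"
  obtains y where "y \<in> Y" "Z y = {i, j, k}"
proof -
  have I: "i \<in> I" "j \<in> I" "k \<in> I" "i \<noteq> j" "i \<noteq> k" "j \<noteq> k" using adj by (auto simp: adj_def)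
  have "\<exists>y\<in>Y. y $ i = 0 \<and> y $ j = 0 \<and> y $ k = 0"
  proof (rule ccontr)
    assume "\<not> ?thesis"
    then have no: "\<not> (y $ i = 0 \<and> y $ j = 0 \<and> y $ k = 0)" if "y \<in> Y" for y using that by blast
    obtain p1 q1 where 1: "common i j = {p1, q1}" "p1 \<noteq> q1" using adj(1) by (auto simp: adj_def card_2_iff)
    obtain p2 q2 where 2: "common i k = {p2, q2}" "p2 \<noteq> q2" using adj(2) by (auto simp: adj_def card_2_iff)
    obtain p3 q3 where 3: "common j k = {p3, q3}" "p3 \<noteq> q3" using adj(3) by (auto simp: adj_def card_2_iff)
    have m: "p1 \<in> common i j" "q1 \<in> common i j" "p2 \<in> common i k" "q2 \<in> common i k"
      "p3 \<in> common j k" "q3 \<in> common j k" using 1 2 3 by auto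
    then have c: "p1 \<in> Y" "p1 $ i = 0" "p1 $ j = 0" "q1 \<in> Y" "q1 $ i = 0" "q1 $ j = 0"
      "p2 \<in> Y" "p2 $ i = 0" "p2 $ k = 0" "q2 \<in> Y" "q2 $ i = 0" "q2 $ k = 0"
      "p3 \<in> Y" "p3 $ j = 0" "p3 $ k = 0" "q3 \<in> Y" "q3 $ j = 0" "q3 $ k = 0"
      by (simp_all add: common_def)
    have nz: "p1 $ k \<noteq> 0" "q1 $ k \<noteq> 0" "p2 $ j \<noteq> 0" "q2 $ j \<noteq> 0" "p3 $ i \<noteq> 0" "q3 $ i \<noteq> 0"
      using no c by blast+
    obtain x a b s t where l: "x \<in> ker {j, k, i}" "a \<noteq> 0" "b \<noteq> 0" "s \<noteq> 0" "t \<noteq> 0"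
      "a *\<^sub>R p1 - b *\<^sub>R q1 = x" "s *\<^sub>R p2 - t *\<^sub>R q2 = x"
      by (rule edge_lines_meet[OF I(2,3,1) I(6) I(4)[symmetric] I(5)[symmetric], of p1 q1 p2 q2])
        (use m 1 2 nz in \<open>simp_all add: common_commute\<close>)
    have "x \<noteq> 0"
      using indep2(1)[OF c(1,4) 1(2), of a b] l(2,6) by auto
    let ?v = "(q3 $ i) *\<^sub>R p3 - (p3 $ i) *\<^sub>R q3"
    have v: "?v \<in> ker {j, k, i}" "?v \<noteq> 0"
      using ker_line_vector[OF m(5,6) 3(2) nz(5)] by (simp_all add: insert_commute)
    obtain r where r: "?v = r *\<^sub>R x"
      by (rule ker_triple_multiple[OF I(2,3,1) I(6) I(4)[symmetric] I(5)[symmetric] l(1) \<open>x \<noteq> 0\<close> v(1)])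
    then have "r \<noteq> 0" using v(2) by auto
    have "(1 / r) *\<^sub>R ?v = x" using r \<open>r \<noteq> 0\<close> by simp
    then have l3: "(q3 $ i / r) *\<^sub>R p3 - (p3 $ i / r) *\<^sub>R q3 = x" by (simp add: scaleR_right_diff_distrib)
    have nz3: "q3 $ i / r \<noteq> 0" "p3 $ i / r \<noteq> 0" using nz \<open>r \<noteq> 0\<close> by auto
    let ?S = "{p1, q1, p2, q2, p3, q3}"
    have SY: "?S \<subseteq> Y" using c by blast
    have "card (pt ` ?S) \<le> 4" by (rule no_concurrent[OF SY l(2,3,4,5) nz3 l(6,7) l3])
    moreover have "p1 \<noteq> p2" "p1 \<noteq> q2" "p1 \<noteq> p3" "p1 \<noteq> q3" "q1 \<noteq> p2" "q1 \<noteq> q2" "q1 \<noteq> p3" "q1 \<noteq> q3"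
      "p2 \<noteq> p3" "p2 \<noteq> q3" "q2 \<noteq> p3" "q2 \<noteq> q3" using c nz by auto
    then have "card ?S = 6" using 1(2) 2(2) 3(2) by simp
    ultimately show False using card_image_ge[OF SY] card_Y_le_8 by simp
  qed
  then obtain y where y: "y \<in> Y" "y $ i = 0" "y $ j = 0" "y $ k = 0" by blast
  have sub: "{i, j, k} \<subseteq> Z y" using y I by (auto simp: Z_def)
  consider "card (Z y) = 3" | "card (Z y) = 4"
    using card_Z_ge_3[OF y(1)] card_Z_le_4[OF card_Y_ge y(1)] by linarith
  then show ?thesis
  proof cases
    case 1
    then have "{i, j, k} = Z y" using card_seteq[OF finite_Z sub] I by simp
    then show ?thesis using that y(1) by blast
  next
    case 2
    obtain a b c d where z: "Z y = {a, b, c, d}" "\<not> adj a b" "\<not> adj c d" by (rule deg4_adj[OF y(1) 2])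
    have "\<not> adj b a" "\<not> adj d c" using z adj_commute by blast+
    then have "card ({i, j, k} \<inter> {a, b}) \<le> 1" "card ({i, j, k} \<inter> {c, d}) \<le> 1"
    proof -
      have aux: "card ({i, j, k} \<inter> {u, v}) \<le> 1" if "\<not> adj u v" for u v
      proof (rule ccontr)
        assume "\<not> ?thesis"
        then have "2 \<le> card ({i, j, k} \<inter> {u, v})" by simp
        moreover have "card {u, v} \<le> 2" by (simp add: card_insert_if)
        ultimately have eq: "{i, j, k} \<inter> {u, v} = {u, v}" "card {u, v} = 2"
          using card_seteq[of "{u, v}" "{i, j, k} \<inter> {u, v}"] card_mono[of "{u, v}" "{i, j, k} \<inter> {u, v}"] by auto
        then have "u \<in> {i, j, k}" "v \<in> {i, j, k}" "u \<noteq> v" by auto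
        then show False using that adj adj_commute by auto
      qed
      show "card ({i, j, k} \<inter> {a, b}) \<le> 1" "card ({i, j, k} \<inter> {c, d}) \<le> 1"
        using aux z by auto
    qed
    moreover have "{i, j, k} = ({i, j, k} \<inter> {a, b}) \<union> ({i, j, k} \<inter> {c, d})" using sub z(1) by auto
    then have "card {i, j, k} \<le> card ({i, j, k} \<inter> {a, b}) + card ({i, j, k} \<inter> {c, d})"
      using card_Un_le by metis
    ultimately show ?thesis using I by simp
  qed
qed

text \<open>The first condition of general position excludes height 0, so the common vector can be
  scaled to a point of the plane.\<close>

lemma meeting_point:
  assumes Y: "{p, q, r, s} \<subseteq> Y" and dist: "distinct [pt p, pt q, pt r, pt s]"
    and nz: "a \<noteq> 0" "c \<noteq> 0"
    and x: "a *\<^sub>R p - b *\<^sub>R q = x" "c *\<^sub>R r - d *\<^sub>R s = x"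
  shows "ht x \<noteq> 0" "(1 / ht x) *\<^sub>R pt x \<in> line (pt p) (pt q) \<inter> line (pt r) (pt s)"
proof -
  have "ht (a *\<^sub>R p - b *\<^sub>R q) = a - b" "ht (c *\<^sub>R r - d *\<^sub>R s) = c - d"
    using Y ht1 by (simp_all add: linear_diff[OF lin_ht] linear_scale[OF lin_ht])
  then have hx: "ht x = a - b" "ht x = c - d" unfolding x by simp_all
  have "pt (a *\<^sub>R p - b *\<^sub>R q) = a *\<^sub>R pt p - b *\<^sub>R pt q"
    "pt (c *\<^sub>R r - d *\<^sub>R s) = c *\<^sub>R pt r - d *\<^sub>R pt s"
    by (simp_all add: linear_diff[OF lin_pt] linear_scale[OF lin_pt])
  then have px: "pt x = a *\<^sub>R pt p - b *\<^sub>R pt q" "pt x = c *\<^sub>R pt r - d *\<^sub>R pt s"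
    unfolding x by simp_all
  show h: "ht x \<noteq> 0"
  proof
    assume "ht x = 0"
    then have "a = b" "c = d" using hx by auto
    then have "a *\<^sub>R (pt p - pt q) = c *\<^sub>R (pt r - pt s)" using px by (simp add: scaleR_right_diff_distrib)
    then have "affine_parallel (line (pt p) (pt q)) (line (pt r) (pt s))" using nz by (intro parallel_lines)
    moreover have "{pt p, pt q, pt r, pt s} \<subseteq> vertices P" using Y pt_Y by auto
    ultimately show False using gp[unfolded general_position_def, THEN conjunct1] dist by blast
  qed
  have on: "(1 / ht x) *\<^sub>R pt x \<in> line u v" if "ht x = s - t" "pt x = s *\<^sub>R u - t *\<^sub>R v" for s t u v
  proof -
    have "(1 / ht x) *\<^sub>R pt x = (s / ht x) *\<^sub>R u + (- t / ht x) *\<^sub>R v"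
      unfolding that(2) by (simp add: scaleR_right_diff_distrib)
    moreover have "s / ht x + - t / ht x = 1" using that(1) h by (simp add: field_simps)
    ultimately show ?thesis unfolding line_def affine_hull_2 by blast
  qed
  show "(1 / ht x) *\<^sub>R pt x \<in> line (pt p) (pt q) \<inter> line (pt r) (pt s)" using on hx px by blast
qed

end

context heptagon_slack
begin

text \<open>\<open>u\<close> lies in the smallest face containing \<open>y\<close> and
  \<open>y'\<close>. Subtracting a little of \<open>u\<close> from \<open>y + y'\<close> therefore
  stays in the cone, which exhibits the vertex \<open>pt y\<close> of \<open>P\<close> as a mean of
  \<open>pt u\<close> and another point of \<open>P\<close>.\<close>

lemma fibre_is_face:
  assumes y: "y \<in> Y" "y' \<in> Y" "pt y = pt y'" and u: "u \<in> Y" "Z y \<inter> Z y' \<subseteq> Z u"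
  shows "pt u = pt y"
proof -
  define S where "S = (\<lambda>i. (y $ i + y' $ i) / (u $ i + 1)) ` {i. 0 < y $ i + y' $ i}"
  define e where "e = Min (insert 1 S)"
  have pos1: "0 < u $ i + 1" for i using nonneg[OF u(1), of i] by simp
  have "finite S" by (simp add: S_def)
  moreover have "\<forall>s\<in>insert 1 S. 0 < s" using pos1 by (auto simp: S_def)
  ultimately have e: "0 < e" "\<forall>s\<in>insert 1 S. e \<le> s" by (auto simp: e_def)
  have nn: "0 \<le> (y + y' - e *\<^sub>R u) $ i" for i
  proof (cases "0 < y $ i + y' $ i")
    case True
    then have "e \<le> (y $ i + y' $ i) / (u $ i + 1)" using e(2) by (auto simp: S_def)
    then have "e * (u $ i + 1) \<le> y $ i + y' $ i" using pos1[of i] by (subst (asm) pos_le_divide_eq) auto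
    then show ?thesis using e(1) by (simp add: distrib_left)
  next
    case False
    then have z: "y $ i = 0" "y' $ i = 0" using nonneg[OF y(1), of i] nonneg[OF y(2), of i] by linarith+
    have "u $ i = 0" using u off[OF u(1), of i] z by (cases "i \<in> I") (auto simp: Z_def)
    then show ?thesis using z by simp
  qed
  have "y + y' - e *\<^sub>R u \<in> span Y" using y u by (intro span_diff span_add span_scale span_base)
  then obtain d where d: "\<forall>w\<in>Y. 0 \<le> d w" "y + y' - e *\<^sub>R u = (\<Sum>w\<in>Y. d w *\<^sub>R w)"
    using in_cone nn by blast
  have "ht (y + y' - e *\<^sub>R u) = 2 - e"
    using y u ht1 by (simp add: linear_diff[OF lin_ht] linear_add[OF lin_ht] linear_scale[OF lin_ht])
  moreover have "ht (\<Sum>w\<in>Y. d w *\<^sub>R w) = (\<Sum>w\<in>Y. d w)"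
    using ht1 by (simp add: linear_sum[OF lin_ht] linear_scale[OF lin_ht])
  ultimately have sd: "(\<Sum>w\<in>Y. d w) = 2 - e" using d(2) by simp
  have e1: "e \<le> 1" using e(2) by simp
  \<comment> \<open>Comparing heights shows that the weights \<open>d\<close> sum to
    \<open>2 - e\<close>, so \<open>m\<close> is a convex combination of points of
    \<open>P\<close>.\<close>
  define m where "m = (\<Sum>w\<in>Y. (d w / (2 - e)) *\<^sub>R pt w)"
  have ptP: "pt w \<in> P" if "w \<in> Y" for w
    using pt_Y that by (auto simp: vertices_def extreme_point_of_def)
  have "m \<in> P"
    unfolding m_def using d(1) sd e1 ptP fin
    by (intro convex_sum conv_P) (auto simp: sum_divide_distrib[symmetric])
  have "pt (y + y' - e *\<^sub>R u) = 2 *\<^sub>R pt y - e *\<^sub>R pt u"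
    using y(3) by (simp add: linear_diff[OF lin_pt] linear_add[OF lin_pt] linear_scale[OF lin_pt] scaleR_2)
  moreover have "pt (\<Sum>w\<in>Y. d w *\<^sub>R w) = (2 - e) *\<^sub>R m"
    using e1 by (simp add: linear_sum[OF lin_pt] linear_scale[OF lin_pt] m_def scaleR_sum_right)
  ultimately have "2 *\<^sub>R pt y = (2 - e) *\<^sub>R m + e *\<^sub>R pt u" using d(2) by (simp add: algebra_simps)
  then have "(1/2) *\<^sub>R (2 *\<^sub>R pt y) = (1/2) *\<^sub>R ((2 - e) *\<^sub>R m + e *\<^sub>R pt u)" by simp
  then have py: "pt y = (1 - e / 2) *\<^sub>R m + (e / 2) *\<^sub>R pt u"
    by (simp add: scaleR_add_right diff_divide_distrib)
  show ?thesis
  proof (cases "m = pt u")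
    case True
    then show ?thesis using py by (simp add: algebra_simps)
  next
    case False
    then have "pt y \<in> open_segment m (pt u)"
      unfolding in_segment(2) using py e(1) e1 by (intro conjI exI[of _ "e / 2"]) auto
    moreover have "pt y \<in> vertices P" using pt_Y y(1) by blast
    ultimately show ?thesis using \<open>m \<in> P\<close> ptP[OF u(1)] by (auto simp: vertices_def extreme_point_of_def)
  qed
qed

end

context heptagon_dim3
begin

text \<open>The three intersection points come from vectors in \<open>ker {A, A'}\<close>, of
  dimension at most 2, so these are dependent and project to collinear points. The fifth vertex
  enters through two slack vectors \<open>w\<close> and \<open>w'\<close> of equal image, which
  differ for the cube and agree in the other case.\<close>

lemma collinear_contradiction:
  assumes I: "A \<in> I" "A' \<in> I" "s1 \<in> I" "s2 \<in> I" "s3 \<in> I" and ne: "distinct [A, A', s1, s2, s3]"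
    and u1: "u1 \<in> common A s1" "u1 \<in> common A s3" "u1 $ A' \<noteq> 0"
    and u2: "u2 \<in> common A s1" "u2 \<in> common A s2" "u2 $ A' \<noteq> 0"
    and w: "w \<in> common A s2" "w $ A' \<noteq> 0" "w' \<in> common A s3" "w' $ A' \<noteq> 0" "pt w' = pt w"
    and u3: "u3 \<in> common A' s1" "u3 \<in> common A' s3" "u3 $ A \<noteq> 0"
    and u4: "u4 \<in> common A' s1" "u4 \<in> common A' s2" "u4 $ A \<noteq> 0"
    and u6: "u6 \<in> common A' s2" "u6 $ A \<noteq> 0"
    and u7: "u7 \<in> common A' s3" "u7 $ A \<noteq> 0"
    and dist: "distinct [pt u1, pt u2, pt u3, pt u4, pt w, pt u6, pt u7]"
  shows False
proof -
  have Y: "u1 \<in> Y" "u2 \<in> Y" "u3 \<in> Y" "u4 \<in> Y" "w \<in> Y" "w' \<in> Y" "u6 \<in> Y" "u7 \<in> Y"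
    using u1 u2 u3 u4 w u6 u7 by (auto simp: common_def)
  have n: "A \<noteq> A'" "A \<noteq> s1" "A' \<noteq> s1" "A \<noteq> s2" "A' \<noteq> s2" "A \<noteq> s3" "A' \<noteq> s3" using ne by auto
  have ud: "u1 \<noteq> u2" "u3 \<noteq> u4" "u2 \<noteq> w" "u4 \<noteq> u6" "u3 \<noteq> u7" "u1 \<noteq> w'"
    using dist w(5) by auto
  obtain x1 a1 b1 c1 d1 where x1: "x1 \<in> ker {A, A', s1}" "a1 \<noteq> 0" "b1 \<noteq> 0" "c1 \<noteq> 0" "d1 \<noteq> 0"
    "a1 *\<^sub>R u1 - b1 *\<^sub>R u2 = x1" "c1 *\<^sub>R u3 - d1 *\<^sub>R u4 = x1"
    by (rule edge_lines_meet[OF I(1,2,3) n(1,2,3) u1(1) u2(1) ud(1) u1(3) u2(3) u3(1) u4(1) ud(2) u3(3) u4(3)])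
  obtain x2 a2 b2 c2 d2 where x2: "x2 \<in> ker {A, A', s2}" "a2 \<noteq> 0" "b2 \<noteq> 0" "c2 \<noteq> 0" "d2 \<noteq> 0"
    "a2 *\<^sub>R u2 - b2 *\<^sub>R w = x2" "c2 *\<^sub>R u4 - d2 *\<^sub>R u6 = x2"
    by (rule edge_lines_meet[OF I(1,2,4) n(1,4,5) u2(2) w(1) ud(3) u2(3) w(2) u4(2) u6(1) ud(4) u4(3) u6(2)])
  obtain x3 a3 b3 c3 d3 where x3: "x3 \<in> ker {A', A, s3}" "a3 \<noteq> 0" "b3 \<noteq> 0" "c3 \<noteq> 0" "d3 \<noteq> 0"
    "a3 *\<^sub>R u3 - b3 *\<^sub>R u7 = x3" "c3 *\<^sub>R u1 - d3 *\<^sub>R w' = x3"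
    by (rule edge_lines_meet[OF I(2,1,5) n(1)[symmetric] n(7,6) u3(2) u7(1) ud(5) u3(3) u7(2) u1(2) w(3) ud(6) u1(3) w(4)])
  have m1: "ht x1 \<noteq> 0" "(1 / ht x1) *\<^sub>R pt x1 \<in> line (pt u1) (pt u2) \<inter> line (pt u3) (pt u4)"
    using meeting_point[OF _ _ x1(2,4,6,7)] Y dist by auto
  have m2: "ht x2 \<noteq> 0" "(1 / ht x2) *\<^sub>R pt x2 \<in> line (pt u2) (pt w) \<inter> line (pt u4) (pt u6)"
    using meeting_point[OF _ _ x2(2,4,6,7)] Y dist by auto
  have m3: "ht x3 \<noteq> 0" "(1 / ht x3) *\<^sub>R pt x3 \<in> line (pt u3) (pt u7) \<inter> line (pt u1) (pt w)"
    using meeting_point[OF _ _ x3(2,4,6,7)] Y dist w(5) by auto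
  have "x1 \<in> ker {A, A'}" "x2 \<in> ker {A, A'}" "x3 \<in> ker {A, A'}" using x1(1) x2(1) x3(1) by (auto simp: ker_def)
  then obtain \<alpha> \<beta> \<gamma> where ab: "\<alpha> *\<^sub>R x1 + \<beta> *\<^sub>R x2 + \<gamma> *\<^sub>R x3 = 0" "\<alpha> \<noteq> 0 \<or> \<beta> \<noteq> 0 \<or> \<gamma> \<noteq> 0"
    using dependent_three[OF subspace_ker dim_ker_pair[OF I(1,2) n(1)]] by metis
  have col: "collinear {(1 / ht x1) *\<^sub>R pt x1, (1 / ht x2) *\<^sub>R pt x2, (1 / ht x3) *\<^sub>R pt x3}"
  proof (rule collinear_if_affinely_dependent)
    have "ht (\<alpha> *\<^sub>R x1 + \<beta> *\<^sub>R x2 + \<gamma> *\<^sub>R x3) = 0" using ab(1) linear_0[OF lin_ht] by simp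
    then show "\<alpha> * ht x1 + \<beta> * ht x2 + \<gamma> * ht x3 = 0"
      by (simp add: linear_add[OF lin_ht] linear_scale[OF lin_ht])
    have "pt (\<alpha> *\<^sub>R x1 + \<beta> *\<^sub>R x2 + \<gamma> *\<^sub>R x3) = 0" using ab(1) linear_0[OF lin_pt] by simp
    then show "(\<alpha> * ht x1) *\<^sub>R (1 / ht x1) *\<^sub>R pt x1 + (\<beta> * ht x2) *\<^sub>R (1 / ht x2) *\<^sub>R pt x2
        + (\<gamma> * ht x3) *\<^sub>R (1 / ht x3) *\<^sub>R pt x3 = 0"
      using m1(1) m2(1) m3(1) by (simp add: linear_add[OF lin_pt] linear_scale[OF lin_pt])
    show "\<alpha> * ht x1 \<noteq> 0 \<or> \<beta> * ht x2 \<noteq> 0 \<or> \<gamma> * ht x3 \<noteq> 0" using ab(2) m1(1) m2(1) m3(1) by simp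
  qed
  have sub: "{pt u1, pt u2, pt u3, pt u4, pt w, pt u6, pt u7} \<subseteq> vertices P"
    using Y pt_Y by blast
  show False
    by (rule notE[OF gp[unfolded general_position_def, THEN conjunct2, THEN conjunct2]])
      (intro exI conjI, rule dist, rule sub, rule m1(2), rule m2(2), rule m3(2), rule col)
qed

section \<open>The non-adjacency graph and its two cases\<close>

definition nonadj :: "'n \<Rightarrow> 'n set" where
  "nonadj i = {j. i \<in> I \<and> j \<in> I \<and> i \<noteq> j \<and> \<not> adj i j}"

lemma nonadj_sym: "i \<in> nonadj j \<Longrightarrow> j \<in> nonadj i"
  by (auto simp: nonadj_def adj_commute)

lemma nonadj_irrefl: "i \<notin> nonadj i"
  by (simp add: nonadj_def)

lemma nonadj_subset: "nonadj i \<subseteq> I"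
  by (auto simp: nonadj_def)

lemma adj_iff_nonadj: "i \<in> I \<Longrightarrow> j \<in> I \<Longrightarrow> adj i j \<longleftrightarrow> i \<noteq> j \<and> j \<notin> nonadj i"
  by (auto simp: nonadj_def adj_irrefl)

lemma sum_card_nonadj: "(\<Sum>i\<in>I. card (nonadj i)) = 2 * (15 - card edges)"
proof -
  define H where "H = {S. S \<subseteq> I \<and> card S = 2} - edges"
  have finH: "finite H" using finite_pairs by (simp add: H_def)
  have "card (nonadj i) = card {S\<in>H. i \<in> S}" if i: "i \<in> I" for i
  proof -
    have "bij_betw (\<lambda>j. {i, j}) (nonadj i) {S\<in>H. i \<in> S}"
    proof (rule bij_betwI')
      show "({i, x} = {i, y}) = (x = y)" if "x \<in> nonadj i" "y \<in> nonadj i" for x y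
        by (auto simp: doubleton_eq_iff)
      show "{i, x} \<in> {S\<in>H. i \<in> S}" if "x \<in> nonadj i" for x
        using that by (auto simp: H_def nonadj_def edges_iff)
      show "\<exists>x\<in>nonadj i. S = {i, x}" if "S \<in> {S\<in>H. i \<in> S}" for S
      proof -
        have S: "S \<subseteq> I" "card S = 2" "S \<notin> edges" "i \<in> S" using that by (auto simp: H_def)
        then obtain x where x: "S = {i, x}" "x \<noteq> i" by (auto simp: card_2_iff)
        then have "x \<in> nonadj i" using S by (auto simp: nonadj_def edges_iff)
        then show ?thesis using x by blast
      qed
    qed
    then show ?thesis by (rule bij_betw_same_card)
  qed
  then have "(\<Sum>i\<in>I. card (nonadj i)) = (\<Sum>i\<in>I. card {S\<in>H. i \<in> S})" by simp
  also have "\<dots> = (\<Sum>S\<in>H. card {i\<in>I. i \<in> S})" by (rule sum_card_swap[OF finite_I finH])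
  also have "\<dots> = (\<Sum>S\<in>H. 2)"
  proof (rule sum.cong)
    fix S assume "S \<in> H"
    then have "{i\<in>I. i \<in> S} = S" "card S = 2" by (auto simp: H_def)
    then show "card {i\<in>I. i \<in> S} = 2" by simp
  qed simp
  also have "\<dots> = 2 * card H" by simp
  also have "card H = 15 - card edges"
    unfolding H_def using card_Diff_subset[OF finite_edges edges_subset] card_pairs by simp
  finally show ?thesis .
qed

text \<open>A facet adjacent to both \<open>i\<close> and \<open>j\<close> gives, by
  \<open>triangle_vertex\<close>, a vertex of their edge, and different facets give different
  vertices. So at most two of the other four facets are adjacent to both.\<close>

lemma two_nonadj:
  assumes ij: "i \<in> I" "j \<in> I" "i \<noteq> j" "j \<notin> nonadj i"
  shows "2 \<le> card (nonadj i \<union> nonadj j)"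
proof -
  have aij: "adj i j" using ij adj_iff_nonadj by blast
  define C where "C = {k. adj i k \<and> adj j k}"
  have CI: "C \<subseteq> I" by (auto simp: C_def adj_def)
  have "\<exists>y\<in>Y. Z y = {i, j, k}" if "k \<in> C" for k
  proof -
    have "adj i k" "adj j k" using that by (auto simp: C_def)
    from triangle_vertex[OF aij this] show ?thesis by blast
  qed
  then obtain v where v: "\<And>k. k \<in> C \<Longrightarrow> v k \<in> Y" "\<And>k. k \<in> C \<Longrightarrow> Z (v k) = {i, j, k}" by metis
  have "inj_on v C"
  proof (rule inj_onI)
    fix k l assume kl: "k \<in> C" "l \<in> C" "v k = v l"
    then have "{i, j, k} = {i, j, l}" using v(2) by metis
    moreover have "k \<noteq> i" "k \<noteq> j" using kl(1) adj_irrefl by (auto simp: C_def)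
    ultimately show "k = l" by blast
  qed
  moreover have "v ` C \<subseteq> common i j"
  proof
    fix y assume "y \<in> v ` C"
    then obtain k where "k \<in> C" "y = v k" by blast
    then have "y \<in> Y" "Z y = {i, j, k}" using v by auto
    then show "y \<in> common i j" by (auto simp: common_def Z_def)
  qed
  ultimately have "card C \<le> card (common i j)" using card_inj_on_le[OF _ _ finite_common] by blast
  then have C2: "card C \<le> 2" using aij by (simp add: adj_def)
  have "I - {i, j} \<subseteq> C \<union> (nonadj i \<union> nonadj j)" using ij by (auto simp: C_def adj_iff_nonadj)
  moreover have "finite (C \<union> (nonadj i \<union> nonadj j))"
    using CI nonadj_subset finite_I by (meson finite_Un finite_subset)
  ultimately have "card (I - {i, j}) \<le> card (C \<union> (nonadj i \<union> nonadj j))" by (rule card_mono[rotated])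
  also have "\<dots> \<le> card C + card (nonadj i \<union> nonadj j)" by (rule card_Un_le)
  finally show ?thesis using C2 ij card_I by simp
qed

lemma common_iff_Z: "i \<in> I \<Longrightarrow> j \<in> I \<Longrightarrow> y \<in> common i j \<longleftrightarrow> y \<in> Y \<and> i \<in> Z y \<and> j \<in> Z y"
  by (auto simp: common_def Z_def)

lemma nonzero_iff_Z: "i \<in> I \<Longrightarrow> y $ i \<noteq> 0 \<longleftrightarrow> i \<notin> Z y"
  by (auto simp: Z_def)

text \<open>Degree sum 8 means 11 edges, hence exactly 7 vertices and an injective projection. The
  other end \<open>w\<close> of the edge of \<open>a\<close> and \<open>e\<close> turns out to lie
  on \<open>a\<close>, \<open>c\<close>, \<open>e\<close>, \<open>f\<close>, so it serves for
  \<open>e\<close> and for \<open>f\<close> alike.\<close>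

lemma path_case:
  assumes I6: "I = {a', a, c, d, e, f}" and dist: "distinct [a', a, c, d, e, f]"
    and N: "nonadj a' = {a}" "nonadj a = {a', c}" "nonadj c = {a, d}" "nonadj d = {c}"
      "nonadj e = {f}" "nonadj f = {e}"
  shows False
proof -
  have I: "a' \<in> I" "a \<in> I" "c \<in> I" "d \<in> I" "e \<in> I" "f \<in> I" using I6 by auto
  have ne: "a' \<noteq> a" "a' \<noteq> c" "a' \<noteq> d" "a' \<noteq> e" "a' \<noteq> f" "a \<noteq> c" "a \<noteq> d" "a \<noteq> e" "a \<noteq> f"
    "c \<noteq> d" "c \<noteq> e" "c \<noteq> f" "d \<noteq> e" "d \<noteq> f" "e \<noteq> f" using dist by auto
  note ne' = ne ne[symmetric]
  have adj: "adj a d" "adj a e" "adj a f" "adj a' c" "adj a' d" "adj a' e" "adj a' f" "adj c e" "adj c f"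
    "adj d e" "adj d f" "adj e c" "adj f c"
    using I N ne' by (simp_all add: adj_iff_nonadj)
  define g where "g i = card (nonadj i)" for i
  have "sum g I = sum g {a', a, c, d, e, f}" using I6 by (rule arg_cong)
  also have "\<dots> = 8" using ne' by (simp add: g_def N)
  finally have "(\<Sum>i\<in>I. card (nonadj i)) = 8" by (simp add: g_def)
  then have "card edges = 11" using sum_card_nonadj by simp
  then have "card Y = 7" using card_edges_ge[OF card_Y_ge] card_Y_ge by simp
  then have inj: "inj_on pt Y" using eq_card_imp_inj_on[OF fin, of pt] pt_Y card_P by simp
  obtain u1 where u1: "u1 \<in> Y" "Z u1 = {a, d, f}" by (rule triangle_vertex[OF adj(1,3,11)])
  obtain u2 where u2: "u2 \<in> Y" "Z u2 = {a, d, e}" by (rule triangle_vertex[OF adj(1,2,10)])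
  obtain u3 where u3: "u3 \<in> Y" "Z u3 = {a', d, f}" by (rule triangle_vertex[OF adj(5,7,11)])
  obtain u4 where u4: "u4 \<in> Y" "Z u4 = {a', d, e}" by (rule triangle_vertex[OF adj(5,6,10)])
  obtain u6 where u6: "u6 \<in> Y" "Z u6 = {a', e, c}" by (rule triangle_vertex[OF adj(6,4,12)])
  obtain u7 where u7: "u7 \<in> Y" "Z u7 = {a', f, c}" by (rule triangle_vertex[OF adj(7,4,13)])
  have "u2 \<in> common a e" using u2 I by (simp add: common_iff_Z)
  then obtain w where w: "w \<in> common a e" "w \<noteq> u2"
    using adj_iff_other[OF I(2,5) ne(8)] adj(2) by blast
  then have wY: "w \<in> Y" and wZ: "a \<in> Z w" "e \<in> Z w" using I by (simp_all add: common_iff_Z)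
  \<comment> \<open>On three facets only, the third would be adjacent to \<open>a\<close> and
    \<open>e\<close>, hence be \<open>d\<close>, and \<open>w\<close> would equal
    \<open>u2\<close>.\<close>
  have w4: "card (Z w) = 4"
  proof (rule ccontr)
    assume "card (Z w) \<noteq> 4"
    then have "card (Z w) = 3" using card_Z_ge_3[OF wY] card_Z_le_4[OF card_Y_ge wY] by simp
    moreover have "card (Z w - {a, e}) = card (Z w) - 2" using wZ ne by (simp add: card_Diff_subset)
    ultimately have "card (Z w - {a, e}) = 1" by simp
    then obtain x where x: "Z w - {a, e} = {x}" by (auto simp: card_1_singleton_iff)
    then have Zw: "Z w = {a, e, x}" and xne: "x \<noteq> a" "x \<noteq> e" using wZ by auto
    have "x \<in> I" using Zw by (auto simp: Z_def)
    have "Z w = {a, x, e}" "Z w = {e, x, a}" using Zw by auto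
    then have "adj a x" "adj e x" using deg3_adj[OF wY, of a x e] deg3_adj[OF wY, of e x a] xne ne by auto
    then have "x \<notin> nonadj a" "x \<notin> nonadj e" by (auto simp: nonadj_def)
    then have "x \<notin> {a', c, f}" unfolding N by simp
    moreover have "x \<in> {a', a, c, d, e, f}" using \<open>x \<in> I\<close> unfolding I6 .
    ultimately have "x = d" using xne by auto
    then have "Z w = Z u2" using Zw u2(2) by auto
    then show False using Z_subset_eq[OF u2(1) wY] w(2) by auto
  qed
  obtain p q r s where z: "Z w = {p, q, r, s}" "distinct [p, q, r, s]" "\<not> adj p q" "\<not> adj r s"
    by (rule deg4_adj[OF wY w4])
  have "Z w \<subseteq> I" by (auto simp: Z_def)
  then have pI: "p \<in> I" "q \<in> I" "r \<in> I" "s \<in> I" using z(1) by auto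
  \<comment> \<open>Four facets around a vertex form two non-adjacent pairs. Since \<open>f\<close>
    is the only facet not adjacent to \<open>e\<close>, it contains \<open>w\<close> too.\<close>
  have partner: "\<exists>y\<in>Z w. y \<in> nonadj x" if "x \<in> Z w" for x
  proof -
    have "q \<in> nonadj p" "p \<in> nonadj q" "s \<in> nonadj r" "r \<in> nonadj s"
      using z pI by (auto simp: nonadj_def adj_commute)
    then show ?thesis using that z(1) by auto
  qed
  have fZ: "f \<in> Z w" using partner[OF wZ(2)] unfolding N by blast
  have a'Z: "a' \<notin> Z w"
  proof
    assume "a' \<in> Z w"
    then have "{w, u4, u6} \<subseteq> common a' e" using wY wZ u4 u6 I by (simp add: common_iff_Z)
    then have "w = u4 \<or> w = u6 \<or> u4 = u6" by (rule adj_no_three[OF adj(6)])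
    then show False
    proof (elim disjE)
      assume "w = u4"
      then show False using wZ(1) u4(2) ne' by simp
    next
      assume "w = u6"
      then show False using wZ(1) u6(2) ne' by simp
    next
      assume "u4 = u6"
      then have "d \<in> {a', e, c}" using u4(2) u6(2) by auto
      then show False using ne' by simp
    qed
  qed
  have dZ: "d \<notin> Z w"
  proof
    assume "d \<in> Z w"
    then have "{d, a, e, f} \<subseteq> Z w" using wZ fZ by simp
    moreover have "card {d, a, e, f} = 4" using ne' by simp
    ultimately have "Z w = {d, a, e, f}" using card_seteq[OF finite_Z, of "{d, a, e, f}" w] w4 by simp
    moreover obtain y where "y \<in> Z w" "y \<in> {a', c}" using partner[OF wZ(1)] unfolding N by blast
    ultimately show False using ne' by auto
  qed
  \<comment> \<open>Membership in three facets already tells the seven vertices apart.\<close>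
  define sig where "sig u = (a' \<in> Z u, d \<in> Z u, e \<in> Z u)" for u
  have "distinct (map sig [u1, u2, u3, u4, w, u6, u7])"
    by (simp add: sig_def u1(2) u2(2) u3(2) u4(2) u6(2) u7(2) wZ a'Z dZ ne')
  then have dist7: "distinct [u1, u2, u3, u4, w, u6, u7]"
    unfolding distinct_map by (rule conjunct1)
  have "pt x \<noteq> pt y" if "x \<in> Y" "y \<in> Y" "x \<noteq> y" for x y using inj that by (auto dest: inj_onD)
  then have distpt: "distinct [pt u1, pt u2, pt u3, pt u4, pt w, pt u6, pt u7]"
    using dist7 u1(1) u2(1) u3(1) u4(1) u6(1) u7(1) wY by simp
  show False
    by (rule collinear_contradiction[OF I(2,1,4,5,6) _ _ _ _ _ _ _ _ _ _ _ _ _ _ _ _ _ _ _ _ _ _ distpt, where w' = w])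
      (use u1 u2 u3 u4 u6 u7 wY wZ fZ a'Z I ne' in \<open>simp_all add: common_iff_Z nonzero_iff_Z\<close>)
qed

text \<open>\<open>\<sigma>\<close> exchanges opposite facets of a combinatorial cube. Its 12 edges
  and simple vertices give 8 vertices over 7 points, so exactly one pair \<open>y\<close>,
  \<open>y'\<close> is identified, and the face property of fibres makes this pair an edge.\<close>

lemma matching_case:
  assumes one: "\<And>i. i \<in> I \<Longrightarrow> card (nonadj i) = 1"
  shows False
proof -
  define \<sigma> where "\<sigma> i = the_elem (nonadj i)" for i
  have N: "nonadj i = {\<sigma> i}" if "i \<in> I" for i
    using one[OF that] unfolding \<sigma>_def by (metis card_1_singletonE the_elem_eq)
  have \<sigma>: "\<sigma> i \<in> I" "\<sigma> i \<noteq> i" "\<sigma> (\<sigma> i) = i" if i: "i \<in> I" for i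
  proof -
    have "\<sigma> i \<in> nonadj i" using N[OF i] by simp
    then show *: "\<sigma> i \<in> I" "\<sigma> i \<noteq> i" by (auto simp: nonadj_def)
    have "i \<in> nonadj (\<sigma> i)" using nonadj_sym \<open>\<sigma> i \<in> nonadj i\<close> by blast
    then show "\<sigma> (\<sigma> i) = i" using N[OF *(1)] by simp
  qed
  have adj: "adj i j \<longleftrightarrow> j \<noteq> i \<and> j \<noteq> \<sigma> i" if "i \<in> I" "j \<in> I" for i j
    using adj_iff_nonadj[OF that] N[OF that(1)] by auto
  have "(\<Sum>i\<in>I. card (nonadj i)) = 6" using one card_I by simp
  then have e12: "card edges = 12" using sum_card_nonadj by simp
  \<comment> \<open>A vertex on \<open>a\<close>, \<open>c\<close> and their opposites would be a
    third vertex on the edge of \<open>a\<close> and \<open>c\<close>, besides those on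
    \<open>e\<close> and on the opposite of \<open>e\<close>.\<close>
  have Z3: "card (Z y) = 3" if y: "y \<in> Y" for y
  proof (rule ccontr)
    assume "card (Z y) \<noteq> 3"
    then have c4: "card (Z y) = 4" using card_Z_ge_3[OF y] card_Z_le_4[OF card_Y_ge y] by simp
    obtain a b c d where z: "Z y = {a, b, c, d}" "distinct [a, b, c, d]" "adj a c" "\<not> adj a b" "\<not> adj c d"
      by (rule deg4_adj[OF y c4])
    have "Z y \<subseteq> I" by (auto simp: Z_def)
    then have I: "a \<in> I" "b \<in> I" "c \<in> I" "d \<in> I" using z(1) by auto
    have b: "b = \<sigma> a" and d: "d = \<sigma> c" using adj z I by auto
    have "card (I - Z y) = 2" using card_Diff_subset[OF finite_Z \<open>Z y \<subseteq> I\<close>] c4 card_I by simp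
    then have "I - Z y \<noteq> {}" by (metis card.empty zero_neq_numeral)
    then obtain e where e: "e \<in> I" "e \<notin> Z y" by blast
    then have e': "e \<noteq> a" "e \<noteq> \<sigma> a" "e \<noteq> c" "e \<noteq> \<sigma> c" using z(1) b d by auto
    have se: "\<sigma> e \<noteq> a" "\<sigma> e \<noteq> \<sigma> a" "\<sigma> e \<noteq> c" "\<sigma> e \<noteq> \<sigma> c" "\<sigma> e \<in> I"
      using e' \<sigma>[OF e(1)] \<sigma>[OF I(1)] \<sigma>[OF I(3)] by metis+
    obtain y1 where y1: "y1 \<in> Y" "Z y1 = {a, c, e}"
      by (rule triangle_vertex[of a c e]) (use z(3) adj I e e' in auto)
    obtain y2 where y2: "y2 \<in> Y" "Z y2 = {a, c, \<sigma> e}"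
      by (rule triangle_vertex[of a c "\<sigma> e"]) (use z(3) adj I se in auto)
    have "{y, y1, y2} \<subseteq> common a c" using y y1 y2 z(1) I by (simp add: common_iff_Z)
    then have "y = y1 \<or> y = y2 \<or> y1 = y2" by (rule adj_no_three[OF z(3)])
    moreover have "b \<notin> Z y1" "b \<notin> Z y2" "b \<in> Z y" using y1 y2 z b e' se by auto
    moreover have "e \<in> Z y1" "e \<notin> Z y2" using y1 y2 e' \<sigma>[OF e(1)] by auto
    ultimately show False by auto
  qed
  have le3: "card {S\<in>edges. S \<subseteq> Z y} \<le> 3" if y: "y \<in> Y" for y
  proof -
    have "card {S\<in>edges. S \<subseteq> Z y} \<le> card {S. S \<subseteq> Z y \<and> card S = 2}"
      using edges_subset finite_Z by (intro card_mono) auto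
    also have "\<dots> = 3" using n_subsets[OF finite_Z, of y 2] Z3[OF y] by (simp add: choose_two)
    finally show ?thesis .
  qed
  have "2 * card edges \<le> card Y * 3"
    using sum_bounded_above[of Y "\<lambda>y. card {S\<in>edges. S \<subseteq> Z y}" 3] le3 by (simp add: sum_edges_at_vertices)
  then have Y8: "card Y = 8" using e12 card_Y_le_8 by simp
  then have "\<not> inj_on pt Y" using card_image[of pt Y] pt_Y card_P by auto
  then obtain y y' where yy: "y \<in> Y" "y' \<in> Y" "y \<noteq> y'" "pt y = pt y'" by (auto simp: inj_on_def)
  have "pt y' \<in> pt ` (Y - {y'})" using yy by (intro image_eqI[of _ pt y]) auto
  then have "pt ` (Y - {y'}) = pt ` Y" by blast
  then have "card (pt ` (Y - {y'})) = card (Y - {y'})" using pt_Y card_P Y8 yy by simp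
  then have inj: "inj_on pt (Y - {y'})" using eq_card_imp_inj_on fin by blast
  \<comment> \<open>Removing \<open>y'\<close> leaves 7 vertices with 7 images, so the fibre
    contains no third vertex.\<close>
  have only: "u = y \<or> u = y'" if "u \<in> Y" "Z y \<inter> Z y' \<subseteq> Z u" for u
    using inj_onD[OF inj, of u y] fibre_is_face[OF yy(1,2,4) that] that(1) yy(1,3) by auto
  have ZI: "Z u \<subseteq> I" for u by (auto simp: Z_def)
  have triple: "p \<in> I \<and> q \<in> I \<and> r \<in> I \<and> adj p q \<and> adj p r \<and> adj q r"
    if "u \<in> Y" "Z u = {p, q, r}" for u p q r
  proof -
    have c: "card {p, q, r} = 3" using Z3[OF that(1)] that(2) by simp
    then have ne: "p \<noteq> q" "p \<noteq> r" "q \<noteq> r" by (auto simp: card_insert_if split: if_splits)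
    have "Z u = {p, r, q}" "Z u = {q, r, p}" using that(2) by auto
    then show ?thesis
      using deg3_adj[OF that ne] deg3_adj[OF that(1), of p r q] deg3_adj[OF that(1), of q r p] ne ZI[of u] that(2)
      by auto
  qed
  define K where "K = Z y \<inter> Z y'"
  have KZ: "K \<subseteq> Z y" by (simp add: K_def)
  have "K \<noteq> Z y" using Z_subset_eq[OF yy(1,2)] yy(3) by (auto simp: K_def)
  then have "card K < card (Z y)" using KZ finite_Z by (simp add: psubset_card_mono psubset_eq)
  then have K2: "card K \<le> 2" using Z3[OF yy(1)] by simp
  have finK: "finite K" using KZ finite_Z finite_subset by blast
  \<comment> \<open>With at most one common facet, \<open>fibre_is_face\<close> would put the
    neighbours \<open>y1\<close> and \<open>y2\<close> of \<open>y\<close> into the fibre, which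
    then has three elements.\<close>
  have "\<not> card K \<le> 1"
  proof
    assume K1: "card K \<le> 1"
    have "Z y \<noteq> {}" using Z3[OF yy(1)] by auto
    then obtain p where p: "p \<in> Z y" "K \<subseteq> {p}"
      using K1 finK KZ by (metis card_le_Suc0_iff_eq One_nat_def all_not_in_conv empty_subsetI insertI1 subsetI singletonI subset_singleton_iff subsetD)
    have "card (Z y - {p}) = 2" using Z3[OF yy(1)] p finite_Z by simp
    then obtain q r where qr: "Z y - {p} = {q, r}" "q \<noteq> r" by (auto simp: card_2_iff)
    then have Zy: "Z y = {p, q, r}" using p by auto
    note t = triple[OF yy(1) Zy]
    have I: "p \<in> I" "q \<in> I" "r \<in> I" using t by auto
    have n: "q \<noteq> p" "q \<noteq> \<sigma> p" "r \<noteq> p" "r \<noteq> \<sigma> p" "r \<noteq> q" "r \<noteq> \<sigma> q" using t adj by auto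
    have n': "\<sigma> r \<noteq> p" "\<sigma> r \<noteq> \<sigma> p" "\<sigma> r \<noteq> q" "\<sigma> q \<noteq> p" "\<sigma> q \<noteq> \<sigma> p" "r \<noteq> \<sigma> (\<sigma> q)" "\<sigma> r \<noteq> \<sigma> q"
      using n \<sigma>[OF I(1)] \<sigma>[OF I(2)] \<sigma>[OF I(3)] by metis+
    obtain y1 where y1: "y1 \<in> Y" "Z y1 = {p, q, \<sigma> r}"
      by (rule triangle_vertex[of p q "\<sigma> r"]) (use adj I \<sigma> n n' in auto)
    obtain y2 where y2: "y2 \<in> Y" "Z y2 = {p, \<sigma> q, r}"
      by (rule triangle_vertex[of p "\<sigma> q" r]) (use adj I \<sigma> n n' in auto)
    have "y1 = y \<or> y1 = y'" by (rule only[OF y1(1)]) (use p y1 in \<open>auto simp: K_def\<close>)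
    moreover have "y2 = y \<or> y2 = y'" by (rule only[OF y2(1)]) (use p y2 in \<open>auto simp: K_def\<close>)
    moreover have "r \<in> Z y" "r \<notin> Z y1" using Zy y1 n \<sigma>[OF I(3)] by auto
    moreover have "q \<in> Z y" "q \<in> Z y1" "q \<notin> Z y2" using Zy y1 y2 n \<sigma>[OF I(2)] by auto
    ultimately show False by auto
  qed
  then have "card K = 2" using K2 by simp
  then obtain p q where K: "K = {p, q}" "p \<noteq> q" by (auto simp: card_2_iff)
  have ex: "\<exists>r. Z u = {p, q, r}" if u: "u \<in> Y" "K \<subseteq> Z u" for u
  proof -
    have "card (Z u - K) = 1" using card_Diff_subset[OF finK u(2)] Z3[OF u(1)] \<open>card K = 2\<close> by simp
    then obtain r where "Z u - K = {r}" by (auto simp: card_1_singleton_iff)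
    then have "Z u = {p, q, r}" using u(2) K by auto
    then show ?thesis by blast
  qed
  obtain r where Zy: "Z y = {p, q, r}" using ex[OF yy(1) KZ] by blast
  obtain r' where Zy': "Z y' = {p, q, r'}" using ex[OF yy(2)] by (auto simp: K_def)
  note t = triple[OF yy(1) Zy] and t' = triple[OF yy(2) Zy']
  have I: "p \<in> I" "q \<in> I" "r \<in> I" using t by auto
  have n: "q \<noteq> p" "q \<noteq> \<sigma> p" "r \<noteq> p" "r \<noteq> \<sigma> p" "r \<noteq> q" "r \<noteq> \<sigma> q" using t adj by auto
  have n2: "\<sigma> r \<noteq> p" "\<sigma> r \<noteq> \<sigma> p" "\<sigma> r \<noteq> q" "\<sigma> r \<noteq> \<sigma> q" "\<sigma> q \<noteq> p" "\<sigma> q \<noteq> \<sigma> p" "\<sigma> p \<noteq> q" "\<sigma> p \<noteq> r" "\<sigma> q \<noteq> r"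
    "\<sigma> p \<noteq> p" "\<sigma> q \<noteq> q" "\<sigma> r \<noteq> r" "\<sigma> (\<sigma> p) = p" "\<sigma> (\<sigma> q) = q" "\<sigma> (\<sigma> r) = r"
    "\<sigma> p \<in> I" "\<sigma> q \<in> I" "\<sigma> r \<in> I"
    using n \<sigma>[OF I(1)] \<sigma>[OF I(2)] \<sigma>[OF I(3)] by metis+
  note nn = n n2 n[symmetric] n2(1-12)[symmetric]
  have "card {p, q, r, \<sigma> p, \<sigma> q, \<sigma> r} = 6" using nn by simp
  then have Ieq: "{p, q, r, \<sigma> p, \<sigma> q, \<sigma> r} = I" using card_seteq[OF finite_I, of "{p, q, r, \<sigma> p, \<sigma> q, \<sigma> r}"] I n2 card_I by simp
  have "r' \<noteq> r" using Zy Zy' Z_subset_eq[OF yy(1,2)] yy(3) by auto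
  moreover have "r' \<noteq> p" "r' \<noteq> \<sigma> p" "r' \<noteq> q" "r' \<noteq> \<sigma> q" "r' \<in> I" using t' adj by auto
  ultimately have r': "r' = \<sigma> r" using Ieq by auto
  obtain u1 where u1: "u1 \<in> Y" "Z u1 = {p, \<sigma> q, \<sigma> r}"
    by (rule triangle_vertex[of p "\<sigma> q" "\<sigma> r"]) (use adj I nn in auto)
  obtain u2 where u2: "u2 \<in> Y" "Z u2 = {p, \<sigma> q, r}"
    by (rule triangle_vertex[of p "\<sigma> q" r]) (use adj I nn in auto)
  obtain u3 where u3: "u3 \<in> Y" "Z u3 = {\<sigma> p, \<sigma> q, \<sigma> r}"
    by (rule triangle_vertex[of "\<sigma> p" "\<sigma> q" "\<sigma> r"]) (use adj I nn in auto)
  obtain u4 where u4: "u4 \<in> Y" "Z u4 = {\<sigma> p, \<sigma> q, r}"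
    by (rule triangle_vertex[of "\<sigma> p" "\<sigma> q" r]) (use adj I nn in auto)
  obtain u6 where u6: "u6 \<in> Y" "Z u6 = {\<sigma> p, r, q}"
    by (rule triangle_vertex[of "\<sigma> p" r q]) (use adj I nn in auto)
  obtain u7 where u7: "u7 \<in> Y" "Z u7 = {\<sigma> p, \<sigma> r, q}"
    by (rule triangle_vertex[of "\<sigma> p" "\<sigma> r" q]) (use adj I nn in auto)
  define sig where "sig u = (\<sigma> p \<in> Z u, \<sigma> q \<in> Z u, \<sigma> r \<in> Z u)" for u
  have "distinct (map sig [u1, u2, u3, u4, y, u6, u7, y'])"
    by (simp add: sig_def u1(2) u2(2) u3(2) u4(2) u6(2) u7(2) Zy Zy' r' nn)
  then have "distinct [u1, u2, u3, u4, y, u6, u7, y']"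
    unfolding distinct_map by (rule conjunct1)
  moreover have "pt u \<noteq> pt v" if "u \<in> Y - {y'}" "v \<in> Y - {y'}" "u \<noteq> v" for u v
    using inj that by (auto dest: inj_onD)
  ultimately have distpt: "distinct [pt u1, pt u2, pt u3, pt u4, pt y, pt u6, pt u7]"
    using u1(1) u2(1) u3(1) u4(1) u6(1) u7(1) yy(1) by simp
  show False
    by (rule collinear_contradiction[OF I(1) n2(16,17) I(3) n2(18) _ _ _ _ _ _ _ _ _ _ _ _ _ _ _ _ _ _ _ _ _ _ distpt, where w' = y'])
      (use u1 u2 u3 u4 u6 u7 yy Zy Zy'[unfolded r'] I nn in \<open>simp_all add: common_iff_Z nonzero_iff_Z\<close>)
qed

lemma dim3_False: False
proof -
  have "3 * card Y \<le> 2 * card edges" by (rule card_edges_ge[OF card_Y_ge])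
  \<comment> \<open>Seven vertices need at least 11 edges; this leaves at most 4 of the 15 pairs,
    each counted twice.\<close>
  then have "(\<Sum>i\<in>I. card (nonadj i)) \<le> 8" using card_Y_ge sum_card_nonadj by simp
  from nonadjacency_structure[of I nonadj, OF finite_I card_I nonadj_sym nonadj_irrefl nonadj_subset this two_nonadj]
  show False using matching_case path_case by blast
qed

end

context heptagon_slack
begin

text \<open>Besides the polygon, simplex and codimension one cases, at most six facets leave only
  linear dimension 4 with six facets.\<close>

theorem slack_heptagon_False:
  assumes "card I \<le> 6" "finite I"
  shows False
proof -
  have le: "dim (span Y) \<le> card I" by (rule dim_le_card[OF assms(2)])
  consider "dim (span Y) \<le> 3" | "card I \<le> dim (span Y)" | "dim (span Y) + 1 = card I" | "dim (span Y) = 4" "card I = 6"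
    using le assms by linarith
  then show False
  proof cases
    case 1
    then show False using card_le_of_dim_le_3[OF _ assms] card_Y_ge by simp
  next
    case 2
    then show False using card_le_of_full_dim[OF _ assms(2)] assms(1) card_Y_ge by simp
  next
    case 3
    obtain n where "relation n" by (rule exists_relation[OF 3])
    then show False using relation_False assms(1) by blast
  next
    case 4
    interpret heptagon_dim3 Y I pt ht P by unfold_locales (use 4 in auto)
    show False by (rule dim3_False)
  qed
qed

end

context slack_vectors
begin

text \<open>The same dimension cases without conditions on the projection. The second bound excludes
  five facets, because an extension of a heptagon has at least seven vertices.\<close>

theorem card_slack_vectors:
  assumes "card I \<le> 6" "finite I"
  shows "card Y \<le> 9" "card I \<le> 5 \<Longrightarrow> card Y \<le> 6"
proof -
  have le: "dim (span Y) \<le> card I" by (rule dim_le_card[OF assms(2)])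
  consider "dim (span Y) \<le> 3" | "card I \<le> dim (span Y)" | "dim (span Y) + 1 = card I" | "dim (span Y) = 4" "card I = 6"
    using le assms by linarith
  then have "card Y \<le> 9 \<and> (card I \<le> 5 \<longrightarrow> card Y \<le> 6)"
  proof cases
    case 1
    then show ?thesis using card_le_of_dim_le_3[OF _ assms] by simp
  next
    case 2
    then show ?thesis using card_le_of_full_dim[OF _ assms(2)] assms(1) by simp
  next
    case 3
    obtain n where n: "relation n" by (rule exists_relation[OF 3])
    let ?k = "card (pos_idx n) * card (neg_idx n) + card (zero_idx n)"
    have "?k \<le> 9" by (rule product_bounds(1)) (use card_idx[of n] assms(1) in simp)
    moreover have "?k \<le> 6" if "card I \<le> 5"
      by (rule product_bounds(2)) (use card_idx[of n] that in simp_all)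
    ultimately show ?thesis using card_Y_relation[OF n] by (meson order_trans)
  next
    case 4
    interpret slack_dim3 Y I pt ht by unfold_locales (use 4 in auto)
    show ?thesis using card_Y_le_8 4 by simp
  qed
  then show "card Y \<le> 9" "card I \<le> 5 \<Longrightarrow> card Y \<le> 6" by auto
qed

end

section \<open>The slack vectors of an extension\<close>

lemma span_image_sum:
  fixes y :: "'i \<Rightarrow> 'a::real_vector"
  assumes V: "finite V" and x: "x \<in> span (y ` V)"
  obtains a where "x = (\<Sum>v\<in>V. a v *\<^sub>R y v)"
proof -
  let ?S = "range (\<lambda>a. \<Sum>v\<in>V. a v *\<^sub>R y v)"
  have "subspace ?S"
  proof (rule subspaceI)
    show "0 \<in> ?S" by (rule range_eqI[of _ _ "\<lambda>_. 0"]) simp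
    show "u + w \<in> ?S" if uw: "u \<in> ?S" "w \<in> ?S" for u w
    proof -
      obtain a b where "u = (\<Sum>v\<in>V. a v *\<^sub>R y v)" "w = (\<Sum>v\<in>V. b v *\<^sub>R y v)" using uw by blast
      then show ?thesis
        by (intro range_eqI[of _ _ "\<lambda>v. a v + b v"]) (simp add: scaleR_add_left sum.distrib)
    qed
    show "c *\<^sub>R u \<in> ?S" if u: "u \<in> ?S" for c u
    proof -
      obtain a where "u = (\<Sum>v\<in>V. a v *\<^sub>R y v)" using u by blast
      then show ?thesis by (intro range_eqI[of _ _ "\<lambda>v. c * a v"]) (simp add: scaleR_sum_right)
    qed
  qed
  moreover have "y ` V \<subseteq> ?S"
  proof safe
    fix v assume v: "v \<in> V"
    have "(\<Sum>w\<in>V. (if w = v then 1 else 0) *\<^sub>R y w) = (\<Sum>w\<in>V. if w = v then y w else 0)"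
      by (rule sum.cong) auto
    then have "y v = (\<Sum>w\<in>V. (if w = v then 1 else 0) *\<^sub>R y w)" using V v by simp
    then show "y v \<in> ?S" by (rule range_eqI[of _ _ "\<lambda>w. if w = v then 1 else 0"])
  qed
  ultimately have "span (y ` V) \<subseteq> ?S" by (simp add: span_minimal)
  then show ?thesis using x that by blast
qed

text \<open>\<open>g\<close> is defined on a basis chosen among the \<open>y v\<close>. Expressing
  another \<open>y v\<close> in it is a relation, which the \<open>z v\<close> satisfy as well, so
  \<open>g\<close> has the right value there too.\<close>

lemma linear_map_from_relations:
  fixes y :: "'i \<Rightarrow> 'a::real_vector" and z :: "'i \<Rightarrow> 'b::real_vector"
  assumes V: "finite V" and rel: "\<And>a. (\<Sum>v\<in>V. a v *\<^sub>R y v) = 0 \<Longrightarrow> (\<Sum>v\<in>V. a v *\<^sub>R z v) = 0"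
  obtains g where "linear g" "\<And>v. v \<in> V \<Longrightarrow> g (y v) = z v"
proof -
  obtain B where B: "B \<subseteq> y ` V" "independent B" "y ` V \<subseteq> span B" by (rule basis_exists)
  have "\<forall>b\<in>B. \<exists>v\<in>V. y v = b" using B(1) by blast
  then obtain s where s: "\<And>b. b \<in> B \<Longrightarrow> s b \<in> V \<and> y (s b) = b" by metis
  obtain g where g: "linear g" "\<forall>b\<in>B. g b = z (s b)"
    using linear_independent_extend[OF B(2), of "\<lambda>b. z (s b)"] by blast
  have finB: "finite B" using B(1) V finite_subset by blast
  have "g (y v) = z v" if v: "v \<in> V" for v
  proof -
    have "y v \<in> span ((\<lambda>b. b) ` B)" using B(3) v by auto
    then obtain k where k: "y v = (\<Sum>b\<in>B. k b *\<^sub>R b)" by (rule span_image_sum[OF finB])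
    \<comment> \<open>The relation expressing \<open>y v\<close> by the basis, written with
      coefficients on \<open>V\<close>; the inner sum moves the coefficient of \<open>b\<close> to
      its representative \<open>s b\<close>.\<close>
    define a where "a u = (if u = v then 1 else 0) - (\<Sum>b\<in>B. if s b = u then k b else 0)" for u
    have sum_a: "(\<Sum>u\<in>V. a u *\<^sub>R r u) = r v - (\<Sum>b\<in>B. k b *\<^sub>R r (s b))" for r :: "'i \<Rightarrow> 'c::real_vector"
    proof -
      have "(\<Sum>u\<in>V. a u *\<^sub>R r u) = (\<Sum>u\<in>V. (if u = v then 1 else 0) *\<^sub>R r u)
          - (\<Sum>u\<in>V. \<Sum>b\<in>B. (if s b = u then k b else 0) *\<^sub>R r u)"
        by (simp add: a_def scaleR_left_diff_distrib sum_subtractf scaleR_sum_left)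
      also have "(\<Sum>u\<in>V. (if u = v then 1 else 0) *\<^sub>R r u) = (\<Sum>u\<in>V. if u = v then r u else 0)"
        by (rule sum.cong) auto
      also have "\<dots> = r v" using V v by simp
      also have "(\<Sum>u\<in>V. \<Sum>b\<in>B. (if s b = u then k b else 0) *\<^sub>R r u)
          = (\<Sum>b\<in>B. \<Sum>u\<in>V. (if s b = u then k b else 0) *\<^sub>R r u)" by (rule sum.swap)
      also have "\<dots> = (\<Sum>b\<in>B. k b *\<^sub>R r (s b))"
      proof (rule sum.cong)
        fix b assume b: "b \<in> B"
        have "(\<Sum>u\<in>V. (if s b = u then k b else 0) *\<^sub>R r u) = (\<Sum>u\<in>V. if s b = u then k b *\<^sub>R r u else 0)"
          by (rule sum.cong) auto
        then show "(\<Sum>u\<in>V. (if s b = u then k b else 0) *\<^sub>R r u) = k b *\<^sub>R r (s b)"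
          using V s[OF b] by simp
      qed simp
      finally show ?thesis .
    qed
    have "(\<Sum>u\<in>V. a u *\<^sub>R y u) = 0" unfolding sum_a using s k by simp
    then have "(\<Sum>u\<in>V. a u *\<^sub>R z u) = 0" by (rule rel)
    then have "z v = (\<Sum>b\<in>B. k b *\<^sub>R z (s b))" unfolding sum_a by simp
    also have "\<dots> = (\<Sum>b\<in>B. k b *\<^sub>R g b)" using g(2) by simp
    also have "\<dots> = g (y v)" unfolding k by (simp add: linear_sum[OF g(1)] linear_scale[OF g(1)])
    finally show ?thesis ..
  qed
  then show ?thesis using that g(1) by blast
qed

lemma sum_in_affine_hull:
  "finite V \<Longrightarrow> sum a V = 1 \<Longrightarrow> (\<Sum>v\<in>V. a v *\<^sub>R v) \<in> affine hull V"
  unfolding affine_hull_finite by (intro CollectI exI[of _ a]) simp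

text \<open>A functional with value 1 at a nonzero \<open>D\<close> is unbounded on the ray, but on
  \<open>Q\<close> it is bounded by its maximum over finitely many generators.\<close>

lemma polytope_no_ray:
  fixes Q :: "'a::real_vector set"
  assumes Q: "polytope Q" and ray: "\<And>s. 0 \<le> s \<Longrightarrow> v + s *\<^sub>R D \<in> Q"
  shows "D = 0"
proof (rule ccontr)
  assume "D \<noteq> 0"
  then have "D \<notin> span {}" by simp
  then obtain g :: "'a \<Rightarrow> real" where g: "linear g" "g D = 1" using linear_separating_span by blast
  obtain S where S: "finite S" "Q = convex hull S" using Q by (auto simp: polytope_def)
  have "v \<in> Q" using ray[of 0] by simp
  then have "S \<noteq> {}" using S by auto
  define M where "M = Max (g ` S)"
  have lm: "linear (\<lambda>x. - g x)" using g(1) by (rule linear_compose_neg)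
  have bound: "g x \<le> M" if "x \<in> Q" for x
  proof -
    have "\<forall>s\<in>S. 0 \<le> - g s + M" using S(1) by (auto simp: M_def)
    then show ?thesis using affine_functional_hull_nonneg[OF lm, of S M x] that S(2) by simp
  qed
  have "g v \<le> M" using bound \<open>v \<in> Q\<close> by blast
  then have "v + (M - g v + 1) *\<^sub>R D \<in> Q" by (intro ray) simp
  then have "g (v + (M - g v + 1) *\<^sub>R D) \<le> M" by (rule bound)
  then show False using g by (simp add: linear_add linear_scale)
qed

lemma extreme_point_in_image:
  fixes f :: "'a::real_vector \<Rightarrow> 'b::real_vector"
  assumes V: "Q = convex hull V" and f: "linear f" "f ` Q \<subseteq> P" and p: "p \<in> vertices P" "p \<in> f ` Q"
  shows "p \<in> f ` V"
proof -
  have "f ` Q = convex hull (f ` V)" using V f(1) convex_hull_linear_image by blast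
  moreover have "p extreme_point_of (f ` Q)"
    using p f(2) by (auto simp: vertices_def extreme_point_of_def)
  ultimately show ?thesis using extreme_point_of_convex_hull by metis
qed

lemma facet_subset_eq:
  fixes Q :: "'a::real_vector set"
  assumes Q: "polytope Q" and F: "is_facet F Q" and G: "is_facet G Q" and "F \<subseteq> G"
  shows "F = G"
proof (rule ccontr)
  assume ne: "F \<noteq> G"
  have "F face_of Q" "F \<noteq> {}" "G face_of Q" using F G by (auto simp: is_facet_def)
  then have "F face_of G" 
    using face_of_subset[OF _ \<open>F \<subseteq> G\<close> face_of_imp_subset] by blast
  then have "adim F < adim G"
    by (rule adim_face_less[OF polytope_face[OF Q \<open>G face_of Q\<close>] _ \<open>F \<noteq> {}\<close> ne])
  then show False using F G by (simp add: is_facet_def)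
qed

text \<open>\<open>'n\<close> only serves to index the facets, hence the embedding \<open>h\<close>.\<close>

lemma polytope_slack_vectors:
  fixes Q :: "'a::real_vector set" and p :: "'a \<Rightarrow> 'b::real_vector" and h :: "'a set \<Rightarrow> 'n::finite"
  assumes Q: "polytope Q" and p: "linear p" and h: "inj_on h {F. is_facet F Q}"
    and two: "v1 \<in> vertices Q" "v2 \<in> vertices Q" "v1 \<noteq> v2"
  obtains y :: "'a \<Rightarrow> real^'n" and pt ht where
    "slack_vectors (y ` vertices Q) (h ` {F. is_facet F Q}) pt ht"
    "inj_on y (vertices Q)" "\<And>v. v \<in> vertices Q \<Longrightarrow> pt (y v) = p v"
proof -
  define V where "V = vertices Q"
  define \<Phi> where "\<Phi> = {F. is_facet F Q}"
  have V: "finite V" "Q = convex hull V" using polytope_vertices[OF Q] by (auto simp: V_def)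
  have VQ: "V \<subseteq> Q" using V(2) hull_subset by metis
  have fin\<Phi>: "finite \<Phi>" using finite_facets[OF Q] by (simp add: \<Phi>_def)
  obtain f c where fc: "\<And>F. is_facet F Q \<Longrightarrow> linear (f F)"
    "\<And>F x. is_facet F Q \<Longrightarrow> x \<in> Q \<Longrightarrow> 0 \<le> f F x + c F"
    "\<And>F. is_facet F Q \<Longrightarrow> F = {x\<in>Q. f F x + c F = (0::real)}"
    "\<And>x. x \<in> affine hull Q \<Longrightarrow> (\<And>F. is_facet F Q \<Longrightarrow> 0 \<le> f F x + c F) \<Longrightarrow> x \<in> Q"
    by (rule facet_description[OF Q]) blast
  have lf: "linear (f F)" if "F \<in> \<Phi>" for F using fc(1) that by (simp add: \<Phi>_def)
  have nonneg: "0 \<le> f F x + c F" if "F \<in> \<Phi>" "x \<in> Q" for F x using fc(2) that by (simp add: \<Phi>_def)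
  have in_facet: "x \<in> F \<longleftrightarrow> f F x + c F = 0" if "F \<in> \<Phi>" "x \<in> Q" for F x
    using fc(3)[of F] that by (auto simp: \<Phi>_def)
  have inQ: "x \<in> Q" if "x \<in> affine hull Q" "\<And>F. F \<in> \<Phi> \<Longrightarrow> 0 \<le> f F x + c F" for x
    using fc(4) that by (simp add: \<Phi>_def)
  define y where "y v = (\<Sum>F\<in>\<Phi>. axis (h F) (f F v + c F))" for v :: 'a
  have ynth: "y v $ h F = f F v + c F" if F: "F \<in> \<Phi>" for v F
  proof -
    have "y v $ h F = (\<Sum>G\<in>\<Phi>. if G = F then f G v + c G else 0)"
      unfolding y_def sum_component
      by (rule sum.cong) (use h F in \<open>auto simp: axis_def \<Phi>_def inj_on_eq_iff\<close>)
    then show ?thesis using fin\<Phi> F by simp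
  qed
  have yoff: "y v $ i = 0" if "i \<notin> h ` \<Phi>" for v i
    unfolding y_def sum_component by (rule sum.neutral) (use that in \<open>auto simp: axis_def\<close>)
  \<comment> \<open>For coefficients \<open>a\<close> on the vertices, \<open>X a\<close> is the
    combined point, \<open>t a\<close> the total weight and \<open>x a\<close> the combined slack
    vector.\<close>
  define X where "X a = (\<Sum>v\<in>V. a v *\<^sub>R v)" for a :: "'a \<Rightarrow> real"
  define t where "t a = (\<Sum>v\<in>V. a v)" for a :: "'a \<Rightarrow> real"
  define x where "x a = (\<Sum>v\<in>V. a v *\<^sub>R y v)" for a :: "'a \<Rightarrow> real"
  have xnth: "x a $ h F = f F (X a) + c F * t a" if F: "F \<in> \<Phi>" for a F
    by (simp add: x_def X_def t_def ynth[OF F] linear_sum[OF lf[OF F]] linear_scale[OF lf[OF F]]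
        sum_distrib_left distrib_left sum.distrib mult.commute)
  have aff_hull: "v + s *\<^sub>R (X a - t a *\<^sub>R v) \<in> affine hull Q" if v: "v \<in> V" for v s a
  proof -
    have "v + s *\<^sub>R (X a - t a *\<^sub>R v) = (\<Sum>u\<in>V. (s * a u + (if u = v then 1 - s * t a else 0)) *\<^sub>R u)"
    proof -
      have "(\<Sum>u\<in>V. (if u = v then 1 - s * t a else 0) *\<^sub>R u) = (\<Sum>u\<in>V. if u = v then (1 - s * t a) *\<^sub>R u else 0)"
        by (rule sum.cong) auto
      then have "(\<Sum>u\<in>V. (if u = v then 1 - s * t a else 0) *\<^sub>R u) = (1 - s * t a) *\<^sub>R v" using V v by simp
      then show ?thesis
        by (simp add: scaleR_add_left sum.distrib X_def scaleR_sum_right algebra_simps)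
    qed
    moreover have "(\<Sum>u\<in>V. s * a u + (if u = v then 1 - s * t a else 0)) = 1"
      using V v by (simp add: sum.distrib t_def sum_distrib_left)
    ultimately have "v + s *\<^sub>R (X a - t a *\<^sub>R v) \<in> affine hull V"
      using sum_in_affine_hull[OF V(1)] by simp
    then show ?thesis by (simp add: V(2))
  qed
  have fD: "f F (v + s *\<^sub>R (X a - t a *\<^sub>R v)) + c F = (f F v + c F) + s * (x a $ h F - t a * (f F v + c F))"
    if "F \<in> \<Phi>" for F v s a
    using xnth[OF that, of a] lf[OF that] by (simp add: linear_add linear_diff linear_scale algebra_simps)
  \<comment> \<open>If the combination has slack 0 on all facets through \<open>v\<close>, then
    \<open>Q\<close> contains small steps from \<open>v\<close> along \<open>D\<close> and along
    \<open>- D\<close>, so \<open>D = 0\<close> by extremality.\<close>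
  have extr: "X a = t a *\<^sub>R v" if v: "v \<in> V" and zero: "\<And>F. F \<in> \<Phi> \<Longrightarrow> v \<in> F \<Longrightarrow> x a $ h F = 0" for v a
  proof (rule ccontr)
    assume ne: "X a \<noteq> t a *\<^sub>R v"
    define D where "D = X a - t a *\<^sub>R v"
    have D0: "D \<noteq> 0" using ne by (simp add: D_def)
    have vQ: "v \<in> Q" using v VQ by blast
    have fd: "f F D = 0" if F: "F \<in> \<Phi>" "f F v + c F = 0" for F
      using fD[OF F(1), of v 1 a] zero[OF F(1)] in_facet[OF F(1) vQ] F(2) linear_add[OF lf[OF F(1)]]
      by (simp add: D_def)
    obtain e1 where e1: "0 < e1" "\<And>F s. F \<in> \<Phi> \<Longrightarrow> 0 \<le> s \<Longrightarrow> s \<le> e1 \<Longrightarrow> 0 \<le> f F (v + s *\<^sub>R D) + c F"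
      by (rule polyhedral_extend[OF fin\<Phi> lf nonneg[OF _ vQ], of "\<lambda>F. F" D]) (use fd in auto)
    obtain e2 where e2: "0 < e2" "\<And>F s. F \<in> \<Phi> \<Longrightarrow> 0 \<le> s \<Longrightarrow> s \<le> e2 \<Longrightarrow> 0 \<le> f F (v + s *\<^sub>R (- D)) + c F"
      by (rule polyhedral_extend[OF fin\<Phi> lf nonneg[OF _ vQ], of "\<lambda>F. F" "- D"])
        (use fd lf in \<open>auto simp: linear_neg\<close>)
    define e where "e = min e1 e2"
    have e: "0 < e" "e \<le> e1" "e \<le> e2" using e1 e2 by (auto simp: e_def)
    have a1: "v + e *\<^sub>R D \<in> Q"
      using e1(2)[of _ e] e aff_hull[OF v, of e a] by (intro inQ) (auto simp: D_def)
    have a2: "v + (- e) *\<^sub>R D \<in> Q"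
    proof (rule inQ)
      show "v + (- e) *\<^sub>R D \<in> affine hull Q" using aff_hull[OF v, of "- e" a] by (simp only: D_def)
      have "v + (- e) *\<^sub>R D = v + e *\<^sub>R (- D)" by simp
      then show "0 \<le> f F (v + (- e) *\<^sub>R D) + c F" if "F \<in> \<Phi>" for F
        using e2(2)[OF that, of e] e by (simp only: less_imp_le)
    qed
    have "v = (1 - 1/2) *\<^sub>R (v + e *\<^sub>R D) + (1/2) *\<^sub>R (v + (- e) *\<^sub>R D)"
    proof -
      have "(1/2) *\<^sub>R v + (1/2) *\<^sub>R v = v" unfolding scaleR_left_distrib[symmetric] by simp
      then show ?thesis by (simp add: scaleR_add_right scaleR_diff_right)
    qed
    moreover have "v + e *\<^sub>R D \<noteq> v + (- e) *\<^sub>R D"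
    proof
      assume "v + e *\<^sub>R D = v + (- e) *\<^sub>R D"
      then have "e *\<^sub>R D + e *\<^sub>R D = 0" by (simp add: eq_neg_iff_add_eq_0)
      then have "(e + e) *\<^sub>R D = 0" unfolding scaleR_left_distrib .
      then show False using e(1) D0 by simp
    qed
    ultimately have "v \<in> open_segment (v + e *\<^sub>R D) (v + (- e) *\<^sub>R D)"
      unfolding in_segment(2) by (intro conjI exI[of _ "1/2"]) auto
    then show False using v a1 a2 by (auto simp: V_def vertices_def extreme_point_of_def)
  qed
  have two': "v1 \<in> V" "v2 \<in> V" using two by (auto simp: V_def)
  \<comment> \<open>\<open>X a\<close> cannot be the same nonzero multiple of two distinct vertices;
    this is what lets the slack vector determine the weight.\<close>
  have zero_if: "X a = 0 \<and> t a = 0" if "X a = t a *\<^sub>R v1" "X a = t a *\<^sub>R v2" for a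
  proof -
    have "t a *\<^sub>R v1 = t a *\<^sub>R v2" using that by (simp only:)
    then have "t a = 0" using two(3) by simp
    then show ?thesis using that(1) by simp
  qed
  have rel: "(\<Sum>v\<in>V. a v *\<^sub>R (v, 1::real)) = 0" if "(\<Sum>v\<in>V. a v *\<^sub>R y v) = 0" for a
  proof -
    have "x a = 0" using that by (simp add: x_def)
    have "X a = t a *\<^sub>R v1" by (rule extr[OF two'(1)]) (simp add: \<open>x a = 0\<close>)
    moreover have "X a = t a *\<^sub>R v2" by (rule extr[OF two'(2)]) (simp add: \<open>x a = 0\<close>)
    ultimately have "X a = 0" "t a = 0" using zero_if by blast+
    then show ?thesis unfolding sum_fst_snd_pair by (simp add: X_def t_def zero_prod_def)
  qed
  \<comment> \<open>Recovers point and weight from a slack vector; \<open>pt\<close> and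
    \<open>ht\<close> are built from its two components.\<close>
  obtain g where g: "linear g" "\<And>v. v \<in> V \<Longrightarrow> g (y v) = (v, 1::real)"
    by (rule linear_map_from_relations[of V y "\<lambda>v. (v, 1::real)", OF V(1) rel]) blast+
  have inj_y: "inj_on y V" by (rule inj_onI) (metis g(2) fst_conv)
  \<comment> \<open>A positive weight allows normalising to a point that satisfies all facet
    inequalities. For weight at most 0, nonnegative slacks make \<open>X a - t a *\<^sub>R v\<close>
    the direction of a ray in \<open>Q\<close>, hence 0.\<close>
  have cone: "\<exists>d. (\<forall>v\<in>V. 0 \<le> d v) \<and> x a = x d" if pos: "\<And>F. F \<in> \<Phi> \<Longrightarrow> 0 \<le> x a $ h F" for a
  proof (cases "0 < t a")
    case True
    define w where "w = (1 / t a) *\<^sub>R X a"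
    have "w = (\<Sum>v\<in>V. (a v / t a) *\<^sub>R v)" by (simp add: w_def X_def scaleR_sum_right)
    moreover have "(\<Sum>v\<in>V. a v / t a) = 1" using True by (simp add: t_def sum_divide_distrib[symmetric])
    ultimately have "w \<in> affine hull Q"
      using sum_in_affine_hull[OF V(1), of "\<lambda>v. a v / t a"] by (simp add: V(2))
    moreover have "0 \<le> f F w + c F" if F: "F \<in> \<Phi>" for F
    proof -
      have "f F w + c F = (x a $ h F) / t a"
        using xnth[OF F, of a] True by (simp add: w_def linear_scale[OF lf[OF F]] field_simps)
      then show ?thesis using pos[OF F] True by simp
    qed
    ultimately have "w \<in> convex hull V" using inQ V(2) by blast
    then obtain u where u: "\<forall>v\<in>V. 0 \<le> u v" "sum u V = 1" "(\<Sum>v\<in>V. u v *\<^sub>R v) = w"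
      unfolding convex_hull_finite[OF V(1)] by blast
    define d where "d v = t a * u v" for v
    have "X d = t a *\<^sub>R w" unfolding u(3)[symmetric] by (simp add: X_def d_def scaleR_sum_right)
    then have "X d = X a" using True by (simp add: w_def)
    moreover have "t d = t a" using u(2) by (simp add: t_def d_def sum_distrib_left[symmetric])
    ultimately have "x a $ i = x d $ i" for i
      using xnth yoff by (cases "i \<in> h ` \<Phi>") (auto simp: x_def)
    then have "x a = x d" by (simp add: vec_eq_iff)
    then show ?thesis using u(1) True by (intro exI[of _ d]) (auto simp: d_def)
  next
    case False
    have "X a = t a *\<^sub>R v" if v: "v \<in> V" for v
    proof -
      have vQ: "v \<in> Q" using v VQ by blast
      have "v + s *\<^sub>R (X a - t a *\<^sub>R v) \<in> Q" if s: "0 \<le> s" for s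
      proof (rule inQ[OF aff_hull[OF v]])
        fix F assume F: "F \<in> \<Phi>"
        have "0 \<le> x a $ h F - t a * (f F v + c F)"
          using pos[OF F] nonneg[OF F vQ] False mult_nonpos_nonneg[of "t a" "f F v + c F"] by simp
        then show "0 \<le> f F (v + s *\<^sub>R (X a - t a *\<^sub>R v)) + c F"
          unfolding fD[OF F] using nonneg[OF F vQ] s by simp
      qed
      then have "X a - t a *\<^sub>R v = 0" by (rule polytope_no_ray[OF Q])
      then show ?thesis by simp
    qed
    then have "X a = 0" "t a = 0" using zero_if two' by blast+
    then have "x a $ i = 0" for i
      using xnth yoff linear_0[OF lf] by (cases "i \<in> h ` \<Phi>") (auto simp: x_def)
    then have "x a = x (\<lambda>_. 0)" by (simp add: vec_eq_iff x_def)
    then show ?thesis by (intro exI[of _ "\<lambda>_. 0"]) simp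
  qed
  have span_x: "\<exists>a. w = x a" if "w \<in> span (y ` V)" for w
    using span_image_sum[OF V(1) that] by (auto simp: x_def)
  have facet_vertex: "\<exists>v\<in>V. v \<in> F \<and> v \<notin> G" if FG: "F \<in> \<Phi>" "G \<in> \<Phi>" "F \<noteq> G" for F G
  proof (rule ccontr)
    assume "\<not> ?thesis"
    then have "V \<inter> F \<subseteq> G" by blast
    moreover have "F = convex hull (V \<inter> F)" "convex G"
      using face_of_convex_hull_finite[OF V(1)] FG V(2) face_of_imp_convex by (auto simp: \<Phi>_def is_facet_def)
    ultimately have "F \<subseteq> G" by (metis hull_minimal)
    then show False using facet_subset_eq[OF Q] FG by (auto simp: \<Phi>_def)
  qed
  have facet_vertex': "\<exists>v\<in>V. v \<notin> F" if F: "F \<in> \<Phi>" for F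
  proof (rule ccontr)
    assume "\<not> ?thesis"
    then have "V \<subseteq> F" by blast
    moreover have "F face_of Q" using F by (simp add: \<Phi>_def is_facet_def)
    ultimately have "Q \<subseteq> F" "F \<subseteq> Q"
      using V(2) hull_minimal[of V F convex] face_of_imp_convex[of F Q] face_of_imp_subset[of F Q] by blast+
    then show False using F by (simp add: \<Phi>_def is_facet_def)
  qed
  have "slack_vectors (y ` V) (h ` \<Phi>) (\<lambda>w. p (fst (g w))) (\<lambda>w. snd (g w))"
  proof (rule slack_vectors.intro)
    show "linear (\<lambda>w. p (fst (g w)))"
      using linear_compose[OF linear_compose[OF g(1) linear_fst] p] by (simp add: o_def)
    show "linear (\<lambda>w. snd (g w))"
      using linear_compose[OF g(1) linear_snd] by (simp add: o_def)
    show "finite (y ` V)" using V(1) by simp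
    show "snd (g w) = 1" if "w \<in> y ` V" for w using that g(2) by auto
    show "0 \<le> w $ i" if "w \<in> y ` V" for w i
      using that VQ nonneg ynth yoff by (cases "i \<in> h ` \<Phi>") auto
    show "w $ i = 0" if "w \<in> y ` V" "i \<notin> h ` \<Phi>" for w i using that yoff by auto
    show "\<exists>k. u = k *\<^sub>R w" if w: "w \<in> y ` V" "u \<in> span (y ` V)" "\<And>i. w $ i = 0 \<Longrightarrow> u $ i = 0" for w u
    proof -
      obtain v where v: "v \<in> V" "w = y v" using w(1) by blast
      obtain a where a: "u = x a" using span_x w(2) by blast
      have "X a = t a *\<^sub>R v"
      proof (rule extr[OF v(1)])
        fix F assume F: "F \<in> \<Phi>" "v \<in> F"
        then have "w $ h F = 0" using ynth in_facet v VQ by auto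
        then show "x a $ h F = 0" using w(3) a by blast
      qed
      then have "x a $ h F = t a * (y v $ h F)" if F: "F \<in> \<Phi>" for F
        using xnth[OF F] ynth[OF F] by (simp add: linear_scale[OF lf[OF F]] algebra_simps)
      then have "x a $ i = t a * (y v $ i)" for i
        using yoff by (cases "i \<in> h ` \<Phi>") (auto simp: x_def)
      then have "u = t a *\<^sub>R w" by (simp add: a v vec_eq_iff)
      then show ?thesis by blast
    qed
    show "\<exists>d. (\<forall>w\<in>y ` V. 0 \<le> d w) \<and> u = (\<Sum>w\<in>y ` V. d w *\<^sub>R w)"
      if u: "u \<in> span (y ` V)" "\<And>i. 0 \<le> u $ i" for u
    proof -
      obtain a where a: "u = x a" using span_x u(1) by blast
      obtain d where d: "\<forall>v\<in>V. 0 \<le> d v" "x a = x d" using cone[of a] u(2) a by blast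
      have "(\<Sum>w\<in>y ` V. d (the_inv_into V y w) *\<^sub>R w) = x d"
        using inj_y by (simp add: sum.reindex x_def the_inv_into_f_f)
      then show ?thesis using a d inj_y
        by (intro exI[of _ "\<lambda>w. d (the_inv_into V y w)"]) (auto simp: the_inv_into_f_f)
    qed
    show "\<exists>w\<in>y ` V. w $ i = 0 \<and> 0 < w $ j" if ij: "i \<in> h ` \<Phi>" "j \<in> h ` \<Phi>" "i \<noteq> j" for i j
    proof -
      obtain F G where FG: "F \<in> \<Phi>" "G \<in> \<Phi>" "i = h F" "j = h G" using ij by blast
      then have "F \<noteq> G" using ij(3) by auto
      then obtain v where v: "v \<in> V" "v \<in> F" "v \<notin> G" using facet_vertex FG by blast
      then have "v \<in> Q" using VQ by blast
      then have "f F v + c F = 0" "f G v + c G \<noteq> 0" "0 \<le> f G v + c G"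
        using v in_facet FG nonneg by auto
      then show ?thesis using v(1) FG ynth by (intro bexI[of _ "y v"]) auto
    qed
    show "\<exists>w\<in>y ` V. 0 < w $ i" if i: "i \<in> h ` \<Phi>" for i
    proof -
      obtain F where F: "F \<in> \<Phi>" "i = h F" using i by blast
      obtain v where v: "v \<in> V" "v \<notin> F" using facet_vertex'[OF F(1)] by blast
      then have "v \<in> Q" using VQ by blast
      then have "f F v + c F \<noteq> 0" "0 \<le> f F v + c F" using v in_facet F nonneg by auto
      then show ?thesis using v(1) F ynth by (intro bexI[of _ "y v"]) auto
    qed
  qed
  then show ?thesis
    using that[of y "\<lambda>w. p (fst (g w))" "\<lambda>w. snd (g w)"] inj_y g(2) by (simp add: V_def \<Phi>_def)
qed

text \<open>With slack vectors indexed by the type \<open>6\<close> there are at most nine vertices,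
  so a single bad one suffices for the ratio, and its absence is what
  \<open>slack_heptagon_False\<close> refutes.\<close>

theorem heptagon_extension_bound:
  fixes Q :: "'a::real_vector set" and p :: "'a \<Rightarrow> real^2"
  assumes P: "convex P" "card (vertices P) = 7" "general_position P"
    and Q: "polytope Q" and p: "linear p" "p ` Q \<subseteq> P" "vertices P \<subseteq> p ` Q"
  shows "6 \<le> psize Q \<and>
    (psize Q \<le> 6 \<longrightarrow> card (vertices Q) \<le> 9 * card {v\<in>vertices Q. p v \<notin> vertices P})"
proof (cases "psize Q \<le> 6")
  case True
  let ?V = "vertices Q" and ?\<Phi> = "{F. is_facet F Q}"
  have V: "finite ?V" "Q = convex hull ?V" using polytope_vertices[OF Q] by auto
  have sub: "vertices P \<subseteq> p ` ?V"
    using extreme_point_in_image[OF V(2) p(1,2)] p(3) by blast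
  have "card (vertices P) \<le> card (p ` ?V)" using sub V(1) by (intro card_mono) auto
  then have V7: "7 \<le> card ?V" using P(2) card_image_le[OF V(1), of p] by simp
  then have "2 \<le> card ?V" by simp
  then obtain T where "T \<subseteq> ?V" "card T = 2" by (rule obtain_subset_with_card_n)
  then obtain v1 v2 where two: "v1 \<in> ?V" "v2 \<in> ?V" "v1 \<noteq> v2" by (auto simp: card_2_iff)
  have "card ?\<Phi> \<le> card (UNIV :: 6 set)" using True by (simp add: psize_def)
  then obtain h :: "'a set \<Rightarrow> 6" where h: "inj_on h ?\<Phi>"
    using card_le_inj[OF finite_facets[OF Q] finite[of UNIV]] by blast
  obtain y :: "'a \<Rightarrow> real^6" and pt ht where y: "slack_vectors (y ` ?V) (h ` ?\<Phi>) pt ht"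
    "inj_on y ?V" "\<And>v. v \<in> ?V \<Longrightarrow> pt (y v) = p v"
    by (rule polytope_slack_vectors[OF Q p(1) h two]) blast
  interpret slack_vectors "y ` ?V" "h ` ?\<Phi>" pt ht by (rule y(1))
  have cI: "card (h ` ?\<Phi>) = psize Q" using card_image[OF h] by (simp add: psize_def)
  have cY: "card (y ` ?V) = card ?V" using card_image[OF y(2)] .
  have I6: "card (h ` ?\<Phi>) \<le> 6" "finite (h ` ?\<Phi>)" using True cI by simp_all
  have "\<not> psize Q \<le> 5"
  proof
    assume "psize Q \<le> 5"
    then show False using card_slack_vectors(2)[OF I6] cI cY V7 by simp
  qed
  moreover have "card ?V \<le> 9 * card {v\<in>?V. p v \<notin> vertices P}"
  proof (cases "{v\<in>?V. p v \<notin> vertices P} = {}")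
    case True
    then have "p ` ?V = vertices P" using sub by auto
    moreover have "pt ` y ` ?V = p ` ?V" using y(3) by (simp add: image_image)
    ultimately interpret heptagon_slack "y ` ?V" "h ` ?\<Phi>" pt ht P
      by unfold_locales (use P in auto)
    show ?thesis using slack_heptagon_False[OF I6] by simp
  next
    case False
    then have "1 \<le> card {v\<in>?V. p v \<notin> vertices P}" using V(1) by (simp add: Suc_le_eq card_gt_0_iff)
    then show ?thesis using card_slack_vectors(1)[OF I6] cY by simp
  qed
  ultimately show ?thesis by simp
qed simp

section \<open>Lifting a heptagon to a polytope with six facets\<close>

definition orient :: "real^2 \<Rightarrow> real^2 \<Rightarrow> real^2 \<Rightarrow> real" where
  "orient a b c = (b$1 - a$1) * (c$2 - a$2) - (b$2 - a$2) * (c$1 - a$1)"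

lemma orient_rotate: "orient a b c = orient b c a"
  by (simp add: orient_def algebra_simps)

lemma orient_swap: "orient a b c = - orient b a c"
  by (simp add: orient_def algebra_simps)

lemma orient_degenerate [simp]: "orient a a b = 0" "orient a b b = 0" "orient a b a = 0"
  by (simp_all add: orient_def)

text \<open>The three-term Pluecker relation for the vectors from \<open>x\<close> to the other four
  points.\<close>

lemma orient_pluecker:
  "orient x a c * orient x b d = orient x a b * orient x c d + orient x a d * orient x b c"
  by (simp add: orient_def algebra_simps)

lemma orient_barycentric:
  "orient a b c *\<^sub>R x = orient x b c *\<^sub>R a + orient a x c *\<^sub>R b + orient a b x *\<^sub>R c"
  by (simp add: vec_eq_iff forall_2 orient_def algebra_simps)

lemma convex_weighted_three:
  assumes "convex S" "a \<in> S" "b \<in> S" "c \<in> S" "0 \<le> \<alpha>" "0 \<le> \<beta>" "0 \<le> \<gamma>" "0 < \<delta>"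
    "\<delta> = \<alpha> + \<beta> + \<gamma>" and eq: "\<delta> *\<^sub>R x = \<alpha> *\<^sub>R a + \<beta> *\<^sub>R b + \<gamma> *\<^sub>R c"
  shows "x \<in> S"
proof -
  have "(1 / \<delta>) *\<^sub>R (\<delta> *\<^sub>R x) = (1 / \<delta>) *\<^sub>R (\<alpha> *\<^sub>R a + \<beta> *\<^sub>R b + \<gamma> *\<^sub>R c)" using eq by simp
  then have x: "x = (\<alpha> / \<delta>) *\<^sub>R a + (\<beta> / \<delta>) *\<^sub>R b + (\<gamma> / \<delta>) *\<^sub>R c" using assms(8) by (simp add: scaleR_add_right)
  have "\<alpha> / \<delta> + \<beta> / \<delta> + \<gamma> / \<delta> = 1" using assms(8,9) by (simp add: add_divide_distrib[symmetric])
  moreover have "0 \<le> \<alpha> / \<delta>" "0 \<le> \<beta> / \<delta>" "0 \<le> \<gamma> / \<delta>" using assms by simp_all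
  ultimately show ?thesis
    using convex_sum[of "{0, 1, 2::nat}" S "\<lambda>i. if i = 0 then \<alpha> / \<delta> else if i = 1 then \<beta> / \<delta> else \<gamma> / \<delta>"
      "\<lambda>i. if i = 0 then a else if i = 1 then b else c"] assms x by (simp add: add.assoc)
qed

lemma extreme_not_weighted_three:
  fixes P :: "'a::real_vector set"
  assumes P: "convex P" and ext: "p \<in> vertices P" and S: "a \<in> P" "b \<in> P" "c \<in> P"
    and pos: "0 < \<alpha>" "0 < \<beta>" "0 < \<gamma>" and eq: "(\<alpha> + \<beta> + \<gamma>) *\<^sub>R p = \<alpha> *\<^sub>R a + \<beta> *\<^sub>R b + \<gamma> *\<^sub>R c"
  shows "a = p"
proof (rule ccontr)
  assume "a \<noteq> p"
  define m where "m = (\<beta> / (\<beta> + \<gamma>)) *\<^sub>R b + (\<gamma> / (\<beta> + \<gamma>)) *\<^sub>R c"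
  have "\<beta> / (\<beta> + \<gamma>) + \<gamma> / (\<beta> + \<gamma>) = 1" using pos by (simp add: add_divide_distrib[symmetric])
  then have mP: "m \<in> P" unfolding m_def using P S pos by (intro convexD) auto
  have mb: "(\<beta> + \<gamma>) *\<^sub>R m = \<beta> *\<^sub>R b + \<gamma> *\<^sub>R c" using pos by (simp add: m_def scaleR_add_right)
  define \<delta> where "\<delta> = \<alpha> + \<beta> + \<gamma>"
  have \<delta>: "0 < \<delta>" using pos by (simp add: \<delta>_def)
  have "\<delta> *\<^sub>R p = \<alpha> *\<^sub>R a + (\<beta> + \<gamma>) *\<^sub>R m" unfolding mb \<delta>_def eq by (simp add: add.assoc)
  then have "(1 / \<delta>) *\<^sub>R (\<delta> *\<^sub>R p) = (1 / \<delta>) *\<^sub>R (\<alpha> *\<^sub>R a + (\<beta> + \<gamma>) *\<^sub>R m)" by simp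
  then have p: "p = (\<alpha> / \<delta>) *\<^sub>R a + ((\<beta> + \<gamma>) / \<delta>) *\<^sub>R m" using \<delta> by (simp add: scaleR_add_right)
  have al: "\<alpha> / \<delta> = 1 - (\<beta> + \<gamma>) / \<delta>" using \<delta> by (simp add: \<delta>_def field_simps)
  show False
  proof (cases "m = a")
    case True
    then have "p = a" using p unfolding al by (simp add: algebra_simps)
    then show False using \<open>a \<noteq> p\<close> by simp
  next
    case False
    have "p \<in> open_segment a m"
      unfolding in_segment(2) using False p al pos \<delta>
      by (intro conjI exI[of _ "(\<beta> + \<gamma>) / \<delta>"]) (auto simp: \<delta>_def)
    then show False using ext S(1) mP by (auto simp: vertices_def extreme_point_of_def)
  qed
qed

lemma strict_order_enumeration:
  assumes A: "finite A" and irr: "\<And>x. x \<in> A \<Longrightarrow> \<not> R x x"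
    and trans: "\<And>x y z. x \<in> A \<Longrightarrow> y \<in> A \<Longrightarrow> z \<in> A \<Longrightarrow> R x y \<Longrightarrow> R y z \<Longrightarrow> R x z"
    and total: "\<And>x y. x \<in> A \<Longrightarrow> y \<in> A \<Longrightarrow> x \<noteq> y \<Longrightarrow> R x y \<or> R y x"
  obtains e where "bij_betw e {..<card A} A" "\<And>i j. i < j \<Longrightarrow> j < card A \<Longrightarrow> R (e i) (e j)"
proof -
  define r where "r x = card {y\<in>A. R y x}" for x
  have mono: "r x < r y" if "x \<in> A" "y \<in> A" "R x y" for x y
  proof -
    have "{z\<in>A. R z x} \<subset> {z\<in>A. R z y}" using that trans irr by blast
    then show ?thesis unfolding r_def using A by (intro psubset_card_mono) auto
  qed
  have inj: "inj_on r A" by (rule inj_onI) (metis mono total less_irrefl)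
  have "r ` A \<subseteq> {..<card A}"
  proof safe
    fix x assume x: "x \<in> A"
    have "{y\<in>A. R y x} \<subset> A" using x irr by blast
    then show "r x < card A" unfolding r_def using A by (intro psubset_card_mono) auto
  qed
  then have "r ` A = {..<card A}" using card_image[OF inj] by (intro card_seteq) auto
  then have bij: "bij_betw r A {..<card A}" using inj by (simp add: bij_betw_def)
  define e where "e = the_inv_into A r"
  have be: "bij_betw e {..<card A} A" unfolding e_def by (rule bij_betw_the_inv_into[OF bij])
  have re: "r (e i) = i" if "i < card A" for i
    unfolding e_def using f_the_inv_into_f_bij_betw[OF bij] that by simp
  have "R (e i) (e j)" if "i < j" "j < card A" for i j
  proof -
    have eA: "e i \<in> A" "e j \<in> A" using be that by (auto simp: bij_betw_def)
    moreover have "e i \<noteq> e j" using re that by (metis less_irrefl less_trans)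
    ultimately have "R (e i) (e j) \<or> R (e j) (e i)" by (rule total)
    then show ?thesis using mono[OF eA(2,1)] re that by fastforce
  qed
  then show ?thesis using that be by blast
qed

text \<open>The other six vertices are sorted by angle around \<open>v0\<close>. No vertex lies
  inside a triangle of others, so this comparison is transitive and the sorted order is the convex
  one. Residues modulo 7 make the indices cyclic.\<close>

lemma convex_heptagon_cyclic_order:
  assumes P: "convex P" and c7: "card (vertices P) = 7"
  obtains v :: "nat \<Rightarrow> real^2" where "v ` {..<7} = vertices P" "\<And>i. v (i + 7) = v i"
    "\<And>i j k. i < j \<Longrightarrow> j < k \<Longrightarrow> k < i + 7 \<Longrightarrow> 0 < orient (v i) (v j) (v k)"
proof -
  let ?V = "vertices P"
  have finV: "finite ?V" using c7 card.infinite by fastforce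
  have VP: "?V \<subseteq> P" by (auto simp: vertices_def extreme_point_of_def)
  have nz: "orient a b c \<noteq> 0" if abc: "a \<in> ?V" "b \<in> ?V" "c \<in> ?V" "a \<noteq> b" "a \<noteq> c" "b \<noteq> c" for a b c
  proof
    assume z: "orient a b c = 0"
    define q where "q = c - a"
    have "(b - a) $ 1 * q $ 2 = (b - a) $ 2 * q $ 1" using z by (simp add: orient_def q_def)
    then have e: "q $ i *\<^sub>R (b - a) = (b - a) $ i *\<^sub>R q" for i
      by (cases i rule: exhaust_2[THEN disjE]) (auto simp: vec_eq_iff forall_2 algebra_simps)
    have "q \<noteq> 0" using abc(5) by (simp add: q_def)
    then obtain i where i: "q $ i \<noteq> 0" by (auto simp: vec_eq_iff)
    have "((b - a) $ i - q $ i) *\<^sub>R a + q $ i *\<^sub>R b + (- (b - a) $ i) *\<^sub>R c = q $ i *\<^sub>R (b - a) - (b - a) $ i *\<^sub>R q"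
      by (simp add: q_def algebra_simps)
    also have "\<dots> = 0" using e by simp
    finally have "q $ i = 0"
      using extreme_points_indep3[OF abc, of "(b - a) $ i - q $ i" "q $ i" "- (b - a) $ i"] by simp
    then show False using i by simp
  qed
  have "?V \<noteq> {}" using c7 by auto
  then obtain v0 where v0: "v0 \<in> ?V" by blast
  let ?A = "?V - {v0}"
  have cA: "card ?A = 6" using c7 v0 by simp
  \<comment> \<open>A point to the left of all three sides has positive barycentric coordinates,
    which an extreme point different from the corners cannot have.\<close>
  have no_around: False
    if "a \<in> ?V" "b \<in> ?V" "c \<in> ?V" "p \<in> ?V" "a \<noteq> p" "0 < orient p b c" "0 < orient a p c" "0 < orient a b p" for a b c p
  proof -
    have "orient a b c = orient p b c + orient a p c + orient a b p" by (simp add: orient_def algebra_simps)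
    then have "(orient p b c + orient a p c + orient a b p) *\<^sub>R p
        = orient p b c *\<^sub>R a + orient a p c *\<^sub>R b + orient a b p *\<^sub>R c"
      using orient_barycentric[of a b c p] by simp
    then have "a = p"
      using that VP by (intro extreme_not_weighted_three[OF P, of p a b c]) auto
    then show False using that by simp
  qed
  obtain e where e: "bij_betw e {..<card ?A} ?A"
    "\<And>i j. i < j \<Longrightarrow> j < card ?A \<Longrightarrow> 0 < orient v0 (e i) (e j)"
  proof (rule strict_order_enumeration[of ?A "\<lambda>x y. 0 < orient v0 x y"])
    show "finite ?A" using finV by simp
    show "\<not> 0 < orient v0 x x" for x by simp
    show "0 < orient v0 x y \<or> 0 < orient v0 y x" if "x \<in> ?A" "y \<in> ?A" "x \<noteq> y" for x y
    proof -
      have "orient v0 x y \<noteq> 0" using nz[of v0 x y] v0 that by auto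
      moreover have "orient v0 y x = - orient v0 x y" by (simp add: orient_def algebra_simps)
      ultimately show ?thesis by linarith
    qed
    show "0 < orient v0 x z" if "x \<in> ?A" "y \<in> ?A" "z \<in> ?A" "0 < orient v0 x y" "0 < orient v0 y z" for x y z
    proof (rule ccontr)
      assume neg: "\<not> 0 < orient v0 x z"
      have "x \<noteq> z"
      proof
        assume "x = z"
        moreover have "orient v0 y x = - orient v0 x y" by (simp add: orient_def algebra_simps)
        ultimately show False using that(4,5) by simp
      qed
      then have "orient v0 x z \<noteq> 0" using nz[of v0 x z] v0 that by auto
      moreover have "orient v0 z x = - orient v0 x z" by (simp add: orient_def algebra_simps)
      ultimately have "0 < orient v0 z x" using neg by linarith
      then show False
        using no_around[of x y z v0] v0 that orient_rotate by (metis DiffE insertI1)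
    qed
  qed blast+
  define w where "w i = (if i = 0 then v0 else e (i - 1))" for i :: nat
  have we: "e i \<in> ?A" if "i < 6" for i using e(1) that cA by (auto simp: bij_betw_def)
  have "w ` {..<7} = ?V"
  proof
    show "w ` {..<7} \<subseteq> ?V" using v0 we by (auto simp: w_def)
    show "?V \<subseteq> w ` {..<7}"
    proof
      fix x assume x: "x \<in> ?V"
      show "x \<in> w ` {..<7}"
      proof (cases "x = v0")
        case True
        then show ?thesis by (intro image_eqI[of _ _ 0]) (auto simp: w_def)
      next
        case False
        then obtain i where "i < 6" "x = e i" using e(1) x cA by (auto simp: bij_betw_def)
        then show ?thesis by (intro image_eqI[of _ _ "Suc i"]) (auto simp: w_def)
      qed
    qed
  qed
  have pos: "0 < orient (w i) (w j) (w k)" if ijk: "i < j" "j < k" "k < 7" for i j k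
  proof (cases "i = 0")
    case True
    then show ?thesis using e(2)[of "j - 1" "k - 1"] ijk cA by (simp add: w_def)
  next
    case False
    define x y z where "x = e (i - 1)" and "y = e (j - 1)" and "z = e (k - 1)"
    have xyz: "x \<in> ?A" "y \<in> ?A" "z \<in> ?A" using we False ijk by (auto simp: x_def y_def z_def)
    have o: "0 < orient v0 x y" "0 < orient v0 y z" "0 < orient v0 x z"
      using e(2) False ijk cA by (auto simp: x_def y_def z_def)
    then have ne: "x \<noteq> y" "y \<noteq> z" "x \<noteq> z" by auto
    have "0 < orient x y z"
    proof (rule ccontr)
      assume "\<not> 0 < orient x y z"
      then have "orient x y z < 0" using nz[of x y z] xyz ne by auto
      then have "0 < orient y x z" using orient_swap[of x y z] by simp
      then show False
        using no_around[of v0 x z y] v0 xyz o by auto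
    qed
    then show ?thesis using False ijk by (simp add: w_def x_def y_def z_def)
  qed
  define v where "v i = w (i mod 7)" for i
  have "v ` {..<7} = w ` {..<7}" by (rule image_cong) (auto simp: v_def)
  moreover have "v (i + 7) = v i" for i by (simp add: v_def)
  moreover have "0 < orient (v i) (v j) (v k)" if ijk: "i < j" "j < k" "k < i + 7" for i j k
  proof -
    define q where "q = i div 7"
    define i0 where "i0 = i mod 7"
    define j1 where "j1 = j - 7 * q"
    define k1 where "k1 = k - 7 * q"
    have i: "i = 7 * q + i0" "i0 < 7" by (simp_all add: q_def i0_def)
    then have jk: "j = 7 * q + j1" "k = 7 * q + k1" "i0 < j1" "j1 < k1" "k1 < i0 + 7"
      using ijk by (auto simp: j1_def k1_def)
    have vv: "v i = w i0" "v j = w (j1 mod 7)" "v k = w (k1 mod 7)"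
      using i(2) unfolding v_def i(1) jk(1,2) by simp_all
    \<comment> \<open>After removing the full turns of \<open>i\<close>, later indices may still
      exceed 6; rotating the triple restores increasing order.\<close>
    consider "k1 < 7" | "j1 < 7" "7 \<le> k1" | "7 \<le> j1" by linarith
    then show ?thesis
    proof cases
      case 1
      then show ?thesis using pos[of i0 j1 k1] jk vv by simp
    next
      case 2
      then have "k1 mod 7 = k1 - 7" using jk i by (simp add: mod_if)
      then have "0 < orient (w (k1 - 7)) (w i0) (w j1)" using pos[of "k1 - 7" i0 j1] jk 2 by simp
      then show ?thesis using vv 2 \<open>k1 mod 7 = k1 - 7\<close> orient_rotate[of "w (k1 - 7)"] by simp
    next
      case 3
      then have m: "k1 mod 7 = k1 - 7" "j1 mod 7 = j1 - 7" using jk i by (simp_all add: mod_if)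
      then have "0 < orient (w (j1 - 7)) (w (k1 - 7)) (w i0)" using pos[of "j1 - 7" "k1 - 7" i0] jk 3 i by simp
      then show ?thesis using vv m orient_rotate[of "w i0"] by simp
    qed
  qed
  ultimately show ?thesis using that[of v] \<open>w ` {..<7} = ?V\<close> by simp
qed

section \<open>Existence of a good labelling\<close>

locale cyclic_heptagon =
  fixes v :: "nat \<Rightarrow> real^2"
  assumes periodic: "v (i + 7) = v i"
    and positive: "i < j \<Longrightarrow> j < k \<Longrightarrow> k < i + 7 \<Longrightarrow> 0 < orient (v i) (v j) (v k)"
begin

definition br :: "nat \<Rightarrow> nat \<Rightarrow> nat \<Rightarrow> real" where
  "br i j k = orient (v i) (v j) (v k)"

lemma br_periodic: "br (i + 7) (j + 7) (k + 7) = br i j k"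
  by (simp add: br_def periodic)

text \<open>The shift by 7 keeps indices increasing, so that \<open>br_pos\<close> and
  \<open>br_crossing\<close> still apply.\<close>

lemma br_rotate: "br i j k = br j k (i + 7)"
  by (simp add: br_def periodic orient_rotate[of "v i"])

lemma br_pos: "i < j \<Longrightarrow> j < k \<Longrightarrow> k < i + 7 \<Longrightarrow> 0 < br i j k"
  by (simp add: br_def positive)

text \<open>For points in cyclic order all products in the Pluecker relation are positive, and the
  product over the crossing pairs is the sum of the other two.\<close>

lemma br_crossing:
  assumes "x < a" "a < b" "b < c" "c < d" "d < x + 7"
  shows "br x a b * br x c d < br x a c * br x b d" "br x a d * br x b c < br x a c * br x b d"
proof -
  have "br x a c * br x b d = br x a b * br x c d + br x a d * br x b c"
    unfolding br_def by (rule orient_pluecker)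
  moreover have "0 < br x a b * br x c d" "0 < br x a d * br x b c"
    using assms by (simp_all add: br_pos)
  ultimately show "br x a b * br x c d < br x a c * br x b d" "br x a d * br x b c < br x a c * br x b d"
    by linarith+
qed

text \<open>\<open>good_left i\<close> and \<open>good_right i\<close> together say that the heptagon, labelled from \<open>v i\<close>, lifts to
  a polytope with six facets.\<close>

definition good_left :: "nat \<Rightarrow> bool" where
  "good_left i \<longleftrightarrow> br i (i+5) (i+6) * br (i+2) (i+3) (i+4) \<le> br i (i+2) (i+6) * br (i+3) (i+4) (i+5)"

definition good_right :: "nat \<Rightarrow> bool" where
  "good_right i \<longleftrightarrow> br i (i+1) (i+2) * br (i+3) (i+4) (i+5) \<le> br i (i+1) (i+5) * br (i+2) (i+3) (i+4)"

lemma good_periodic: "good_left (i + 7 * q) = good_left i" "good_right (i + 7 * q) = good_right i"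
proof -
  have "v (j + 7 * q) = v j" for j
  proof (induction q)
    case (Suc q)
    have "v (j + 7 * Suc q) = v ((j + 7 * q) + 7)" by (simp add: algebra_simps)
    then show ?case using Suc periodic by simp
  qed simp
  then have vs: "v (i + 7 * q + k) = v (i + k)" "v (i + 7 * q) = v i" for k
    by (metis add.assoc add.commute)+
  show "good_left (i + 7 * q) = good_left i" "good_right (i + 7 * q) = good_right i"
    by (simp_all only: good_left_def good_right_def br_def vs)
qed

text \<open>Multiplying the two failed inequalities cancels \<open>?A * ?B\<close>; multiplying two
  crossing inequalities cancels another common factor and gives the opposite comparison of the same
  two products.\<close>

lemma not_both_bad:
  assumes "\<not> good_left i"
  shows "good_right (i + 3)"
proof (rule ccontr)
  assume "\<not> good_right (i + 3)"
  then have b: "br (i+3) (i+4) (i+8) * br (i+5) (i+6) (i+7) < br (i+3) (i+4) (i+5) * br (i+6) (i+7) (i+8)"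
    by (simp add: good_right_def not_le numeral_eq_Suc)
  have r: "br (i+3) (i+4) (i+8) = br (i+1) (i+3) (i+4)" "br (i+5) (i+6) (i+7) = br i (i+5) (i+6)"
    "br (i+6) (i+7) (i+8) = br i (i+1) (i+6)"
    using br_rotate[of "i+1" "i+3" "i+4"] br_rotate[of i "i+5" "i+6"]
      br_rotate[of i "i+1" "i+6"] br_rotate[of "i+1" "i+6" "i+7"] by (simp_all add: numeral_eq_Suc)
  let ?A = "br (i+3) (i+4) (i+5)" and ?B = "br i (i+5) (i+6)"
  have a: "br i (i+2) (i+6) * ?A < ?B * br (i+2) (i+3) (i+4)"
    using assms by (simp add: good_left_def not_le)
  have b': "br (i+1) (i+3) (i+4) * ?B < ?A * br i (i+1) (i+6)" using b unfolding r .
  have p: "0 < ?A" "0 < ?B" "0 < br i (i+2) (i+6)" "0 < br (i+2) (i+3) (i+4)" "0 < br (i+1) (i+3) (i+4)"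
    "0 < br i (i+1) (i+6)" "0 < br i (i+1) (i+4)" "0 < br i (i+2) (i+4)" by (simp_all add: br_pos)
  have "(br i (i+2) (i+6) * ?A) * (br (i+1) (i+3) (i+4) * ?B)
      < (?B * br (i+2) (i+3) (i+4)) * (?A * br i (i+1) (i+6))"
    by (rule mult_strict_mono[OF a b']) (use p in \<open>simp_all add: less_imp_le\<close>)
  then have "(br i (i+2) (i+6) * br (i+1) (i+3) (i+4)) * (?A * ?B)
      < (br (i+2) (i+3) (i+4) * br i (i+1) (i+6)) * (?A * ?B)" by (simp add: ac_simps)
  then have lt: "br i (i+2) (i+6) * br (i+1) (i+3) (i+4) < br (i+2) (i+3) (i+4) * br i (i+1) (i+6)"
    using p by (simp add: mult_less_cancel_right_pos)
  have c1: "br i (i+1) (i+6) * br i (i+2) (i+4) < br i (i+1) (i+4) * br i (i+2) (i+6)"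
    by (rule br_crossing(2)) auto
  have "br (i+4) (i+7) (i+8) * br (i+4) (i+9) (i+10) < br (i+4) (i+7) (i+9) * br (i+4) (i+8) (i+10)"
    by (rule br_crossing(1)) auto
  moreover have "br (i+4) (i+7) (i+8) = br i (i+1) (i+4)" "br (i+4) (i+9) (i+10) = br (i+2) (i+3) (i+4)"
    "br (i+4) (i+7) (i+9) = br i (i+2) (i+4)" "br (i+4) (i+8) (i+10) = br (i+1) (i+3) (i+4)"
    using br_rotate[of i "i+1" "i+4"] br_rotate[of "i+1" "i+4" "i+7"]
      br_rotate[of "i+2" "i+3" "i+4"] br_rotate[of "i+3" "i+4" "i+9"]
      br_rotate[of i "i+2" "i+4"] br_rotate[of "i+2" "i+4" "i+7"]
      br_rotate[of "i+1" "i+3" "i+4"] br_rotate[of "i+3" "i+4" "i+8"] by (simp_all add: numeral_eq_Suc)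
  ultimately have c2: "br i (i+1) (i+4) * br (i+2) (i+3) (i+4) < br i (i+2) (i+4) * br (i+1) (i+3) (i+4)"
    by simp
  have "(br i (i+1) (i+6) * br i (i+2) (i+4)) * (br i (i+1) (i+4) * br (i+2) (i+3) (i+4))
      < (br i (i+1) (i+4) * br i (i+2) (i+6)) * (br i (i+2) (i+4) * br (i+1) (i+3) (i+4))"
    by (rule mult_strict_mono[OF c1 c2]) (use p in \<open>simp_all add: less_imp_le\<close>)
  then have "(br i (i+1) (i+6) * br (i+2) (i+3) (i+4)) * (br i (i+2) (i+4) * br i (i+1) (i+4))
      < (br i (i+2) (i+6) * br (i+1) (i+3) (i+4)) * (br i (i+2) (i+4) * br i (i+1) (i+4))"
    by (simp add: ac_simps)
  then have "br i (i+1) (i+6) * br (i+2) (i+3) (i+4) < br i (i+2) (i+6) * br (i+1) (i+3) (i+4)"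
    using p by (simp add: mult_less_cancel_right_pos)
  then show False using lt by (simp add: mult.commute)
qed

text \<open>\<open>cp\<close> belongs to three consecutive vertices; \<open>tp\<close> and
  \<open>mp\<close> belong to the ends of four consecutive vertices together with the second or the
  third. Their cyclic products are compared.\<close>

definition tp :: "nat \<Rightarrow> real" where "tp i = br i (i+1) (i+3)"
definition cp :: "nat \<Rightarrow> real" where "cp i = br i (i+1) (i+2)"
definition mp :: "nat \<Rightarrow> real" where "mp i = br i (i+2) (i+3)"

lemma prod_shift:
  fixes f :: "nat \<Rightarrow> real"
  assumes "\<And>i. f (i + 7) = f i"
  shows "(\<Prod>i<7. f (i + k)) = (\<Prod>i<7. f i)"
proof (induction k)
  case (Suc k)
  have "(\<Prod>i<7. f (i + Suc k)) * f k = (\<Prod>i<Suc 7. f (i + k))"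
    by (subst prod.lessThan_Suc_shift) (simp add: mult.commute)
  also have "\<dots> = (\<Prod>i<7. f (i + k)) * f (7 + k)" by (rule prod.lessThan_Suc)
  also have "f (7 + k) = f k" using assms[of k] by (simp add: add.commute)
  finally have eq: "(\<Prod>i<7. f (i + Suc k)) * f k = (\<Prod>i<7. f (i + k)) * f k" .
  show ?case
  proof (cases "f k = 0")
    case False
    then show ?thesis using eq Suc by simp
  next
    case True
    have "(\<Prod>i<7. f (i + k)) = 0" using True by (intro prod_zero) (auto intro!: bexI[of _ 0])
    moreover have "(\<Prod>i<7. f (i + Suc k)) = 0"
      using True assms[of k] by (intro prod_zero) (auto intro!: bexI[of _ 6] simp: add.commute)
    ultimately show ?thesis using Suc.IH by (simp only:)
  qed
qed simp

lemma periodic_tp: "tp (i + 7) = tp i" and periodic_cp: "cp (i + 7) = cp i" and periodic_mp: "mp (i + 7) = mp i"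
  using br_periodic[of i "i+1" "i+3"] br_periodic[of i "i+1" "i+2"] br_periodic[of i "i+2" "i+3"]
  by (simp_all add: tp_def cp_def mp_def numeral_eq_Suc)

lemma prods_pos: "0 < (\<Prod>i<7. tp i)" "0 < (\<Prod>i<7. cp i)" "0 < (\<Prod>i<7. mp i)"
  by (auto intro!: prod_pos simp: tp_def cp_def mp_def br_pos)

lemma prod_less:
  fixes f g :: "nat \<Rightarrow> real"
  assumes "\<And>i. i < 7 \<Longrightarrow> 0 < f i" "\<And>i. i < 7 \<Longrightarrow> f i < g i"
  shows "(\<Prod>i<7. f i) < (\<Prod>i<7. g i)"
proof (rule prod_mono_strict[of 0])
  show "0 < g j" if "j \<in> {..<7}" for j
    using assms[of j] that by (meson lessThan_iff order_less_trans)
qed (use assms in \<open>auto intro: less_imp_le\<close>)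

text \<open>Crossing inequalities for five consecutive vertices, multiplied over all
  rotations.\<close>

lemma tp_mp_products:
  "(\<Prod>i<7. cp i) * (\<Prod>i<7. mp i) < (\<Prod>i<7. tp i) * (\<Prod>i<7. tp i)"
  "(\<Prod>i<7. cp i) * (\<Prod>i<7. tp i) < (\<Prod>i<7. mp i) * (\<Prod>i<7. mp i)"
proof -
  have "(\<Prod>i<7. cp i * mp (i + 1)) < (\<Prod>i<7. tp i * tp (i + 1))"
  proof (rule prod_less)
    fix i
    show "0 < cp i * mp (i + 1)" by (simp add: cp_def mp_def br_pos)
    have "br (i+1) (i+2) (i+7) * br (i+1) (i+3) (i+4) < br (i+1) (i+2) (i+4) * br (i+1) (i+3) (i+7)"
      by (rule br_crossing(2)) auto
    then show "cp i * mp (i + 1) < tp i * tp (i + 1)"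
      using br_rotate[of i "i+1" "i+2"] br_rotate[of i "i+1" "i+3"]
      by (simp add: cp_def mp_def tp_def numeral_eq_Suc mult.commute)
  qed
  then show "(\<Prod>i<7. cp i) * (\<Prod>i<7. mp i) < (\<Prod>i<7. tp i) * (\<Prod>i<7. tp i)"
    using prod_shift[of mp 1, OF periodic_mp] prod_shift[of tp 1, OF periodic_tp] by (simp add: prod.distrib)
  have "(\<Prod>i<7. cp (i + 2) * tp i) < (\<Prod>i<7. mp i * mp (i + 1))"
  proof (rule prod_less)
    fix i
    show "0 < cp (i + 2) * tp i" by (simp add: cp_def tp_def br_pos)
    have "br (i+3) (i+4) (i+9) * br (i+3) (i+7) (i+8) < br (i+3) (i+4) (i+8) * br (i+3) (i+7) (i+9)"
      by (rule br_crossing(2)) auto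
    moreover have "br (i+3) (i+4) (i+9) = br (i+2) (i+3) (i+4)" "br (i+3) (i+7) (i+8) = br i (i+1) (i+3)"
      "br (i+3) (i+4) (i+8) = br (i+1) (i+3) (i+4)" "br (i+3) (i+7) (i+9) = br i (i+2) (i+3)"
      using br_rotate[of "i+2" "i+3" "i+4"] br_rotate[of i "i+1" "i+3"] br_rotate[of "i+1" "i+3" "i+7"]
        br_rotate[of "i+1" "i+3" "i+4"] br_rotate[of i "i+2" "i+3"] br_rotate[of "i+2" "i+3" "i+7"]
      by (simp_all add: numeral_eq_Suc)
    ultimately show "cp (i + 2) * tp i < mp i * mp (i + 1)"
      by (simp add: cp_def mp_def tp_def numeral_eq_Suc mult.commute)
  qed
  then show "(\<Prod>i<7. cp i) * (\<Prod>i<7. tp i) < (\<Prod>i<7. mp i) * (\<Prod>i<7. mp i)"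
    using prod_shift[of cp 2, OF periodic_cp] prod_shift[of mp 1, OF periodic_mp] by (simp add: prod.distrib)
qed

text \<open>A failure of \<open>good_left\<close> propagates through \<open>not_both_bad\<close> in
  steps of 3, hence to all residues modulo 7. Multiplied cyclically the failures give
  \<open>?T < ?C\<close>, and then \<open>tp_mp_products\<close> yields both
  \<open>?T * ?T < ?M * ?M\<close> and \<open>?M < ?T\<close>. If \<open>good_left\<close> never
  fails, \<open>good_right\<close> always does, and \<open>?T\<close> and \<open>?M\<close> change
  roles.\<close>

lemma exists_good: "\<exists>i. good_left i \<and> good_right i"
proof (rule ccontr)
  assume neg: "\<not> ?thesis"
  let ?T = "\<Prod>i<7. tp i" and ?C = "\<Prod>i<7. cp i" and ?M = "\<Prod>i<7. mp i"
  have step: "\<not> good_left (i + 3 * k)" if "\<not> good_left i" for i k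
  proof (induction k)
    case (Suc k)
    then have "good_right (i + 3 * k + 3)" by (rule not_both_bad)
    moreover have "i + 3 * Suc k = i + 3 * k + 3" by simp
    ultimately show ?case using neg by metis
  qed (use that in simp)
  show False
  proof (cases "\<exists>i. \<not> good_left i")
    case True
    then obtain i0 where i0: "\<not> good_left i0" by blast
    have "\<not> good_left i" for i
    proof -
      \<comment> \<open>\<open>3 * 5\<close> is 1 modulo 7 and \<open>6 * i0\<close> stands for
        \<open>- i0\<close>, so this number of steps leads from \<open>i0\<close> to
        \<open>i\<close> without subtraction.\<close>
      have "i0 + 3 * (5 * (i + 6 * i0)) = i + 7 * (2 * i + 13 * i0)" by simp
      then show ?thesis using step[OF i0, of "5 * (i + 6 * i0)"] good_periodic(1) by metis
    qed
    then have lt: "br i (i+2) (i+6) * br (i+3) (i+4) (i+5) < br i (i+5) (i+6) * br (i+2) (i+3) (i+4)" for i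
      by (simp add: good_left_def not_le)
    have "(\<Prod>i<7. tp (i + 6) * cp (i + 3)) < (\<Prod>i<7. cp (i + 5) * cp (i + 2))"
    proof (rule prod_less)
      fix i
      show "0 < tp (i + 6) * cp (i + 3)" by (simp add: tp_def cp_def br_pos)
      show "tp (i + 6) * cp (i + 3) < cp (i + 5) * cp (i + 2)"
        using lt[of i] br_rotate[of i "i+2" "i+6"] br_rotate[of "i+2" "i+6" "i+7"]
          br_rotate[of i "i+5" "i+6"] by (simp add: tp_def cp_def numeral_eq_Suc mult.commute)
    qed
    then have "?T * ?C < ?C * ?C"
      using prod_shift[of tp 6, OF periodic_tp] prod_shift[of cp 3, OF periodic_cp]
        prod_shift[of cp 5, OF periodic_cp] prod_shift[of cp 2, OF periodic_cp] by (simp add: prod.distrib)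
    then have TC: "?T < ?C" using prods_pos by (simp add: mult_less_cancel_right_pos)
    then have "?T * ?T < ?C * ?T" using prods_pos by simp
    then have TM: "?T * ?T < ?M * ?M" using tp_mp_products(2) by linarith
    have "?T * ?M < ?C * ?M" using TC prods_pos by simp
    then have "?T * ?M < ?T * ?T" using tp_mp_products(1) by linarith
    then have "?M < ?T" using prods_pos by (simp add: mult_less_cancel_left_pos)
    then have "?M * ?M < ?T * ?T" using prods_pos by (meson mult_strict_mono less_imp_le)
    then show False using TM by simp
  next
    case False
    then have "\<not> good_right i" for i using neg by blast
    then have lt: "br i (i+1) (i+5) * br (i+2) (i+3) (i+4) < br i (i+1) (i+2) * br (i+3) (i+4) (i+5)" for i
      by (simp add: good_right_def not_le)
    have "(\<Prod>i<7. mp (i + 5) * cp (i + 2)) < (\<Prod>i<7. cp i * cp (i + 3))"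
    proof (rule prod_less)
      fix i
      show "0 < mp (i + 5) * cp (i + 2)" by (simp add: mp_def cp_def br_pos)
      show "mp (i + 5) * cp (i + 2) < cp i * cp (i + 3)"
        using lt[of i] br_rotate[of i "i+1" "i+5"] br_rotate[of "i+1" "i+5" "i+7"]
        by (simp add: mp_def cp_def numeral_eq_Suc mult.commute)
    qed
    then have "?M * ?C < ?C * ?C"
      using prod_shift[of mp 5, OF periodic_mp] prod_shift[of cp 2, OF periodic_cp]
        prod_shift[of cp 3, OF periodic_cp] by (simp add: prod.distrib)
    then have MC: "?M < ?C" using prods_pos by (simp add: mult_less_cancel_right_pos)
    then have "?M * ?M < ?C * ?M" using prods_pos by simp
    then have TM: "?M * ?M < ?T * ?T" using tp_mp_products(1) by linarith
    have "?M * ?T < ?C * ?T" using MC prods_pos by simp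
    then have "?M * ?T < ?M * ?M" using tp_mp_products(2) by linarith
    then have "?T < ?M" using prods_pos by (simp add: mult_less_cancel_left_pos)
    then have "?T * ?T < ?M * ?M" using prods_pos by (meson mult_strict_mono less_imp_le)
    then show False using TM by simp
  qed
qed

end

section \<open>The lifted polytope given by six inequalities\<close>

definition edge_normal :: "real^2 \<Rightarrow> real^2 \<Rightarrow> real^2" where
  "edge_normal a b = vector [a$2 - b$2, b$1 - a$1]"

lemma orient_affine: "orient a b x = edge_normal a b \<bullet> x + orient a b 0"
  by (simp add: orient_def edge_normal_def inner_vec_def sum_2 algebra_simps)

lemma all_less_6: "(\<forall>j<6. P j) \<longleftrightarrow> P 0 \<and> P 1 \<and> P 2 \<and> P 3 \<and> P 4 \<and> P (5::nat)"
  by (simp add: numeral_eq_Suc All_less_Suc) blast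

text \<open>The triangles with apex \<open>v 0\<close> form a fan; a sign change of \<open>h\<close>
  along the fan singles out one that contains \<open>x\<close>.\<close>

lemma (in cyclic_heptagon) in_hull_if_left_of_edges:
  assumes edges: "\<And>j. j < 7 \<Longrightarrow> 0 \<le> orient (v j) (v (j+1)) x"
  shows "x \<in> convex hull (v ` {..<7})"
proof -
  define h where "h j = orient (v 0) (v j) x" for j
  have h1: "0 \<le> h 1" using edges[of 0] by (simp add: h_def)
  have "v 7 = v 0" using periodic[of 0] by simp
  then have "0 \<le> orient (v 6) (v 0) x" using edges[of 6] by simp
  then have h6: "h 6 \<le> 0" by (simp add: h_def orient_swap[of "v 0"])
  have "\<exists>j. 1 \<le> j \<and> j < 6 \<and> 0 \<le> h j \<and> h (j + 1) \<le> 0"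
  proof (rule ccontr)
    assume neg: "\<not> ?thesis"
    have "1 \<le> j \<Longrightarrow> j \<le> 6 \<Longrightarrow> 0 \<le> h j \<and> (1 < j \<longrightarrow> 0 < h j)" for j
    proof (induction j rule: dec_induct)
      case (step j)
      then have "\<not> h (j + 1) \<le> 0" using neg by auto
      then show ?case by simp
    qed (use h1 in simp)
    from this[of 6] h6 show False by simp
  qed
  then obtain j where j: "1 \<le> j" "j < 6" "0 \<le> h j" "h (j + 1) \<le> 0" by blast
  have m: "v k \<in> convex hull (v ` {..<7})" if "k < 7" for k using that by (intro hull_inc) auto
  show ?thesis
  proof (rule convex_weighted_three)
    show "convex (convex hull (v ` {..<7}))" by simp
    show "v 0 \<in> convex hull (v ` {..<7})" "v j \<in> convex hull (v ` {..<7})"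
      "v (j+1) \<in> convex hull (v ` {..<7})" using m j by simp_all
    show "0 \<le> orient x (v j) (v (j+1))" using edges[of j] j orient_rotate[of x] by simp
    show "0 \<le> orient (v 0) x (v (j+1))"
      using j(4) by (simp add: h_def orient_def algebra_simps)
    show "0 \<le> orient (v 0) (v j) x" using j(3) by (simp add: h_def)
    show "0 < orient (v 0) (v j) (v (j+1))" using j by (intro positive) auto
    show "orient (v 0) (v j) (v (j+1)) *\<^sub>R x = orient x (v j) (v (j+1)) *\<^sub>R v 0
        + orient (v 0) x (v (j+1)) *\<^sub>R v j + orient (v 0) (v j) x *\<^sub>R v (j+1)"
      by (rule orient_barycentric)
    show "orient (v 0) (v j) (v (j+1)) = orient x (v j) (v (j+1)) + orient (v 0) x (v (j+1)) + orient (v 0) (v j) x"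
      by (simp add: orient_def algebra_simps)
  qed
qed

lemma six_inequalities_polytope:
  fixes a :: "nat \<Rightarrow> 'a::euclidean_space"
  assumes S: "S = {(x, z). \<forall>j<6. 0 \<le> a j \<bullet> x + b j * z + c j}" and "bounded S"
  shows "polytope S"
proof -
  have "S = \<Inter> ((\<lambda>j. {y. (- a j, - b j) \<bullet> y \<le> c j}) ` {..<6::nat})"
  proof -
    have "0 \<le> a j \<bullet> x + b j * z + c j \<longleftrightarrow> (- a j, - b j) \<bullet> (x, z) \<le> c j" for j x z
      by (simp add: inner_Pair) linarith
    then show ?thesis unfolding S by auto
  qed
  moreover have "polyhedron \<dots>" by (intro polyhedron_Inter) (auto simp: polyhedron_halfspace_le)
  ultimately show ?thesis using assms by (simp add: polytope_eq_bounded_polyhedron)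
qed

text \<open>The lift moves only the vertices \<open>2\<close> and \<open>5\<close> off the plane, to the heights making them
  coplanar with the lifted neighbours.\<close>

lemma (in cyclic_heptagon) six_inequalities_at_0:
  assumes good: "good_left 0" "good_right 0" and P: "P = convex hull (v ` {..<7})"
  shows "\<exists>(a :: nat \<Rightarrow> real^2) b c. polytope {(x::real^2, z::real). \<forall>j<6. 0 \<le> a j \<bullet> x + b j * z + c j}
    \<and> fst ` {(x::real^2, z::real). \<forall>j<6. 0 \<le> a j \<bullet> x + b j * z + c j} = P"
proof -
  let ?D = "\<lambda>i j. orient (v i) (v j)"
  let ?n = "\<lambda>i j. edge_normal (v i) (v j)"
  \<comment> \<open>The planes in order: \<open>z = 0\<close> with the five unmoved vertices;
    through 3, 4 and both lifted vertices; through 1, 3 and lifted 2; through 4, 6 and lifted 5;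
    through 0, 1 and lifted 2; through 6, 0 and lifted 5. The heights of 2 and 5 are
    \<open>br 2 3 4\<close> and \<open>br 3 4 5\<close>.\<close>
  define a where "a j = [0, ?n 3 4, br 2 3 4 *\<^sub>R ?n 1 3, br 3 4 5 *\<^sub>R ?n 4 6, br 2 3 4 *\<^sub>R ?n 0 1,
    br 3 4 5 *\<^sub>R ?n 6 0] ! j" for j
  define b where "b j = [1, -1, br 1 2 3, br 4 5 6, - br 0 1 2, - br 0 5 6] ! j" for j
  define c where "c j = [0, ?D 3 4 0, br 2 3 4 * ?D 1 3 0, br 3 4 5 * ?D 4 6 0, br 2 3 4 * ?D 0 1 0,
    br 3 4 5 * ?D 6 0 0] ! j" for j
  define S where "S = {(x, z). \<forall>j<6. 0 \<le> a j \<bullet> x + b j * z + c j}"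
  have S_iff: "(x, z) \<in> S \<longleftrightarrow> 0 \<le> z \<and> z \<le> ?D 3 4 x \<and> 0 \<le> br 2 3 4 * ?D 1 3 x + br 1 2 3 * z
      \<and> 0 \<le> br 3 4 5 * ?D 4 6 x + br 4 5 6 * z \<and> br 0 1 2 * z \<le> br 2 3 4 * ?D 0 1 x
      \<and> br 0 5 6 * z \<le> br 3 4 5 * ?D 6 0 x" for x z
  proof -
    have o: "?D i j x = ?n i j \<bullet> x + ?D i j 0" for i j by (rule orient_affine)
    show ?thesis
      unfolding S_def o[of 3 4] o[of 1 3] o[of 4 6] o[of 0 1] o[of 6 0]
      by (simp add: all_less_6 a_def b_def c_def algebra_simps)
  qed
  have bp: "0 < br i j k" if "i < j" "j < k" "k < i + 7" for i j k using that by (rule br_pos)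
  have sub: "x \<in> P" "0 \<le> z" "z \<le> ?D 3 4 x" if "(x, z) \<in> S" for x z
  proof -
    have I: "0 \<le> z" "z \<le> ?D 3 4 x" "0 \<le> br 2 3 4 * ?D 1 3 x + br 1 2 3 * z"
      "0 \<le> br 3 4 5 * ?D 4 6 x + br 4 5 6 * z" "br 0 1 2 * z \<le> br 2 3 4 * ?D 0 1 x"
      "br 0 5 6 * z \<le> br 3 4 5 * ?D 6 0 x" using that unfolding S_iff by blast+
    show "0 \<le> z" "z \<le> ?D 3 4 x" by (fact I)+
    have e3: "0 \<le> ?D 3 4 x" using I by simp
    have "0 \<le> br 0 1 2 * z" "0 \<le> br 0 5 6 * z" using I(1) bp by (simp_all add: less_imp_le)
    then have "0 \<le> br 2 3 4 * ?D 0 1 x" "0 \<le> br 3 4 5 * ?D 6 0 x" using I by linarith+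
    then have e0: "0 \<le> ?D 0 1 x" and e6: "0 \<le> ?D 6 0 x"
      using bp[of 2 3 4] bp[of 3 4 5] by (simp_all add: zero_le_mult_iff)
    have m: "br 1 2 3 * z \<le> br 1 2 3 * ?D 3 4 x" "br 4 5 6 * z \<le> br 4 5 6 * ?D 3 4 x"
      "br 1 2 3 * (br 0 1 2 * z) \<le> br 1 2 3 * (br 2 3 4 * ?D 0 1 x)"
      "br 4 5 6 * (br 0 5 6 * z) \<le> br 4 5 6 * (br 3 4 5 * ?D 6 0 x)"
      using I bp by (auto intro!: mult_left_mono less_imp_le)
    have m': "0 \<le> br 0 1 2 * (br 2 3 4 * ?D 1 3 x + br 1 2 3 * z)"
      "0 \<le> br 0 5 6 * (br 3 4 5 * ?D 4 6 x + br 4 5 6 * z)"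
      by (rule mult_nonneg_nonneg[OF less_imp_le[OF bp]]; use I in simp)+
    \<comment> \<open>Each of the edges 23, 45, 12 and 56 lies below the common line of two of the
      planes; eliminating \<open>z\<close> between these two yields its inequality.\<close>
    have "br 1 3 4 * ?D 2 3 x = br 2 3 4 * ?D 1 3 x + br 1 2 3 * ?D 3 4 x"
      by (simp add: br_def orient_def algebra_simps)
    then have "0 \<le> br 1 3 4 * ?D 2 3 x" using I m by linarith
    then have e2: "0 \<le> ?D 2 3 x" using bp[of 1 3 4] by (simp add: zero_le_mult_iff)
    have "br 3 4 6 * ?D 4 5 x = br 3 4 5 * ?D 4 6 x + br 4 5 6 * ?D 3 4 x"
      by (simp add: br_def orient_def algebra_simps)
    then have "0 \<le> br 3 4 6 * ?D 4 5 x" using I m by linarith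
    then have e4: "0 \<le> ?D 4 5 x" using bp[of 3 4 6] by (simp add: zero_le_mult_iff)
    have "br 0 1 3 * ?D 1 2 x = br 0 1 2 * ?D 1 3 x + br 1 2 3 * ?D 0 1 x"
      by (simp add: br_def orient_def algebra_simps)
    then have "br 2 3 4 * (br 0 1 3 * ?D 1 2 x)
        = br 0 1 2 * (br 2 3 4 * ?D 1 3 x + br 1 2 3 * z)
          + (br 1 2 3 * (br 2 3 4 * ?D 0 1 x) - br 1 2 3 * (br 0 1 2 * z))" by (simp add: algebra_simps)
    then have "0 \<le> br 2 3 4 * (br 0 1 3 * ?D 1 2 x)" using m m' by linarith
    then have e1: "0 \<le> ?D 1 2 x" using bp[of 2 3 4] bp[of 0 1 3] by (simp add: zero_le_mult_iff)
    have "br 0 4 6 * ?D 5 6 x = br 0 5 6 * ?D 4 6 x + br 4 5 6 * ?D 6 0 x"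
      by (simp add: br_def orient_def algebra_simps)
    then have "br 3 4 5 * (br 0 4 6 * ?D 5 6 x)
        = br 0 5 6 * (br 3 4 5 * ?D 4 6 x + br 4 5 6 * z)
          + (br 4 5 6 * (br 3 4 5 * ?D 6 0 x) - br 4 5 6 * (br 0 5 6 * z))" by (simp add: algebra_simps)
    then have "0 \<le> br 3 4 5 * (br 0 4 6 * ?D 5 6 x)" using m m' by linarith
    then have e5: "0 \<le> ?D 5 6 x" using bp[of 3 4 5] bp[of 0 4 6] by (simp add: zero_le_mult_iff)
    have "v 7 = v 0" using periodic[of 0] by simp
    then have "0 \<le> ?D j (j + 1) x" if "j < 7" for j
    proof -
      have "j = 0 \<or> j = 1 \<or> j = 2 \<or> j = 3 \<or> j = 4 \<or> j = 5 \<or> j = 6" using that by linarith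
      then show ?thesis using e0 e1 e2 e3 e4 e5 e6 \<open>v 7 = v 0\<close> by (auto simp: numeral_eq_Suc)
    qed
    then show "x \<in> P" unfolding P by (rule in_hull_if_left_of_edges)
  qed
  have cP: "compact P" unfolding P by (intro finite_imp_compact_convex_hull) simp
  have "continuous_on P (?D 3 4)"
    unfolding orient_def by (intro continuous_intros)
  then have "compact (?D 3 4 ` P)" using cP by (rule compact_continuous_image)
  then obtain M where M: "\<forall>y\<in>?D 3 4 ` P. norm y \<le> M" using compact_imp_bounded bounded_iff by blast
  have "S \<subseteq> P \<times> {0..M}"
  proof (rule subrelI)
    fix x z assume xz: "(x, z) \<in> S"
    have "norm (?D 3 4 x) \<le> M" using M sub(1)[OF xz] by blast
    then show "(x, z) \<in> P \<times> {0..M}" using sub[OF xz] by auto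
  qed
  moreover have "bounded (P \<times> {0..M})" using cP by (intro bounded_Times) (auto simp: compact_imp_bounded)
  ultimately have "bounded S" using bounded_subset by blast
  then have poly: "polytope S" by (rule six_inequalities_polytope[OF S_def])
  \<comment> \<open>Lifted 2 lies below the plane of 6, 0 and lifted 5, and lifted 5 below that of
    0, 1 and lifted 2. All other inequalities at the lifted vertices follow from convex
    position.\<close>
  have g: "br 0 5 6 * br 2 3 4 \<le> br 3 4 5 * br 0 2 6" "br 0 1 2 * br 3 4 5 \<le> br 2 3 4 * br 0 1 5"
    using good by (simp_all add: good_left_def good_right_def mult.commute numeral_eq_Suc)
  have fl: "(v j, 0) \<in> S" if "j \<in> {0, 1, 3, 4, 6}" for j
  proof -
    have r: "?D 3 4 (v 0) = br 0 3 4" "?D 1 3 (v 0) = br 0 1 3" "?D 4 6 (v 0) = br 0 4 6"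
      "?D 3 4 (v 1) = br 1 3 4" "?D 4 6 (v 1) = br 1 4 6" "?D 6 0 (v 1) = br 0 1 6"
      "?D 4 6 (v 3) = br 3 4 6" "?D 0 1 (v 3) = br 0 1 3" "?D 6 0 (v 3) = br 0 3 6"
      "?D 1 3 (v 4) = br 1 3 4" "?D 0 1 (v 4) = br 0 1 4" "?D 6 0 (v 4) = br 0 4 6"
      "?D 3 4 (v 6) = br 3 4 6" "?D 1 3 (v 6) = br 1 3 6" "?D 0 1 (v 6) = br 0 1 6"
      by (simp_all add: br_def orient_def algebra_simps)
    show ?thesis using that bp
      unfolding S_iff by (elim insertE emptyE; simp only: r; simp add: less_imp_le r)
  qed
  have f2: "(v 2, br 2 3 4) \<in> S"
  proof -
    have r: "?D 3 4 (v 2) = br 2 3 4" "?D 1 3 (v 2) = - br 1 2 3" "?D 4 6 (v 2) = br 2 4 6"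
      "?D 0 1 (v 2) = br 0 1 2" "?D 6 0 (v 2) = br 0 2 6"
      by (simp_all add: br_def orient_def algebra_simps)
    show ?thesis unfolding S_iff r using bp g by (simp add: less_imp_le mult.commute)
  qed
  have f5: "(v 5, br 3 4 5) \<in> S"
  proof -
    have r: "?D 3 4 (v 5) = br 3 4 5" "?D 1 3 (v 5) = br 1 3 5" "?D 4 6 (v 5) = - br 4 5 6"
      "?D 0 1 (v 5) = br 0 1 5" "?D 6 0 (v 5) = br 0 5 6"
      by (simp_all add: br_def orient_def algebra_simps)
    show ?thesis unfolding S_iff r using bp g by (simp add: less_imp_le mult.commute)
  qed
  have "v j \<in> fst ` S" if "j < 7" for j
  proof -
    have "j \<in> {0, 1, 3, 4, 6} \<or> j = 2 \<or> j = 5" using that by auto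
    then show ?thesis using fl f2 f5 by (metis fst_conv image_eqI)
  qed
  then have "v ` {..<7} \<subseteq> fst ` S" by blast
  moreover have "convex (fst ` S)"
    using polytope_imp_convex[OF poly] by (intro convex_linear_image linear_fst)
  ultimately have "P \<subseteq> fst ` S" unfolding P by (rule hull_minimal)
  then have "fst ` S = P" using sub(1) by force
  then show ?thesis using poly unfolding S_def by blast
qed

lemma heptagon_six_inequalities:
  assumes P: "polytope P" "card (vertices P) = 7"
  shows "\<exists>(a :: nat \<Rightarrow> real^2) b c. polytope {(x::real^2, z::real). \<forall>j<6. 0 \<le> a j \<bullet> x + b j * z + c j}
    \<and> fst ` {(x::real^2, z::real). \<forall>j<6. 0 \<le> a j \<bullet> x + b j * z + c j} = P"
proof -
  obtain v :: "nat \<Rightarrow> real^2" where v: "v ` {..<7} = vertices P" "\<And>i. v (i + 7) = v i"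
    "\<And>i j k. i < j \<Longrightarrow> j < k \<Longrightarrow> k < i + 7 \<Longrightarrow> 0 < orient (v i) (v j) (v k)"
    by (rule convex_heptagon_cyclic_order[OF polytope_imp_convex[OF P(1)] P(2)]) blast
  interpret cyclic_heptagon v using v(2,3) by unfold_locales
  obtain i where i: "good_left i" "good_right i" using exists_good by blast
  define w where "w j = v (i + j)" for j
  have w7: "w (j + 7) = w j" for j using v(2)[of "i + j"] by (simp add: w_def add.assoc)
  interpret w: cyclic_heptagon w
    using v(3) w7 by unfold_locales (auto simp: w_def)
  have "w.good_left 0" "w.good_right 0"
    using i by (simp_all add: w.good_left_def w.good_right_def good_left_def good_right_def
        w.br_def br_def w_def)
  moreover have "P = convex hull (w ` {..<7})"
  proof -
    have per: "v (r + 7 * q) = v r" for r q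
    proof (induction q)
      case (Suc q)
      have "v (r + 7 * Suc q) = v ((r + 7 * q) + 7)" by (simp add: algebra_simps)
      then show ?case using Suc v(2) by simp
    qed simp
    have vm: "v (k mod 7) = v k" for k using per[of "k mod 7" "k div 7"] by simp
    have "v ` {..<7} = w ` {..<7}"
    proof
      show "w ` {..<7} \<subseteq> v ` {..<7}"
      proof safe
        fix k
        have "w k = v ((i + k) mod 7)" using vm by (simp add: w_def)
        then show "w k \<in> v ` {..<7}" by simp
      qed
      show "v ` {..<7} \<subseteq> w ` {..<7}"
      proof safe
        fix k
        \<comment> \<open>\<open>6 * i\<close> stands for \<open>- i\<close> modulo 7.\<close>
        define l where "l = (k + 6 * i) mod 7"
        have "(i + l) mod 7 = (k + 7 * i) mod 7" unfolding l_def by (simp add: mod_simps algebra_simps)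
        then have "v (i + l) = v (k + 7 * i)" using vm by metis
        then have "v k = w l" using per by (simp add: w_def)
        moreover have "l < 7" by (simp add: l_def)
        ultimately show "v k \<in> w ` {..<7}" by blast
      qed
    qed
    then show ?thesis using v(1) polytope_vertices(2)[OF P(1)] by simp
  qed
  ultimately show ?thesis by (rule w.six_inequalities_at_0)
qed

section \<open>The product with the cube\<close>

abbreviation coord :: "(nat \<Rightarrow>\<^sub>0 real) \<Rightarrow> nat \<Rightarrow> real" where
  "coord \<equiv> Poly_Mapping.lookup"

definition plane :: "(nat \<Rightarrow>\<^sub>0 real) \<Rightarrow> real^2" where
  "plane x = vector [coord x 0, coord x 1]"

definition unplane :: "real^2 \<Rightarrow> (nat \<Rightarrow>\<^sub>0 real)" where
  "unplane x = Poly_Mapping.single 0 (x$1) + Poly_Mapping.single 1 (x$2)"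

lemma coord_single: "coord (Poly_Mapping.single i r) j = (if i = j then r else 0)"
  by (simp add: lookup_single when_def)

lemma coord_scaleR: "coord (r *\<^sub>R x) i = r * coord x i"
proof -
  have "finite {k. r *\<^sub>R coord x k \<noteq> 0}"
    by (rule finite_subset[OF _ finite_lookup[of x]]) auto
  then show ?thesis by (simp add: scaleR_poly_mapping_def)
qed

lemma coord_unplane: "coord (unplane x) i = (if i = 0 then x$1 else if i = 1 then x$2 else 0)"
  by (simp add: unplane_def lookup_add coord_single)

lemma linear_coord: "linear (\<lambda>x. coord x i)"
  by (rule linearI) (simp_all add: lookup_add coord_scaleR)

lemma linear_plane: "linear plane"
  by (rule linearI) (simp_all add: plane_def vec_eq_iff forall_2 lookup_add coord_scaleR)

lemma linear_unplane: "linear unplane"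
  by (rule linearI) (simp_all add: poly_mapping_eq_iff fun_eq_iff coord_unplane lookup_add coord_scaleR)

lemma linear_single: "linear (Poly_Mapping.single i :: real \<Rightarrow> nat \<Rightarrow>\<^sub>0 real)"
  by (rule linearI) (simp_all add: poly_mapping_eq_iff fun_eq_iff lookup_add coord_scaleR coord_single)

lemma plane_eqI: "coord x 0 = p$1 \<Longrightarrow> coord x 1 = p$2 \<Longrightarrow> plane x = p"
  by (simp add: plane_def vec_eq_iff forall_2)

lemma rspace_iff: "x \<in> rspace n \<longleftrightarrow> (\<forall>i\<ge>n. coord x i = 0)"
  by (auto simp: rspace_def in_keys_iff not_less[symmetric] subset_iff)

lemma affine_rspace: "affine (rspace n)"
  by (auto simp: affine_def rspace_iff lookup_add coord_scaleR)

lemma times_cube_iff: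
  "x \<in> times_cube P d \<longleftrightarrow> x \<in> rspace (2 + d) \<and> plane x \<in> P \<and> (\<forall>i<d. coord x (2 + i) \<in> {0..1})"
proof -
  have "(\<forall>i\<in>{2..<2 + d}. coord x i \<in> {0..1}) \<longleftrightarrow> (\<forall>i<d. coord x (2 + i) \<in> {0..1})"
  proof (intro iffI allI ballI impI)
    fix i assume "\<forall>i<d. coord x (2 + i) \<in> {0..1}" "i \<in> {2..<2 + d}"
    moreover from this(2) have "2 + (i - 2) = i" "i - 2 < d" by auto
    ultimately show "coord x i \<in> {0..1}" by metis
  qed auto
  then show ?thesis by (simp add: times_cube_def plane_def)
qed

text \<open>An open segment around \<open>w\<close> in \<open>A\<close> is carried by the injective
  affine map \<open>v + h (a - w)\<close> to an open segment around \<open>v\<close> in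
  \<open>S\<close>.\<close>

lemma vertex_of_section:
  assumes v: "v \<in> vertices S" and h: "linear h" "inj h" and w: "w \<in> A"
    and into: "\<And>a. a \<in> A \<Longrightarrow> v + h (a - w) \<in> S"
  shows "w \<in> vertices A"
proof -
  have False if ab: "a \<in> A" "b \<in> A" "w \<in> open_segment a b" for a b
  proof -
    obtain u where u: "a \<noteq> b" "0 < u" "u < 1" "w = (1 - u) *\<^sub>R a + u *\<^sub>R b"
      using ab(3) by (auto simp: in_segment)
    have "(1 - u) *\<^sub>R (a - w) + u *\<^sub>R (b - w) = 0" 
      by (simp add: u(4) algebra_simps flip: scaleR_add_left)
    then have "h ((1 - u) *\<^sub>R (a - w) + u *\<^sub>R (b - w)) = 0" using linear_0[OF h(1)] by simp
    then have z: "(1 - u) *\<^sub>R h (a - w) + u *\<^sub>R h (b - w) = 0"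
      by (simp add: linear_add[OF h(1)] linear_scale[OF h(1)])
    have "(1 - u) *\<^sub>R (v + h (a - w)) + u *\<^sub>R (v + h (b - w))
        = v + ((1 - u) *\<^sub>R h (a - w) + u *\<^sub>R h (b - w))"
      by (simp add: algebra_simps)
    then have "v = (1 - u) *\<^sub>R (v + h (a - w)) + u *\<^sub>R (v + h (b - w))" using z by simp
    moreover have "v + h (a - w) \<noteq> v + h (b - w)" using u(1) h(2) by (auto dest: injD)
    ultimately have "v \<in> open_segment (v + h (a - w)) (v + h (b - w))"
      using u(2,3) by (auto simp: in_segment)
    then show False
      using v into[OF ab(1)] into[OF ab(2)] by (auto simp: vertices_def extreme_point_of_def)
  qed
  then show ?thesis using w by (auto simp: vertices_def extreme_point_of_def)
qed

lemma vertices_unit_interval: "x \<in> vertices {0..1::real} \<Longrightarrow> x \<in> {0, 1}"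
proof (rule ccontr)
  assume x: "x \<in> vertices {0..1}" "x \<notin> {0, 1}"
  then have "x \<in> {0..1}" by (simp add: vertices_def extreme_point_of_def)
  then have "x \<in> open_segment 0 1" using x(2) by (auto simp: open_segment_eq_real_ivl)
  then show False using x(1) by (auto simp: vertices_def extreme_point_of_def)
qed

text \<open>Changing a single factor keeps a point in the product, so each factor of a vertex is
  extreme in its own set.\<close>

lemma vertices_times_cube:
  assumes v: "v \<in> vertices (times_cube P d)"
  shows "plane v \<in> vertices P" "i < d \<Longrightarrow> coord v (2 + i) \<in> {0, 1}"
proof -
  have vS: "v \<in> rspace (2 + d)" "plane v \<in> P" "\<And>i. i < d \<Longrightarrow> coord v (2 + i) \<in> {0..1}"
    using v times_cube_iff by (auto simp: vertices_def extreme_point_of_def)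
  show "plane v \<in> vertices P"
  proof (rule vertex_of_section[OF v linear_unplane])
    show "inj unplane"
    proof (rule injI)
      fix x y :: "real^2" assume "unplane x = unplane y"
      then have "coord (unplane x) 0 = coord (unplane y) 0" "coord (unplane x) 1 = coord (unplane y) 1" by simp_all
      then show "x = y" by (simp add: coord_unplane vec_eq_iff forall_2)
    qed
    show "v + unplane (a - plane v) \<in> times_cube P d" if "a \<in> P" for a
    proof -
      have "plane (v + unplane (a - plane v)) = a"
        by (rule plane_eqI) (simp_all add: lookup_add coord_unplane plane_def)
      then show ?thesis
        using vS that by (auto simp: times_cube_iff rspace_iff lookup_add coord_unplane)
    qed
  qed (fact vS(2))
  show "coord v (2 + i) \<in> {0, 1}" if i: "i < d"
  proof (rule vertices_unit_interval, rule vertex_of_section[OF v linear_single])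
    show "inj (Poly_Mapping.single (2 + i) :: real \<Rightarrow> nat \<Rightarrow>\<^sub>0 real)"
      by (rule injI) (metis coord_single)
    show "coord v (2 + i) \<in> {0..1}" using vS(3) i by blast
    show "v + Poly_Mapping.single (2 + i) (a - coord v (2 + i)) \<in> times_cube P d" if "a \<in> {0..1}" for a
    proof -
      have "plane (v + Poly_Mapping.single (2 + i) (a - coord v (2 + i))) = plane v"
        by (simp add: plane_def lookup_add coord_single)
      then show ?thesis
        using vS that i by (auto simp: times_cube_iff rspace_iff lookup_add coord_single)
    qed
  qed
qed

lemma polytope_add_segment:
  fixes A :: "'a::real_vector set"
  assumes "polytope A"
  shows "polytope {x + s *\<^sub>R w | x s. x \<in> A \<and> s \<in> {0..1}}"
proof -
  obtain V where V: "finite V" "A = convex hull V" using assms by (auto simp: polytope_def)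
  have "{x + s *\<^sub>R w | x s. x \<in> A \<and> s \<in> {0..1}} = A + closed_segment 0 w"
  proof
    show "{x + s *\<^sub>R w | x s. x \<in> A \<and> s \<in> {0..1}} \<subseteq> A + closed_segment 0 w"
    proof clarify
      fix x s assume "x \<in> A" "s \<in> {0..1::real}"
      then show "x + s *\<^sub>R w \<in> A + closed_segment 0 w" by (intro set_plus_intro) (auto simp: in_segment)
    qed
    show "A + closed_segment 0 w \<subseteq> {x + s *\<^sub>R w | x s. x \<in> A \<and> s \<in> {0..1}}"
    proof
      fix z assume "z \<in> A + closed_segment 0 w"
      then obtain x y where xy: "z = x + y" "x \<in> A" "y \<in> closed_segment 0 w" by (rule set_plus_elim)
      then obtain s where "y = s *\<^sub>R w" "s \<in> {0..1}" by (auto simp: in_segment)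
      then show "z \<in> {x + s *\<^sub>R w | x s. x \<in> A \<and> s \<in> {0..1}}" using xy by blast
    qed
  qed
  also have "\<dots> = convex hull (V + {0, w})"
    unfolding V(2) segment_convex_hull convex_hull_set_plus ..
  finally show ?thesis unfolding polytope_def using finite_set_plus[OF V(1), of "{0, w}"] by blast
qed

text \<open>The lifting coordinate \<open>z\<close> is stored last, at index \<open>2 + d\<close>,
  so that \<open>proj (2 + d)\<close> forgets exactly this coordinate.\<close>

lemma prism_over_six_inequalities:
  fixes a :: "nat \<Rightarrow> real^2"
  assumes S: "polytope {(x, z::real). \<forall>j<6. 0 \<le> a j \<bullet> x + b j * z + c j}" (is "polytope ?S")
    and proj: "fst ` {(x, z::real). \<forall>j<6. 0 \<le> a j \<bullet> x + b j * z + c j} = P"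
  obtains E where "polytope E" "E \<subseteq> rspace (3 + d)" "proj (2 + d) ` E = times_cube P d" "psize E \<le> 6 + 2 * d"
proof -
  define ok where "ok x \<longleftrightarrow> (\<forall>j<6. 0 \<le> a j \<bullet> plane x + b j * coord x (2 + d) + c j)" for x
  \<comment> \<open>Only the first \<open>k\<close> cube coordinates are released from 0; passing to
    \<open>Suc k\<close> adds a segment, which keeps a polytope.\<close>
  define E where "E k = {x\<in>rspace (3 + d). ok x \<and> (\<forall>i<k. coord x (2 + i) \<in> {0..1})
    \<and> (\<forall>i<d. k \<le> i \<longrightarrow> coord x (2 + i) = 0)}" for k
  define \<phi> where "\<phi> y = unplane (fst y) + Poly_Mapping.single (2 + d) (snd y)" for y
  have c\<phi>: "coord (\<phi> (y, z)) i = (if i = 0 then y$1 else if i = 1 then y$2 else if i = 2 + d then z else 0)" for y z i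
    by (simp add: \<phi>_def lookup_add coord_unplane coord_single)
  have pl\<phi>: "plane (\<phi> (y, z)) = y" for y z by (rule plane_eqI) (simp_all add: c\<phi>)
  have E0: "E 0 = \<phi> ` ?S"
  proof
    show "\<phi> ` ?S \<subseteq> E 0"
    proof safe
      fix y :: "real^2" and z assume "\<forall>j<6. 0 \<le> a j \<bullet> y + b j * z + c j"
      then show "\<phi> (y, z) \<in> E 0"
        using pl\<phi>[of y z] by (simp add: E_def ok_def rspace_iff c\<phi>)
    qed
    show "E 0 \<subseteq> \<phi> ` ?S"
    proof
      fix x assume x: "x \<in> E 0"
      have "x = \<phi> (plane x, coord x (2 + d))"
      proof (rule poly_mapping_eqI)
        fix i
        consider "i = 0" | "i = 1" | k where "k < d" "i = 2 + k" | "i = 2 + d" | "3 + d \<le> i"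
        proof (cases "i < 2 + d")
          case True
          then show ?thesis using that(1,2) that(3)[of "i - 2"] by linarith
        qed (use that(4,5) in linarith)
        then show "coord x i = coord (\<phi> (plane x, coord x (2 + d))) i"
          using x by cases (auto simp: c\<phi> E_def rspace_iff plane_def)
      qed
      moreover have "(plane x, coord x (2 + d)) \<in> ?S" using x by (simp add: E_def ok_def)
      ultimately show "x \<in> \<phi> ` ?S" by (rule image_eqI)
    qed
  qed
  have "linear \<phi>"
    by (rule linearI) (auto intro!: poly_mapping_eqI simp: \<phi>_def lookup_add coord_scaleR coord_unplane coord_single)
  then have "polytope (E 0)"
    unfolding E0 polytope_def using S unfolding polytope_def by (metis convex_hull_linear_image finite_imageI)
  moreover have "polytope (E (Suc k))" if "polytope (E k)" "k < d" for k
  proof -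
    define w where "w = Poly_Mapping.single (2 + k) (1::real)"
    have cw: "coord (s *\<^sub>R w) i = (if i = 2 + k then s else 0)" for s i
      by (simp add: w_def coord_scaleR coord_single)
    have "E (Suc k) = {x + s *\<^sub>R w | x s. x \<in> E k \<and> s \<in> {0..1}}"
    proof safe
      fix x assume x: "x \<in> E (Suc k)"
      define y where "y = x - coord x (2 + k) *\<^sub>R w"
      have cy: "coord y i = (if i = 2 + k then 0 else coord x i)" for i
        by (simp add: y_def lookup_minus cw)
      have "plane y = plane x" by (simp add: plane_def cy)
      then have "y \<in> E k" using x \<open>k < d\<close> by (auto simp: E_def ok_def rspace_iff cy)
      moreover have "coord x (2 + k) \<in> {0..1}" using x by (auto simp: E_def)
      moreover have "x = y + coord x (2 + k) *\<^sub>R w" by (simp add: y_def)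
      ultimately show "\<exists>y s. x = y + s *\<^sub>R w \<and> y \<in> E k \<and> s \<in> {0..1}" by blast
    next
      fix x s assume x: "x \<in> E k" and s: "s \<in> {0..1::real}"
      have cy: "coord (x + s *\<^sub>R w) i = (if i = 2 + k then s else coord x i)" for i
        using x \<open>k < d\<close> by (simp add: lookup_add cw E_def)
      have "plane (x + s *\<^sub>R w) = plane x" by (simp add: plane_def cy)
      then show "x + s *\<^sub>R w \<in> E (Suc k)"
        using x s \<open>k < d\<close> by (auto simp: E_def ok_def rspace_iff cy less_Suc_eq)
    qed
    then show ?thesis using polytope_add_segment[OF that(1), of w] by simp
  qed
  ultimately have "k \<le> d \<Longrightarrow> polytope (E k)" for k by (induction k) auto
  then have pE: "polytope (E d)" by simp
  have "proj (2 + d) ` E d = times_cube P d"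
  proof
    show "proj (2 + d) ` E d \<subseteq> times_cube P d"
    proof safe
      fix x assume x: "x \<in> E d"
      have "(plane x, coord x (2 + d)) \<in> ?S" using x by (simp add: E_def ok_def)
      then have "fst (plane x, coord x (2 + d)) \<in> P" unfolding proj[symmetric] by (rule imageI)
      moreover have "plane (proj (2 + d) x) = plane x" by (simp add: plane_def lookup_proj)
      ultimately show "proj (2 + d) x \<in> times_cube P d"
        using x by (simp add: times_cube_iff rspace_iff lookup_proj E_def)
    qed
    show "times_cube P d \<subseteq> proj (2 + d) ` E d"
    proof
      fix x assume x: "x \<in> times_cube P d"
      then have "plane x \<in> fst ` ?S" unfolding proj by (simp add: times_cube_iff)
      then obtain z where z: "\<forall>j<6. 0 \<le> a j \<bullet> plane x + b j * z + c j" by auto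
      define y where "y = x + Poly_Mapping.single (2 + d) z"
      have cy: "coord y i = (if i = 2 + d then z else coord x i)" for i
        using x by (simp add: y_def lookup_add coord_single times_cube_iff rspace_iff)
      have "plane y = plane x" by (simp add: plane_def cy)
      then have "y \<in> E d" using x z by (auto simp: E_def ok_def cy times_cube_iff rspace_iff)
      moreover have "x = proj (2 + d) y"
        using x by (intro poly_mapping_eqI) (auto simp: lookup_proj cy times_cube_iff rspace_iff)
      ultimately show "x \<in> proj (2 + d) ` E d" by blast
    qed
  qed
  moreover have "psize (E d) \<le> 6 + 2 * d"
  proof -
    \<comment> \<open>Six inequalities of the lift and two for each cube coordinate account for
      \<open>6 + 2 * d\<close>.\<close>
    define J where "J = {..<6::nat} <+> ({..<d} \<times> (UNIV :: bool set))"
    define f where "f j x = (case j of Inl j \<Rightarrow> a j \<bullet> plane x + b j * coord x (2 + d)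
      | Inr (i, up) \<Rightarrow> if up then - coord x (2 + i) else coord x (2 + i))" for j x
    define e where "e j = (case j of Inl j \<Rightarrow> c j | Inr (i, up) \<Rightarrow> if up then 1 else 0)" for j :: "nat + nat \<times> bool"
    have "linear (f j)" for j
    proof (cases j)
      case (Inl i)
      show ?thesis
        by (rule linearI) (simp_all add: f_def Inl linear_add[OF linear_plane] linear_scale[OF linear_plane]
            lookup_add coord_scaleR inner_add_right algebra_simps)
    next
      case (Inr i)
      show ?thesis
        by (rule linearI) (simp_all add: f_def Inr lookup_add coord_scaleR split: prod.split)
    qed
    moreover have "E d = {x\<in>rspace (3 + d). \<forall>j\<in>J. 0 \<le> f j x + e j}"
    proof -
      have "(\<forall>j\<in>J. 0 \<le> f j x + e j) \<longleftrightarrow> ok x \<and> (\<forall>i<d. coord x (2 + i) \<in> {0..1})" for x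
        by (auto simp: J_def f_def e_def ok_def Plus_def ball_Un split: if_splits)
      then show ?thesis by (auto simp: E_def)
    qed
    ultimately have "psize (E d) \<le> card J"
      using pE affine_rspace by (intro psize_le_inequalities) (auto simp: J_def)
    also have "card J = 6 + 2 * d" by (simp add: J_def card_Plus card_cartesian_product)
    finally show ?thesis .
  qed
  moreover have "E d \<subseteq> rspace (3 + d)" by (auto simp: E_def)
  ultimately show ?thesis using that pE by blast
qed

theorem theorem6:
  fixes P :: "(real^2) set" and d q :: nat and Q :: "(nat \<Rightarrow>\<^sub>0 real) set"
  assumes "convex_heptagon P"
    and "general_position P"
    and "minimum_size_extension ((2 + d) + q) Q (2 + d) (times_cube P d)"
  shows "real (card {v \<in> vertices Q. proj (2 + d) v \<notin> vertices (times_cube P d)})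
           \<ge> 1 / 9 * real (card (vertices Q))"
proof -
  let ?R = "times_cube P d"
  have P: "polytope P" "card (vertices P) = 7" using assms(1) by (auto simp: convex_heptagon_def)
  have R: "polytope ?R" "?R \<subseteq> rspace (2 + d)" and Q: "polytope Q" "proj (2 + d) ` Q = ?R"
    and size: "psize Q = extension_complexity (2 + d) ?R"
    using assms(3) by (auto simp: minimum_size_extension_def is_extension_def)
  obtain a :: "nat \<Rightarrow> real^2" and b c
    where abc: "polytope {(x, z::real). \<forall>j<6. 0 \<le> a j \<bullet> x + b j * z + c j}"
      "fst ` {(x, z::real). \<forall>j<6. 0 \<le> a j \<bullet> x + b j * z + c j} = P"
    using heptagon_six_inequalities[OF P] by blast
  obtain E where E: "polytope E" "E \<subseteq> rspace (3 + d)" "proj (2 + d) ` E = ?R" "psize E \<le> 6 + 2 * d"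
    by (rule prism_over_six_inequalities[OF abc])
  have "is_extension (3 + d) E (2 + d) ?R" using E R by (simp add: is_extension_def)
  then have "extension_complexity (2 + d) ?R \<le> psize E"
    unfolding extension_complexity_def by (intro Least_le) blast
  \<comment> \<open>Here minimality of \<open>Q\<close> enters: it makes the count in
    \<open>prism_extension_bound\<close> tight.\<close>
  then have small: "psize Q \<le> 6 + 2 * d" using size E(4) by simp
  have pr: "plane (proj (2 + d) x) = plane x" "i < d \<Longrightarrow> coord (proj (2 + d) x) (2 + i) = coord x (2 + i)" for x i
    by (simp_all add: plane_def lookup_proj)
  have QR: "plane x \<in> P" "i < d \<Longrightarrow> coord x (2 + i) \<in> {0..1}" if "x \<in> Q" for x i
  proof -
    have "proj (2 + d) x \<in> ?R" using Q(2) that by blast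
    then show "plane x \<in> P" "i < d \<Longrightarrow> coord x (2 + i) \<in> {0..1}" using pr by (auto simp: times_cube_iff)
  qed
  let ?bad = "{v\<in>vertices Q. \<not> (plane v \<in> vertices P \<and> (\<forall>i<d. coord v (2 + i) \<in> {0, 1}))}"
  have "6 + 2 * d \<le> psize Q \<and> (psize Q \<le> 6 + 2 * d \<longrightarrow> card (vertices Q) \<le> 9 * card ?bad)"
  proof (rule prism_extension_bound[where t = "\<lambda>i x. coord x (2 + i)"])
    show "vertices P \<noteq> {}" using P(2) by auto
    show "6 \<le> psize Q' \<and> (psize Q' \<le> 6 \<longrightarrow>
        card (vertices Q') \<le> 9 * card {v \<in> vertices Q'. plane v \<notin> vertices P})"
      if "polytope Q'" "plane ` Q' \<subseteq> P" "vertices P \<subseteq> plane ` Q'" for Q'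
      by (rule heptagon_extension_bound[OF polytope_imp_convex[OF P(1)] P(2) assms(2) that(1) linear_plane that(2,3)])
    show "plane ` Q \<subseteq> P" using QR by blast
    show "\<exists>x\<in>Q. plane x = w \<and> (\<forall>i<d. coord x (2 + i) = (if i \<in> T then 1 else 0))" if w: "w \<in> vertices P" for w T
    proof -
      define y where "y = unplane w + (\<Sum>i<d. Poly_Mapping.single (2 + i) (if i \<in> T then 1 else 0))"
      \<comment> \<open>The first two cases catch \<open>i < 2\<close>, so the truncated
        \<open>i - 2\<close> is harmless.\<close>
      have cy: "coord y i = (if i = 0 then w$1 else if i = 1 then w$2 else if i - 2 < d \<and> i - 2 \<in> T then 1 else 0)" for i
      proof -
        have "(\<Sum>j<d. coord (Poly_Mapping.single (2 + j) (if j \<in> T then 1 else 0)) i)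
            = (\<Sum>j<d. if j = i - 2 then (if 2 \<le> i \<and> j \<in> T then 1 else 0) else 0)"
          by (intro sum.cong) (auto simp: coord_single)
        also have "\<dots> = (if i - 2 < d \<and> 2 \<le> i \<and> i - 2 \<in> T then 1 else 0)" by simp
        finally show ?thesis by (auto simp: y_def lookup_add lookup_sum coord_unplane)
      qed
      have "plane y = w" by (rule plane_eqI) (simp_all add: cy)
      moreover have "w \<in> P" using w by (simp add: vertices_def extreme_point_of_def)
      ultimately have "y \<in> ?R" by (auto simp: times_cube_iff rspace_iff cy)
      then obtain x where x: "x \<in> Q" "y = proj (2 + d) x" using Q(2) by blast
      have "plane x = w" using pr(1)[of x] x(2) \<open>plane y = w\<close> by simp
      moreover have "coord x (2 + i) = (if i \<in> T then 1 else 0)" if "i < d" for i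
        using pr(2)[OF that, of x] cy[of "2 + i"] that unfolding x(2)[symmetric] by simp
      ultimately show ?thesis using x(1) by blast
    qed
  qed (use QR Q(1) linear_plane linear_coord in auto)
  then have "card (vertices Q) \<le> 9 * card ?bad" using small by blast
  also have "card ?bad \<le> card {v \<in> vertices Q. proj (2 + d) v \<notin> vertices ?R}"
  proof (rule card_mono)
    show "finite {v \<in> vertices Q. proj (2 + d) v \<notin> vertices ?R}" using polytope_vertices(1)[OF Q(1)] by simp
    show "?bad \<subseteq> {v \<in> vertices Q. proj (2 + d) v \<notin> vertices ?R}"
    proof clarify
      fix v assume v: "v \<in> vertices Q" "\<not> (plane v \<in> vertices P \<and> (\<forall>i<d. coord v (2 + i) \<in> {0, 1}))"
        "proj (2 + d) v \<in> vertices ?R"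
      have "plane v \<in> vertices P" using vertices_times_cube(1)[OF v(3)] pr(1) by simp
      moreover have "coord v (2 + i) \<in> {0, 1}" if "i < d" for i
        using vertices_times_cube(2)[OF v(3) that] pr(2)[OF that] by simp
      ultimately show False using v(2) by blast
    qed
  qed
  finally show ?thesis by simp
qed

end
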